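(* Let $q=3^r$, $r\ge 1$, and let $\Gamma=\Delta_J$ be one of the $H$-graphs, with $H=G(\widehat J)$, defined in the context. Let $(x_1,x_2)$ be a $1$-arc of $\Gamma$ with $|\Gamma(x_1)|=q+1$ and $|\Gamma(x_2)|=q$, and let $\mathfrak A=(H_{x_1},H_{x_2};H_{x_1,x_2})$ be the vertex stabilizer amalgam of $\Gamma$ with respect to this arc, with core $\mathfrak A^*: H_1^*\leftarrow B\rightarrow H_2^*$ and with $T_i$ ($i=1,2$) the largest subgroup of $H_{x_1,x_2}$ normal in $H_{x_i}$. For a vertex $z$ of $\Gamma$ let $Q_z:=O_3(H_z^{[1]})$, and let $L_1:=\langle Q_u\mid u\in\Gamma(x_1)\rangle Q_{x_1}$. Then there exists a divisor $d$ of $q-1$ such that: (i) $L_1\cong E_q\times \mathrm{ASL}_2(q)$, $Z(L_1)\cong E_q$ and $O_3(B)=O_3(L_1\cap B)=O_3(T_2)\in \mathrm{Syl}_3(L_1)$; (ii) $B=(L_1\cap B)T_2$ with $L_1\cap B\cong E_q\times \mathrm{ASL}_2(q,S_0)$ and $T_2/Z(L_1)\cong K_2(q,S_0)^{(d)}$; (iii) $H_1^*\cong E_{q^3}\rtimes \mathrm{GL}_2(q)^{(d)}$ and $C_{H_1^*}(Z(L_1))\cong E_q\times \mathrm{AGL}_2(q)^{(\frac{q-1}{2})}$; (iv) $H_2^*\cong O_3(T_2)\rtimes(\mathrm{GL}_1(q)^{(d)}\times \mathrm{AGL}_1(q))$ and $C_{H_2^*}(Z(O_3(T_2)))\cong E_q\times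 K_2(q,S_0)^{(\frac{q-1}{2})}$. Moreover, $H_{x_1}/L_1$ is isomorphic to a point stabilizer in a $2$-transitive subgroup of $\mathrm{A\Gamma L}_1(q)$.
   Context: Graph terminology. Graphs are finite, connected, undirected, without loops or multiple edges. An $H$-graph is a graph $\Gamma$ together with a subgroup $H\le\mathrm{Aut}(\Gamma)$. $\Gamma(z)$ is the set of neighbours of $z$, $H_z$ the stabilizer of $z$, $H_{x_1,x_2}=H_{x_1}\cap H_{x_2}$, and $H_z^{[1]}$ the kernel of $H_z$ acting on $\Gamma(z)$. The vertex stabilizer amalgam with respect to the $1$-arc $(x_1,x_2)$ is $(H_{x_1},H_{x_2};H_{x_1,x_2})$. Core. For such an amalgam, with $H_1=H_{x_1}$, $H_2=H_{x_2}$, $H_{1,2}=H_{x_1,x_2}$, let $T_i$ be the largest subgroup of $H_{1,2}$ with $T_i\trianglelefteq H_i$. There is a unique inclusion-minimal subgroup $B$ of $H_{1,2}$ such that $T_1T_2\le B$ and $B=H_{1,2}\cap\langle B^{H_i}\rangle$ for $i=1,2$. Put $H_i^*=\langle B^{H_i}\rangle$. The amalgam $H_1^*\leftarrow B\rightarrow H_2^*$ is the core. Group notation. $E_q$, $E_{q^3}$ are elementary abelian of order $q$, $q^3$. $\mathrm{ASL}_2(q)$ is the semidirect product of $\mathrm{SL}_2(q)$ with its natural module. Let $S_0\in\mathrm{Syl}_3(\mathrm{ASL}_2(q))$, $\mathrm{ASL}_2(q,S_0)=N_{\mathrm{ASL}_2(q)}(S_0)$, $\mathrm{AGL}_2(q,S_0)=N_{\mathrm{AGL}_2(q)}(S_0)$,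 and let $K_2(q,S_0)$ be the kernel of the (conjugation) action of $\mathrm{AGL}_2(q,S_0)$ on the set of elementary abelian subgroups of $S_0$ of order $q^2$. For a divisor $d$ of $q-1$, $\mathrm{GL}_1(q)^{(d)}$, $\mathrm{GL}_2(q)^{(d)}$, $\mathrm{AGL}_2(q)^{(d)}$, $K_2(q,S_0)^{(d)}$ denote the unique normal subgroup of index $d$ in the respective group. Permutations. Let $\varepsilon=q/3$, $\Omega=\mathbb F_q^3$; permutations are applied from left to right. Define $\alpha_{(u,v,w)}:(a,b,c)\mapsto(a+u,b+v,c+w)$ ($u,v,w\in\mathbb F_q$); $\beta_{\lambda,\mu}:(a,b,c)\mapsto(\lambda a,\mu b,(\lambda\mu)^{2\varepsilon}c)$ ($\lambda,\mu\in\mathbb F_q^*$); $\gamma_e:(a,b,c)\mapsto(a+eb,b,c)$ ($e\in\mathbb F_q$); $\delta:(a,b,c)\mapsto(b,-a,c)$; $\tau_d:(a,b,c)\mapsto(a+db^2+d^{\varepsilon}c,b,c)$ ($d\in\mathbb F_q$); $\sigma:(a,b,c)\mapsto(a^3,b^3,c^3)$. Put $V=\langle\alpha_{(u,v,0)}\mid u,v\in\mathbb F_q\rangle$, $F=\langle\alpha_{(0,0,w)}\mid w\in\mathbb F_q\rangle$, $C=\langle\gamma_e\mid e\in\mathbb F_q\rangle$, $S=\langle\beta_{\mu^2,\mu}\mid\mu\in\mathbb F_q^*\rangle$, $T=\langle\beta_{\mu,\mu^{-1}}\mid\mu\in\mathbb F_q^*\rangle$, $D=\langle\delta\rangle$,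 $E=\langle\tau_d\mid d\in\mathbb F_q\rangle$, $\Sigma=\langle\sigma\rangle$, $M=\langle C,D,T\rangle$, $K_1=VM$, $K_2=VCET$. The graphs $\Delta_J$. One has $CS\Sigma\cong\mathrm{A\Gamma L}_1(q)$, acting $2$-transitively on the $q$ elements of $C$ ($C$ by translation, $S\Sigma$ by conjugation). Let $C\le\widehat J\le CS\Sigma$ be such that $\widehat J$ is a $2$-transitive group, and let $J\le S\Sigma$ be the stabilizer in $\widehat J$ of $\gamma_0=1$. Put $G_1(\widehat J)=K_1FJ$, $G_2(\widehat J)=K_2FJ$, $G(\widehat J)=\langle G_1(\widehat J),G_2(\widehat J)\rangle$. $\Delta_J$ is the graph whose vertices are the right cosets of $G_1(\widehat J)$ and $G_2(\widehat J)$ in $G(\widehat J)$, with $G_1(\widehat J)g_1$ and $G_2(\widehat J)g_2$ adjacent iff $G_1(\widehat J)g_1\cap G_2(\widehat J)g_2\neq\emptyset$; $G(\widehat J)$ acts by right multiplication. *)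

theory Defs
  imports
    "HOL-Analysis.Determinants"
    "HOL-Algebra.Sylow"
    "HOL-Algebra.Generated_Groups"
    "HOL-Algebra.Group_Action"
    "Graph_Theory.Pair_Digraph"
begin

section \<open>General group theory\<close>

text \<open>Subgroups are carrier sets; a subgroup \<open>K\<close> of \<open>G\<close> regarded as a group is \<open>G\<lparr>carrier := K\<rparr>\<close>.\<close>

text \<open>All permutations of a type, composed from left to right.\<close>

definition Sym :: "('b \<Rightarrow> 'b) monoid" where
  "Sym = \<lparr>carrier = {f. bij f}, mult = (\<lambda>f g. g \<circ> f), one = id\<rparr>"

definition centralizer :: "('g, 'm) monoid_scheme \<Rightarrow> 'g set \<Rightarrow> 'g set" where
  "centralizer G X = {g \<in> carrier G. \<forall>x\<in>X. g \<otimes>\<^bsub>G\<^esub> x = x \<otimes>\<^bsub>G\<^esub> g}"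

definition center :: "('g, 'm) monoid_scheme \<Rightarrow> 'g set" where
  "center G = centralizer G (carrier G)"

text \<open>\<open>O\<^sub>p(G)\<close>, the largest normal \<open>p\<close>-subgroup (with respect to inclusion).\<close>

definition Op :: "nat \<Rightarrow> ('g, 'm) monoid_scheme \<Rightarrow> 'g set" where
  "Op p G = (GREATEST N. N \<lhd> G \<and> (\<exists>n. card N = p ^ n))"

definition Syl :: "nat \<Rightarrow> ('g, 'm) monoid_scheme \<Rightarrow> 'g set set" where
  "Syl p G = {P. subgroup P G \<and> card P = p ^ multiplicity p (order G)}"

definition elementary_abelian :: "nat \<Rightarrow> ('g, 'm) monoid_scheme \<Rightarrow> bool" where
  "elementary_abelian p G \<longleftrightarrow> comm_group G \<and> (\<forall>x\<in>carrier G. x [^]\<^bsub>G\<^esub> p = \<one>\<^bsub>G\<^esub>)"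

text \<open>\<open>G\<^sup>(\<^sup>d\<^sup>)\<close>, the unique normal subgroup of index \<open>d\<close>; only meaningful when there is exactly one.\<close>

definition index_subgroup :: "('g, 'm) monoid_scheme \<Rightarrow> nat \<Rightarrow> ('g, 'm) monoid_scheme" where
  "index_subgroup G d = G\<lparr>carrier := (THE N. N \<lhd> G \<and> card (rcosets\<^bsub>G\<^esub> N) = d)\<rparr>"

text \<open>External semidirect product; meaningful for \<open>\<theta> \<in> hom K (AutoGroup N)\<close>.\<close>

definition semidirect ::
    "('n, 'a) monoid_scheme \<Rightarrow> ('k, 'b) monoid_scheme \<Rightarrow> ('k \<Rightarrow> 'n \<Rightarrow> 'n) \<Rightarrow> ('n \<times> 'k) monoid" where
  "semidirect N K \<theta> =
    \<lparr>carrier = carrier N \<times> carrier K,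
     mult = (\<lambda>(n, k) (n', k'). (n \<otimes>\<^bsub>N\<^esub> \<theta> k n', k \<otimes>\<^bsub>K\<^esub> k')),
     one = (\<one>\<^bsub>N\<^esub>, \<one>\<^bsub>K\<^esub>)\<rparr>"

text \<open>\<open>G \<cong> N \<rtimes> K\<close> for some action of \<open>K\<close> on \<open>N\<close>.\<close>

definition is_semidirect ::
    "('g, 'c) monoid_scheme \<Rightarrow> ('n, 'a) monoid_scheme \<Rightarrow> ('k, 'b) monoid_scheme \<Rightarrow> bool" where
  "is_semidirect G N K \<longleftrightarrow> (\<exists>\<theta>\<in>hom K (AutoGroup N). G \<cong> semidirect N K \<theta>)"

definition two_transitive_on :: "'x set \<Rightarrow> 'g set \<Rightarrow> ('g \<Rightarrow> 'x \<Rightarrow> 'x) \<Rightarrow> bool" where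
  "two_transitive_on X P \<phi> \<longleftrightarrow>
    (\<forall>x\<in>X. \<forall>y\<in>X. \<forall>x'\<in>X. \<forall>y'\<in>X. x \<noteq> y \<longrightarrow> x' \<noteq> y' \<longrightarrow>
      (\<exists>g\<in>P. \<phi> g x = x' \<and> \<phi> g y = y'))"


section \<open>Graphs, vertex stabilizers, and the core of an amalgam\<close>

definition nbrs :: "'v pair_pre_digraph \<Rightarrow> 'v \<Rightarrow> 'v set" where
  "nbrs \<Gamma> z = {w. (z, w) \<in> parcs \<Gamma>}"

text \<open>An undirected graph is represented by its symmetric arc relation. For \<open>A \<noteq> B\<close> no right coset
  of \<open>A\<close> is also a right coset of \<open>B\<close>, so the union of the two coset sets is disjoint.\<close>

definition coset_graph ::
    "('g, 'm) monoid_scheme \<Rightarrow> 'g set \<Rightarrow> 'g set \<Rightarrow> 'g set pair_pre_digraph" where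
  "coset_graph G A B =
    \<lparr>pverts = rcosets\<^bsub>G\<^esub> A \<union> rcosets\<^bsub>G\<^esub> B,
     parcs = {(x, y). x \<inter> y \<noteq> {} \<and>
        (x \<in> rcosets\<^bsub>G\<^esub> A \<and> y \<in> rcosets\<^bsub>G\<^esub> B \<or> x \<in> rcosets\<^bsub>G\<^esub> B \<and> y \<in> rcosets\<^bsub>G\<^esub> A)}\<rparr>"

text \<open>\<open>H\<close> acts on cosets, i.e. on the vertices of a coset graph, by right multiplication.
  \<open>vstab H z\<close> is \<open>H\<^sub>z\<close>, and \<open>vker H \<Gamma> z\<close> is the kernel of \<open>H\<^sub>z\<close> acting on \<open>\<Gamma>(z)\<close>.\<close>

definition vstab :: "('g, 'm) monoid_scheme \<Rightarrow> 'g set \<Rightarrow> 'g set" where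
  "vstab H z = stabilizer H (\<lambda>h x. x #>\<^bsub>H\<^esub> h) z"

definition vker :: "('g, 'm) monoid_scheme \<Rightarrow> 'g set pair_pre_digraph \<Rightarrow> 'g set \<Rightarrow> 'g set" where
  "vker H \<Gamma> z = {h \<in> vstab H z. \<forall>w\<in>nbrs \<Gamma> z. w #>\<^bsub>H\<^esub> h = w}"

text \<open>\<open>conj_closure G X K\<close> is \<open>\<langle>X\<^sup>K\<rangle>\<close>.\<close>

definition conj_closure :: "('g, 'm) monoid_scheme \<Rightarrow> 'g set \<Rightarrow> 'g set \<Rightarrow> 'g set" where
  "conj_closure G X K = generate G {inv\<^bsub>G\<^esub> k \<otimes>\<^bsub>G\<^esub> x \<otimes>\<^bsub>G\<^esub> k | x k. x \<in> X \<and> k \<in> K}"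

text \<open>In the following, \<open>H1\<close> and \<open>H2\<close> are subgroups of \<open>G\<close> forming the amalgam
  \<open>(H1, H2; H1 \<inter> H2)\<close>. \<open>largest_normal_in G N K\<close> is the largest subgroup of \<open>N\<close> that is
  normal in \<open>K\<close>.\<close>

definition largest_normal_in :: "('g, 'm) monoid_scheme \<Rightarrow> 'g set \<Rightarrow> 'g set \<Rightarrow> 'g set" where
  "largest_normal_in G N K = (GREATEST T. T \<subseteq> N \<and> T \<lhd> G\<lparr>carrier := K\<rparr>)"

definition core_candidate ::
    "('g, 'm) monoid_scheme \<Rightarrow> 'g set \<Rightarrow> 'g set \<Rightarrow> 'g set \<Rightarrow> bool" where
  "core_candidate G H1 H2 B \<longleftrightarrow>
    subgroup B (G\<lparr>carrier := H1 \<inter> H2\<rparr>) \<and>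
    largest_normal_in G (H1 \<inter> H2) H1 <#>\<^bsub>G\<^esub> largest_normal_in G (H1 \<inter> H2) H2 \<subseteq> B \<and>
    B = (H1 \<inter> H2) \<inter> conj_closure G B H1 \<and>
    B = (H1 \<inter> H2) \<inter> conj_closure G B H2"

definition core_edge_group :: "('g, 'm) monoid_scheme \<Rightarrow> 'g set \<Rightarrow> 'g set \<Rightarrow> 'g set" where
  "core_edge_group G H1 H2 =
    (THE B. core_candidate G H1 H2 B \<and>
      (\<forall>B'. core_candidate G H1 H2 B' \<and> B' \<subseteq> B \<longrightarrow> B' = B))"


section \<open>Linear and affine groups over a finite field\<close>

text \<open>The field \<open>\<bbbF>\<^sub>q\<close> is a type \<open>'a :: {field, finite}\<close> with \<open>CARD('a) = q\<close>. \<open>GL\<^sub>1\<close> and \<open>GL\<^sub>2\<close>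
  are the instances of \<open>GL\<close> at \<open>'a^1^1\<close> and \<open>'a^2^2\<close>.\<close>

definition additive_group :: "'b::ab_group_add monoid" where
  "additive_group = \<lparr>carrier = UNIV, mult = (+), one = 0\<rparr>"

definition GL :: "('a::field^'n^'n) monoid" where
  "GL = \<lparr>carrier = {A. invertible A}, mult = (**), one = mat 1\<rparr>"

definition SL :: "('a::field^'n^'n) monoid" where
  "SL = GL\<lparr>carrier := {A. det A = 1}\<rparr>"

definition AGL :: "(('a::field^'n) \<times> ('a^'n^'n)) monoid" where
  "AGL = semidirect additive_group GL (\<lambda>A v. A *v v)"

definition ASL :: "(('a::field^'n) \<times> ('a^'n^'n)) monoid" where
  "ASL = semidirect additive_group SL (\<lambda>A v. A *v v)"

definition ASL2_S0 :: "(('a::field^2) \<times> ('a^2^2)) set \<Rightarrow> (('a^2) \<times> ('a^2^2)) monoid" where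
  "ASL2_S0 S0 = ASL\<lparr>carrier := normalizer ASL S0\<rparr>"

definition AGL2_S0 :: "(('a::field^2) \<times> ('a^2^2)) set \<Rightarrow> (('a^2) \<times> ('a^2^2)) monoid" where
  "AGL2_S0 S0 = AGL\<lparr>carrier := normalizer AGL S0\<rparr>"

text \<open>The kernel of the conjugation action on the elementary abelian subgroups of \<open>S\<^sub>0\<close> of
  order \<open>q\<^sup>2\<close>.\<close>

definition K2_S0 :: "(('a::{field,finite}^2) \<times> ('a^2^2)) set \<Rightarrow> (('a^2) \<times> ('a^2^2)) monoid" where
  "K2_S0 S0 = AGL\<lparr>carrier := {g \<in> carrier (AGL2_S0 S0).
      \<forall>A. subgroup A AGL \<and> A \<subseteq> S0 \<and> elementary_abelian 3 (AGL\<lparr>carrier := A\<rparr>) \<and>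
          card A = CARD('a)\<^sup>2 \<longrightarrow>
        g <#\<^bsub>AGL\<^esub> A #>\<^bsub>AGL\<^esub> inv\<^bsub>AGL\<^esub> g = A}\<rparr>"

definition field_aut :: "('a::field \<Rightarrow> 'a) \<Rightarrow> bool" where
  "field_aut f \<longleftrightarrow> bij f \<and> (\<forall>x y. f (x + y) = f x + f y) \<and> (\<forall>x y. f (x * y) = f x * f y)"

definition AGammaL1 :: "('a::field \<Rightarrow> 'a) monoid" where
  "AGammaL1 = Sym\<lparr>carrier := {(\<lambda>x. l * f x + e) | l f e. l \<noteq> 0 \<and> field_aut f}\<rparr>"


section \<open>The permutations and the graphs \<open>\<Delta>\<^sub>J\<close>\<close>

type_synonym 'a perm3 = "'a \<times> 'a \<times> 'a \<Rightarrow> 'a \<times> 'a \<times> 'a"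

text \<open>Throughout, \<open>\<epsilon> = q / 3\<close> is \<open>CARD('a) div 3\<close>.\<close>

definition p_alpha :: "'a::{field,finite} \<Rightarrow> 'a \<Rightarrow> 'a \<Rightarrow> 'a perm3" where
  "p_alpha u v w = (\<lambda>(a, b, c). (a + u, b + v, c + w))"

definition p_beta :: "'a::{field,finite} \<Rightarrow> 'a \<Rightarrow> 'a perm3" where
  "p_beta l m = (\<lambda>(a, b, c). (l * a, m * b, (l * m) ^ (2 * (CARD('a) div 3)) * c))"

definition p_gamma :: "'a::{field,finite} \<Rightarrow> 'a perm3" where
  "p_gamma e = (\<lambda>(a, b, c). (a + e * b, b, c))"

definition p_delta :: "'a::{field,finite} perm3" where
  "p_delta = (\<lambda>(a, b, c). (b, - a, c))"

definition p_tau :: "'a::{field,finite} \<Rightarrow> 'a perm3" where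
  "p_tau d = (\<lambda>(a, b, c). (a + d * b ^ 2 + d ^ (CARD('a) div 3) * c, b, c))"

definition p_sigma :: "'a::{field,finite} perm3" where
  "p_sigma = (\<lambda>(a, b, c). (a ^ 3, b ^ 3, c ^ 3))"

definition P_V :: "'a::{field,finite} perm3 set" where
  "P_V = generate Sym {p_alpha u v 0 | u v. True}"

definition P_F :: "'a::{field,finite} perm3 set" where
  "P_F = generate Sym {p_alpha 0 0 w | w. True}"

definition P_C :: "'a::{field,finite} perm3 set" where
  "P_C = generate Sym {p_gamma e | e. True}"

definition P_S :: "'a::{field,finite} perm3 set" where
  "P_S = generate Sym {p_beta (m ^ 2) m | m. m \<noteq> 0}"

definition P_T :: "'a::{field,finite} perm3 set" where
  "P_T = generate Sym {p_beta m (inverse m) | m. m \<noteq> 0}"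

definition P_D :: "'a::{field,finite} perm3 set" where
  "P_D = generate Sym {p_delta}"

definition P_E :: "'a::{field,finite} perm3 set" where
  "P_E = generate Sym {p_tau d | d. True}"

definition P_Sigma :: "'a::{field,finite} perm3 set" where
  "P_Sigma = generate Sym {p_sigma}"

definition P_M :: "'a::{field,finite} perm3 set" where
  "P_M = generate Sym (P_C \<union> P_D \<union> P_T)"

definition P_K1 :: "'a::{field,finite} perm3 set" where
  "P_K1 = P_V <#>\<^bsub>Sym\<^esub> P_M"

definition P_K2 :: "'a::{field,finite} perm3 set" where
  "P_K2 = P_V <#>\<^bsub>Sym\<^esub> P_C <#>\<^bsub>Sym\<^esub> P_E <#>\<^bsub>Sym\<^esub> P_T"

definition P_SSigma :: "'a::{field,finite} perm3 set" where
  "P_SSigma = P_S <#>\<^bsub>Sym\<^esub> P_Sigma"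

definition P_CSSigma :: "'a::{field,finite} perm3 set" where
  "P_CSSigma = P_C <#>\<^bsub>Sym\<^esub> P_SSigma"

text \<open>The action of \<open>CS\<Sigma>\<close> on \<open>C\<close>: the element \<open>g = cs\<close>, with \<open>c \<in> C\<close> and \<open>s \<in> S\<Sigma>\<close> uniquely
  determined by \<open>g\<close>, takes \<open>x \<in> C\<close> to \<open>s\<^sup>-\<^sup>1(xc)s\<close>.\<close>

definition C_act :: "'a::{field,finite} perm3 \<Rightarrow> 'a perm3 \<Rightarrow> 'a perm3" where
  "C_act g x = (THE y. \<exists>c\<in>P_C. \<exists>s\<in>P_SSigma. g = c \<otimes>\<^bsub>Sym\<^esub> s \<and>
      y = inv\<^bsub>Sym\<^esub> s \<otimes>\<^bsub>Sym\<^esub> (x \<otimes>\<^bsub>Sym\<^esub> c) \<otimes>\<^bsub>Sym\<^esub> s)"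

definition admissible :: "'a::{field,finite} perm3 set \<Rightarrow> bool" where
  "admissible Jhat \<longleftrightarrow>
    subgroup Jhat Sym \<and> P_C \<subseteq> Jhat \<and> Jhat \<subseteq> P_CSSigma \<and> two_transitive_on P_C Jhat C_act"

definition J_of :: "'a::{field,finite} perm3 set \<Rightarrow> 'a perm3 set" where
  "J_of Jhat = stabilizer (Sym\<lparr>carrier := Jhat\<rparr>) C_act (p_gamma 0)"

definition G1_of :: "'a::{field,finite} perm3 set \<Rightarrow> 'a perm3 set" where
  "G1_of Jhat = P_K1 <#>\<^bsub>Sym\<^esub> P_F <#>\<^bsub>Sym\<^esub> J_of Jhat"

definition G2_of :: "'a::{field,finite} perm3 set \<Rightarrow> 'a perm3 set" where
  "G2_of Jhat = P_K2 <#>\<^bsub>Sym\<^esub> P_F <#>\<^bsub>Sym\<^esub> J_of Jhat"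

definition G_of :: "'a::{field,finite} perm3 set \<Rightarrow> 'a perm3 monoid" where
  "G_of Jhat = Sym\<lparr>carrier := generate Sym (G1_of Jhat \<union> G2_of Jhat)\<rparr>"

definition Delta :: "'a::{field,finite} perm3 set \<Rightarrow> 'a perm3 set pair_pre_digraph" where
  "Delta Jhat = coset_graph (G_of Jhat) (G1_of Jhat) (G2_of Jhat)"


section \<open>Elementary abelian groups\<close>

text \<open>The elementary abelian groups of order \<open>q\<close> and \<open>q ^ 3\<close> are represented by the additive groups
  of \<open>\<bbbF>\<^sub>q\<close> and \<open>\<bbbF>\<^sub>q\<^sup>3\<close>.\<close>

lemma comm_group_additive_group: "comm_group (additive_group :: 'b::ab_group_add monoid)"
  by (rule comm_groupI) (auto simp: additive_group_def add_ac intro: exI[of _ "- _"])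

lemma three_eq_0:
  assumes "CARD('a::{field,finite}) = 3 ^ r"
  shows "(3::'a) = 0"
proof -
  have "(\<Sum>x\<in>UNIV. x + 1) = (\<Sum>x\<in>UNIV. x :: 'a)"
    by (rule sum.reindex_bij_witness[of _ "\<lambda>x. x - 1" "\<lambda>x. x + 1"]) auto
  then have "(of_nat (3 ^ r) :: 'a) = 0"
    by (simp add: sum.distrib assms)
  then show ?thesis by simp
qed

lemma elementary_abelian_additive_group:
  assumes "CARD('a::{field,finite}) = 3 ^ r"
  shows "elementary_abelian 3 (additive_group :: 'a monoid)"
    and "order (additive_group :: 'a monoid) = 3 ^ r"
    and "elementary_abelian 3 (additive_group :: ('a^3) monoid)"
    and "order (additive_group :: ('a^3) monoid) = (3 ^ r) ^ 3"
proof -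
  have triple: "x + x + x = 0" for x :: 'a
  proof -
    have "x + x + x = 3 * x" by simp
    then show ?thesis using three_eq_0[OF assms] by simp
  qed
  have triple': "x + x + x = 0" for x :: "'a^3"
    using three_eq_0[OF assms] by (simp add: vec_eq_iff)
  show "elementary_abelian 3 (additive_group :: 'a monoid)"
    using comm_group_additive_group triple
    by (simp add: elementary_abelian_def additive_group_def nat_pow_def eval_nat_numeral)
  show "elementary_abelian 3 (additive_group :: ('a^3) monoid)"
    using comm_group_additive_group triple'
    by (simp add: elementary_abelian_def additive_group_def nat_pow_def eval_nat_numeral)
  show "order (additive_group :: 'a monoid) = 3 ^ r"
    by (simp add: order_def additive_group_def assms)
  show "order (additive_group :: ('a^3) monoid) = (3 ^ r) ^ 3"
    by (simp add: order_def additive_group_def assms)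
qed

end

(* In coordinates, the stabilizer of the arc and the stabilizers of its two ends consist of explicit
   semilinear maps of F_q^3 (those of x_2 carry one quadratic term), parametrized by a pair (nu, f)
   from J, with f a power of Frobenius, together with a matrix and a translation part. Let Y be the
   group of all nu with (nu, 1) in J. Then T_1 T_2 already contains T_2, whose H_1-conjugates generate
   the linear maps of determinant 1 together with those for nu in Y; this forces B to be the subgroup of
   H_{1,2} with f = 1, and H_1^*, H_2^* to be the subgroups of H_1, H_2 with f = 1, so d = (q-1)/|Y|.
   A normal subgroup of index d dividing q - 1 contains all 3-elements, hence is determined by its
   image under the determinant; this identifies every group in (i)-(iv). Transitivity of J on the
   nonzero elements is used only to see that |Y| is even, so that -1 lies in Y and the centralizers,
   where nu^2 = 1, have index (q-1)/2 in the full affine groups. *)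

theory Submission
  imports Defs "HOL-Algebra.Multiplicative_Group" "HOL-Computational_Algebra.Polynomial"
begin

section \<open>Subgroups of finite groups\<close>

text \<open>The group L_1 involves Q_u for every neighbour u of x_1, so coordinates at a single arc
  do not suffice. The computations are therefore made once, for abstract elements \<open>s1\<close>
  and \<open>s2\<close> known only by parameters and product laws, and then instantiated at each arc
  through cosets of \<open>g\<close> by conjugating the base maps with \<open>g\<close>. Inverses
  are avoided: a conjugate \<open>z\<close> of \<open>g\<close> by \<open>k\<close> is found by
  comparing parameters in \<open>g k = k z\<close>, and finite sets closed under products are
  subgroups. The recurring fact of characteristic 3 is that cubing is bijective, with inverse
  \<open>x ^ eps\<close> for \<open>eps = q / 3\<close>. It explains the exponents in \<beta> and
  \<tau>, recovers \<nu> from the determinant \<open>\<nu> ^ 3\<close>, and shows that elements of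
  3-power order in B have trivial diagonal parameters. Permutations compose from left to right while
  matrices act on columns from the left, so comparisons with affine groups reverse products;
  inversion or transposition repairs this. \<open>S0\<close> is an arbitrary Sylow subgroup, and
  conjugacy of Sylow subgroups moves it to the triangular one.\<close>

lemma (in group) inv_cancel:
  assumes "x \<in> carrier G" "y \<in> carrier G"
  shows "inv x \<otimes> (x \<otimes> y) = y" "x \<otimes> (inv x \<otimes> y) = y"
  using assms by (simp_all flip: m_assoc)

lemma (in group) finite_subgroupI:
  assumes "finite (carrier G)" "K \<subseteq> carrier G" "K \<noteq> {}"
    and closed: "\<And>x y. x \<in> K \<Longrightarrow> y \<in> K \<Longrightarrow> x \<otimes> y \<in> K"
  shows "subgroup K G"
proof (rule subgroupI)
  fix x assume x: "x \<in> K"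
  then have xG: "x \<in> carrier G" using assms by blast
  have pow: "x [^] Suc n \<in> K" for n
    by (induction n) (use x xG closed in auto)
  have "Coset.order G > 0" using assms(1) order_gt_0_iff_finite by blast
  \<comment> \<open>The inverse is the power with exponent \<open>2 * order - 1\<close>. Doubling
    keeps this exponent positive in the trivial group too, so it has the form \<open>Suc m\<close>
    that \<open>pow\<close> covers.\<close>
  define m where "m = 2 * Coset.order G - 2"
  have m: "2 * Coset.order G = Suc (Suc m)" using \<open>Coset.order G > 0\<close> by (simp add: m_def)
  have "x [^] (2 * Coset.order G) = \<one>"
    using pow_order_eq_1[OF xG] xG by (metis mult.commute nat_pow_pow nat_pow_one)
  then have "x [^] Suc m \<otimes> x = \<one>" by (simp add: m)
  then have "inv x = x [^] Suc m" using xG by (intro inv_equality) auto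
  then show "inv x \<in> K" using pow by simp
qed (use assms in auto)

text \<open>Normality in the form \<open>x k = k z\<close> asks only for products, so a coordinate
  description can be checked against its multiplication law without a formula for inverses.\<close>

lemma (in group) normal_restrictI:
  assumes K: "subgroup K G" and N: "subgroup N G" "N \<subseteq> K"
    and conj: "\<And>k x. k \<in> K \<Longrightarrow> x \<in> N \<Longrightarrow> \<exists>z\<in>N. x \<otimes> k = k \<otimes> z"
  shows "N \<lhd> G\<lparr>carrier := K\<rparr>"
proof -
  interpret K: group "G\<lparr>carrier := K\<rparr>" by (rule subgroup_imp_group[OF K])
  have KG: "K \<subseteq> carrier G" using K subgroup.subset by blast
  show ?thesis
  proof (rule K.normal_invI)
    show "subgroup N (G\<lparr>carrier := K\<rparr>)" using subgroup_incl N K by blast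
  next
    fix k x assume k: "k \<in> carrier (G\<lparr>carrier := K\<rparr>)" and x: "x \<in> N"
    then have k': "k \<in> K" "inv k \<in> K" using K subgroup.m_inv_closed by auto
    then obtain z where z: "z \<in> N" "x \<otimes> inv k = inv k \<otimes> z" using conj x by blast
    have "k \<otimes> (x \<otimes> inv k) = z"
      using z k' x KG N by (metis inv_solve_left' subgroup.mem_carrier inv_closed inv_inv m_closed subsetD)
    then show "k \<otimes>\<^bsub>G\<lparr>carrier := K\<rparr>\<^esub> x \<otimes>\<^bsub>G\<lparr>carrier := K\<rparr>\<^esub> inv\<^bsub>G\<lparr>carrier := K\<rparr>\<^esub> k \<in> N"
      using z k' x KG N m_inv_consistent[OF K k'(1)] by (simp add: m_assoc subset_iff)
  qed
qed

lemma (in group) normal_restrict_conj: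
  assumes "N \<lhd> G\<lparr>carrier := K\<rparr>" "subgroup K G" "x \<in> N" "k \<in> K"
  shows "inv k \<otimes> x \<otimes> k \<in> N"
  using normal.inv_op_closed1[OF assms(1), of k x] assms m_inv_consistent by simp

text \<open>The intersection of the \<open>K\<close>-conjugates of \<open>N\<close> is normal in
  \<open>K\<close>, and every normal subgroup inside \<open>N\<close> lies in each conjugate. This
  turns the \<open>GREATEST\<close> of the definition into a condition that can be tested on
  elements.\<close>

lemma (in group) largest_normal_in_eq:
  assumes K: "subgroup K G" and N: "subgroup N G" "N \<subseteq> K"
  shows "largest_normal_in G N K = {x \<in> N. \<forall>k\<in>K. inv k \<otimes> x \<otimes> k \<in> N}" (is "_ = ?T")
proof -
  have KG: "K \<subseteq> carrier G" using K subgroup.subset by blast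
  have NG: "N \<subseteq> carrier G" using N subgroup.subset by blast
  have conj_mult: "inv k \<otimes> (x \<otimes> y) \<otimes> k = (inv k \<otimes> x \<otimes> k) \<otimes> (inv k \<otimes> y \<otimes> k)"
    if "k \<in> K" "x \<in> N" "y \<in> N" for k x y
  proof -
    have c: "k \<in> carrier G" "x \<in> carrier G" "y \<in> carrier G" using that KG NG by auto
    have "(inv k \<otimes> x \<otimes> k) \<otimes> (inv k \<otimes> y \<otimes> k) = inv k \<otimes> x \<otimes> (k \<otimes> inv k) \<otimes> (y \<otimes> k)"
      using c by (simp only: m_assoc m_closed inv_closed)
    also have "\<dots> = inv k \<otimes> (x \<otimes> y) \<otimes> k"
      using c by (simp add: m_assoc)
    finally show ?thesis by simp
  qed
  have conj_inv: "inv k \<otimes> inv x \<otimes> k = inv (inv k \<otimes> x \<otimes> k)"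
    if "k \<in> K" "x \<in> N" for k x
  proof -
    have c: "k \<in> carrier G" "x \<in> carrier G" using that KG NG by auto
    then show ?thesis by (simp add: inv_mult_group m_assoc)
  qed
  have conj2: "inv l \<otimes> (inv k \<otimes> x \<otimes> k) \<otimes> l = inv (k \<otimes> l) \<otimes> x \<otimes> (k \<otimes> l)"
    if "k \<in> K" "l \<in> K" "x \<in> N" for k l x
  proof -
    have c: "k \<in> carrier G" "l \<in> carrier G" "x \<in> carrier G" using that KG NG by auto
    then show ?thesis by (simp add: inv_mult_group m_assoc)
  qed
  have T: "subgroup ?T G"
  proof (rule subgroupI)
    have "inv k \<otimes> \<one> \<otimes> k = \<one>" if "k \<in> K" for k using that KG by auto
    then have "\<one> \<in> ?T" using N subgroup.one_closed by auto
    then show "?T \<noteq> {}" by blast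
  qed (use NG conj_mult conj_inv N in \<open>auto simp: subgroup.m_closed subgroup.m_inv_closed\<close>)
  have Tn: "?T \<lhd> G\<lparr>carrier := K\<rparr>"
  proof (rule normal_restrictI[OF K T])
    show "?T \<subseteq> K" using N by auto
    fix k x assume k: "k \<in> K" and x: "x \<in> ?T"
    have "inv k \<otimes> x \<otimes> k \<in> ?T"
      using x k conj2 subgroup.m_closed[OF K] by auto
    moreover have "x \<otimes> k = k \<otimes> (inv k \<otimes> x \<otimes> k)"
    proof -
      have c: "k \<in> carrier G" "x \<in> carrier G" using k x KG NG by auto
      then have "k \<otimes> (inv k \<otimes> x \<otimes> k) = (k \<otimes> inv k) \<otimes> (x \<otimes> k)"
        by (simp only: m_assoc m_closed inv_closed)
      then show ?thesis using c by simp
    qed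
    ultimately show "\<exists>z\<in>?T. x \<otimes> k = k \<otimes> z" by blast
  qed
  show ?thesis
    unfolding largest_normal_in_def
  proof (rule Greatest_equality)
    show "?T \<subseteq> N \<and> ?T \<lhd> G\<lparr>carrier := K\<rparr>" using Tn by auto
  next
    fix U assume "U \<subseteq> N \<and> U \<lhd> G\<lparr>carrier := K\<rparr>"
    then show "U \<le> ?T" using normal_restrict_conj[OF _ K] by blast
  qed
qed

lemma (in group) conj_closure_subgroup:
  assumes "X \<subseteq> carrier G" "K \<subseteq> carrier G"
  shows "subgroup (conj_closure G X K) G"
  unfolding conj_closure_def using assms by (intro generate_is_subgroup) (auto simp: subset_iff)

lemma (in group) conj_closure_mono:
  "X \<subseteq> Y \<Longrightarrow> conj_closure G X K \<subseteq> conj_closure G Y K"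
  unfolding conj_closure_def by (intro mono_generate) auto

lemma (in group) conj_closure_memI:
  assumes "x \<in> X" "k \<in> K"
  shows "inv k \<otimes> x \<otimes> k \<in> conj_closure G X K"
  unfolding conj_closure_def using assms by (intro generate.incl) auto

lemma (in group) conj_closure_incl:
  assumes "X \<subseteq> carrier G" "subgroup K G"
  shows "X \<subseteq> conj_closure G X K"
proof
  fix x assume "x \<in> X"
  then show "x \<in> conj_closure G X K"
    using conj_closure_memI[of x X \<one> K] assms subgroup.one_closed by fastforce
qed

lemma (in group) conj_closure_subset:
  assumes "L \<lhd> G\<lparr>carrier := K\<rparr>" "subgroup K G" "X \<subseteq> L"
  shows "conj_closure G X K \<subseteq> L"
proof -
  have "subgroup L G" using assms(1,2) normal_imp_subgroup incl_subgroup by blast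
  then show ?thesis
    unfolding conj_closure_def
    using assms normal_restrict_conj[OF assms(1,2)] by (intro generate_subgroup_incl) auto
qed

text \<open>By \<open>min\<close> the closure of T_1 T_2 under \<open>H1\<close> contains
  \<open>H1s\<close>. Every candidate contains T_1 T_2, so its closure contains \<open>H1s\<close>
  and the candidate itself contains \<open>B\<close>. Thus \<open>B\<close> is the least candidate
  and not merely a minimal one, which settles uniqueness in the \<open>THE\<close>.\<close>

lemma (in group) core_edge_group_eqI:
  assumes "subgroup B (G\<lparr>carrier := H1 \<inter> H2\<rparr>)"
    and T: "largest_normal_in G (H1 \<inter> H2) H1 <#> largest_normal_in G (H1 \<inter> H2) H2 \<subseteq> B"
    and cl: "conj_closure G B H1 = H1s" "conj_closure G B H2 = H2s"
    and B: "B = (H1 \<inter> H2) \<inter> H1s" "B = (H1 \<inter> H2) \<inter> H2s"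
    and min: "H1s \<subseteq> conj_closure G (largest_normal_in G (H1 \<inter> H2) H1 <#> largest_normal_in G (H1 \<inter> H2) H2) H1"
  shows "core_edge_group G H1 H2 = B"
proof -
  have cand: "core_candidate G H1 H2 B"
    unfolding core_candidate_def cl using assms by simp
  have least: "B \<subseteq> B'" if "core_candidate G H1 H2 B'" for B'
    using that min conj_closure_mono B(1) unfolding core_candidate_def by blast
  show ?thesis
    unfolding core_edge_group_def
  proof (rule the_equality)
    show "core_candidate G H1 H2 B \<and> (\<forall>B'. core_candidate G H1 H2 B' \<and> B' \<subseteq> B \<longrightarrow> B' = B)"
      using cand least by blast
  qed (use cand least in blast)
qed

text \<open>Elements of a subgroup of order \<open>p ^ k\<close> are killed by \<open>p ^ k\<close>,
  so \<open>max\<close> puts every normal \<open>p\<close>-subgroup inside \<open>P\<close>.\<close>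

lemma (in group) Op_eqI:
  assumes "finite (carrier G)" "P \<lhd> G" "card P = p ^ n"
    and max: "\<And>x k. x \<in> carrier G \<Longrightarrow> x [^] (p ^ k :: nat) = \<one> \<Longrightarrow> x \<in> P"
  shows "Op p G = P"
  unfolding Op_def
proof (rule Greatest_equality)
  show "P \<lhd> G \<and> (\<exists>n. card P = p ^ n)" using assms by blast
next
  fix N assume N: "N \<lhd> G \<and> (\<exists>n. card N = p ^ n)"
  then obtain k where k: "card N = p ^ k" by blast
  have sub: "subgroup N G" using N normal_imp_subgroup by blast
  interpret N: group "G\<lparr>carrier := N\<rparr>" by (rule subgroup_imp_group[OF sub])
  show "N \<le> P"
  proof
    fix x assume x: "x \<in> N"
    have "x [^]\<^bsub>G\<lparr>carrier := N\<rparr>\<^esub> Coset.order (G\<lparr>carrier := N\<rparr>) = \<one>"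
      using N.pow_order_eq_1 x by simp
    then have "x [^] (p ^ k) = \<one>"
      by (simp add: Coset.order_def k flip: nat_pow_consistent)
    then show "x \<in> P" using max x sub subgroup.mem_carrier by metis
  qed
qed

text \<open>Bezout writes \<open>x\<close> as a product of powers of \<open>x [^] a\<close> and
  \<open>x [^] b\<close>. The case of interest is \<open>a = 3\<close> and \<open>b\<close> the
  index of \<open>N\<close>.\<close>

lemma (in group) coprime_pow_mem:
  assumes "subgroup N G" "x \<in> carrier G" "x [^] (a::nat) \<in> N" "x [^] (b::nat) \<in> N" "coprime a b"
  shows "x \<in> N"
proof -
  obtain u v :: int where uv: "u * int a + v * int b = 1"
    using assms(5) bezout_int[of "int a" "int b"] by (metis coprime_int_iff coprime_imp_gcd_eq_1)
  have "x = x [^] (u * int a + v * int b)" using assms by (simp add: uv)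
  also have "\<dots> = (x [^] int a) [^] u \<otimes> (x [^] int b) [^] v"
    using assms by (simp add: int_pow_mult int_pow_pow mult.commute)
  also have "\<dots> \<in> N"
    using assms by (auto simp: int_pow_int intro!: subgroup.m_closed subgroup_int_pow_closed)
  finally show ?thesis .
qed

lemma (in group) pow_index_mem:
  assumes "N \<lhd> G" "card (rcosets N) = d" "x \<in> carrier G"
  shows "x [^] d \<in> N"
proof -
  interpret N: normal N G by fact
  interpret Q: group "G Mod N" by (rule N.factorgroup_is_group)
  have "(N #> x) [^]\<^bsub>G Mod N\<^esub> Coset.order (G Mod N) = \<one>\<^bsub>G Mod N\<^esub>"
    using assms by (intro Q.pow_order_eq_1) (auto simp: carrier_FactGroup)
  moreover have "Coset.order (G Mod N) = d" using assms by (simp add: Coset.order_def FactGroup_def)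
  ultimately have "N #> (x [^] d) = N" using assms N.FactGroup_pow by simp
  then show ?thesis using assms coset_join1 N.subset N.subgroup_axioms by (metis nat_pow_closed)
qed

section \<open>Uniqueness of normal subgroups of a given index\<close>

definition unit_group :: "'a::field monoid" where
  "unit_group = \<lparr>carrier = UNIV - {0}, mult = (*), one = 1\<rparr>"

lemma unit_group_group: "group (unit_group :: 'a::field monoid)"
proof (rule groupI)
  show "\<exists>y\<in>carrier unit_group. y \<otimes>\<^bsub>unit_group\<^esub> x = \<one>\<^bsub>unit_group\<^esub>"
    if "x \<in> carrier unit_group" for x :: 'a
    using that by (intro bexI[of _ "inverse x"]) (auto simp: unit_group_def)
qed (auto simp: unit_group_def mult.assoc)

lemma unit_group_simps [simp]:
  "carrier unit_group = UNIV - {0}" "x \<otimes>\<^bsub>unit_group\<^esub> y = x * y" "\<one>\<^bsub>unit_group\<^esub> = 1"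
  by (auto simp: unit_group_def)

lemma unit_group_pow [simp]: "x [^]\<^bsub>unit_group\<^esub> (n::nat) = x ^ n"
  by (induction n) (auto simp: power_commutes)

text \<open>Lagrange: a finite nonempty set of units closed under products is a subgroup of the
  multiplicative group.\<close>

lemma pow_card_eq_1:
  fixes Z :: "'a::{field,finite} set"
  assumes "Z \<noteq> {}" "0 \<notin> Z" "\<And>x y. x \<in> Z \<Longrightarrow> y \<in> Z \<Longrightarrow> x * y \<in> Z" "x \<in> Z"
  shows "x ^ card Z = 1"
proof -
  interpret U: group "unit_group :: 'a monoid" by (rule unit_group_group)
  have Z: "subgroup Z unit_group"
    using assms by (intro U.finite_subgroupI) auto
  interpret Z: group "unit_group\<lparr>carrier := Z\<rparr>" by (rule U.subgroup_imp_group[OF Z])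
  have "x [^]\<^bsub>unit_group\<lparr>carrier := Z\<rparr>\<^esub> Coset.order (unit_group\<lparr>carrier := Z\<rparr>) = 1"
    using Z.pow_order_eq_1 assms by simp
  then show ?thesis
    by (simp add: Coset.order_def flip: U.nat_pow_consistent)
qed

lemma card_roots_of_unity_le:
  fixes n :: nat
  assumes "n > 0"
  shows "card {x::'a::{field,finite}. x ^ n = 1} \<le> n"
proof -
  have "poly (monom (1::'a) n - 1) 0 \<noteq> 0" using assms by (simp add: poly_monom power_0_left)
  then have "monom (1::'a) n - 1 \<noteq> 0" by (metis poly_0)
  then have "card {x::'a. poly (monom 1 n - 1) x = 0} \<le> degree (monom (1::'a) n - 1)"
    by (rule card_poly_roots_bound)
  also have "\<dots> \<le> n" by (rule degree_diff_le) (auto simp: degree_monom_le)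
  finally show ?thesis by (simp add: poly_monom)
qed

text \<open>Because \<open>N\<close> contains the kernel of \<psi>, each fibre of \<psi> on
  \<open>N\<close> is a whole coset of that kernel.\<close>

lemma card_fibres:
  fixes \<psi> :: "'g \<Rightarrow> 'a::field"
  assumes "group G" "finite (carrier G)" "subgroup N G"
    and mult: "\<And>x y. x \<in> carrier G \<Longrightarrow> y \<in> carrier G \<Longrightarrow> \<psi> (x \<otimes>\<^bsub>G\<^esub> y) = \<psi> x * \<psi> y"
    and nz: "\<And>x. x \<in> carrier G \<Longrightarrow> \<psi> x \<noteq> 0"
    and ker: "{x \<in> carrier G. \<psi> x = 1} \<subseteq> N"
  shows "card N = card (\<psi> ` N) * card {x \<in> carrier G. \<psi> x = 1}"
proof -
  interpret group G by fact
  have NG: "N \<subseteq> carrier G" using assms subgroup.subset by blast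
  have fin: "finite N" using NG assms finite_subset by blast
  let ?K = "{x \<in> carrier G. \<psi> x = 1}"
  have fib: "card {x. x \<in> N \<and> \<psi> x = y} = card ?K" if "y \<in> \<psi> ` N" for y
  proof -
    from that obtain a where a: "a \<in> N" "\<psi> a = y" by blast
        have ac: "a \<in> carrier G" using a NG by blast
    have "bij_betw (\<lambda>k. a \<otimes>\<^bsub>G\<^esub> k) ?K {x. x \<in> N \<and> \<psi> x = y}"
    proof (rule bij_betw_byWitness[where f' = "\<lambda>x. inv\<^bsub>G\<^esub> a \<otimes>\<^bsub>G\<^esub> x"])
      show "\<forall>k\<in>?K. inv\<^bsub>G\<^esub> a \<otimes>\<^bsub>G\<^esub> (a \<otimes>\<^bsub>G\<^esub> k) = k" using ac by (auto simp: inv_cancel)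
      show "\<forall>x\<in>{x. x \<in> N \<and> \<psi> x = y}. a \<otimes>\<^bsub>G\<^esub> (inv\<^bsub>G\<^esub> a \<otimes>\<^bsub>G\<^esub> x) = x" using ac NG by (auto simp: inv_cancel)
      show "(\<lambda>k. a \<otimes>\<^bsub>G\<^esub> k) ` ?K \<subseteq> {x. x \<in> N \<and> \<psi> x = y}"
        using a ac mult ker assms(3) by (auto intro: subgroup.m_closed)
      have "\<psi> (inv\<^bsub>G\<^esub> a \<otimes>\<^bsub>G\<^esub> x) = 1" if "x \<in> N" "\<psi> x = y" for x
      proof -
        have "inv\<^bsub>G\<^esub> a \<otimes>\<^bsub>G\<^esub> x \<in> carrier G" using ac that NG by auto
        from mult[OF ac this]
        have "\<psi> (a \<otimes>\<^bsub>G\<^esub> (inv\<^bsub>G\<^esub> a \<otimes>\<^bsub>G\<^esub> x)) = \<psi> a * \<psi> (inv\<^bsub>G\<^esub> a \<otimes>\<^bsub>G\<^esub> x)" .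
        moreover have "a \<otimes>\<^bsub>G\<^esub> (inv\<^bsub>G\<^esub> a \<otimes>\<^bsub>G\<^esub> x) = x" using ac that NG by (auto simp: inv_cancel)
        ultimately show ?thesis using that a nz[OF ac] by simp
      qed
      then show "(\<lambda>x. inv\<^bsub>G\<^esub> a \<otimes>\<^bsub>G\<^esub> x) ` {x. x \<in> N \<and> \<psi> x = y} \<subseteq> ?K" using ac NG by auto
    qed
    then show ?thesis by (simp add: bij_betw_same_card)
  qed
  have "card N = sum (\<lambda>_. 1) N" by simp
  also have "\<dots> = sum (\<lambda>y. sum (\<lambda>_. 1) {x. x \<in> N \<and> \<psi> x = y}) (\<psi> ` N)"
    by (rule sum.image_gen[OF fin])
  also have "\<dots> = card (\<psi> ` N) * card ?K" using fib by simp
  finally show ?thesis .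
qed

text \<open>A normal subgroup of index prime to 3 contains all elements of order 3, hence the kernel of
  \<open>\<psi>\<close>; it is therefore determined by its image under \<open>\<psi>\<close>, a group of roots of unity.\<close>

lemma index_subgroup_eq:
  fixes \<psi> :: "'g \<Rightarrow> 'a::{field,finite}" and d n :: nat
  assumes G: "group G" "finite (carrier G)"
    and mult: "\<And>x y. x \<in> carrier G \<Longrightarrow> y \<in> carrier G \<Longrightarrow> \<psi> (x \<otimes>\<^bsub>G\<^esub> y) = \<psi> x * \<psi> y"
    and nz: "\<And>x. x \<in> carrier G \<Longrightarrow> \<psi> x \<noteq> 0"
    and surj: "\<And>a. a \<noteq> 0 \<Longrightarrow> \<exists>x\<in>carrier G. \<psi> x = a"
    and ker: "\<And>x. x \<in> carrier G \<Longrightarrow> \<psi> x = 1 \<Longrightarrow> x \<in> generate G {y \<in> carrier G. y [^]\<^bsub>G\<^esub> (3::nat) = \<one>\<^bsub>G\<^esub>}"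
    and d: "d * n = CARD('a) - 1" "coprime 3 d"
    and Y: "card {a::'a. a ^ n = 1} = n"
  shows "index_subgroup G d = G\<lparr>carrier := {x \<in> carrier G. \<psi> x ^ n = 1}\<rparr>"
proof -
  interpret group G by fact
  let ?K = "{x \<in> carrier G. \<psi> x = 1}" and ?N = "{x \<in> carrier G. \<psi> x ^ n = 1}"
  have "CARD('a) > 1"
    using card_mono[of "UNIV :: 'a set" "{0, 1}"] by simp
  then have pos: "d > 0" "n > 0" using d(1) by (auto intro!: Nat.gr0I)
  have one: "\<psi> \<one>\<^bsub>G\<^esub> = 1" using mult[of "\<one>\<^bsub>G\<^esub>" "\<one>\<^bsub>G\<^esub>"] nz[of "\<one>\<^bsub>G\<^esub>"] by simp
  have Kpos: "card ?K > 0" using one G(2) by (auto simp: card_gt_0_iff)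
  have Nsub: "subgroup ?N G"
    using mult one by (intro finite_subgroupI G) (auto simp: power_mult_distrib)
  have inv: "\<psi> (inv\<^bsub>G\<^esub> x) * \<psi> x = 1" if "x \<in> carrier G" for x
    using mult[of "inv\<^bsub>G\<^esub> x" x] that one by simp
  have Nnorm: "?N \<lhd> G"
  proof (rule normal_invI[OF Nsub])
    fix x h assume "x \<in> carrier G" "h \<in> ?N"
    moreover from this have "\<psi> (x \<otimes>\<^bsub>G\<^esub> h \<otimes>\<^bsub>G\<^esub> inv\<^bsub>G\<^esub> x) = \<psi> h" using mult inv[of x] by (auto simp: algebra_simps)
    ultimately show "x \<otimes>\<^bsub>G\<^esub> h \<otimes>\<^bsub>G\<^esub> inv\<^bsub>G\<^esub> x \<in> ?N" by auto
  qed
  have ordG: "Coset.order G = (CARD('a) - 1) * card ?K"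
  proof -
    have "\<psi> ` carrier G = UNIV - {0}" using nz surj by fastforce
    then show ?thesis
      using card_fibres[OF G subgroup_self mult nz] by (simp add: Coset.order_def card_Diff_subset)
  qed
  have img: "\<psi> ` ?N = {a. a ^ n = 1}"
  proof
    show "{a. a ^ n = 1} \<subseteq> \<psi> ` ?N"
    proof
      fix a :: 'a assume "a \<in> {a. a ^ n = 1}"
      then have a: "a ^ n = 1" by simp
      then have "a \<noteq> 0" using pos by (metis power_eq_0_iff zero_neq_one power_0_left not_gr0)
      then obtain x where "x \<in> carrier G" "\<psi> x = a" using surj by blast
      then show "a \<in> \<psi> ` ?N" using a by (intro image_eqI[of _ _ x]) auto
    qed
  qed auto
  have cardN: "card ?N = n * card ?K"
  proof -
    have "?K \<subseteq> ?N" by auto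
    then show ?thesis using card_fibres[OF G Nsub mult nz] img Y by simp
  qed
  have index: "card (rcosets\<^bsub>G\<^esub> ?N) = d"
  proof -
    have "card (rcosets\<^bsub>G\<^esub> ?N) * (n * card ?K) = d * (n * card ?K)"
      using lagrange[OF Nsub] unfolding ordG cardN d(1)[symmetric] by (simp only: mult.assoc)
    then show ?thesis using pos Kpos by simp
  qed
  have unique: "N = ?N" if N: "N \<lhd> G" "card (rcosets\<^bsub>G\<^esub> N) = d" for N
  proof -
    have sub: "subgroup N G" using N normal_imp_subgroup by blast
    have "y \<in> N" if "y \<in> carrier G" "y [^]\<^bsub>G\<^esub> (3::nat) = \<one>\<^bsub>G\<^esub>" for y
      using coprime_pow_mem[OF sub that(1), of 3 d] that pow_index_mem[OF N that(1)] d(2)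
        subgroup.one_closed[OF sub] by simp
    then have "generate G {y \<in> carrier G. y [^]\<^bsub>G\<^esub> (3::nat) = \<one>\<^bsub>G\<^esub>} \<subseteq> N"
      by (intro generate_subgroup_incl sub) auto
    then have K: "?K \<subseteq> N" using ker by blast
    have NG: "N \<subseteq> carrier G" using sub subgroup.subset by blast
    \<comment> \<open>Lagrange turns the index into the order of \<open>N\<close>; dividing by the
      order of the kernel leaves exactly \<open>n\<close> values of \<psi> on
      \<open>N\<close>.\<close>
    have "d * card N = d * (n * card ?K)"
      using lagrange[OF sub] unfolding ordG d(1)[symmetric] N(2) by (simp only: mult.assoc)
    then have cN: "card N = n * card ?K" using pos by simp
    then have im: "card (\<psi> ` N) = n" using card_fibres[OF G sub mult nz K] Kpos by simp
    have root: "x ^ card (\<psi> ` N) = 1" if "x \<in> \<psi> ` N" for x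
    proof (rule pow_card_eq_1[OF _ _ _ that])
      fix a b assume "a \<in> \<psi> ` N" "b \<in> \<psi> ` N"
      then obtain x y where xy: "x \<in> N" "y \<in> N" "a = \<psi> x" "b = \<psi> y" by blast
      then have "a * b = \<psi> (x \<otimes>\<^bsub>G\<^esub> y)" using mult NG by (simp add: subset_iff)
      then show "a * b \<in> \<psi> ` N" using xy subgroup.m_closed[OF sub] by blast
    next
      show "0 \<notin> \<psi> ` N"
      proof
        assume "0 \<in> \<psi> ` N"
        then obtain x where "x \<in> N" "\<psi> x = 0" by (metis imageE)
        then show False using nz[of x] NG by blast
      qed
    qed (use that in blast)
    \<comment> \<open>The \<open>n\<close> values form a group, so each is an \<open>n\<close>-th
      root of unity. The resulting inclusion is an equality because the orders agree.\<close>
    have "N \<subseteq> ?N"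
    proof
      fix x assume x: "x \<in> N"
      then have "\<psi> x ^ n = 1" using root[of "\<psi> x"] unfolding im by blast
      then show "x \<in> ?N" using x NG by blast
    qed
    then show ?thesis using cN cardN G(2) by (intro card_subset_eq) auto
  qed
  have "(THE N. N \<lhd> G \<and> card (rcosets\<^bsub>G\<^esub> N) = d) = ?N"
    using Nnorm index unique by (intro the_equality) blast+
  then show ?thesis by (simp add: index_subgroup_def)
qed

section \<open>Conjugacy of Sylow subgroups\<close>

text \<open>\<open>P\<close> acts on the right cosets of \<open>Q\<close>. Their number is prime to
  \<open>p\<close>, so some orbit has length prime to \<open>p\<close>; this length divides the
  order of \<open>P\<close>, hence is 1. If \<open>Q g\<close> is the fixed coset, then the
  conjugate of \<open>P\<close> by \<open>g\<close> lies in \<open>Q\<close>, and the orders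
  agree.\<close>

lemma (in group) sylow_conjugate:
  assumes fin: "finite (carrier G)" and p: "prime p" and P: "P \<in> Syl p G" and Q: "Q \<in> Syl p G"
  obtains g where "g \<in> carrier G" "Q = (\<lambda>x. g \<otimes> x \<otimes> inv g) ` P"
proof -
  have Psub: "subgroup P G" and Pc: "card P = p ^ multiplicity p (Coset.order G)"
    and Qsub: "subgroup Q G" and Qc: "card Q = p ^ multiplicity p (Coset.order G)"
    using P Q by (auto simp: Syl_def)
  have PG: "P \<subseteq> carrier G" and QG: "Q \<subseteq> carrier G"
    using Psub Qsub subgroup.subset by blast+
  interpret P: group "G\<lparr>carrier := P\<rparr>" by (rule subgroup_imp_group[OF Psub])
  define X where "X = rcosets Q"
  \<comment> \<open>Inversion turns right multiplication into a homomorphism to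
    \<open>BijGroup\<close>, whose product applies its right factor first; restriction to
    \<open>X\<close> makes the maps extensional.\<close>
  define \<phi> where "\<phi> a = (\<lambda>C\<in>X. C #> inv a)" for a
  have XG: "C \<subseteq> carrier G" if "C \<in> X" for C
    using that rcosets_subset_PowG[OF Qsub] X_def by blast
  have shift: "C #> a \<in> X" if "C \<in> X" "a \<in> carrier G" for C a
    using that QG unfolding X_def RCOSETS_def by (auto simp: coset_mult_assoc)
  have undo: "C #> a #> inv a = C" "C #> inv a #> a = C" if "C \<in> X" "a \<in> carrier G" for C a
    using that XG by (auto simp: coset_mult_assoc)
  have bij: "\<phi> a \<in> Bij X" if "a \<in> P" for a
  proof -
    have a: "a \<in> carrier G" using that PG by blast
    have "bij_betw (\<phi> a) X X"
      by (rule bij_betw_byWitness[where f' = "\<lambda>C. C #> a"]) (use a shift undo in \<open>auto simp: \<phi>_def\<close>)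
    then show ?thesis by (simp add: Bij_def \<phi>_def)
  qed
  have hom: "\<phi> \<in> hom (G\<lparr>carrier := P\<rparr>) (BijGroup X)"
  proof (rule homI)
    fix a b assume ab: "a \<in> carrier (G\<lparr>carrier := P\<rparr>)" "b \<in> carrier (G\<lparr>carrier := P\<rparr>)"
    then have c: "a \<in> carrier G" "b \<in> carrier G" using PG by auto
    show "\<phi> (a \<otimes>\<^bsub>G\<lparr>carrier := P\<rparr>\<^esub> b) = \<phi> a \<otimes>\<^bsub>BijGroup X\<^esub> \<phi> b"
      using ab bij c shift XG
      by (auto simp: BijGroup_def \<phi>_def compose_def fun_eq_iff inv_mult_group coset_mult_assoc)
  qed (use bij in \<open>auto simp: BijGroup_def\<close>)
  interpret A: group_action "G\<lparr>carrier := P\<rparr>" X \<phi>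
    using hom P.is_group group_BijGroup
    by (simp add: group_action_def group_hom_def group_hom_axioms_def)
  have finX: "finite X" using XG fin by (intro finite_subset[of X "Pow (carrier G)"]) auto
  have index: "card X * card Q = Coset.order G" using lagrange[OF Qsub] X_def by simp
  have ord0: "Coset.order G \<noteq> 0" using fin order_gt_0_iff_finite by auto
  \<comment> \<open>The order of \<open>Q\<close> already carries the full power of \<open>p\<close>
    that divides the group order.\<close>
  have ndvd: "\<not> p dvd card X"
  proof
    assume "p dvd card X"
    then have "p ^ Suc (multiplicity p (Coset.order G)) dvd card X * card Q"
      using Qc by (auto intro: mult_dvd_mono)
    then have "p ^ Suc (multiplicity p (Coset.order G)) dvd Coset.order G" by (simp add: index)
    then show False
      using p ord0 by (subst (asm) power_dvd_iff_le_multiplicity) (auto simp: prime_nat_iff)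
  qed
  obtain O1 where O1: "O1 \<in> orbits (G\<lparr>carrier := P\<rparr>) X \<phi>" "\<not> p dvd card O1"
  proof (rule ccontr)
    assume "\<not> thesis"
    then have "p dvd (\<Sum>B\<in>orbits (G\<lparr>carrier := P\<rparr>) X \<phi>. card B)"
      using that by (intro dvd_sum) blast
    moreover have "(\<Sum>B\<in>orbits (G\<lparr>carrier := P\<rparr>) X \<phi>. card B) = card X"
      using A.disjoint_sum[OF finX, of "\<lambda>_. 1 :: nat"] by simp
    ultimately show False using ndvd by simp
  qed
  then obtain C where C: "C \<in> X" "O1 = orbit (G\<lparr>carrier := P\<rparr>) \<phi> C"
    by (auto simp: orbits_def)
  have "card O1 dvd card P"
    using A.orbit_stabilizer_theorem[OF C(1)] C(2) by (simp add: Coset.order_def) (metis dvd_triv_left)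
  then have "card O1 = 1"
    using O1(2) Pc p by (metis divides_primepow_nat dvd_power gr0I power_0)
  moreover have "C \<in> O1" using A.orbit_refl C by simp
  ultimately have O1_eq: "O1 = {C}" by (metis card_1_singletonE singletonD)
  obtain g where g: "g \<in> carrier G" "C = Q #> g" using C(1) by (auto simp: X_def RCOSETS_def)
  have "(\<lambda>x. g \<otimes> x \<otimes> inv g) ` P \<subseteq> Q"
  proof clarify
    fix x assume x: "x \<in> P"
    then have xi: "inv x \<in> P" "x \<in> carrier G" using Psub PG subgroup.m_inv_closed by auto
    then have "\<phi> (inv x) C \<in> O1" unfolding C(2) orbit_def by auto
    then have "C #> x = C" using C(1) xi by (simp add: O1_eq \<phi>_def)
    then have "Q #> (g \<otimes> x) = Q #> g" using g xi QG by (simp add: coset_mult_assoc)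
    then have "Q #> (g \<otimes> x \<otimes> inv g) = Q"
      using g xi QG by (metis coset_mult_assoc coset_mult_inv2 inv_closed m_closed r_inv coset_mult_one)
    then show "g \<otimes> x \<otimes> inv g \<in> Q"
      using coset_join1[OF _ _ Qsub] g xi by simp
  qed
  moreover have "inj_on (\<lambda>x. g \<otimes> x \<otimes> inv g) P"
  proof (rule inj_onI)
    fix x y assume "x \<in> P" "y \<in> P" "g \<otimes> x \<otimes> inv g = g \<otimes> y \<otimes> inv g"
    moreover from this have "x \<in> carrier G" "y \<in> carrier G" using PG by auto
    ultimately show "x = y" using g by simp
  qed
  then have "card ((\<lambda>x. g \<otimes> x \<otimes> inv g) ` P) = card Q"
    using Pc Qc by (simp add: card_image)
  moreover have "finite Q" using QG fin finite_subset by blast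
  ultimately have "Q = (\<lambda>x. g \<otimes> x \<otimes> inv g) ` P" by (metis card_subset_eq)
  then show ?thesis using that g by blast
qed

section \<open>Recognizing isomorphism types\<close>

text \<open>Permutations here compose from left to right, while matrices act on column vectors from
  the left. Comparing the two therefore reverses products; composing with inversion repairs
  this.\<close>

definition antihom :: "('g, 'm) monoid_scheme \<Rightarrow> ('h, 'n) monoid_scheme \<Rightarrow> ('g \<Rightarrow> 'h) \<Rightarrow> bool" where
  "antihom G H h \<longleftrightarrow> h ` carrier G \<subseteq> carrier H \<and>
    (\<forall>x\<in>carrier G. \<forall>y\<in>carrier G. h (x \<otimes>\<^bsub>G\<^esub> y) = h y \<otimes>\<^bsub>H\<^esub> h x)"

lemma (in group) antihom_comp_inv:
  assumes "antihom G H h"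
  shows "(\<lambda>x. h (inv x)) \<in> hom G H"
  using assms by (auto simp: antihom_def hom_def inv_mult_group image_subset_iff)

lemma (in group) image_comp_inv: "(\<lambda>x. h (inv x)) ` carrier G = h ` carrier G"
proof (intro equalityI subsetI)
  fix y assume "y \<in> h ` carrier G"
  then obtain x where "x \<in> carrier G" "y = h x" by blast
  then show "y \<in> (\<lambda>x. h (inv x)) ` carrier G" by (intro image_eqI[of _ _ "inv x"]) auto
qed auto

lemma (in group) inj_on_comp_inv:
  assumes "inj_on h (carrier G)"
  shows "inj_on (\<lambda>x. h (inv x)) (carrier G)"
proof (rule inj_onI)
  fix x y assume "x \<in> carrier G" "y \<in> carrier G" "h (inv x) = h (inv y)"
  then have "inv x = inv y" using inj_onD[OF assms] by simp
  then show "x = y" using \<open>x \<in> carrier G\<close> \<open>y \<in> carrier G\<close> by (metis inv_inv)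
qed

lemma (in group) antihom_iso:
  assumes "antihom G H h" "bij_betw h (carrier G) (carrier H)"
  shows "H \<cong> G"
proof -
  have "(\<lambda>x. h (inv x)) \<in> iso G H"
    using antihom_comp_inv[OF assms(1)] assms(2) image_comp_inv[of h]
    by (auto simp: iso_def bij_betw_def inj_on_comp_inv)
  then have "G \<cong> H" by (rule is_isoI)
  then show ?thesis by (rule iso_sym)
qed

text \<open>An internal decomposition made external: \<open>K\<close> acts on \<open>N\<close> by
  conjugation inside \<open>G\<close>, pulled back along \<iota>.\<close>

lemma (in group) is_semidirectI:
  assumes N: "group N" and K: "group K"
    and \<iota>: "\<iota> \<in> hom N G" "inj_on \<iota> (carrier N)" and \<kappa>: "\<kappa> \<in> hom K G" "inj_on \<kappa> (carrier K)"
    and norm: "\<iota> ` carrier N \<lhd> G"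
    and disj: "\<iota> ` carrier N \<inter> \<kappa> ` carrier K \<subseteq> {\<one>}"
    and cover: "\<And>g. g \<in> carrier G \<Longrightarrow> \<exists>n\<in>carrier N. \<exists>k\<in>carrier K. g = \<iota> n \<otimes> \<kappa> k"
  shows "is_semidirect G N K"
proof -
  interpret N: group N by fact
  interpret K: group K by fact
  interpret \<iota>: group_hom N G \<iota> using \<iota> by unfold_locales
  interpret \<kappa>: group_hom K G \<kappa> using \<kappa> by unfold_locales
  \<comment> \<open>The restriction to \<open>carrier N\<close> is there because
    \<open>AutoGroup\<close> consists of extensional maps.\<close>
  define \<theta> where "\<theta> k = (\<lambda>n\<in>carrier N. inv_into (carrier N) \<iota> (\<kappa> k \<otimes> \<iota> n \<otimes> inv (\<kappa> k)))" for k
  have img: "\<kappa> k \<otimes> \<iota> n \<otimes> inv (\<kappa> k) \<in> \<iota> ` carrier N" if "n \<in> carrier N" "k \<in> carrier K" for n k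
    using normal.inv_op_closed2[OF norm] that by simp
  have \<theta>_cl: "\<theta> k n \<in> carrier N" if "n \<in> carrier N" "k \<in> carrier K" for n k
    using inv_into_into[OF img[OF that]] that by (simp add: \<theta>_def)
  have \<theta>_eq: "\<iota> (\<theta> k n) = \<kappa> k \<otimes> \<iota> n \<otimes> inv (\<kappa> k)" if "n \<in> carrier N" "k \<in> carrier K" for n k
    using f_inv_into_f[OF img[OF that]] that by (simp add: \<theta>_def)
  have \<iota>_inj: "x = y" if "\<iota> x = \<iota> y" "x \<in> carrier N" "y \<in> carrier N" for x y
    using that \<iota>(2) by (auto dest: inj_onD)
  have \<theta>_comp: "\<theta> (k \<otimes>\<^bsub>K\<^esub> l) n = \<theta> k (\<theta> l n)" if "n \<in> carrier N" "k \<in> carrier K" "l \<in> carrier K" for n k l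
    using that by (intro \<iota>_inj \<theta>_cl) (simp_all add: \<theta>_eq \<theta>_cl inv_mult_group m_assoc)
  have \<theta>_one: "\<theta> \<one>\<^bsub>K\<^esub> n = n" if "n \<in> carrier N" for n
    using that by (intro \<iota>_inj \<theta>_cl) (simp_all add: \<theta>_eq)
  have \<theta>_mult: "\<theta> k (n \<otimes>\<^bsub>N\<^esub> n') = \<theta> k n \<otimes>\<^bsub>N\<^esub> \<theta> k n'"
    if "n \<in> carrier N" "n' \<in> carrier N" "k \<in> carrier K" for n n' k
  proof (intro \<iota>_inj)
    have "inv (\<kappa> k) \<otimes> (\<kappa> k \<otimes> z) = z" if "z \<in> carrier G" for z
      using that \<open>k \<in> carrier K\<close> by (simp flip: m_assoc)
    then show "\<iota> (\<theta> k (n \<otimes>\<^bsub>N\<^esub> n')) = \<iota> (\<theta> k n \<otimes>\<^bsub>N\<^esub> \<theta> k n')"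
      using that by (simp add: \<theta>_eq \<theta>_cl m_assoc)
  qed (use that \<theta>_cl in auto)
  have \<theta>_Bij: "\<theta> k \<in> Bij (carrier N)" if "k \<in> carrier K" for k
  proof -
    have "bij_betw (\<theta> k) (carrier N) (carrier N)"
      by (rule bij_betw_byWitness[where f' = "\<theta> (inv\<^bsub>K\<^esub> k)"])
        (use that \<theta>_cl \<theta>_one in \<open>auto simp flip: \<theta>_comp\<close>)
    then show ?thesis by (simp add: Bij_def \<theta>_def)
  qed
  have \<theta>_auto: "\<theta> k \<in> auto N" if "k \<in> carrier K" for k
    using that \<theta>_Bij \<theta>_cl \<theta>_mult by (auto simp: auto_def hom_def)
  have "\<theta> \<in> hom K (AutoGroup N)"
  proof (rule homI)
    fix k l assume kl: "k \<in> carrier K" "l \<in> carrier K"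
    have "\<theta> (k \<otimes>\<^bsub>K\<^esub> l) n = compose (carrier N) (\<theta> k) (\<theta> l) n" for n
      using kl \<theta>_comp by (cases "n \<in> carrier N") (auto simp: compose_def, auto simp: \<theta>_def)
    then show "\<theta> (k \<otimes>\<^bsub>K\<^esub> l) = \<theta> k \<otimes>\<^bsub>AutoGroup N\<^esub> \<theta> l"
      using kl \<theta>_Bij by (auto simp: AutoGroup_def BijGroup_def)
  qed (use \<theta>_auto in \<open>auto simp: AutoGroup_def\<close>)
  moreover have "G \<cong> semidirect N K \<theta>"
  proof -
    let ?S = "semidirect N K \<theta>"
    let ?h = "\<lambda>(n, k). \<iota> n \<otimes> \<kappa> k"
    have inj: "inj_on ?h (carrier ?S)"
    proof (rule inj_onI, clarify)
      fix n k n' k' assume c: "(n, k) \<in> carrier ?S" "(n', k') \<in> carrier ?S" and eq: "\<iota> n \<otimes> \<kappa> k = \<iota> n' \<otimes> \<kappa> k'"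
      then have cc: "n \<in> carrier N" "n' \<in> carrier N" "k \<in> carrier K" "k' \<in> carrier K"
        by (auto simp: semidirect_def)
      have "\<iota> (inv\<^bsub>N\<^esub> n' \<otimes>\<^bsub>N\<^esub> n) = inv (\<iota> n') \<otimes> (\<iota> n \<otimes> \<kappa> k) \<otimes> inv (\<kappa> k)"
        using cc by (simp add: m_assoc)
      also have "\<dots> = \<kappa> (k' \<otimes>\<^bsub>K\<^esub> inv\<^bsub>K\<^esub> k)"
        using cc by (simp add: eq flip: m_assoc)
      finally have e: "\<iota> (inv\<^bsub>N\<^esub> n' \<otimes>\<^bsub>N\<^esub> n) = \<kappa> (k' \<otimes>\<^bsub>K\<^esub> inv\<^bsub>K\<^esub> k)" .
      have c1: "inv\<^bsub>N\<^esub> n' \<otimes>\<^bsub>N\<^esub> n \<in> carrier N" "k' \<otimes>\<^bsub>K\<^esub> inv\<^bsub>K\<^esub> k \<in> carrier K" using cc by auto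
      have o: "\<iota> (inv\<^bsub>N\<^esub> n' \<otimes>\<^bsub>N\<^esub> n) = \<one>"
        using disj imageI[OF c1(1), of \<iota>] imageI[OF c1(2), of \<kappa>] unfolding e by blast
      have "inv\<^bsub>N\<^esub> n' \<otimes>\<^bsub>N\<^esub> n = \<one>\<^bsub>N\<^esub>" using \<iota>_inj[of _ "\<one>\<^bsub>N\<^esub>"] o c1 by simp
      then have "n' = n" using cc N.inv_equality[of "inv\<^bsub>N\<^esub> n'" n] N.inv_comm N.inv_inv by (metis N.inv_closed)
      moreover have "k' \<otimes>\<^bsub>K\<^esub> inv\<^bsub>K\<^esub> k = \<one>\<^bsub>K\<^esub>"
        using inj_onD[OF \<kappa>(2), of _ "\<one>\<^bsub>K\<^esub>"] e o c1 by simp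
      then have "k' = k" using cc K.inv_equality[of k' "inv\<^bsub>K\<^esub> k"] by simp
      ultimately show "n = n' \<and> k = k'" by simp
    qed
    have img: "?h ` carrier ?S = carrier G"
      using cover by (force simp: semidirect_def)
    have mult: "?h (x \<otimes>\<^bsub>?S\<^esub> y) = ?h x \<otimes> ?h y" and cl: "x \<otimes>\<^bsub>?S\<^esub> y \<in> carrier ?S"
      if "x \<in> carrier ?S" "y \<in> carrier ?S" for x y
    proof -
      obtain n k n' k' where xy: "x = (n, k)" "y = (n', k')" by fastforce
      then have cc: "n \<in> carrier N" "n' \<in> carrier N" "k \<in> carrier K" "k' \<in> carrier K"
        using that by (auto simp: semidirect_def)
      have "inv (\<kappa> k) \<otimes> (\<kappa> k \<otimes> z) = z" if "z \<in> carrier G" for z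
        using that cc by (simp flip: m_assoc)
      then show "?h (x \<otimes>\<^bsub>?S\<^esub> y) = ?h x \<otimes> ?h y"
        using cc by (simp add: xy semidirect_def \<theta>_eq \<theta>_cl m_assoc)
      show "x \<otimes>\<^bsub>?S\<^esub> y \<in> carrier ?S"
        using cc by (simp add: xy semidirect_def \<theta>_cl)
    qed
    let ?g = "inv_into (carrier ?S) ?h"
    have g: "?g x \<in> carrier ?S" "?h (?g x) = x" if "x \<in> carrier G" for x
      using that img by (metis inv_into_into, metis f_inv_into_f)
    have "?g \<in> iso G ?S"
    proof (rule isoI)
      show "?g \<in> hom G ?S"
      proof (rule homI)
        fix x y assume xy: "x \<in> carrier G" "y \<in> carrier G"
        show "?g (x \<otimes> y) = ?g x \<otimes>\<^bsub>?S\<^esub> ?g y"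
          using xy g mult cl by (intro inj_onD[OF inj]) auto
      qed (use g in auto)
      show "bij_betw ?g (carrier G) (carrier ?S)"
        using bij_betw_inv_into inj img by (metis bij_betw_imageI)
    qed
    then show ?thesis by (rule is_isoI)
  qed
  ultimately show ?thesis unfolding is_semidirect_def by blast
qed

text \<open>Inversion permutes the carrier of \<open>K\<close>, so precomposing \<kappa> with it
  gives a homomorphism with the same image.\<close>

lemma (in group) is_semidirect_antihomI:
  assumes N: "group N" and K: "group K"
    and \<iota>: "\<iota> \<in> hom N G" "inj_on \<iota> (carrier N)" and \<kappa>: "antihom K G \<kappa>" "inj_on \<kappa> (carrier K)"
    and norm: "\<iota> ` carrier N \<lhd> G"
    and disj: "\<iota> ` carrier N \<inter> \<kappa> ` carrier K \<subseteq> {\<one>}"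
    and cover: "\<And>g. g \<in> carrier G \<Longrightarrow> \<exists>n\<in>carrier N. \<exists>k\<in>carrier K. g = \<iota> n \<otimes> \<kappa> k"
  shows "is_semidirect G N K"
proof -
  interpret K: group K by fact
  show ?thesis
  proof (rule is_semidirectI[OF N K \<iota> K.antihom_comp_inv[OF \<kappa>(1)] _ norm])
    show "inj_on (\<lambda>k. \<kappa> (inv\<^bsub>K\<^esub> k)) (carrier K)"
      by (rule K.inj_on_comp_inv[OF \<kappa>(2)])
    show "\<exists>n\<in>carrier N. \<exists>k\<in>carrier K. g = \<iota> n \<otimes> \<kappa> (inv\<^bsub>K\<^esub> k)" if "g \<in> carrier G" for g
      using cover[OF that] by (metis K.inv_closed K.inv_inv)
  qed (use disj in \<open>simp add: K.image_comp_inv\<close>)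
qed

section \<open>Finite fields of characteristic 3\<close>

locale gf3 =
  fixes r :: nat and ty :: "'a::{field,finite} itself"
  assumes card_field: "CARD('a) = 3 ^ r" and r_pos: "r \<ge> 1"
begin

text \<open>Raising to this power is the inverse of cubing, since \<open>x ^ CARD('a) = x\<close>
  and \<open>eps * 3 = CARD('a)\<close>.\<close>

definition eps :: nat where "eps = 3 ^ (r - 1)"

lemma eps: "CARD('a) div 3 = eps" "eps * 3 = CARD('a)"
proof -
  obtain k where k: "r = Suc k" using r_pos by (cases r) auto
  show "CARD('a) div 3 = eps" "eps * 3 = CARD('a)"
    unfolding card_field eps_def unfolding k by simp_all
qed

lemma three: "(3::'a) = 0"
  by (rule three_eq_0[OF card_field])

lemma two: "(2::'a) = -1"
  using three by (simp add: eq_neg_iff_add_eq_0)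

lemma triple: "x + x + x = (0::'a)"
proof -
  have "x + x + x = 3 * x" by simp
  then show ?thesis by (simp only: three) simp
qed

lemma minus_one_neq_one: "(-1::'a) \<noteq> 1"
proof
  assume "(-1::'a) = 1"
  then have "(2::'a) = 1" using two by simp
  then have "(1::'a) = 0" by (metis add_cancel_right_right one_add_one)
  then show False by simp
qed

lemma cube_add: "(x + y) ^ 3 = x ^ 3 + (y::'a) ^ 3"
proof -
  have "(x + y) ^ 3 = x ^ 3 + y ^ 3 + 3 * (x * x * y + x * y * y)"
    by (simp add: power3_eq_cube algebra_simps)
  then show ?thesis by (simp only: three) simp
qed

lemma pow3_add: "(x + y) ^ 3 ^ k = x ^ 3 ^ k + (y::'a) ^ 3 ^ k"
  by (induction k) (simp_all add: cube_add power_mult mult.commute[of 3])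

lemma pow3_minus: "(- x) ^ 3 ^ k = - ((x::'a) ^ 3 ^ k)"
  by (simp add: power_minus_odd)

lemma pow3_eq_0_iff: "x ^ 3 ^ k = 0 \<longleftrightarrow> (x::'a) = 0"
  by simp

lemma pow3_inj: "x ^ 3 ^ k = (y::'a) ^ 3 ^ k \<longleftrightarrow> x = y"
proof
  assume "x ^ 3 ^ k = y ^ 3 ^ k"
  then have "(x + - y) ^ 3 ^ k = 0" unfolding pow3_add pow3_minus by simp
  then show "x = y" unfolding pow3_eq_0_iff by simp
qed simp

lemma pow3_eq_1: "x ^ 3 ^ k = 1 \<longleftrightarrow> (x::'a) = 1"
  using pow3_inj[of x k 1] by simp

lemma unit_pow: "(x::'a) ^ (CARD('a) - 1) = 1" if "x \<noteq> 0"
  using pow_card_eq_1[of "UNIV - {0::'a}" x] that by (auto simp: card_Diff_subset)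

lemma card_gt_1: "CARD('a) > 1"
  using card_mono[of "UNIV :: 'a set" "{0, 1}"] by simp

lemma pow_card: "(x::'a) ^ CARD('a) = x"
proof (cases "x = 0")
  case False
  have "CARD('a) = Suc (CARD('a) - 1)" using card_gt_1 by simp
  then have "x ^ CARD('a) = x * x ^ (CARD('a) - 1)" by (metis power_Suc)
  then show ?thesis using unit_pow[OF False] by simp
qed (use card_gt_1 in \<open>simp add: power_0_left\<close>)

lemma eps_add: "(x + y) ^ eps = x ^ eps + (y::'a) ^ eps"
  unfolding eps_def by (rule pow3_add)

lemma eps_cube: "((x::'a) ^ eps) ^ 3 = x" "(x ^ 3) ^ eps = x"
  using pow_card[of x] by (simp_all only: eps(2) mult.commute[of 3] flip: power_mult)

lemma eps_inj: "x ^ eps = (y::'a) ^ eps \<longleftrightarrow> x = y"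
  unfolding eps_def by (rule pow3_inj)

lemma eps_pos: "eps > 0"
  unfolding eps_def by simp

lemma eps_eq_0: "x ^ eps = 0 \<longleftrightarrow> (x::'a) = 0"
  using eps_pos by simp

lemma cube_inj: "x ^ 3 = (y::'a) ^ 3 \<longleftrightarrow> x = y"
  using pow3_inj[of x 1 y] by simp

lemma cube_eq_1: "x ^ 3 = 1 \<longleftrightarrow> (x::'a) = 1"
  using cube_inj[of x 1] by simp

text \<open>\<open>q\<close> is divisible by 3, so \<open>q - 1\<close> is not, nor is any divisor
  of it. Under this condition a normal subgroup of index \<open>d\<close> contains all elements of
  order 3.\<close>

lemma coprime_divisor: "coprime 3 d" if "d * n = CARD('a) - 1" for d n :: nat
proof -
  have "\<not> 3 dvd CARD('a) - 1"
  proof -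
    obtain k where k: "r = Suc k" using r_pos by (cases r) auto
    have "\<not> 3 dvd 3 * j - (1::nat)" if "j > 0" for j using that by presburger
    then show ?thesis unfolding card_field k by simp
  qed
  then have "\<not> 3 dvd d" using that by (metis dvd_mult2)
  moreover have "prime (3::nat)" by simp
  ultimately show ?thesis by (simp add: prime_imp_coprime)
qed

lemma square_eq_1: "(x::'a) ^ 2 = 1 \<longleftrightarrow> x = 1 \<or> x = -1"
  by (simp add: power2_eq_1_iff)

lemma card_square_roots: "card {a::'a. a ^ 2 = 1} = 2"
proof -
  have "{a::'a. a ^ 2 = 1} = {1, -1}" by (auto simp: square_eq_1)
  then show ?thesis using minus_one_neq_one by (simp add: card_insert_if)
qed

lemma half: "(CARD('a) - 1) div 2 * 2 = CARD('a) - 1"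
  by (simp add: card_field)

end

section \<open>Affine groups of the plane\<close>

text \<open>Upper and lower unitriangular matrices generate SL_2. The matrix enters through its four
  entries, so that one induction serves for matrices, affine maps, permutations and the abstract
  elements \<open>s1\<close>.\<close>

lemma SL2_induct:
  fixes p :: "'a::field"
  assumes det: "p * m - x * y = 1"
    and upper: "\<And>e. P 1 e 0 1" and lower: "\<And>e. P 1 0 e 1"
    and mult: "\<And>p x y m p' x' y' m'. P p x y m \<Longrightarrow> P p' x' y' m' \<Longrightarrow>
      P (p * p' + x * y') (p * x' + x * m') (y * p' + m * y') (y * x' + m * m')"
  shows "P p x y m"
proof -
  have nz: "P p x y m" if det: "p * m - x * y = 1" and y: "y \<noteq> 0" for p x y m
  proof -
    \<comment> \<open>For nonzero \<open>y\<close> the matrix is a product upper, lower, upper of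
      unitriangular factors; the two outer entries are forced by \<open>p\<close> and
      \<open>m\<close>.\<close>
    have "P 1 ((p - 1) / y) 0 1" "P 1 0 y 1" "P 1 ((m - 1) / y) 0 1" using upper lower by auto
    from mult[OF mult[OF this(1,2)] this(3)]
    have "P p ((m - 1) / y * p + (p - 1) / y) y m" using y by (simp add: field_simps)
    moreover have "(m - 1) / y * p + (p - 1) / y = x"
      using det y by (simp add: field_simps)
    ultimately show ?thesis by simp
  qed
  show ?thesis
  proof (cases "y = 0")
    case True
    then have "m \<noteq> 0" using det by auto
    \<comment> \<open>If \<open>y = 0\<close>, adding the second column to the first puts the
      nonzero \<open>m\<close> into the lower left corner; the lower factor with entry -1 undoes
      this.\<close>
    have "P (p + x) x (y + m) m"
      by (rule nz) (use det True \<open>m \<noteq> 0\<close> in \<open>auto simp: algebra_simps\<close>)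
    from mult[OF this lower[of "-1"]] show ?thesis by simp
  qed (use nz det in blast)
qed

definition vec2 :: "'a \<Rightarrow> 'a \<Rightarrow> 'a^2" where
  "vec2 u v = (\<chi> i. if i = 1 then u else v)"

definition mat2 :: "'a \<Rightarrow> 'a \<Rightarrow> 'a \<Rightarrow> 'a \<Rightarrow> 'a^2^2" where
  "mat2 p x y m = vec2 (vec2 p x) (vec2 y m)"

definition aff :: "'a \<Rightarrow> 'a \<Rightarrow> 'a \<Rightarrow> 'a \<Rightarrow> 'a \<Rightarrow> 'a \<Rightarrow> (('a::field)^2) \<times> ('a^2^2)" where
  "aff u v p x y m = (vec2 u v, mat2 p x y m)"

lemma vec2_nth [simp]: "vec2 u v $ 1 = u" "vec2 u v $ 2 = v"
  by (simp_all add: vec2_def)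

lemma mat2_nth [simp]:
  "mat2 p x y m $ 1 $ 1 = p" "mat2 p x y m $ 1 $ 2 = x" "mat2 p x y m $ 2 $ 1 = y" "mat2 p x y m $ 2 $ 2 = m"
  by (simp_all add: mat2_def)

lemma vec2_eq_iff: "v = w \<longleftrightarrow> v $ 1 = w $ 1 \<and> v $ 2 = w $ 2" for v w :: "'a^2"
  by (simp add: vec_eq_iff forall_2)

lemma mat2_surj: "mat2 (A $ 1 $ 1) (A $ 1 $ 2) (A $ 2 $ 1) (A $ 2 $ 2) = A"
  by (simp add: vec2_eq_iff)

lemma vec2_surj: "vec2 (v $ 1) (v $ 2) = v"
  by (simp add: vec2_eq_iff)

lemma mat2_mult: "mat2 p x y m ** mat2 p' x' y' m' =
    mat2 (p * p' + x * y') (p * x' + x * m') (y * p' + m * y') (y * x' + m * m')"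
  by (simp add: vec2_eq_iff matrix_matrix_mult_def sum_2)

lemma mat2_vec2: "mat2 p x y m *v vec2 u v = vec2 (p * u + x * v) (y * u + m * v)"
  by (simp add: vec2_eq_iff matrix_vector_mult_def sum_2)

lemma mat2_one: "mat 1 = mat2 1 0 0 1"
  by (simp add: vec2_eq_iff mat_def)

lemma det_mat2: "det (mat2 p x y m) = p * m - x * y"
  by (simp add: det_2)

lemma invertible_mat2: "invertible (mat2 p x y m) \<longleftrightarrow> p * m - x * y \<noteq> (0::'a::field)"
  by (simp add: invertible_det_nz det_mat2)

lemma GL_simps [simp]:
  "carrier GL = {A. invertible A}" "A \<otimes>\<^bsub>GL\<^esub> B = A ** B" "\<one>\<^bsub>GL\<^esub> = mat 1"
  by (auto simp: GL_def)

lemma GL_group: "group (GL :: ('a::field^'n^'n) monoid)"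
proof (rule groupI)
  show "\<exists>B\<in>carrier GL. B \<otimes>\<^bsub>GL\<^esub> A = \<one>\<^bsub>GL\<^esub>" if "A \<in> carrier GL" for A :: "'a^'n^'n"
    using that unfolding invertible_def by (auto simp: invertible_def)
qed (auto simp: matrix_mul_assoc invertible_mult intro: exI[of _ "mat 1"] simp: invertible_def[of "mat 1"])

lemma AGL_carrier: "carrier AGL = {(v, A). invertible A}"
  by (auto simp: AGL_def semidirect_def additive_group_def)

lemma AGL_mult [simp]: "(v, A) \<otimes>\<^bsub>AGL\<^esub> (w, B) = (v + A *v w, A ** B)"
  by (simp add: AGL_def semidirect_def additive_group_def)

lemma AGL_one: "\<one>\<^bsub>AGL\<^esub> = (0, mat 1)"
  by (simp add: AGL_def semidirect_def additive_group_def)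

lemma AGL_group: "group (AGL :: (('a::field^'n) \<times> ('a^'n^'n)) monoid)"
proof (rule groupI)
  interpret GL: group "GL :: ('a^'n^'n) monoid" by (rule GL_group)
  show "\<exists>h\<in>carrier AGL. h \<otimes>\<^bsub>AGL\<^esub> g = \<one>\<^bsub>AGL\<^esub>" if g: "g \<in> carrier AGL" for g :: "('a^'n) \<times> ('a^'n^'n)"
  proof -
    obtain v A where vA: "g = (v, A)" "invertible A" using g by (auto simp: AGL_carrier)
    then obtain B where B: "invertible B" "B ** A = mat 1" using GL.l_inv_ex[of A] by auto
    then show ?thesis
      by (intro bexI[of _ "(- (B *v v), B)"]) (auto simp: vA AGL_carrier AGL_one)
  qed
  show "x \<otimes>\<^bsub>AGL\<^esub> y \<in> carrier AGL" if "x \<in> carrier AGL" "y \<in> carrier AGL" for x y :: "('a^'n) \<times> ('a^'n^'n)"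
    using that GL.m_closed by (auto simp: AGL_carrier)
  show "\<one>\<^bsub>AGL\<^esub> \<in> carrier (AGL :: (('a^'n) \<times> ('a^'n^'n)) monoid)"
    using GL.one_closed by (simp add: AGL_carrier AGL_one)
qed (auto simp: AGL_carrier AGL_one matrix_mul_assoc matrix_vector_mul_assoc matrix_vector_right_distrib)

lemma ASL_eq: "ASL = AGL\<lparr>carrier := {(v, A). det A = 1}\<rparr>"
  by (auto simp: ASL_def AGL_def semidirect_def SL_def additive_group_def)

lemma aff_carrier: "aff u v p x y m \<in> carrier AGL \<longleftrightarrow> p * m - x * y \<noteq> 0"
  by (simp add: aff_def AGL_carrier invertible_mat2)

lemma aff_mult: "aff u v p x y m \<otimes>\<^bsub>AGL\<^esub> aff u' v' p' x' y' m' =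
    aff (u + p * u' + x * v') (v + y * u' + m * v')
      (p * p' + x * y') (p * x' + x * m') (y * p' + m * y') (y * x' + m * m')"
  by (simp add: aff_def mat2_mult mat2_vec2) (simp add: vec2_eq_iff)

lemma aff_one: "\<one>\<^bsub>AGL\<^esub> = aff 0 0 1 0 0 1"
  by (simp add: aff_def AGL_one mat2_one vec2_eq_iff)

lemma aff_eq_iff: "aff u v p x y m = aff u' v' p' x' y' m' \<longleftrightarrow>
    u = u' \<and> v = v' \<and> p = p' \<and> x = x' \<and> y = y' \<and> m = m'"
  by (auto simp: aff_def vec2_eq_iff)

lemma aff_surj: obtains u v p x y m where "g = aff u v p x y m"
  by (metis aff_def mat2_surj vec2_surj surj_pair)

lemma finite_AGL: "finite (carrier (AGL :: (('a::{field,finite}^2) \<times> ('a^2^2)) monoid))"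
  by (rule finite)

context gf3
begin

text \<open>The determinant serves as \<psi>. Its kernel SL_2 is generated by transvections, whose
  cubes are trivial in characteristic 3.\<close>

lemma index_GL2:
  assumes "d * n = CARD('a) - 1" "card {a::'a. a ^ n = 1} = n"
  shows "index_subgroup (GL :: ('a^2^2) monoid) d = GL\<lparr>carrier := {A. det A \<noteq> 0 \<and> det A ^ n = 1}\<rparr>"
proof -
  interpret GL: group "GL :: ('a^2^2) monoid" by (rule GL_group)
  let ?W = "{B \<in> carrier GL. B [^]\<^bsub>GL\<^esub> (3::nat) = \<one>\<^bsub>GL\<^esub>} :: ('a^2^2) set"
  have "index_subgroup (GL :: ('a^2^2) monoid) d = GL\<lparr>carrier := {A \<in> carrier GL. det A ^ n = 1}\<rparr>"
  proof (rule index_subgroup_eq[OF GL_group _ _ _ _ _ assms(1) coprime_divisor[OF assms(1)] assms(2)])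
    show "\<exists>A\<in>carrier GL. det (A :: 'a^2^2) = a" if "a \<noteq> 0" for a
      using that by (intro bexI[of _ "mat2 a 0 0 1"]) (auto simp: det_mat2 invertible_mat2)
  next
    fix A :: "'a^2^2" assume "A \<in> carrier GL" "det A = 1"
    have "mat2 p x y m \<in> generate GL ?W" if "p * m - x * y = 1" for p x y m
    proof (rule SL2_induct[OF that, where P = "\<lambda>p x y m. mat2 p x y m \<in> generate GL ?W"])
      show "mat2 1 e 0 1 \<in> generate GL ?W" "mat2 1 0 e 1 \<in> generate GL ?W" for e :: 'a
        by (rule generate.incl, simp add: invertible_mat2 numeral_3_eq_3 mat2_mult mat2_one three)+
    next
      fix p x y m p' x' y' m' :: 'a
      assume "mat2 p x y m \<in> generate GL ?W" "mat2 p' x' y' m' \<in> generate GL ?W"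
      from generate.eng[OF this]
      show "mat2 (p * p' + x * y') (p * x' + x * m') (y * p' + m * y') (y * x' + m * m') \<in> generate GL ?W"
        by (simp add: mat2_mult)
    qed
    from this[of "A$1$1" "A$2$2" "A$1$2" "A$2$1"] \<open>det A = 1\<close>
    show "A \<in> generate GL ?W" by (simp add: mat2_surj det_2)
  qed (auto simp: det_mul invertible_det_nz)
  then show ?thesis by (simp add: invertible_det_nz)
qed

text \<open>As for GL_2, with the translations as further generators of the kernel; their cubes are
  trivial as well.\<close>

lemma index_AGL2:
  assumes "d * n = CARD('a) - 1" "card {a::'a. a ^ n = 1} = n"
  shows "index_subgroup (AGL :: (('a^2) \<times> ('a^2^2)) monoid) d =
    AGL\<lparr>carrier := {(v, A). det A \<noteq> 0 \<and> det A ^ n = 1}\<rparr>"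
proof -
  interpret AGL: group "AGL :: (('a^2) \<times> ('a^2^2)) monoid" by (rule AGL_group)
  let ?W = "{B \<in> carrier AGL. B [^]\<^bsub>AGL\<^esub> (3::nat) = \<one>\<^bsub>AGL\<^esub>} :: (('a^2) \<times> ('a^2^2)) set"
  have "index_subgroup (AGL :: (('a^2) \<times> ('a^2^2)) monoid) d =
      AGL\<lparr>carrier := {g \<in> carrier AGL. det (snd g) ^ n = 1}\<rparr>"
  proof (rule index_subgroup_eq[OF AGL_group finite_AGL _ _ _ _ assms(1) coprime_divisor[OF assms(1)] assms(2)])
    show "\<exists>g\<in>carrier AGL. det (snd (g :: ('a^2) \<times> ('a^2^2))) = a" if "a \<noteq> 0" for a
      using that by (intro bexI[of _ "aff 0 0 a 0 0 1"]) (auto simp: aff_carrier aff_def det_mat2 AGL_carrier invertible_mat2)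
  next
    fix g :: "('a^2) \<times> ('a^2^2)" assume g: "g \<in> carrier AGL" "det (snd g) = 1"
    obtain u v p x y m where a: "g = aff u v p x y m" by (rule aff_surj)
    have "aff 0 0 p x y m \<in> generate AGL ?W" if "p * m - x * y = 1" for p x y m
    proof (rule SL2_induct[OF that, where P = "\<lambda>p x y m. aff 0 0 p x y m \<in> generate AGL ?W"])
      show "aff 0 0 1 e 0 1 \<in> generate AGL ?W" "aff 0 0 1 0 e 1 \<in> generate AGL ?W" for e :: 'a
        by (rule generate.incl, simp add: aff_carrier numeral_3_eq_3 aff_mult aff_one three)+
    next
      fix p x y m p' x' y' m' :: 'a
      assume "aff 0 0 p x y m \<in> generate AGL ?W" "aff 0 0 p' x' y' m' \<in> generate AGL ?W"
      from generate.eng[OF this]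
      show "aff 0 0 (p * p' + x * y') (p * x' + x * m') (y * p' + m * y') (y * x' + m * m') \<in> generate AGL ?W"
        by (simp add: aff_mult)
    qed
    moreover have "p * m - x * y = 1" using g by (simp add: a aff_def det_mat2)
    ultimately have "aff 0 0 p x y m \<in> generate AGL ?W" by blast
    moreover have "aff u v 1 0 0 1 \<in> generate AGL ?W"
      by (rule generate.incl, simp add: aff_carrier numeral_3_eq_3 aff_mult aff_one three)
    ultimately have "aff u v 1 0 0 1 \<otimes>\<^bsub>AGL\<^esub> aff 0 0 p x y m \<in> generate AGL ?W"
      by (blast intro: generate.eng)
    then show "g \<in> generate AGL ?W" by (simp add: aff_mult a)
  qed (auto simp: AGL_carrier det_mul invertible_det_nz)
  moreover have "{g \<in> carrier AGL. det (snd g) ^ n = 1} = {(v, A). det A \<noteq> 0 \<and> det (A :: 'a^2^2) ^ n = 1}"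
    by (auto simp: AGL_carrier invertible_det_nz)
  ultimately show ?thesis by simp
qed

text \<open>In degree 1 the determinant is injective, so the kernel condition concerns the identity
  alone.\<close>

lemma index_GL1:
  assumes "d * n = CARD('a) - 1" "card {a::'a. a ^ n = 1} = n"
  shows "index_subgroup (GL :: ('a^1^1) monoid) d = GL\<lparr>carrier := {A. det A \<noteq> 0 \<and> det A ^ n = 1}\<rparr>"
proof -
  interpret GL: group "GL :: ('a^1^1) monoid" by (rule GL_group)
  have "index_subgroup (GL :: ('a^1^1) monoid) d = GL\<lparr>carrier := {A \<in> carrier GL. det A ^ n = 1}\<rparr>"
  proof (rule index_subgroup_eq[OF GL_group _ _ _ _ _ assms(1) coprime_divisor[OF assms(1)] assms(2)])
    show "\<exists>A\<in>carrier GL. det (A :: 'a^1^1) = a" if "a \<noteq> 0" for a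
      using that by (intro bexI[of _ "mat a"]) (auto simp: invertible_det_nz det_1 mat_def)
  next
    fix A :: "'a^1^1" assume "det A = 1"
    then have A: "A = \<one>\<^bsub>GL\<^esub>" by (simp add: det_1 vec_eq_iff mat_def)
    show "A \<in> generate GL {B \<in> carrier GL. B [^]\<^bsub>GL\<^esub> (3::nat) = \<one>\<^bsub>GL\<^esub>}"
      unfolding A by (rule generate.one)
  qed (auto simp: det_mul invertible_det_nz)
  then show ?thesis by (simp add: invertible_det_nz)
qed

end

section \<open>Sylow normalizers in the affine groups\<close>

context group
begin

definition cj :: "'a \<Rightarrow> 'a \<Rightarrow> 'a" where
  "cj g x = g \<otimes> x \<otimes> inv g"

lemma cj_closed [simp]: "g \<in> carrier G \<Longrightarrow> x \<in> carrier G \<Longrightarrow> cj g x \<in> carrier G"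
  by (simp add: cj_def)

lemma cj_cj: "g \<in> carrier G \<Longrightarrow> h \<in> carrier G \<Longrightarrow> x \<in> carrier G \<Longrightarrow> cj g (cj h x) = cj (g \<otimes> h) x"
  by (simp add: cj_def inv_mult_group m_assoc)

lemma cj_one: "x \<in> carrier G \<Longrightarrow> cj \<one> x = x"
  by (simp add: cj_def)

lemma cj_inv_cancel:
  assumes "g \<in> carrier G" "x \<in> carrier G"
  shows "cj (inv g) (cj g x) = x" "cj g (cj (inv g) x) = x"
  using assms by (simp_all add: cj_cj cj_one)

lemma cj_mult: "g \<in> carrier G \<Longrightarrow> x \<in> carrier G \<Longrightarrow> y \<in> carrier G \<Longrightarrow> cj g (x \<otimes> y) = cj g x \<otimes> cj g y"
  by (simp add: cj_def m_assoc inv_cancel)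

lemma cj_eqI: "k \<in> carrier G \<Longrightarrow> s' \<in> carrier G \<Longrightarrow> s' \<otimes> k = k \<otimes> s \<Longrightarrow> cj k s = s'"
  by (metis cj_def inv_closed m_assoc r_inv r_one)

lemma cj_eqD: "cj k s = s' \<Longrightarrow> k \<in> carrier G \<Longrightarrow> s \<in> carrier G \<Longrightarrow> s' \<otimes> k = k \<otimes> s"
  by (auto simp: cj_def m_assoc)

lemma cj_inj: "g \<in> carrier G \<Longrightarrow> inj_on (cj g) (carrier G)"
  by (metis cj_inv_cancel(1) inj_onI)

lemma cj_hom: "g \<in> carrier G \<Longrightarrow> cj g \<in> hom G G"
  by (auto simp: hom_def cj_mult)

lemma cj_subgroup: "g \<in> carrier G \<Longrightarrow> subgroup A G \<Longrightarrow> subgroup (cj g ` A) G"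
  using group_hom.subgroup_img_is_subgroup[of G G "cj g" A] cj_hom
  by (simp add: group_hom_def group_hom_axioms_def is_group)

lemma cj_iso: "g \<in> carrier G \<Longrightarrow> A \<subseteq> carrier G \<Longrightarrow> G\<lparr>carrier := A\<rparr> \<cong> G\<lparr>carrier := cj g ` A\<rparr>"
  by (rule is_isoI[of "cj g"], rule isoI)
    (auto simp: hom_def cj_mult subset_iff bij_betw_def intro: inj_on_subset[OF cj_inj])

lemma cj_image_eqI:
  assumes "g \<in> carrier G" "A \<subseteq> carrier G" "finite A" "cj g ` A \<subseteq> A"
  shows "cj g ` A = A"
proof -
  have "card (cj g ` A) = card A" using assms cj_inj by (intro card_image) (rule inj_on_subset)
  then show ?thesis using assms card_subset_eq by metis
qed

lemma coset_cj: "A \<subseteq> carrier G \<Longrightarrow> g <# A #> inv g = cj g ` A"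
  by (auto simp: l_coset_def r_coset_def cj_def)

lemma normalizer_iff: "S \<subseteq> carrier G \<Longrightarrow> k \<in> normalizer G S \<longleftrightarrow> k \<in> carrier G \<and> cj k ` S = S"
  by (simp add: normalizer_def stabilizer_def coset_cj)

lemma normalizer_restrict:
  assumes M: "subgroup M G" and S: "S \<subseteq> M"
  shows "normalizer (G\<lparr>carrier := M\<rparr>) S = normalizer G S \<inter> M"
proof -
  interpret M: group "G\<lparr>carrier := M\<rparr>" by (rule subgroup_imp_group[OF M])
  have MG: "M \<subseteq> carrier G" using M subgroup.subset by blast
  have "M.cj k x = cj k x" if "k \<in> M" for k x
    using that m_inv_consistent[OF M] by (simp add: M.cj_def cj_def)
  then have "M.cj k ` S = cj k ` S" if "k \<in> M" for k using that by simp
  moreover have "S \<subseteq> carrier G" using S MG by blast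
  ultimately have "k \<in> normalizer (G\<lparr>carrier := M\<rparr>) S \<longleftrightarrow> k \<in> normalizer G S \<inter> M" for k
    using S MG M.normalizer_iff[of S] normalizer_iff[of S] by (cases "k \<in> M") (simp_all add: subset_iff)
  then show ?thesis by blast
qed

lemma cj_image_conj:
  assumes "g \<in> carrier G" "k \<in> carrier G" "A \<subseteq> carrier G"
  shows "cj (cj g k) ` (cj g ` A) = cj g ` (cj k ` A)"
proof -
  have "cj (cj g k) (cj g x) = cj g (cj k x)" if "x \<in> A" for x
  proof -
    have "x \<in> carrier G" using that assms by blast
    moreover have "cj g k \<otimes> g = g \<otimes> k" using assms by (simp add: cj_def m_assoc)
    ultimately show ?thesis using assms by (simp add: cj_cj)
  qed
  then show ?thesis by (simp add: image_image)
qed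

lemma normalizer_cj:
  assumes "g \<in> carrier G" "S \<subseteq> carrier G" "k \<in> normalizer G S"
  shows "cj g k \<in> normalizer G (cj g ` S)"
proof -
  have "cj g ` S \<subseteq> carrier G" using assms by auto
  moreover have "k \<in> carrier G" "cj k ` S = S" using assms normalizer_iff by auto
  ultimately show ?thesis using assms by (simp add: normalizer_iff cj_image_conj)
qed

lemma cj_inv_image: "g \<in> carrier G \<Longrightarrow> S \<subseteq> carrier G \<Longrightarrow> cj (inv g) ` (cj g ` S) = S"
  by (force simp: image_image cj_inv_cancel subset_iff)

lemma elementary_abelian_restrict:
  assumes A: "subgroup A G"
  shows "elementary_abelian n (G\<lparr>carrier := A\<rparr>) \<longleftrightarrow>
    (\<forall>x\<in>A. \<forall>y\<in>A. x \<otimes> y = y \<otimes> x) \<and> (\<forall>x\<in>A. x [^] n = \<one>)"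
proof -
  interpret A: group "G\<lparr>carrier := A\<rparr>" by (rule subgroup_imp_group[OF A])
  have "comm_group (G\<lparr>carrier := A\<rparr>) \<longleftrightarrow> (\<forall>x\<in>A. \<forall>y\<in>A. x \<otimes> y = y \<otimes> x)"
    using A.group_comm_groupI comm_groupE(4)[of "G\<lparr>carrier := A\<rparr>"] by auto
  then show ?thesis by (simp add: elementary_abelian_def flip: nat_pow_consistent)
qed

lemma cj_pow: "g \<in> carrier G \<Longrightarrow> x \<in> carrier G \<Longrightarrow> cj g x [^] (n::nat) = cj g (x [^] n)"
  by (induction n) (simp_all add: cj_mult, simp add: cj_def)

lemma elementary_abelian_cj:
  assumes "g \<in> carrier G" "subgroup A G" "elementary_abelian n (G\<lparr>carrier := A\<rparr>)"
  shows "elementary_abelian n (G\<lparr>carrier := cj g ` A\<rparr>)"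
proof -
  have AG: "A \<subseteq> carrier G" using assms subgroup.subset by blast
  have "cj g \<one> = \<one>" using assms by (simp add: cj_def)
  then show ?thesis
    using assms AG elementary_abelian_restrict[OF assms(2)]
      elementary_abelian_restrict[OF cj_subgroup[OF assms(1,2)]]
    by (auto simp: cj_pow subset_iff simp flip: cj_mult)
qed

end

lemma SL_subgroup: "subgroup {(v, A). det A = 1} (AGL :: (('a::{field,finite}^2) \<times> ('a^2^2)) monoid)"
proof -
  interpret group "AGL :: (('a^2) \<times> ('a^2^2)) monoid" by (rule AGL_group)
  have "(0, mat 1) \<in> {(v :: 'a^2, A :: 'a^2^2). det A = 1}" by simp
  then have "{(v :: 'a^2, A :: 'a^2^2). det A = 1} \<noteq> {}" by blast
  then show ?thesis
    by (intro finite_subgroupI) (auto simp: AGL_carrier invertible_det_nz det_mul)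
qed

lemma aff_SL: "aff u v p x y m \<in> {(v, A). det A = 1} \<longleftrightarrow> p * m - x * y = 1"
  by (simp add: aff_def det_mat2)

text \<open>The triangular Sylow 3-subgroup of ASL_2. In the coordinates \<open>(u, v, x)\<close> it
  is the Heisenberg group, whose center consists of the translations by \<open>u\<close>.\<close>

definition S00 :: "(('a::field^2) \<times> ('a^2^2)) set" where
  "S00 = {aff u v 1 x 0 1 | u v x. True}"

section \<open>Orders of SL_2 and ASL_2, Sylow normalizers, and the groups K_2\<close>

context gf3
begin

interpretation AGL: group "AGL :: (('a^2) \<times> ('a^2^2)) monoid" by (rule AGL_group)

text \<open>A matrix of determinant 1 is given by its nonzero second row \<open>(y, m)\<close> and
  one free entry of the first row: \<open>x\<close> if \<open>m\<close> is nonzero, and otherwise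
  \<open>p\<close>, where \<open>x\<close> is forced to be \<open>- 1 / y\<close>.\<close>

lemma card_SL2: "card {(p::'a, x, y, m). p * m - x * y = 1} = CARD('a) * (CARD('a) ^ 2 - 1)"
proof -
  let ?D = "{(p::'a, x, y, m). p * m - x * y = 1}"
  let ?E = "(UNIV - {(0::'a, 0::'a)}) \<times> (UNIV :: 'a set)"
  have aux: "- (1 / b) = a" if "1 + a * b = 0" for a b :: 'a
  proof -
    have "b \<noteq> 0" using that by auto
    moreover have "a * b = -1" using that by (metis add_eq_0_iff)
    ultimately show ?thesis by (simp add: field_simps)
  qed
  have "bij_betw (\<lambda>((y, m), s). if m \<noteq> 0 then ((1 + s * y) / m, s, y, m) else (s, - 1 / y, y, m)) ?E ?D"
    by (rule bij_betw_byWitness[where f' = "\<lambda>(p, x, y, m). ((y, m), if m \<noteq> 0 then x else p)"])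
      (auto simp: field_simps aux split: if_splits)
  then have "card ?D = card ?E" by (simp add: bij_betw_same_card)
  also have "\<dots> = CARD('a) * (CARD('a) ^ 2 - 1)"
    by (simp add: card_cartesian_product card_Diff_subset power2_eq_square mult.commute)
  finally show ?thesis .
qed

lemma card_ASL: "Coset.order (ASL :: (('a^2) \<times> ('a^2^2)) monoid) = CARD('a) ^ 3 * (CARD('a) ^ 2 - 1)"
proof -
  let ?D = "{(p::'a, x, y, m). p * m - x * y = 1}"
  let ?f = "\<lambda>((u, v), (p, x, y, m)). aff u v p x y (m::'a)"
  have "bij_betw ?f (UNIV \<times> ?D) (carrier ASL)"
  proof (rule bij_betwI')
    fix g :: "('a^2) \<times> ('a^2^2)" assume "g \<in> carrier ASL"
    moreover obtain u v p x y m where "g = aff u v p x y m" by (rule aff_surj)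
    ultimately show "\<exists>z\<in>UNIV \<times> ?D. g = ?f z"
      by (intro bexI[of _ "((u, v), (p, x, y, m))"]) (auto simp: ASL_eq aff_def det_mat2)
  next
    show "?f z \<in> carrier ASL" if "z \<in> UNIV \<times> ?D" for z using that by (auto simp: ASL_eq aff_def det_mat2)
  qed (auto simp: aff_eq_iff)
  then have "card (carrier (ASL :: (('a^2) \<times> ('a^2^2)) monoid)) = card ((UNIV :: ('a \<times> 'a) set) \<times> ?D)"
    by (simp add: bij_betw_same_card)
  then show ?thesis
    unfolding Coset.order_def
    by (simp add: card_cartesian_product card_SL2 eval_nat_numeral)
qed

lemma card_S00: "card (S00 :: (('a^2) \<times> ('a^2^2)) set) = CARD('a) ^ 3"
proof -
  have "bij_betw (\<lambda>(u, v, x). aff u v 1 x 0 1) (UNIV :: ('a \<times> 'a \<times> 'a) set) S00"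
    by (rule bij_betwI') (auto simp: aff_eq_iff S00_def)
  then have "card (UNIV :: ('a \<times> 'a \<times> 'a) set) = card (S00 :: (('a^2) \<times> ('a^2^2)) set)"
    by (rule bij_betw_same_card)
  then show ?thesis by (simp add: eval_nat_numeral)
qed

lemma S00_subset: "(S00 :: (('a^2) \<times> ('a^2^2)) set) \<subseteq> {(v, A). det A = 1}"
  by (auto simp: S00_def aff_def det_mat2)

lemma S00_carrier: "(S00 :: (('a^2) \<times> ('a^2^2)) set) \<subseteq> carrier AGL"
  by (auto simp: S00_def aff_carrier)

lemma S00_subgroup: "subgroup (S00 :: (('a^2) \<times> ('a^2^2)) set) AGL"
proof (rule AGL.finite_subgroupI)
  have "aff 0 0 1 0 0 1 \<in> (S00 :: (('a^2) \<times> ('a^2^2)) set)" unfolding S00_def by blast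
  then show "(S00 :: (('a^2) \<times> ('a^2^2)) set) \<noteq> {}" by blast
  show "g \<otimes>\<^bsub>AGL\<^esub> h \<in> S00" if gh: "g \<in> S00" "h \<in> S00" for g h :: "('a^2) \<times> ('a^2^2)"
  proof -
    obtain u v x u' v' x' where "g = aff u v 1 x 0 1" "h = aff u' v' 1 x' 0 1" using gh unfolding S00_def by blast
    then have "g \<otimes>\<^bsub>AGL\<^esub> h = aff (u + u' + x * v') (v + v') 1 (x' + x) 0 1" by (simp add: aff_mult)
    then show ?thesis unfolding S00_def by blast
  qed
qed (use S00_carrier in auto)

lemma multiplicity_card: "\<not> 3 dvd c \<Longrightarrow> 3 ^ multiplicity (3::nat) (CARD('a) ^ k * c) = CARD('a) ^ k"
proof -
  assume c: "\<not> 3 dvd c"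
  have "multiplicity (3::nat) (3 ^ (r * k) * c) = r * k"
    by (rule multiplicity_decomposeI[OF refl c]) simp
  then show ?thesis by (simp add: card_field power_mult)
qed

lemma not_3_dvd_square: "\<not> 3 dvd CARD('a) ^ 2 - 1"
proof -
  have "(CARD('a) + 1) * (CARD('a) - 1) = CARD('a) ^ 2 - 1"
    using card_gt_1 by (simp add: algebra_simps power2_eq_square)
  from coprime_divisor[of "CARD('a) - 1" 1] coprime_divisor this
  have "coprime 3 (CARD('a) - 1)" by simp
  moreover have "3 dvd CARD('a)" unfolding eps(2)[symmetric] by simp
  then have "coprime 3 (CARD('a) + 1)" by (metis coprime_add_one_right coprime_divisors dvd_refl)
  ultimately have "coprime 3 (CARD('a) ^ 2 - 1)"
    using \<open>(CARD('a) + 1) * (CARD('a) - 1) = CARD('a) ^ 2 - 1\<close> by (metis coprime_mult_right_iff)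
  then show ?thesis by (auto dest: coprime_common_divisor)
qed

lemma S00_Syl: "(S00 :: (('a^2) \<times> ('a^2^2)) set) \<in> Syl 3 ASL"
proof -
  have "subgroup S00 (ASL :: (('a^2) \<times> ('a^2^2)) monoid)"
    unfolding ASL_eq using AGL.subgroup_incl[OF S00_subgroup SL_subgroup S00_subset] .
  then show ?thesis
    using multiplicity_card[OF not_3_dvd_square, of 3] by (simp add: Syl_def card_S00 card_ASL)
qed

text \<open>Modulo the center of \<open>S00\<close> a triangular element scales the coordinates
  \<open>(b, e)\<close> by \<open>m\<close> and \<open>p / m\<close>. It preserves every line of
  this plane exactly when \<open>p = m ^ 2\<close>.\<close>

lemma cj_aff_S00:
  assumes "p * m \<noteq> 0"
  shows "AGL.cj (aff u v p x 0 m) (aff a b 1 e 0 (1::'a)) = aff (p * a + x * b - p * e / m * v) (m * b) 1 (p * e / m) 0 1"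
  using assms by (intro AGL.cj_eqI) (auto simp: aff_carrier aff_mult aff_eq_iff field_simps)

lemma normalizer_S00: "normalizer AGL (S00 :: (('a^2) \<times> ('a^2^2)) set) = {aff u v p x 0 m | u v p x m. p * m \<noteq> 0}"
proof (intro equalityI subsetI)
  fix k :: "('a^2) \<times> ('a^2^2)" assume "k \<in> normalizer AGL S00"
  then have k: "k \<in> carrier AGL" "AGL.cj k ` S00 = S00" by (auto simp: AGL.normalizer_iff S00_carrier)
  obtain u v p x y m where k_eq: "k = aff u v p x y m" by (rule aff_surj)
  \<comment> \<open>A single transvection suffices: the lower right entries of the two products
    compared below differ by \<open>y\<close>.\<close>
  have s: "aff 0 0 1 1 0 1 \<in> (S00 :: (('a^2) \<times> ('a^2^2)) set)" unfolding S00_def by blast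
  then have "AGL.cj k (aff 0 0 1 1 0 1) \<in> S00" using k by blast
  then obtain a b e where abe: "AGL.cj k (aff 0 0 1 1 0 1) = aff a b 1 e 0 1" unfolding S00_def by blast
  have "aff a b 1 e 0 1 \<otimes>\<^bsub>AGL\<^esub> k = k \<otimes>\<^bsub>AGL\<^esub> aff 0 0 1 1 0 1"
    using AGL.cj_eqD[OF abe k(1)] s S00_carrier by blast
  then have "y = 0" by (simp add: k_eq aff_mult aff_eq_iff)
  moreover from this have "p * m \<noteq> 0" using k(1) by (simp add: k_eq aff_carrier)
  ultimately show "k \<in> {aff u v p x 0 m | u v p x m. p * m \<noteq> 0}" using k_eq by blast
next
  fix k :: "('a^2) \<times> ('a^2^2)" assume "k \<in> {aff u v p x 0 m | u v p x m. p * m \<noteq> 0}"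
  then obtain u v p x m where k: "k = aff u v p x 0 m" "p * m \<noteq> 0" by blast
  then have kc: "k \<in> carrier AGL" by (auto simp: aff_carrier)
  have "AGL.cj k ` S00 = S00"
  proof (rule AGL.cj_image_eqI[OF kc S00_carrier])
    show "AGL.cj k ` S00 \<subseteq> S00"
    proof
      fix z assume "z \<in> AGL.cj k ` S00"
      then obtain a b e where "z = AGL.cj k (aff a b 1 e 0 1)" unfolding S00_def by blast
      then show "z \<in> S00" unfolding k(1) cj_aff_S00[OF k(2)] S00_def by blast
    qed
  qed simp
  then show "k \<in> normalizer AGL S00" using kc by (simp add: AGL.normalizer_iff S00_carrier)
qed

text \<open>The preimage in \<open>S00\<close> of the line spanned by \<open>(b, e)\<close> in the
  quotient by the center; the central coordinate \<open>a\<close> is free.\<close>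

definition L0 :: "'a \<Rightarrow> 'a \<Rightarrow> (('a^2) \<times> ('a^2^2)) set" where
  "L0 b e = {aff a (s * b) 1 (s * e) 0 1 | a s. True}"

lemma card_L0: "(b, e) \<noteq> (0, 0) \<Longrightarrow> card (L0 b e) = CARD('a) ^ 2"
proof -
  assume "(b, e) \<noteq> (0, 0)"
  then have "bij_betw (\<lambda>(a, s). aff a (s * b) 1 (s * e) 0 1) (UNIV :: ('a \<times> 'a) set) (L0 b e)"
    by (intro bij_betwI') (auto simp: aff_eq_iff L0_def)
  then have "card (UNIV :: ('a \<times> 'a) set) = card (L0 b e)" by (rule bij_betw_same_card)
  then show ?thesis by (simp add: power2_eq_square)
qed

text \<open>The elementary abelian subgroups of order \<open>q\<^sup>2\<close> are the preimages of the lines of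
  \<open>S\<^sub>0 / Z(S\<^sub>0)\<close>, a plane over \<open>\<bbbF>\<^sub>q\<close>.\<close>

lemma elementary_abelian_S00:
  assumes A: "subgroup A AGL" "A \<subseteq> S00" "elementary_abelian 3 (AGL\<lparr>carrier := A\<rparr>)" "card A = CARD('a) ^ 2"
  obtains b e where "A = L0 b e"
proof -
  have comm: "g \<otimes>\<^bsub>AGL\<^esub> h = h \<otimes>\<^bsub>AGL\<^esub> g" if "g \<in> A" "h \<in> A" for g h
    using A that by (simp add: AGL.elementary_abelian_restrict)
  \<comment> \<open>The center has only \<open>q\<close> elements, too few for a subgroup of order
    \<open>q ^ 2\<close>, so some element has a nonzero pair \<open>(b, e)\<close>.\<close>
  obtain a0 b e where g: "aff a0 b 1 e 0 1 \<in> A" "(b, e) \<noteq> (0, 0)"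
  proof (rule ccontr)
    assume *: "\<not> thesis"
    have "A \<subseteq> range (\<lambda>a. aff a 0 1 0 0 1)"
    proof
      fix g assume gA: "g \<in> A"
      then obtain u v x where g: "g = aff u v 1 x 0 1" using A(2) unfolding S00_def by blast
      then have "(v, x) = (0, 0)" using * that gA by blast
      then show "g \<in> range (\<lambda>a. aff a 0 1 0 0 1)" using g by auto
    qed
    then have "card A \<le> card (range (\<lambda>a::'a. aff a 0 1 0 0 1))" by (intro card_mono) auto
    also have "\<dots> \<le> CARD('a)" by (rule card_image_le) simp
    finally show False using A(4) card_gt_1 by (simp add: power2_eq_square)
  qed
  have "A \<subseteq> L0 b e"
  proof
    fix h assume hA: "h \<in> A"
    then obtain u v x where h: "h = aff u v 1 x 0 1" using A(2) unfolding S00_def by blast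
    \<comment> \<open>The commutator in \<open>S00\<close> is the determinant of the pairs
      \<open>(b, e)\<close> and \<open>(v, x)\<close>; when it vanishes, the second pair is a
      multiple of the first.\<close>
    have "e * v = x * b" using comm[OF g(1) hA] by (simp add: h aff_mult aff_eq_iff)
    then have "\<exists>s. v = s * b \<and> x = s * e"
      using g(2) by (cases "b = 0") (auto intro: exI[of _ "v / b"] exI[of _ "x / e"] simp: field_simps)
    then show "h \<in> L0 b e" unfolding h L0_def by blast
  qed
  moreover have "card A = card (L0 b e)" using A card_L0 g by simp
  ultimately have "A = L0 b e" by (intro card_subset_eq) auto
  then show ?thesis using that by blast
qed

lemma L0_subgroup: "subgroup (L0 b e) AGL"
proof (rule AGL.finite_subgroupI)
  show "L0 b e \<subseteq> carrier AGL" by (auto simp: L0_def aff_carrier)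
  have "aff 0 (0 * b) 1 (0 * e) 0 1 \<in> L0 b e" unfolding L0_def by blast
  then show "L0 b e \<noteq> {}" by blast
  show "g \<otimes>\<^bsub>AGL\<^esub> h \<in> L0 b e" if gh: "g \<in> L0 b e" "h \<in> L0 b e" for g h
  proof -
    obtain a s a' s' where "g = aff a (s * b) 1 (s * e) 0 1" "h = aff a' (s' * b) 1 (s' * e) 0 1"
      using gh unfolding L0_def by blast
    then have "g \<otimes>\<^bsub>AGL\<^esub> h = aff (a + a' + s * e * (s' * b)) ((s + s') * b) 1 ((s + s') * e) 0 1"
      by (simp add: aff_mult aff_eq_iff algebra_simps)
    then show ?thesis unfolding L0_def by blast
  qed
qed simp

lemma L0_elementary: "elementary_abelian 3 (AGL\<lparr>carrier := L0 b e\<rparr>)"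
  unfolding AGL.elementary_abelian_restrict[OF L0_subgroup]
proof (intro conjI ballI)
  fix g h assume "g \<in> L0 b e" "h \<in> L0 b e"
  then obtain a s a' s' where "g = aff a (s * b) 1 (s * e) 0 1" "h = aff a' (s' * b) 1 (s' * e) 0 1"
    unfolding L0_def by blast
  then show "g \<otimes>\<^bsub>AGL\<^esub> h = h \<otimes>\<^bsub>AGL\<^esub> g" by (simp add: aff_mult aff_eq_iff algebra_simps)
next
  fix g assume "g \<in> L0 b e"
  then obtain a s where "g = aff a (s * b) 1 (s * e) 0 1" unfolding L0_def by blast
  then show "g [^]\<^bsub>AGL\<^esub> (3::nat) = \<one>\<^bsub>AGL\<^esub>"
    by (simp add: aff_mult aff_eq_iff numeral_3_eq_3 aff_one algebra_simps three)
qed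

text \<open>The diagonal \<open>(m ^ 2, m)\<close> is the condition for acting on \<open>S00\<close>
  modulo its center by the scalar \<open>m\<close>. For \<open>n = 0\<close> the last condition is
  void, which gives all of K_2; a positive \<open>n\<close> cuts out the subgroup where the scalar
  is an \<open>n\<close>-th root of unity.\<close>

definition KK :: "nat \<Rightarrow> (('a^2) \<times> ('a^2^2)) set" where
  "KK n = {aff u v (m ^ 2) x 0 m | u v x m. m \<noteq> 0 \<and> m ^ n = 1}"

lemma K2_carrier:
  assumes "S \<subseteq> carrier AGL"
  shows "k \<in> carrier (K2_S0 S) \<longleftrightarrow> k \<in> normalizer AGL S \<and>
    (\<forall>A. subgroup A AGL \<and> A \<subseteq> S \<and> elementary_abelian 3 (AGL\<lparr>carrier := A\<rparr>) \<and> card A = CARD('a)\<^sup>2 \<longrightarrow> AGL.cj k ` A = A)"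
proof -
  have "A \<subseteq> carrier AGL" if "subgroup A AGL" for A :: "(('a^2) \<times> ('a^2^2)) set"
    using that subgroup.subset by blast
  then show ?thesis by (auto simp: K2_S0_def AGL2_S0_def AGL.coset_cj)
qed

lemma K2_S00: "carrier (K2_S0 (S00 :: (('a^2) \<times> ('a^2^2)) set)) = KK 0"
proof (intro equalityI subsetI)
  fix k :: "('a^2) \<times> ('a^2^2)" assume "k \<in> carrier (K2_S0 S00)"
  then have k: "k \<in> normalizer AGL S00" and fix_A: "\<And>A. subgroup A AGL \<Longrightarrow> A \<subseteq> S00 \<Longrightarrow>
      elementary_abelian 3 (AGL\<lparr>carrier := A\<rparr>) \<Longrightarrow> card A = CARD('a)\<^sup>2 \<Longrightarrow> AGL.cj k ` A = A"
    using K2_carrier[OF S00_carrier] by blast+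
  obtain u v p x m where k_eq: "k = aff u v p x 0 m" and pm: "p * m \<noteq> 0"
    using k unfolding normalizer_S00 by blast
  \<comment> \<open>The diagonal line already detects the scalars: its generator
    \<open>(1, 1)\<close> goes to \<open>(m, p / m)\<close>, which lies on the line only if
    \<open>p = m ^ 2\<close>.\<close>
  have "L0 1 1 \<subseteq> S00" unfolding L0_def S00_def by blast
  then have "AGL.cj k ` L0 1 1 = L0 1 1"
    using card_L0[of 1 1] L0_elementary by (intro fix_A L0_subgroup) auto
  moreover have "aff 0 (1 * 1) 1 (1 * 1) 0 1 \<in> L0 1 1" unfolding L0_def by blast
  then have "aff 0 1 1 1 0 1 \<in> L0 1 1" by simp
  ultimately have "AGL.cj k (aff 0 1 1 1 0 1) \<in> L0 1 1" by blast
  then obtain a s where "AGL.cj k (aff 0 1 1 1 0 1) = aff a (s * 1) 1 (s * 1) 0 1" unfolding L0_def by blast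
  then have "m = s \<and> p / m = s" 
    unfolding k_eq cj_aff_S00[OF pm] aff_eq_iff mult_1_right by blast
  then have "m = p / m" by metis
  then have "p = m ^ 2" using pm by (simp add: field_simps power2_eq_square)
  moreover have "m \<noteq> 0" "m ^ 0 = 1" using pm by auto
  ultimately show "k \<in> KK 0" unfolding k_eq KK_def by blast
next
  fix k :: "('a^2) \<times> ('a^2^2)" assume "k \<in> KK 0"
  then obtain u v x m where k: "k = aff u v (m ^ 2) x 0 m" "m \<noteq> 0" unfolding KK_def by blast
  then have k2: "m ^ 2 * m \<noteq> 0" by simp
  have kn: "k \<in> normalizer AGL S00" unfolding normalizer_S00 using k(1) k2 by blast
  then have kc: "k \<in> carrier AGL" by (simp add: AGL.normalizer_iff S00_carrier)
  have "AGL.cj k ` A = A" if A: "subgroup A AGL" "A \<subseteq> S00" "elementary_abelian 3 (AGL\<lparr>carrier := A\<rparr>)"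
    "card A = CARD('a)\<^sup>2" for A
  proof -
    obtain b e where A_eq: "A = L0 b e" using elementary_abelian_S00[OF A] .
    have "AGL.cj k (aff a (s * b) 1 (s * e) 0 1) =
        aff (m ^ 2 * a + x * (s * b) - m ^ 2 * (s * e) / m * v) ((m * s) * b) 1 ((m * s) * e) 0 1" for a s
      using k unfolding k(1) cj_aff_S00[OF k2] by (simp add: aff_eq_iff power2_eq_square)
    then have *: "AGL.cj k (aff a (s * b) 1 (s * e) 0 1) \<in> L0 b e" for a s unfolding L0_def by blast
    have "AGL.cj k ` A \<subseteq> A"
    proof
      fix z assume "z \<in> AGL.cj k ` A"
      then obtain a s where "z = AGL.cj k (aff a (s * b) 1 (s * e) 0 1)" unfolding A_eq L0_def by blast
      then show "z \<in> A" using * A_eq by simp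
    qed
    then show ?thesis using A S00_carrier kc by (intro AGL.cj_image_eqI) auto
  qed
  then show "k \<in> carrier (K2_S0 S00)" unfolding K2_carrier[OF S00_carrier] using kn by simp
qed

text \<open>A test subgroup of the conjugate of \<open>S\<close> is pulled back by \<open>g\<close>
  to a test subgroup of \<open>S\<close>, which \<open>k\<close> fixes.\<close>

lemma K2_cj:
  assumes g: "g \<in> carrier AGL" and S: "S \<subseteq> carrier AGL" and k: "k \<in> carrier (K2_S0 S)"
  shows "AGL.cj g k \<in> carrier (K2_S0 (AGL.cj g ` S :: (('a^2) \<times> ('a^2^2)) set))"
proof -
  have kn: "k \<in> normalizer AGL S" using k K2_carrier[OF S] by blast
  then have kc: "k \<in> carrier AGL" using AGL.normalizer_iff[OF S] by blast
  have gi: "inv\<^bsub>AGL\<^esub> g \<in> carrier AGL" using g by simp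
  have fix_A: "AGL.cj (AGL.cj g k) ` A = A" if A: "subgroup A AGL" "A \<subseteq> AGL.cj g ` S"
    "elementary_abelian 3 (AGL\<lparr>carrier := A\<rparr>)" "card A = CARD('a)\<^sup>2" for A
  proof -
    let ?A = "AGL.cj (inv\<^bsub>AGL\<^esub> g) ` A"
    have AG: "A \<subseteq> carrier AGL" using A subgroup.subset by blast
    have A_eq: "A = AGL.cj g ` ?A" using AGL.cj_inv_image[OF gi AG] g by simp
    have "?A \<subseteq> S" using A(2) AGL.cj_inv_image[OF g S] by blast
    moreover have "card ?A = CARD('a)\<^sup>2"
      using A(4) AGL.cj_inj[OF gi] AG by (simp add: card_image inj_on_subset)
    ultimately have "AGL.cj k ` ?A = ?A"
      using k K2_carrier[OF S] AGL.cj_subgroup[OF gi A(1)] AGL.elementary_abelian_cj[OF gi A(1,3)] by blast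
    moreover have "?A \<subseteq> carrier AGL" using gi AG by auto
    ultimately show ?thesis using AGL.cj_image_conj[OF g kc, of ?A] A_eq by simp
  qed
  have sub: "AGL.cj g ` S \<subseteq> carrier AGL" using g S by auto
  show ?thesis
    unfolding K2_carrier[OF sub] using AGL.normalizer_cj[OF g S kn] fix_A by simp
qed

lemma KK_mult: "aff u v (m ^ 2) x 0 m \<otimes>\<^bsub>AGL\<^esub> aff u' v' (m' ^ 2) x' 0 m' =
    aff (u + m ^ 2 * u' + x * v') (v + m * v') ((m * m') ^ 2) (m ^ 2 * x' + x * m') 0 (m * m')"
  by (simp add: aff_mult power_mult_distrib)

lemma KK_carrier: "KK n \<subseteq> carrier AGL"
  by (auto simp: KK_def aff_carrier)

lemma KK_subgroup: "subgroup (KK n) AGL"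
proof (rule AGL.finite_subgroupI)
  have "aff 0 0 (1 ^ 2) 0 0 1 \<in> KK n" 
    unfolding KK_def by (rule CollectI, rule exI[of _ 0], rule exI[of _ 0], rule exI[of _ 0], rule exI[of _ 1]) simp
  then show "KK n \<noteq> {}" by blast
  show "g \<otimes>\<^bsub>AGL\<^esub> h \<in> KK n" if gh: "g \<in> KK n" "h \<in> KK n" for g h
  proof -
    obtain u v x m u' v' x' m' where g: "g = aff u v (m ^ 2) x 0 m" "m \<noteq> 0" "m ^ n = 1"
      and h: "h = aff u' v' (m' ^ 2) x' 0 m'" "m' \<noteq> 0" "m' ^ n = 1"
      using gh unfolding KK_def by blast
    then have "m * m' \<noteq> 0" "(m * m') ^ n = 1" by (simp_all add: power_mult_distrib)
    then show ?thesis unfolding g h KK_mult KK_def by blast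
  qed
qed (use KK_carrier in auto)

text \<open>All Sylow 3-subgroups of ASL_2 are conjugate, so some \<open>g\<close> carries
  \<open>S00\<close> to \<open>S0\<close>, and the three statements are transported along
  conjugation by \<open>g\<close>.\<close>

lemma index_K2:
  fixes S0 :: "(('a^2) \<times> ('a^2^2)) set"
  assumes S0: "S0 \<in> Syl 3 ASL" and d: "d * n = CARD('a) - 1" "card {a::'a. a ^ n = 1} = n"
  shows "group (index_subgroup (K2_S0 S0) d)"
    and "index_subgroup (K2_S0 S0) d \<cong> AGL\<lparr>carrier := KK n\<rparr>"
    and "AGL\<lparr>carrier := {aff u v p x 0 m | u v p x m. p * m = (1::'a)}\<rparr> \<cong> ASL2_S0 S0"
proof -
  interpret SL: group "AGL\<lparr>carrier := {(v :: 'a^2, A :: 'a^2^2). det A = 1}\<rparr>"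
    by (rule AGL.subgroup_imp_group[OF SL_subgroup])
  have S: "S00 \<in> Syl 3 (AGL\<lparr>carrier := {(v :: 'a^2, A :: 'a^2^2). det A = 1}\<rparr>)"
    "S0 \<in> Syl 3 (AGL\<lparr>carrier := {(v :: 'a^2, A :: 'a^2^2). det A = 1}\<rparr>)"
    using S0 S00_Syl by (simp_all add: ASL_eq)
  have "finite (carrier (AGL\<lparr>carrier := {(v :: 'a^2, A :: 'a^2^2). det A = 1}\<rparr>))" by simp
  then obtain g where g: "g \<in> {(v, A). det A = 1}" and S0_eq: "S0 = SL.cj g ` S00"
    using SL.sylow_conjugate[OF _ _ S] unfolding SL.cj_def by auto
  have gc: "g \<in> carrier AGL" using g SL_subgroup subgroup.subset by blast
  then have gi: "inv\<^bsub>AGL\<^esub> g \<in> carrier AGL" by simp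
  have "SL.cj g = AGL.cj g"
    using g AGL.m_inv_consistent[OF SL_subgroup g] by (auto simp: SL.cj_def AGL.cj_def fun_eq_iff)
  then have S0_cj: "S0 = AGL.cj g ` S00" using S0_eq by simp
  have S0_back: "S00 = AGL.cj (inv\<^bsub>AGL\<^esub> g) ` S0"
    using AGL.cj_inv_image[OF gc S00_carrier] S0_cj by simp
  have S0_carrier: "S0 \<subseteq> carrier AGL" using S0_cj gc S00_carrier by auto
  have eq_image: "A = AGL.cj g ` B"
    if "\<And>k. k \<in> B \<Longrightarrow> AGL.cj g k \<in> A" "\<And>k. k \<in> A \<Longrightarrow> AGL.cj (inv\<^bsub>AGL\<^esub> g) k \<in> B" "A \<subseteq> carrier AGL"
    for A B
  proof (intro equalityI subsetI)
    fix k assume k: "k \<in> A"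
    then have "k \<in> carrier AGL" using that(3) by blast
    from AGL.cj_inv_cancel(2)[OF gc this] have "k = AGL.cj g (AGL.cj (inv\<^bsub>AGL\<^esub> g) k)" by simp
    then show "k \<in> AGL.cj g ` B" using that(2)[OF k] by (rule image_eqI)
  qed (use that(1) in blast)
  have K2: "carrier (K2_S0 S0) = AGL.cj g ` KK 0"
  proof (rule eq_image)
    show "AGL.cj g k \<in> carrier (K2_S0 S0)" if "k \<in> KK 0" for k
      using K2_cj[OF gc S00_carrier] that unfolding K2_S00 S0_cj by blast
    show "AGL.cj (inv\<^bsub>AGL\<^esub> g) k \<in> KK 0" if "k \<in> carrier (K2_S0 S0)" for k
      using K2_cj[OF gi S0_carrier that] S0_back K2_S00 by simp
    show "carrier (K2_S0 S0) \<subseteq> carrier AGL"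
      using K2_carrier[OF S0_carrier] AGL.normalizer_iff[OF S0_carrier] by blast
  qed
  have K2_eq: "K2_S0 S0 = AGL\<lparr>carrier := AGL.cj g ` KK 0\<rparr>"
    using K2 by (simp add: K2_S0_def)
  \<comment> \<open>\<psi> undoes the conjugation by \<open>g\<close> and reads off the diagonal
    entry \<open>m\<close>, which is multiplicative on triangular matrices.\<close>
  define \<psi> :: "('a^2) \<times> ('a^2^2) \<Rightarrow> 'a" where "\<psi> k = snd (AGL.cj (inv\<^bsub>AGL\<^esub> g) k) $ 2 $ 2" for k
  have \<psi>: "\<psi> (AGL.cj g (aff u v (m ^ 2) x 0 m)) = m" if "m \<noteq> 0" for u v x m
  proof -
    have "aff u v (m ^ 2) x 0 m \<in> carrier AGL" using that by (simp add: aff_carrier)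
    then show ?thesis using AGL.cj_inv_cancel(1)[OF gc] by (simp add: \<psi>_def aff_def)
  qed
  have K2_group: "group (K2_S0 S0)"
    unfolding K2_eq by (rule AGL.subgroup_imp_group[OF AGL.cj_subgroup[OF gc KK_subgroup]])
  have elem: "\<exists>u v x m. k = AGL.cj g (aff u v (m ^ 2) x 0 m) \<and> m \<noteq> 0" if "k \<in> carrier (K2_S0 S0)" for k
    using that unfolding K2 KK_def by blast
  have elemI: "AGL.cj g (aff u v (m ^ 2) x 0 m) \<in> carrier (K2_S0 S0)" if "m \<noteq> 0" for u v x m
    unfolding K2 KK_def using that power_0[of m] by blast
  have affc: "aff u v (m ^ 2) x 0 m \<in> carrier AGL" if "m \<noteq> 0" for u v x m :: 'a
    using that by (simp add: aff_carrier)
  have "index_subgroup (K2_S0 S0) d = (K2_S0 S0)\<lparr>carrier := {k \<in> carrier (K2_S0 S0). \<psi> k ^ n = 1}\<rparr>"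
  proof (rule index_subgroup_eq[OF K2_group _ _ _ _ _ d(1) coprime_divisor[OF d(1)] d(2)])
    fix k l assume "k \<in> carrier (K2_S0 S0)" "l \<in> carrier (K2_S0 S0)"
    then obtain u v x m u' v' x' m' where k: "k = AGL.cj g (aff u v (m ^ 2) x 0 m)" "m \<noteq> 0"
      and l: "l = AGL.cj g (aff u' v' (m' ^ 2) x' 0 m')" "m' \<noteq> 0" by (meson elem)
    then have "k \<otimes>\<^bsub>AGL\<^esub> l = AGL.cj g (aff u v (m ^ 2) x 0 m \<otimes>\<^bsub>AGL\<^esub> aff u' v' (m' ^ 2) x' 0 m')"
      using AGL.cj_mult[OF gc] affc by simp
    then show "\<psi> (k \<otimes>\<^bsub>K2_S0 S0\<^esub> l) = \<psi> k * \<psi> l"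
      using k l by (simp add: K2_eq KK_mult \<psi> del: power_mult_distrib)
  next
    show "\<psi> k \<noteq> 0" if "k \<in> carrier (K2_S0 S0)" for k
      using elem[OF that] \<psi> by auto
  next
    show "\<exists>k\<in>carrier (K2_S0 S0). \<psi> k = a" if "a \<noteq> 0" for a
      using elemI[OF that, of 0 0 0] \<psi>[OF that, of 0 0 0] by blast
  next
    fix k assume k: "k \<in> carrier (K2_S0 S0)" "\<psi> k = 1"
    then obtain u v x m where "k = AGL.cj g (aff u v (m ^ 2) x 0 m)" "m \<noteq> 0" by (meson elem)
    with k \<psi> have k_eq: "k = AGL.cj g (aff u v 1 x 0 1)" by simp
    \<comment> \<open>The Heisenberg group has exponent 3 here: the first coordinate of the cube is
      \<open>3 * u + 3 * x * v\<close>.\<close>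
    have "aff u v 1 x 0 1 [^]\<^bsub>AGL\<^esub> (3::nat) = \<one>\<^bsub>AGL\<^esub>"
      by (simp add: numeral_3_eq_3 aff_mult aff_one aff_eq_iff algebra_simps three)
    then have "k [^]\<^bsub>AGL\<^esub> (3::nat) = \<one>\<^bsub>AGL\<^esub>"
      using gc k_eq by (simp add: AGL.cj_pow aff_carrier) (simp add: AGL.cj_def)
    then have "k [^]\<^bsub>K2_S0 S0\<^esub> (3::nat) = \<one>\<^bsub>K2_S0 S0\<^esub>"
      by (simp add: K2_eq flip: AGL.nat_pow_consistent)
    then show "k \<in> generate (K2_S0 S0) {y \<in> carrier (K2_S0 S0). y [^]\<^bsub>K2_S0 S0\<^esub> (3::nat) = \<one>\<^bsub>K2_S0 S0\<^esub>}"
      using k by (intro generate.incl) blast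
  qed simp
  also have "{k \<in> carrier (K2_S0 S0). \<psi> k ^ n = 1} = AGL.cj g ` KK n"
  proof (intro equalityI subsetI)
    fix k assume "k \<in> {k \<in> carrier (K2_S0 S0). \<psi> k ^ n = 1}"
    then have k: "k \<in> carrier (K2_S0 S0)" "\<psi> k ^ n = 1" by blast+
    obtain u v x m where "k = AGL.cj g (aff u v (m ^ 2) x 0 m)" "m \<noteq> 0" using elem[OF k(1)] by blast
    moreover from this k(2) have "m ^ n = 1" using \<psi> by simp
    ultimately show "k \<in> AGL.cj g ` KK n" unfolding KK_def by blast
  next
    fix k assume "k \<in> AGL.cj g ` KK n"
    then obtain u v x m where "k = AGL.cj g (aff u v (m ^ 2) x 0 m)" "m \<noteq> 0" "m ^ n = 1" unfolding KK_def by blast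
    then show "k \<in> {k \<in> carrier (K2_S0 S0). \<psi> k ^ n = 1}" using \<psi> elemI by simp
  qed
  also have "(K2_S0 S0)\<lparr>carrier := AGL.cj g ` KK n\<rparr> = AGL\<lparr>carrier := AGL.cj g ` KK n\<rparr>"
    by (simp add: K2_eq)
  finally have idx: "index_subgroup (K2_S0 S0) d = AGL\<lparr>carrier := AGL.cj g ` KK n\<rparr>" .
  interpret KK: group "AGL\<lparr>carrier := KK n\<rparr>" by (rule AGL.subgroup_imp_group[OF KK_subgroup])
  show "group (index_subgroup (K2_S0 S0) d)"
    unfolding idx by (rule AGL.subgroup_imp_group[OF AGL.cj_subgroup[OF gc KK_subgroup]])
  show "index_subgroup (K2_S0 S0) d \<cong> AGL\<lparr>carrier := KK n\<rparr>"
    unfolding idx using KK.iso_sym[OF AGL.cj_iso[OF gc KK_carrier]] .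
  let ?SL = "{(v :: 'a^2, A :: 'a^2^2). det A = 1}" and ?B = "{aff u v p x 0 m | u v p x m. p * m = (1::'a)}"
  have S0_SL: "S0 \<subseteq> ?SL"
    using S0 subgroup.subset by (fastforce simp: Syl_def ASL_eq)
  have det_g: "AGL.cj h k \<in> ?SL" if "h \<in> ?SL" "k \<in> ?SL" for h k
    unfolding AGL.cj_def
    by (rule subgroup.m_closed[OF SL_subgroup subgroup.m_closed[OF SL_subgroup that] subgroup.m_inv_closed[OF SL_subgroup that(1)]])
  have "normalizer AGL S00 \<inter> ?SL = ?B"
  proof (intro equalityI subsetI)
    fix k assume k: "k \<in> normalizer AGL S00 \<inter> ?SL"
    then obtain u v p x m where k_eq: "k = aff u v p x 0 m" unfolding normalizer_S00 by blast
    have "aff u v p x 0 m \<in> ?SL" using k unfolding k_eq by (rule IntD2)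
    then have "p * m = 1" unfolding aff_SL by simp
    then show "k \<in> ?B" unfolding k_eq by blast
  next
    fix k assume "k \<in> ?B"
    then obtain u v p x m where k: "k = aff u v p x 0 m" "p * m = 1" by blast
    then have "p * m \<noteq> 0" by simp
    then have "k \<in> normalizer AGL S00" unfolding normalizer_S00 k(1) by blast
    moreover have "k \<in> ?SL" unfolding k(1) aff_SL using k(2) by simp
    ultimately show "k \<in> normalizer AGL S00 \<inter> ?SL" by (rule IntI)
  qed
  moreover have "normalizer AGL S0 \<inter> ?SL = AGL.cj g ` (normalizer AGL S00 \<inter> ?SL)"
  proof (rule eq_image)
    show "AGL.cj g k \<in> normalizer AGL S0 \<inter> ?SL" if "k \<in> normalizer AGL S00 \<inter> ?SL" for k
      using AGL.normalizer_cj[OF gc S00_carrier IntD1[OF that]] det_g[OF g IntD2[OF that]]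
      unfolding S0_cj by (rule IntI)
    have "inv\<^bsub>AGL\<^esub> g \<in> ?SL" using g SL_subgroup by (rule subgroup.m_inv_closed[rotated])
    then show "AGL.cj (inv\<^bsub>AGL\<^esub> g) k \<in> normalizer AGL S00 \<inter> ?SL" if "k \<in> normalizer AGL S0 \<inter> ?SL" for k
      using AGL.normalizer_cj[OF gi S0_carrier IntD1[OF that]] det_g[OF _ IntD2[OF that]]
      unfolding S0_back by (intro IntI)
    show "normalizer AGL S0 \<inter> ?SL \<subseteq> carrier AGL"
      using AGL.normalizer_iff[OF S0_carrier] by blast
  qed
  moreover have "ASL2_S0 S0 = AGL\<lparr>carrier := normalizer AGL S0 \<inter> ?SL\<rparr>"
    using AGL.normalizer_restrict[OF SL_subgroup S0_SL] by (simp add: ASL2_S0_def ASL_eq)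
  moreover have "?B \<subseteq> carrier AGL" by (auto simp: aff_carrier)
  ultimately show "AGL\<lparr>carrier := ?B\<rparr> \<cong> ASL2_S0 S0"
    using AGL.cj_iso[OF gc] by simp
qed

end

section \<open>Transitive semilinear groups on the line\<close>

lemma Sym_simps [simp]:
  "carrier Sym = {f. bij f}" "f \<otimes>\<^bsub>Sym\<^esub> g = g \<circ> f" "\<one>\<^bsub>Sym\<^esub> = id"
  by (auto simp: Sym_def)

lemma Sym_group: "group (Sym :: ('b \<Rightarrow> 'b) monoid)"
proof (rule groupI)
  show "\<exists>g\<in>carrier Sym. g \<otimes>\<^bsub>Sym\<^esub> f = \<one>\<^bsub>Sym\<^esub>" if "f \<in> carrier Sym" for f :: "'b \<Rightarrow> 'b"
    using that by (intro bexI[of _ "inv_into UNIV f"])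
      (auto simp: bij_imp_bij_inv fun_eq_iff bij_is_surj surj_f_inv_f)
qed (auto simp: bij_comp comp_assoc)

lemma Sym_finite: "finite (carrier (Sym :: ('b::finite \<Rightarrow> 'b) monoid))"
  by (rule finite)

text \<open>First isomorphism theorem for a group enumerated by parameters: \<open>E p\<close> is an
  element and \<open>k p\<close> its image, both known only through \<open>p\<close>. The
  enumeration may repeat elements, hence the condition \<open>wd\<close>.\<close>

lemma Mod_iso_params:
  assumes G: "group G" and K: "group K"
    and E: "carrier G = E ` Ps" and k: "carrier K = k ` Ps"
    and wd: "\<And>p p'. p \<in> Ps \<Longrightarrow> p' \<in> Ps \<Longrightarrow> E p = E p' \<Longrightarrow> k p = k p'"
    and mult: "\<And>p p'. p \<in> Ps \<Longrightarrow> p' \<in> Ps \<Longrightarrow>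
      \<exists>p''\<in>Ps. E p \<otimes>\<^bsub>G\<^esub> E p' = E p'' \<and> k p'' = k p \<otimes>\<^bsub>K\<^esub> k p'"
  shows "G Mod (E ` {p \<in> Ps. k p = \<one>\<^bsub>K\<^esub>}) \<cong> K" "E ` {p \<in> Ps. k p = \<one>\<^bsub>K\<^esub>} \<lhd> G"
proof -
  interpret G: group G by fact
  interpret K: group K by fact
  define \<pi> where "\<pi> g = k (SOME p. p \<in> Ps \<and> E p = g)" for g
  have \<pi>: "\<pi> (E p) = k p" if "p \<in> Ps" for p
  proof -
    have "(SOME p'. p' \<in> Ps \<and> E p' = E p) \<in> Ps \<and> E (SOME p'. p' \<in> Ps \<and> E p' = E p) = E p"
      by (rule someI[of _ p]) (use that in simp)
    then show ?thesis unfolding \<pi>_def using wd that by blast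
  qed
  have hom: "\<pi> \<in> hom G K"
  proof (rule homI)
    fix g assume "g \<in> carrier G"
    then obtain p where p: "p \<in> Ps" "g = E p" unfolding E by blast
    then show "\<pi> g \<in> carrier K" using \<pi> k by blast
  next
    fix g g' assume "g \<in> carrier G" "g' \<in> carrier G"
    then obtain p p' where p: "p \<in> Ps" "g = E p" "p' \<in> Ps" "g' = E p'" unfolding E by blast
    then obtain p'' where "p'' \<in> Ps" "E p \<otimes>\<^bsub>G\<^esub> E p' = E p''" "k p'' = k p \<otimes>\<^bsub>K\<^esub> k p'" using mult by blast
    then show "\<pi> (g \<otimes>\<^bsub>G\<^esub> g') = \<pi> g \<otimes>\<^bsub>K\<^esub> \<pi> g'" using \<pi> p by simp
  qed
  then interpret \<pi>: group_hom G K \<pi> by unfold_locales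
  have ker: "kernel G K \<pi> = E ` {p \<in> Ps. k p = \<one>\<^bsub>K\<^esub>}"
    unfolding kernel_def E using \<pi> by auto
  have "\<pi> ` carrier G = k ` Ps" unfolding E image_image using \<pi> by simp
  then show "G Mod (E ` {p \<in> Ps. k p = \<one>\<^bsub>K\<^esub>}) \<cong> K"
    using \<pi>.FactGroup_iso ker k by simp
  show "E ` {p \<in> Ps. k p = \<one>\<^bsub>K\<^esub>} \<lhd> G" using \<pi>.normal_kernel ker by simp
qed

text \<open>Replacing each \<open>k p\<close> by its inverse reduces the order reversing case to the
  previous one and leaves the kernel unchanged.\<close>

lemma Mod_iso_params_anti:
  assumes G: "group G" and K: "group K"
    and E: "carrier G = E ` Ps" and k: "carrier K = k ` Ps"
    and wd: "\<And>p p'. p \<in> Ps \<Longrightarrow> p' \<in> Ps \<Longrightarrow> E p = E p' \<Longrightarrow> k p = k p'"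
    and mult: "\<And>p p'. p \<in> Ps \<Longrightarrow> p' \<in> Ps \<Longrightarrow>
      \<exists>p''\<in>Ps. E p \<otimes>\<^bsub>G\<^esub> E p' = E p'' \<and> k p'' = k p' \<otimes>\<^bsub>K\<^esub> k p"
  shows "G Mod (E ` {p \<in> Ps. k p = \<one>\<^bsub>K\<^esub>}) \<cong> K" "E ` {p \<in> Ps. k p = \<one>\<^bsub>K\<^esub>} \<lhd> G"
proof -
  interpret K: group K by fact
  define k' where "k' p = inv\<^bsub>K\<^esub> (k p)" for p
  have kc: "k p \<in> carrier K" if "p \<in> Ps" for p using that k by blast
  have k1: "carrier K = k' ` Ps"
  proof (intro equalityI subsetI)
    fix z assume z: "z \<in> carrier K"
    then obtain p where "p \<in> Ps" "inv\<^bsub>K\<^esub> z = k p" using k by (metis K.inv_closed imageE)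
    then show "z \<in> k' ` Ps" using z by (metis K.inv_inv k'_def image_eqI)
  qed (use kc in \<open>auto simp: k'_def\<close>)
  have mult': "\<exists>p''\<in>Ps. E p \<otimes>\<^bsub>G\<^esub> E p' = E p'' \<and> k' p'' = k' p \<otimes>\<^bsub>K\<^esub> k' p'" if p: "p \<in> Ps" "p' \<in> Ps" for p p'
  proof -
    obtain p'' where "p'' \<in> Ps" "E p \<otimes>\<^bsub>G\<^esub> E p' = E p''" "k p'' = k p' \<otimes>\<^bsub>K\<^esub> k p" using mult[OF p] by blast
    then show ?thesis using kc p by (intro bexI[of _ p'']) (simp_all add: k'_def K.inv_mult_group)
  qed
  have eq: "{p \<in> Ps. k' p = \<one>\<^bsub>K\<^esub>} = {p \<in> Ps. k p = \<one>\<^bsub>K\<^esub>}"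
    using kc by (auto simp: k'_def)
  have wd': "k' p = k' p'" if "p \<in> Ps" "p' \<in> Ps" "E p = E p'" for p p'
    using wd[OF that] by (simp add: k'_def)
  show "G Mod (E ` {p \<in> Ps. k p = \<one>\<^bsub>K\<^esub>}) \<cong> K" "E ` {p \<in> Ps. k p = \<one>\<^bsub>K\<^esub>} \<lhd> G"
    using Mod_iso_params[OF G K E k1 wd' mult'] unfolding eq by blast+
qed

section \<open>Powers of the Frobenius automorphism\<close>

context gf3
begin

text \<open>The exponent \<open>i\<close> is not reduced modulo \<open>r\<close>, so closure under
  composition is just addition of exponents.\<close>

definition frob :: "('a \<Rightarrow> 'a) \<Rightarrow> bool" where
  "frob f \<longleftrightarrow> (\<exists>i. f = (\<lambda>x. x ^ 3 ^ i))"

lemma frob_id: "frob id" "frob (\<lambda>x. x)"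
  unfolding frob_def by (rule exI[of _ 0], force)+

lemma frob_comp: "frob f \<Longrightarrow> frob g \<Longrightarrow> frob (g \<circ> f)"
proof -
  assume "frob f" "frob g"
  then obtain i j where "f = (\<lambda>x. x ^ 3 ^ i)" "g = (\<lambda>x. x ^ 3 ^ j)" by (auto simp: frob_def)
  then have "g \<circ> f = (\<lambda>x. x ^ 3 ^ (i + j))" by (simp add: fun_eq_iff power_add flip: power_mult)
  then show ?thesis by (auto simp: frob_def)
qed

lemma frob_commute: "frob f \<Longrightarrow> frob g \<Longrightarrow> f (g x) = g (f x)"
  by (auto simp: frob_def mult.commute simp flip: power_mult)

lemma frob_simps:
  assumes "frob f"
  shows "f (x + y) = f x + f y" "f (x * y) = f x * f y" "f 0 = 0" "f 1 = 1" "f (- x) = - f x"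
    "f (x - y) = f x - f y" "f (x / y) = f x / f y" "f (x ^ n) = f x ^ n" "f x = f y \<longleftrightarrow> x = y"
    "f x = 0 \<longleftrightarrow> x = 0" "f x = 1 \<longleftrightarrow> x = 1"
proof -
  obtain i where f: "f = (\<lambda>x. x ^ 3 ^ i)" using assms by (auto simp: frob_def)
  show add: "f (x + y) = f x + f y" for x y by (simp add: f pow3_add)
  show "f (x * y) = f x * f y" by (simp add: f power_mult_distrib)
  show "f 0 = 0" "f 1 = 1" by (simp_all add: f)
  show neg: "f (- x) = - f x" for x by (simp add: f pow3_minus)
  show "f (x - y) = f x - f y" using add[of x "- y"] neg by simp
  show "f (x / y) = f x / f y" by (simp add: f power_divide)
  show "f (x ^ n) = f x ^ n" by (simp add: f mult.commute flip: power_mult)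
  show "f x = f y \<longleftrightarrow> x = y" by (simp add: f pow3_inj)
  show "f x = 0 \<longleftrightarrow> x = 0" by (simp add: f)
  show "f x = 1 \<longleftrightarrow> x = 1" by (simp add: f pow3_eq_1)
qed

lemma frob_bij: "frob f \<Longrightarrow> bij f"
  by (metis bijI finite_UNIV_inj_surj finite frob_simps(9) injI)

lemma frob_id_iff: "frob f \<Longrightarrow> frob g \<Longrightarrow> g \<circ> f = f \<longleftrightarrow> g = id"
  by (auto simp: fun_eq_iff frob_commute frob_simps)

lemma frob_field_aut: "frob f \<Longrightarrow> field_aut f"
  by (simp add: field_aut_def frob_bij frob_simps)

end

text \<open>The pair \<open>(\<nu>, f)\<close> encodes the element of \<open>J\<close> acting on \<open>\<Omega>\<close> as \<open>f\<close> followed by \<open>\<beta>\<^bsub>\<nu>\<^sup>2,\<nu>\<^esub>\<close>, and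
  on \<open>C\<close>, identified with the field, as \<open>x \<mapsto> \<nu> f(x)\<close>.\<close>

locale semilinear = gf3 r ty for r and ty :: "'a::{field,finite} itself" +
  fixes JP :: "('a \<times> ('a \<Rightarrow> 'a)) set"
  assumes JP_nz: "(\<nu>, f) \<in> JP \<Longrightarrow> \<nu> \<noteq> 0" and JP_frob: "(\<nu>, f) \<in> JP \<Longrightarrow> frob f"
    and JP_one: "(1, id) \<in> JP"
    and JP_mult: "(\<nu>, f) \<in> JP \<Longrightarrow> (\<nu>', f') \<in> JP \<Longrightarrow> (\<nu>' * f' \<nu>, f' \<circ> f) \<in> JP"
    and JP_trans: "x \<noteq> 0 \<Longrightarrow> \<exists>f. (x, f) \<in> JP"
begin

definition Y :: "'a set" where "Y = {\<nu>. (\<nu>, id) \<in> JP}"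

lemma Y_props: "1 \<in> Y" "0 \<notin> Y" "x \<in> Y \<Longrightarrow> y \<in> Y \<Longrightarrow> x * y \<in> Y"
  using JP_one JP_nz JP_mult[of x id y id] by (auto simp: Y_def mult.commute)

lemma card_Y: "card Y dvd CARD('a) - 1" "card Y > 0"
proof -
  interpret U: group "unit_group :: 'a monoid" by (rule unit_group_group)
  have "Y \<noteq> {}" using Y_props by blast
  then have "subgroup Y unit_group"
    using Y_props by (intro U.finite_subgroupI) auto
  from U.lagrange[OF this] have "card (rcosets\<^bsub>unit_group\<^esub> Y) * card Y = CARD('a) - 1"
    by (simp add: Coset.order_def card_Diff_subset)
  then show "card Y dvd CARD('a) - 1" by (metis dvd_triv_right)
  show "card Y > 0" using Y_props by (auto simp: card_gt_0_iff)
qed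

text \<open>Lagrange gives one inclusion; equality follows because \<open>x ^ n - 1\<close> has at
  most \<open>n\<close> roots.\<close>

lemma Y_roots: "Y = {x. x ^ card Y = 1}" "card {x::'a. x ^ card Y = 1} = card Y"
proof -
  have "Y \<subseteq> {x. x ^ card Y = 1}"
    using pow_card_eq_1[of Y] Y_props by blast
  moreover have "card {x::'a. x ^ card Y = 1} \<le> card Y"
    by (rule card_roots_of_unity_le[OF card_Y(2)])
  ultimately show eq: "Y = {x. x ^ card Y = 1}" by (intro card_seteq) auto
  then show "card {x::'a. x ^ card Y = 1} = card Y" by simp
qed

lemma Y_I: "x ^ card Y = 1 \<Longrightarrow> x \<in> Y"
  by (subst Y_roots(1)) simp

lemma Y_D: "x \<in> Y \<Longrightarrow> x ^ card Y = 1"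
  by (subst (asm) Y_roots(1)) simp

text \<open>\<open>Y\<close> is cut out by a single equation \<open>x ^ n = 1\<close>, which powers
  of Frobenius preserve.\<close>

lemma Y_frob:
  assumes "frob f" "x \<in> Y"
  shows "f x \<in> Y"
proof (rule Y_I)
  have "f x ^ card Y = f (x ^ card Y)" using frob_simps(8)[OF assms(1)] by simp
  then show "f x ^ card Y = 1" using Y_D[OF assms(2)] frob_simps(4)[OF assms(1)] by simp
qed

lemma Y_pow: "x ^ k \<in> Y" if "x \<in> Y"
  using that by (induction k) (auto simp: Y_props)

lemma JP_divide:
  assumes "(\<nu>, f) \<in> JP" "(\<nu>', f) \<in> JP"
  obtains y where "y \<in> Y" "\<nu>' = \<nu> * y"
proof -
  \<comment> \<open>Multiplication by a fixed element is injective on the finite set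
    \<open>JP\<close>, hence onto. This solves equations in \<open>JP\<close> from closure under
    products alone.\<close>
  let ?R = "\<lambda>(\<mu>, g). (\<nu> * f \<mu>, f \<circ> g)"
  have inj: "inj_on ?R JP"
    using JP_nz[OF assms(1)] frob_simps[OF JP_frob[OF assms(1)]]
    by (auto simp: inj_on_def fun_eq_iff)
  moreover have "?R ` JP \<subseteq> JP" using JP_mult assms(1) by auto
  ultimately have "?R ` JP = JP" by (intro endo_inj_surj) auto
  then obtain \<mu> g where \<mu>: "(\<mu>, g) \<in> JP" "\<nu>' = \<nu> * f \<mu>" "f = f \<circ> g" using assms(2) by force
  then have "g = id" using frob_simps[OF JP_frob[OF assms(1)]] by (metis comp_apply eq_id_iff)
  then have "f \<mu> \<in> Y" using \<mu> Y_frob[OF JP_frob[OF assms(1)]] by (simp add: Y_def)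
  then show ?thesis using that \<mu> by blast
qed

text \<open>Two elements of \<open>JP\<close> with the same \<open>f\<close> differ by a factor in
  \<open>Y\<close>, so the fibres of the projection to \<open>f\<close> all have the size of
  \<open>Y\<close>.\<close>

lemma card_Y_image: "card JP = card (snd ` JP) * card Y"
proof -
  have "card {p \<in> JP. snd p = f} = card Y" if f: "f \<in> snd ` JP" for f
  proof -
    obtain \<nu> where \<nu>: "(\<nu>, f) \<in> JP" using f by force
    have "bij_betw (\<lambda>y. (\<nu> * y, f)) Y {p \<in> JP. snd p = f}"
    proof (rule bij_betwI')
      show "(\<nu> * y, f) \<in> {p \<in> JP. snd p = f}" if "y \<in> Y" for y
        using JP_mult[OF \<nu>, of y id] that by (simp add: Y_def mult.commute)
      show "\<exists>y\<in>Y. p = (\<nu> * y, f)" if p: "p \<in> {p \<in> JP. snd p = f}" for p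
      proof -
        have "(fst p, f) \<in> JP" using p by auto
        then obtain y where "y \<in> Y" "fst p = \<nu> * y" using JP_divide[OF \<nu>] by blast
        then show ?thesis using p by (intro bexI[of _ y] prod_eqI) auto
      qed
    qed (use JP_nz[OF \<nu>] in auto)
    then show ?thesis by (simp add: bij_betw_same_card)
  qed
  then have "(\<Sum>f\<in>snd ` JP. card {p \<in> JP. snd p = f}) = card (snd ` JP) * card Y" by simp
  moreover have "card JP = (\<Sum>f\<in>snd ` JP. card {p \<in> JP. snd p = f})"
    using sum.image_gen[of JP "\<lambda>_. 1::nat" snd] by simp
  ultimately show ?thesis by simp
qed

text \<open>Orbit counting: \<open>(\<nu>, f)\<close> sends 1 to \<nu>, so transitivity makes the
  fibres of the first projection cosets of the stabilizer of 1, all of the same size.\<close>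

lemma card_units_dvd: "CARD('a) - 1 dvd card JP"
proof -
  have "card {p \<in> JP. fst p = x} = card {f. (1, f) \<in> JP}" if x: "x \<in> UNIV - {0}" for x
  proof -
    obtain g where g: "(x, g) \<in> JP" using JP_trans x by auto
    have bij: "bij g" and fg: "frob g" using frob_bij JP_frob g by auto
    have inj: "inj_on (\<lambda>f. (x, g \<circ> f)) {f. (1, f) \<in> JP}"
      using frob_simps(9)[OF fg] by (auto simp: inj_on_def fun_eq_iff)
    let ?R = "\<lambda>(\<mu>, f). (x * g \<mu>, g \<circ> f)"
    have "inj_on ?R JP" using x frob_simps[OF fg] by (auto simp: inj_on_def fun_eq_iff)
    moreover have "?R ` JP \<subseteq> JP" using JP_mult g by auto
    ultimately have R: "?R ` JP = JP" by (intro endo_inj_surj) auto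
    have "(\<lambda>f. (x, g \<circ> f)) ` {f. (1, f) \<in> JP} = {p \<in> JP. fst p = x}"
    proof (intro equalityI subsetI)
      fix p assume "p \<in> {p \<in> JP. fst p = x}"
      then have p: "p \<in> ?R ` JP" "fst p = x" using R by auto
      then obtain \<mu> f where \<mu>: "(\<mu>, f) \<in> JP" "p = (x * g \<mu>, g \<circ> f)" by auto
      then have "g \<mu> = 1" using p x by auto
      then have "\<mu> = 1" using frob_simps[OF fg] by simp
      then show "p \<in> (\<lambda>f. (x, g \<circ> f)) ` {f. (1, f) \<in> JP}" using \<mu> frob_simps[OF fg] by auto
    next
      fix p assume "p \<in> (\<lambda>f. (x, g \<circ> f)) ` {f. (1, f) \<in> JP}"
      then show "p \<in> {p \<in> JP. fst p = x}" using JP_mult[OF _ g] frob_simps(4)[OF fg] by force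
    qed
    then show ?thesis using card_image[OF inj] by simp
  qed
  then have "(\<Sum>x\<in>UNIV - {0}. card {p \<in> JP. fst p = x}) = (CARD('a) - 1) * card {f. (1, f) \<in> JP}"
    by (simp add: card_Diff_subset)
  moreover have "fst ` JP = UNIV - {0}"
    using JP_nz JP_trans by (auto simp: image_iff) force+
  then have "card JP = (\<Sum>x\<in>UNIV - {0}. card {p \<in> JP. fst p = x})"
    using sum.image_gen[of JP "\<lambda>_. 1::nat" fst] by simp
  ultimately show ?thesis by simp
qed

text \<open>The second components form a subgroup of the cyclic group generated by cubing, whose
  order divides \<open>r\<close> because \<open>x ^ 3 ^ r = x\<close>.\<close>

lemma card_frob_image: "card (snd ` JP) dvd r"
proof -
  interpret Sym: group "Sym :: ('a \<Rightarrow> 'a) monoid" by (rule Sym_group)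
  let ?c = "\<lambda>x::'a. x ^ 3"
  have cfrob: "frob ?c" unfolding frob_def by (rule exI[of _ 1]) simp
  then have c: "?c \<in> carrier Sym" using frob_bij by simp
  have pow: "?c [^]\<^bsub>Sym\<^esub> k = (\<lambda>x. x ^ 3 ^ k)" for k :: nat
    by (induction k) (auto simp: fun_eq_iff mult.commute simp flip: power_mult)
  have "?c [^]\<^bsub>Sym\<^esub> r = \<one>\<^bsub>Sym\<^esub>"
    unfolding pow using pow_card by (simp add: fun_eq_iff card_field)
  then have "Sym.ord ?c dvd r" using Sym.pow_eq_id[OF c] by simp
  moreover have "Sym.ord ?c = card (generate Sym {?c})"
    using Sym.generate_pow_card[OF c] .
  moreover have "snd ` JP \<subseteq> generate Sym {?c}"
  proof
    fix f assume "f \<in> snd ` JP"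
    then obtain \<nu> where "(\<nu>, f) \<in> JP" by force
    then obtain k where "f = ?c [^]\<^bsub>Sym\<^esub> (k::nat)" using JP_frob pow by (force simp: frob_def)
    then have "f = ?c [^]\<^bsub>Sym\<^esub> int k" by (simp add: int_pow_int)
    then show "f \<in> generate Sym {?c}" unfolding Sym.generate_pow[OF c] by blast
  qed
  moreover have "subgroup (snd ` JP) Sym"
  proof (rule Sym.finite_subgroupI)
    show "snd ` JP \<noteq> {}" using JP_one by auto
    fix f g assume "f \<in> snd ` JP" "g \<in> snd ` JP"
    then obtain \<nu> \<mu> where "(\<nu>, f) \<in> JP" "(\<mu>, g) \<in> JP" by force
    from JP_mult[OF this] show "f \<otimes>\<^bsub>Sym\<^esub> g \<in> snd ` JP" by force
  qed (use JP_frob frob_bij in auto)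
  moreover have gen: "subgroup (generate Sym {?c}) Sym"
    using c by (intro Sym.generate_is_subgroup) blast
  ultimately have "subgroup (snd ` JP) (Sym\<lparr>carrier := generate Sym {?c}\<rparr>)"
    using Sym.subgroup_incl by blast
  from group.lagrange[OF Sym.subgroup_imp_group[OF gen] this]
  have "card (snd ` JP) dvd card (generate Sym {?c})"
    by (simp add: Coset.order_def) (metis dvd_triv_right)
  then show ?thesis
    using \<open>Sym.ord ?c dvd r\<close> \<open>Sym.ord ?c = card (generate Sym {?c})\<close> by (metis dvd_trans)
qed

text \<open>For odd \<open>x\<close> each squaring gains a factor 2, since
  \<open>x ^ 2 ^ Suc k - 1\<close> is the product of \<open>x ^ 2 ^ k - 1\<close> and the even
  number \<open>x ^ 2 ^ k + 1\<close>.\<close>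

lemma two_power_dvd: "2 ^ k dvd m \<Longrightarrow> 2 ^ Suc k dvd (3::nat) ^ m - 1"
proof -
  have sq: "2 ^ Suc k dvd (x::nat) ^ 2 ^ k - 1" if "odd x" for x
    using that
  proof (induction k)
    case 0
    then show ?case by simp
  next
    case (Suc k)
    have "x > 0" using \<open>odd x\<close> by (cases x) auto
    then have "(x ^ 2 ^ k + 1) * (x ^ 2 ^ k - 1) = x ^ 2 ^ Suc k - 1"
      by (simp add: algebra_simps power_mult power2_eq_square)
    moreover have "2 dvd x ^ 2 ^ k + 1" using \<open>odd x\<close> by simp
    ultimately show ?case using mult_dvd_mono[of 2 "x ^ 2 ^ k + 1" "2 ^ Suc k" "x ^ 2 ^ k - 1"] Suc by simp
  qed
  assume "2 ^ k dvd m"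
  then obtain j where m: "m = j * 2 ^ k" by (auto simp: dvd_def mult.commute)
  show ?thesis unfolding m power_mult by (rule sq) simp
qed

text \<open>Transitivity gives \<open>q - 1\<close> dividing \<open>|Y| s\<close> for some \<open>s\<close> dividing \<open>r\<close>, and \<open>q - 1\<close> contains a
  higher power of 2 than \<open>r\<close>.\<close>

lemma even_card_Y: "even (card Y)"
proof -
  have "CARD('a) - 1 dvd card (snd ` JP) * card Y"
    using card_units_dvd card_Y_image by simp
  then have dvd: "3 ^ r - 1 dvd r * card Y"
    using card_frob_image by (metis card_field dvd_trans mult_dvd_mono dvd_refl)
  define k where "k = multiplicity 2 r"
  have "2 ^ Suc k dvd (3::nat) ^ r - 1"
    by (rule two_power_dvd) (simp add: k_def multiplicity_dvd)
  with dvd have "2 ^ Suc k dvd r * card Y" by (rule dvd_trans[rotated])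
  moreover obtain s where s: "r = 2 ^ k * s" "\<not> 2 dvd s"
    using multiplicity_decompose'[of r 2] r_pos unfolding k_def by auto
  ultimately have "2 ^ k * 2 dvd 2 ^ k * (s * card Y)" by (simp add: mult.assoc mult.commute[of 2])
  then have "2 dvd s * card Y" by simp
  then show ?thesis using s by simp
qed

lemma minus_one_Y: "-1 \<in> Y"
  by (rule Y_I) (use even_card_Y in simp)

lemma square_root_Y: "\<nu> ^ 2 = 1 \<Longrightarrow> \<nu> \<in> Y"
  using square_eq_1[of \<nu>] minus_one_Y Y_props by auto

lemma square_root_Y_JP: "\<nu> ^ 2 = 1 \<Longrightarrow> (\<nu>, id) \<in> JP"
  using square_root_Y by (simp add: Y_def)

subsection \<open>The associated 2-transitive group\<close>

text \<open>In the application this is the group that the action of \<open>Jhat\<close> on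
  \<open>C\<close> becomes when \<open>p_gamma e\<close> is identified with \<open>e\<close>; its
  translations come from \<open>C\<close> itself.\<close>

definition PJ :: "('a \<Rightarrow> 'a) set" where
  "PJ = {(\<lambda>x. \<nu> * f x + e) | \<nu> f e. (\<nu>, f) \<in> JP}"

lemma AGammaL1_carrier: "carrier AGammaL1 = {(\<lambda>x. l * f x + e) | (l::'a) f e. l \<noteq> 0 \<and> field_aut f}"
  by (simp add: AGammaL1_def)

lemma AGammaL1_subgroup: "subgroup (carrier (AGammaL1 :: ('a \<Rightarrow> 'a) monoid)) Sym"
proof (rule group.finite_subgroupI[OF Sym_group Sym_finite])
  show "carrier (AGammaL1 :: ('a \<Rightarrow> 'a) monoid) \<subseteq> carrier Sym"
  proof
    fix g :: "'a \<Rightarrow> 'a" assume "g \<in> carrier AGammaL1"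
    then obtain l f e where g: "g = (\<lambda>x. l * f x + e)" "l \<noteq> 0" "field_aut f"
      unfolding AGammaL1_carrier by blast
    have "inj f" using g(3) unfolding field_aut_def by (metis bij_is_inj)
    then have "inj g" using g(2) unfolding g(1) inj_def by simp
    then have "bij g" by (metis bijI finite_UNIV_inj_surj finite)
    then show "g \<in> carrier Sym" by simp
  qed
  have "id \<in> carrier (AGammaL1 :: ('a \<Rightarrow> 'a) monoid)"
    unfolding AGammaL1_carrier
    by (rule CollectI, rule exI[of _ 1], rule exI[of _ id], rule exI[of _ 0]) (auto simp: field_aut_def)
  then show "carrier (AGammaL1 :: ('a \<Rightarrow> 'a) monoid) \<noteq> {}" by blast
next
  fix g h :: "'a \<Rightarrow> 'a" assume "g \<in> carrier AGammaL1" "h \<in> carrier AGammaL1"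
  then obtain l f e l' f' e' where g: "g = (\<lambda>x. l * f x + e)" "l \<noteq> 0" "field_aut f"
    and h: "h = (\<lambda>x. l' * f' x + e')" "l' \<noteq> 0" "field_aut f'"
    unfolding AGammaL1_carrier by blast
  have "f' 0 = f' 0 + f' 0" using h(3) unfolding field_aut_def by (metis add.right_neutral)
  then have "f' 0 = 0" by (simp only: add_cancel_right_right)
  moreover have "inj f'" using h(3) unfolding field_aut_def by (metis bij_is_inj)
  ultimately have "f' l \<noteq> 0" using g(2) by (metis injD)
  then have nz: "l' * f' l \<noteq> 0" using h(2) by simp
  have comp: "field_aut (f' \<circ> f)" using g(3) h(3) by (auto simp: field_aut_def bij_comp)
  have "g \<otimes>\<^bsub>Sym\<^esub> h = (\<lambda>x. (l' * f' l) * (f' \<circ> f) x + (l' * f' e + e'))"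
    using h(3) unfolding g h field_aut_def by (auto simp: fun_eq_iff algebra_simps)
  then show "g \<otimes>\<^bsub>Sym\<^esub> h \<in> carrier AGammaL1"
    unfolding AGammaL1_carrier using nz comp by blast
qed

lemma AGammaL1_group: "group (AGammaL1 :: ('a \<Rightarrow> 'a) monoid)"
  using group.subgroup_imp_group[OF Sym_group AGammaL1_subgroup] by (simp add: AGammaL1_def)

lemma AGammaL1_mult: "g \<otimes>\<^bsub>AGammaL1\<^esub> h = h \<circ> g" for g h :: "'a \<Rightarrow> 'a"
  by (simp add: AGammaL1_def)

lemma PJ_subgroup: "subgroup PJ AGammaL1"
proof (rule group.finite_subgroupI[OF AGammaL1_group])
  show "PJ \<subseteq> carrier AGammaL1"
    unfolding PJ_def AGammaL1_carrier using JP_nz JP_frob frob_field_aut by blast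
  show "PJ \<noteq> {}" unfolding PJ_def using JP_one by blast
next
  fix g h assume "g \<in> PJ" "h \<in> PJ"
  then obtain l f e l' f' e' where g: "g = (\<lambda>x. l * f x + e)" "(l, f) \<in> JP"
    and h: "h = (\<lambda>x. l' * f' x + e')" "(l', f') \<in> JP"
    unfolding PJ_def by blast
  have "g \<otimes>\<^bsub>AGammaL1\<^esub> h = (\<lambda>x. (l' * f' l) * (f' \<circ> f) x + (l' * f' e + e'))"
    using frob_simps[OF JP_frob[OF h(2)]] unfolding g h AGammaL1_mult by (simp add: fun_eq_iff algebra_simps)
  then show "g \<otimes>\<^bsub>AGammaL1\<^esub> h \<in> PJ"
    unfolding PJ_def using JP_mult[OF g(2) h(2)] by blast
qed simp

lemma PJ_two_transitive: "two_transitive_on UNIV PJ (\<lambda>g y. g y)"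
  unfolding two_transitive_on_def
proof (intro ballI impI)
  fix x y x' y' :: 'a assume xy: "x \<noteq> y" "x' \<noteq> y'"
  define l where "l = x - y"
  have l: "l \<noteq> 0" "x' - y' \<noteq> 0" using xy l_def by auto
  obtain k where k: "(l, k) \<in> JP" using JP_trans[OF l(1)] by blast
  obtain k' where k': "(x' - y', k') \<in> JP" using JP_trans[OF l(2)] by blast
  \<comment> \<open>Composing with \<open>(l, k)\<close> permutes \<open>JP\<close>, so the element
    with first component \<open>x' - y'\<close> arises in this way. The factor
    \<open>(\<mu>, h)\<close> found then sends the difference \<open>l\<close> to
    \<open>x' - y'\<close>, and a translation does the rest.\<close>
  let ?R = "\<lambda>(\<mu>, h). (\<mu> * h l, h \<circ> k)"
  have "inj_on ?R JP"
  proof (rule inj_onI, clarify)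
    fix \<mu> h \<mu>' h' assume h: "(\<mu>, h) \<in> JP" "(\<mu>', h') \<in> JP" and eq: "\<mu> * h l = \<mu>' * h' l" "h \<circ> k = h' \<circ> k"
    have "surj k" using frob_bij[OF JP_frob[OF k]] by (simp add: bij_is_surj)
    then have "h = h'" using eq(2) by (metis comp_apply ext surjD)
    then show "\<mu> = \<mu>' \<and> h = h'" using eq(1) l(1) frob_simps(10)[OF JP_frob[OF h(2)]] by simp
  qed
  moreover have "?R ` JP \<subseteq> JP" using JP_mult[OF k] by auto
  ultimately have "?R ` JP = JP" by (intro endo_inj_surj) auto
  then have "(x' - y', k') \<in> ?R ` JP" using k' by simp
  then obtain \<mu> h where \<mu>: "(\<mu>, h) \<in> JP" "\<mu> * h (x - y) = x' - y'" unfolding l_def by auto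
  show "\<exists>g\<in>PJ. g x = x' \<and> g y = y'"
  proof (intro bexI conjI)
    let ?g = "\<lambda>z. \<mu> * h z + (y' - \<mu> * h y)"
    show "?g \<in> PJ" using \<mu> unfolding PJ_def by blast
    show "?g y = y'" by simp
    show "?g x = x'" using \<mu> frob_simps(6)[OF JP_frob[OF \<mu>(1)]] by (simp add: algebra_simps)
  qed
qed

lemma PJ_stabilizer: "stabilizer (AGammaL1\<lparr>carrier := PJ\<rparr>) (\<lambda>g y. g y) 0 = {(\<lambda>x. \<nu> * f x) | \<nu> f. (\<nu>, f) \<in> JP}"
proof (intro equalityI subsetI)
  fix g assume "g \<in> stabilizer (AGammaL1\<lparr>carrier := PJ\<rparr>) (\<lambda>g y. g y) 0"
  then have "g \<in> PJ" "g 0 = 0" by (auto simp: stabilizer_def)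
  then obtain \<nu> f e where g: "g = (\<lambda>x. \<nu> * f x + e)" "(\<nu>, f) \<in> JP" unfolding PJ_def by blast
  then have "e = 0" using \<open>g 0 = 0\<close> frob_simps(3)[OF JP_frob[OF g(2)]] by simp
  then have "g = (\<lambda>x. \<nu> * f x)" using g by simp
  then show "g \<in> {(\<lambda>x. \<nu> * f x) | \<nu> f. (\<nu>, f) \<in> JP}" using g(2) by blast
next
  fix g assume "g \<in> {(\<lambda>x. \<nu> * f x) | \<nu> f. (\<nu>, f) \<in> JP}"
  then obtain \<nu> f where g: "g = (\<lambda>x. \<nu> * f x)" "(\<nu>, f) \<in> JP" by blast
  then have "g = (\<lambda>x. \<nu> * f x + 0)" by simp
  then have "g \<in> PJ" unfolding PJ_def using g(2) by blast
  moreover have "g 0 = 0" using g frob_simps(3)[OF JP_frob[OF g(2)]] by simp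
  ultimately show "g \<in> stabilizer (AGammaL1\<lparr>carrier := PJ\<rparr>) (\<lambda>g y. g y) 0" by (simp add: stabilizer_def)
qed

end

section \<open>The amalgam in coordinates\<close>

context semilinear
begin

definition ok1 :: "('a \<Rightarrow> 'a) \<Rightarrow> 'a \<Rightarrow> 'a \<Rightarrow> 'a \<Rightarrow> 'a \<Rightarrow> 'a \<Rightarrow> bool" where
  "ok1 f \<nu> p x y m \<longleftrightarrow> (\<nu>, f) \<in> JP \<and> p * m - x * y = \<nu> ^ 3"

lemma ok1_id: "ok1 id \<nu> p x y m \<longleftrightarrow> \<nu> \<in> Y \<and> p * m - x * y = \<nu> ^ 3"
  by (simp add: ok1_def Y_def)

lemma det_mult:
  fixes p :: 'a
  shows "(p' * p + x' * y) * (y' * x + m' * m) - (p' * x + x' * m) * (y' * p + m' * y) =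
    (p' * m' - x' * y') * (p * m - x * y)"
  by (simp add: algebra_simps)

lemma ok1_mult:
  assumes "ok1 f \<nu> p x y m" "ok1 f' \<nu>' p' x' y' m'"
  shows "ok1 (f' \<circ> f) (\<nu>' * f' \<nu>) (p' * f' p + x' * f' y) (p' * f' x + x' * f' m)
    (y' * f' p + m' * f' y) (y' * f' x + m' * f' m)"
proof -
  have f': "frob f'" using assms JP_frob by (auto simp: ok1_def)
  have "f' p * f' m - f' x * f' y = f' \<nu> ^ 3"
    using assms(1) frob_simps[OF f'] by (metis ok1_def)
  then show ?thesis
    using assms JP_mult by (simp add: ok1_def det_mult power_mult_distrib)
qed

end

text \<open>\<open>s1 f \<nu> p x y m u v w\<close> stands for
  \<open>(a, b, c) \<mapsto> (p f(a) + x f(b) + u, y f(a) + m f(b) + v, \<nu>\<^sup>2 f(c) + w)\<close> and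
  \<open>s2 f \<nu> t D e u v w\<close> for
  \<open>(a, b, c) \<mapsto> (\<nu>\<^sup>2 t f(a) + e f(b) + D \<nu>\<^sup>2 t\<^sup>-\<^sup>2 f(b)\<^sup>2 + D\<^sup>\<epsilon> \<nu>\<^sup>2 f(c) + u, \<nu> t\<^sup>-\<^sup>1 f(b) + v, \<nu>\<^sup>2 f(c) + w)\<close>,
  both conjugated by a fixed element that moves the base arc to the given one. The relation
  \<open>p m - x y = \<nu>\<^sup>3\<close> in \<open>ok1\<close> holds because \<open>\<beta>\<^bsub>\<nu>\<^sup>2,\<nu>\<^esub>\<close> acts on \<open>V\<close> with determinant \<open>\<nu>\<^sup>3\<close>.\<close>

locale amalgam = semilinear r ty JP + group H
  for r and ty :: "'a::{field,finite} itself" and JP and H :: "('h, 'mm) monoid_scheme" (structure) +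
  fixes s1 :: "('a \<Rightarrow> 'a) \<Rightarrow> 'a \<Rightarrow> 'a \<Rightarrow> 'a \<Rightarrow> 'a \<Rightarrow> 'a \<Rightarrow> 'a \<Rightarrow> 'a \<Rightarrow> 'a \<Rightarrow> 'h"
    and s2 :: "('a \<Rightarrow> 'a) \<Rightarrow> 'a \<Rightarrow> 'a \<Rightarrow> 'a \<Rightarrow> 'a \<Rightarrow> 'a \<Rightarrow> 'a \<Rightarrow> 'a \<Rightarrow> 'h"
  assumes fin: "finite (carrier H)"
    and s1_closed: "ok1 f \<nu> p x y m \<Longrightarrow> s1 f \<nu> p x y m u v w \<in> carrier H"
    and s2_closed: "(\<nu>, f) \<in> JP \<Longrightarrow> t \<noteq> 0 \<Longrightarrow> s2 f \<nu> t D e u v w \<in> carrier H"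
    and s1_mult: "ok1 f \<nu> p x y m \<Longrightarrow> ok1 f' \<nu>' p' x' y' m' \<Longrightarrow>
      s1 f \<nu> p x y m u v w \<otimes> s1 f' \<nu>' p' x' y' m' u' v' w' =
      s1 (f' \<circ> f) (\<nu>' * f' \<nu>) (p' * f' p + x' * f' y) (p' * f' x + x' * f' m)
        (y' * f' p + m' * f' y) (y' * f' x + m' * f' m)
        (p' * f' u + x' * f' v + u') (y' * f' u + m' * f' v + v') (\<nu>' ^ 2 * f' w + w')"
    and s2_mult: "(\<nu>, f) \<in> JP \<Longrightarrow> (\<nu>', f') \<in> JP \<Longrightarrow> t \<noteq> 0 \<Longrightarrow> t' \<noteq> 0 \<Longrightarrow>
      s2 f \<nu> t D e u v w \<otimes> s2 f' \<nu>' t' D' e' u' v' w' =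
      s2 (f' \<circ> f) (\<nu>' * f' \<nu>) (t' * f' t) (t' ^ 3 * f' D + D')
        (\<nu>' ^ 2 * t' * f' e + e' * (f' \<nu> / f' t) + 2 * D' * (\<nu>' ^ 2 / t' ^ 2) * (f' \<nu> / f' t) * f' v)
        (\<nu>' ^ 2 * t' * f' u + e' * f' v + D' * (\<nu>' ^ 2 / t' ^ 2) * (f' v) ^ 2 + D' ^ eps * \<nu>' ^ 2 * f' w + u')
        (\<nu>' / t' * f' v + v') (\<nu>' ^ 2 * f' w + w')"
    and s1_inj: "ok1 f \<nu> p x y m \<Longrightarrow> ok1 f' \<nu>' p' x' y' m' \<Longrightarrow>
      s1 f \<nu> p x y m u v w = s1 f' \<nu>' p' x' y' m' u' v' w' \<longleftrightarrow>
      f = f' \<and> \<nu> = \<nu>' \<and> p = p' \<and> x = x' \<and> y = y' \<and> m = m' \<and> u = u' \<and> v = v' \<and> w = w'"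
    and s2_inj: "(\<nu>, f) \<in> JP \<Longrightarrow> (\<nu>', f') \<in> JP \<Longrightarrow> t \<noteq> 0 \<Longrightarrow> t' \<noteq> 0 \<Longrightarrow>
      s2 f \<nu> t D e u v w = s2 f' \<nu>' t' D' e' u' v' w' \<longleftrightarrow>
      f = f' \<and> \<nu> = \<nu>' \<and> t = t' \<and> D = D' \<and> e = e' \<and> u = u' \<and> v = v' \<and> w = w'"
    and s2_0: "(\<nu>, f) \<in> JP \<Longrightarrow> t \<noteq> 0 \<Longrightarrow> s2 f \<nu> t 0 e u v w = s1 f \<nu> (\<nu> ^ 2 * t) e 0 (\<nu> / t) u v w"
    and s1_s2: "ok1 f \<nu> p x y m \<Longrightarrow> (\<nu>', f') \<in> JP \<Longrightarrow> t \<noteq> 0 \<Longrightarrow>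
      s1 f \<nu> p x y m u v w = s2 f' \<nu>' t D e u' v' w' \<Longrightarrow> D = 0"
begin

text \<open>\<open>H1c\<close> and \<open>H2c\<close> are \<open>H\<^sub>1\<^sup>*\<close> and \<open>H\<^sub>2\<^sup>*\<close>; \<open>VF\<close> is \<open>Q\<close> at \<open>x\<^sub>1\<close>, \<open>VCF\<close> is \<open>O\<^sub>3(T\<^sub>2)\<close>, \<open>FF\<close> is \<open>Z(L\<^sub>1)\<close>.\<close>

definition A1 where "A1 = {s1 f \<nu> p x y m u v w | f \<nu> p x y m u v w. ok1 f \<nu> p x y m}"
definition A2 where "A2 = {s2 f \<nu> t D e u v w | f \<nu> t D e u v w. (\<nu>, f) \<in> JP \<and> t \<noteq> 0}"
definition A12 where "A12 = {s2 f \<nu> t 0 e u v w | f \<nu> t e u v w. (\<nu>, f) \<in> JP \<and> t \<noteq> 0}"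
definition Bs where "Bs = {s2 id \<nu> t 0 e u v w | \<nu> t e u v w. \<nu> \<in> Y \<and> t \<noteq> 0}"
text \<open>The condition \<open>\<nu> * t ^ 2 = 1\<close> equates the diagonal entries
  \<open>\<nu> ^ 2 * t\<close> and \<open>\<nu> / t\<close>: these are the homotheties of the plane
  combined with all translations.\<close>

definition T1s where "T1s = {s2 id \<nu> t 0 0 u v w | \<nu> t u v w. \<nu> \<in> Y \<and> \<nu> * t ^ 2 = 1}"
definition T2s where "T2s = {s2 id \<nu> 1 0 e u v w | \<nu> e u v w. \<nu> \<in> Y}"
definition H1c where "H1c = {s1 id \<nu> p x y m u v w | \<nu> p x y m u v w. ok1 id \<nu> p x y m}"
definition H2c where "H2c = {s2 id \<nu> t D e u v w | \<nu> t D e u v w. \<nu> \<in> Y \<and> t \<noteq> 0}"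
definition L1s where "L1s = {s1 id 1 p x y m u v w | p x y m u v w. p * m - x * y = 1}"
definition LBs where "LBs = {s2 id 1 t 0 e u v w | t e u v w. t \<noteq> 0}"
definition VCF where "VCF = {s2 id 1 1 0 e u v w | e u v w. True}"
definition VF where "VF = {s2 id 1 1 0 0 u v w | u v w. True}"
definition FF where "FF = {s2 id 1 1 0 0 0 0 w | w. True}"

lemma one_nz: "(1::'a) \<noteq> 0"
  by simp

lemma Y_JP: "\<nu> \<in> Y \<longleftrightarrow> (\<nu>, id) \<in> JP"
  by (simp add: Y_def)

lemma Y_nz: "\<nu> \<in> Y \<Longrightarrow> \<nu> \<noteq> 0"
  using Y_props by blast

lemma ok1_s2: "(\<nu>, f) \<in> JP \<Longrightarrow> t \<noteq> 0 \<Longrightarrow> ok1 f \<nu> (\<nu> ^ 2 * t) e 0 (\<nu> / t)"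
  by (simp add: ok1_def power2_eq_square power3_eq_cube)

lemma eps_0: "(0::'a) ^ eps = 0"
  using eps_pos by (simp add: power_0_left)

lemma s1_mult_id:
  assumes "ok1 id \<nu> p x y m" "ok1 id \<nu>' p' x' y' m'"
  shows "s1 id \<nu> p x y m u v w \<otimes> s1 id \<nu>' p' x' y' m' u' v' w' =
      s1 id (\<nu>' * \<nu>) (p' * p + x' * y) (p' * x + x' * m) (y' * p + m' * y) (y' * x + m' * m)
        (p' * u + x' * v + u') (y' * u + m' * v + v') (\<nu>' ^ 2 * w + w')"
  using s1_mult[OF assms, of u v w u' v' w'] by simp

lemma s2_mult_id:
  assumes "\<nu> \<in> Y" "\<nu>' \<in> Y" "t \<noteq> 0" "t' \<noteq> 0"
  shows "s2 id \<nu> t D e u v w \<otimes> s2 id \<nu>' t' D' e' u' v' w' =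
      s2 id (\<nu>' * \<nu>) (t' * t) (t' ^ 3 * D + D')
        (\<nu>' ^ 2 * t' * e + e' * (\<nu> / t) + 2 * D' * (\<nu>' ^ 2 / t' ^ 2) * (\<nu> / t) * v)
        (\<nu>' ^ 2 * t' * u + e' * v + D' * (\<nu>' ^ 2 / t' ^ 2) * v ^ 2 + D' ^ eps * \<nu>' ^ 2 * w + u')
        (\<nu>' / t' * v + v') (\<nu>' ^ 2 * w + w')"
  using s2_mult[of \<nu> id \<nu>' id t t' D e u v w D' e' u' v' w'] assms by (simp add: Y_JP)

lemma s2_mult_0:
  assumes "\<nu> \<in> Y" "\<nu>' \<in> Y" "t \<noteq> 0" "t' \<noteq> 0"
  shows "s2 id \<nu> t 0 e u v w \<otimes> s2 id \<nu>' t' 0 e' u' v' w' =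
      s2 id (\<nu>' * \<nu>) (t' * t) 0 (\<nu>' ^ 2 * t' * e + e' * (\<nu> / t))
        (\<nu>' ^ 2 * t' * u + e' * v + u') (\<nu>' / t' * v + v') (\<nu>' ^ 2 * w + w')"
  using s2_mult_id[OF assms, of 0 e u v w 0 e' u' v' w'] by (simp add: eps_0)

section \<open>Subgroups of the two stabilizers in coordinates\<close>

lemma A1_carrier: "A1 \<subseteq> carrier H"
  unfolding A1_def using s1_closed by blast

lemma A2_carrier: "A2 \<subseteq> carrier H"
  unfolding A2_def using s2_closed by blast

lemma A12_eq: "A1 \<inter> A2 = A12"
proof (intro equalityI subsetI)
  fix g assume "g \<in> A1 \<inter> A2"
  then obtain f \<nu> p x y m u v w f' \<nu>' t D e u' v' w' where
    "g = s1 f \<nu> p x y m u v w" "ok1 f \<nu> p x y m" and g: "g = s2 f' \<nu>' t D e u' v' w'" "(\<nu>', f') \<in> JP" "t \<noteq> 0"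
    unfolding A1_def A2_def by blast
  then have "D = 0" using s1_s2 by metis
  then show "g \<in> A12" unfolding A12_def using g by blast
next
  fix g assume "g \<in> A12"
  then obtain f \<nu> t e u v w where g: "g = s2 f \<nu> t 0 e u v w" "(\<nu>, f) \<in> JP" "t \<noteq> 0" unfolding A12_def by blast
  then have "g \<in> A2" unfolding A2_def by blast
  moreover have "g \<in> A1" unfolding A1_def g(1) s2_0[OF g(2,3)] using ok1_s2[OF g(2,3)] by blast
  ultimately show "g \<in> A1 \<inter> A2" by blast
qed

lemma A1_subgroup: "subgroup A1 H"
proof (rule finite_subgroupI[OF fin A1_carrier])
  have "ok1 id 1 1 0 0 1" by (simp add: ok1_id Y_props)
  then show "A1 \<noteq> {}" unfolding A1_def by blast
next
  fix g h assume "g \<in> A1" "h \<in> A1"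
  then obtain f \<nu> p x y m u v w f' \<nu>' p' x' y' m' u' v' w' where
    g: "g = s1 f \<nu> p x y m u v w" "ok1 f \<nu> p x y m" and h: "h = s1 f' \<nu>' p' x' y' m' u' v' w'" "ok1 f' \<nu>' p' x' y' m'"
    unfolding A1_def by blast
  show "g \<otimes> h \<in> A1"
    unfolding g(1) h(1) s1_mult[OF g(2) h(2)] A1_def using ok1_mult[OF g(2) h(2)] by blast
qed

lemma A2_subgroup: "subgroup A2 H"
proof (rule finite_subgroupI[OF fin A2_carrier])
  have "s2 id 1 1 0 0 0 0 0 \<in> A2" unfolding A2_def using JP_one one_nz by blast
  then show "A2 \<noteq> {}" by blast
next
  fix g h assume "g \<in> A2" "h \<in> A2"
  then obtain f \<nu> t D e u v w f' \<nu>' t' D' e' u' v' w' where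
    g: "g = s2 f \<nu> t D e u v w" "(\<nu>, f) \<in> JP" "t \<noteq> 0" and h: "h = s2 f' \<nu>' t' D' e' u' v' w'" "(\<nu>', f') \<in> JP" "t' \<noteq> 0"
    unfolding A2_def by blast
  have "t' * f' t \<noteq> 0" using g h frob_simps(10)[OF JP_frob] by simp
  then show "g \<otimes> h \<in> A2"
    unfolding g(1) h(1) s2_mult[OF g(2) h(2) g(3) h(3)] A2_def using JP_mult[OF g(2) h(2)] by blast
qed

lemma A12_subgroup: "subgroup A12 H"
  unfolding A12_eq[symmetric] by (rule subgroups_Inter_pair[OF A1_subgroup A2_subgroup])

lemma A12_sub: "A12 \<subseteq> A1" "A12 \<subseteq> A2"
  using A12_eq by auto

lemma H1c_subgroup: "subgroup H1c H"
proof (rule finite_subgroupI[OF fin])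
  have "ok1 id 1 1 0 0 1" by (simp add: ok1_id Y_props)
  then show "H1c \<noteq> {}" unfolding H1c_def by blast
  show "H1c \<subseteq> carrier H" unfolding H1c_def using s1_closed by blast
next
  fix g h assume "g \<in> H1c" "h \<in> H1c"
  then obtain \<nu> p x y m u v w \<nu>' p' x' y' m' u' v' w' where
    g: "g = s1 id \<nu> p x y m u v w" "ok1 id \<nu> p x y m" and h: "h = s1 id \<nu>' p' x' y' m' u' v' w'" "ok1 id \<nu>' p' x' y' m'"
    unfolding H1c_def by blast
  show "g \<otimes> h \<in> H1c"
    unfolding g(1) h(1) s1_mult_id[OF g(2) h(2)] H1c_def using ok1_mult[OF g(2) h(2)] unfolding id_o id_apply by blast
qed

lemma H2c_subgroup: "subgroup H2c H"
proof (rule finite_subgroupI[OF fin])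
  have "s2 id 1 1 0 0 0 0 0 \<in> H2c" unfolding H2c_def using Y_props(1) one_nz by blast
  then show "H2c \<noteq> {}" by blast
  show "H2c \<subseteq> carrier H" unfolding H2c_def Y_JP using s2_closed by blast
next
  fix g h assume "g \<in> H2c" "h \<in> H2c"
  then obtain \<nu> t D e u v w \<nu>' t' D' e' u' v' w' where
    g: "g = s2 id \<nu> t D e u v w" "\<nu> \<in> Y" "t \<noteq> 0" and h: "h = s2 id \<nu>' t' D' e' u' v' w'" "\<nu>' \<in> Y" "t' \<noteq> 0"
    unfolding H2c_def by blast
  have "t' * t \<noteq> 0" using g h by simp
  then show "g \<otimes> h \<in> H2c"
    unfolding g(1) h(1) s2_mult_id[OF g(2) h(2) g(3) h(3)] H2c_def using Y_props(3)[OF h(2) g(2)] by blast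
qed

lemma L1s_sub: "L1s \<subseteq> H1c"
proof
  fix g assume "g \<in> L1s"
  then obtain p x y m u v w where "g = s1 id 1 p x y m u v w" "p * m - x * y = 1" unfolding L1s_def by blast
  moreover from this have "ok1 id 1 p x y m" using Y_props by (simp add: ok1_id)
  ultimately show "g \<in> H1c" unfolding H1c_def by blast
qed

lemma L1s_subgroup: "subgroup L1s H"
proof (rule finite_subgroupI[OF fin])
  have "(1::'a) * 1 - 0 * 0 = 1" by simp
  then show "L1s \<noteq> {}" unfolding L1s_def by blast
  show "L1s \<subseteq> carrier H" using L1s_sub subgroup.subset[OF H1c_subgroup] by blast
next
  fix g h assume "g \<in> L1s" "h \<in> L1s"
  then obtain p x y m u v w p' x' y' m' u' v' w' where
    g: "g = s1 id 1 p x y m u v w" "p * m - x * y = 1" and h: "h = s1 id 1 p' x' y' m' u' v' w'" "p' * m' - x' * y' = 1"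
    unfolding L1s_def by blast
  have ok: "ok1 id 1 p x y m" "ok1 id 1 p' x' y' m'" using g h Y_props by (simp_all add: ok1_id)
  have "(p' * p + x' * y) * (y' * x + m' * m) - (p' * x + x' * m) * (y' * p + m' * y) = 1"
    using g(2) h(2) by (simp only: det_mult) simp
  then show "g \<otimes> h \<in> L1s"
    unfolding g(1) h(1) s1_mult_id[OF ok] mult_1_left L1s_def by blast
qed

lemma Bs_subgroup: "subgroup Bs H"
proof (rule finite_subgroupI[OF fin])
  have "s2 id 1 1 0 0 0 0 0 \<in> Bs" unfolding Bs_def using Y_props(1) one_nz by blast
  then show "Bs \<noteq> {}" by blast
  show "Bs \<subseteq> carrier H" unfolding Bs_def Y_JP using s2_closed by blast
next
  fix g h assume "g \<in> Bs" "h \<in> Bs"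
  then obtain \<nu> t e u v w \<nu>' t' e' u' v' w' where
    g: "g = s2 id \<nu> t 0 e u v w" "\<nu> \<in> Y" "t \<noteq> 0" and h: "h = s2 id \<nu>' t' 0 e' u' v' w'" "\<nu>' \<in> Y" "t' \<noteq> 0"
    unfolding Bs_def by blast
  have "t' * t \<noteq> 0" using g h by simp
  then show "g \<otimes> h \<in> Bs"
    unfolding g(1) h(1) s2_mult_0[OF g(2) h(2) g(3) h(3)] Bs_def using Y_props(3)[OF h(2) g(2)] by blast
qed

lemma Bs_subsetI:
  assumes "X \<subseteq> Bs" "s2 id 1 1 0 0 0 0 0 \<in> X" and "\<And>g h. g \<in> X \<Longrightarrow> h \<in> X \<Longrightarrow> g \<otimes> h \<in> X"
  shows "subgroup X H"
  using assms subgroup.subset[OF Bs_subgroup] by (intro finite_subgroupI[OF fin]) auto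

lemma Bs_subs: "T1s \<subseteq> Bs" "T2s \<subseteq> Bs" "LBs \<subseteq> Bs" "VCF \<subseteq> Bs" "VF \<subseteq> Bs" "FF \<subseteq> Bs"
proof -
  show "T1s \<subseteq> Bs"
  proof
    fix g assume "g \<in> T1s"
    then obtain \<nu> t u v w where "g = s2 id \<nu> t 0 0 u v w" "\<nu> \<in> Y" "\<nu> * t ^ 2 = 1" unfolding T1s_def by blast
    moreover from this have "t \<noteq> 0" by auto
    ultimately show "g \<in> Bs" unfolding Bs_def by blast
  qed
  show "T2s \<subseteq> Bs" "LBs \<subseteq> Bs" "VCF \<subseteq> Bs" "VF \<subseteq> Bs" "FF \<subseteq> Bs"
    unfolding Bs_def T2s_def LBs_def VCF_def VF_def FF_def using Y_props(1) one_nz by blast+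
qed

lemma VCF_subs: "VCF \<subseteq> T2s" "VCF \<subseteq> LBs" "VF \<subseteq> VCF" "VF \<subseteq> T1s" "FF \<subseteq> VF"
proof -
  show "VCF \<subseteq> T2s" "VCF \<subseteq> LBs" "VF \<subseteq> VCF" "FF \<subseteq> VF"
    unfolding VCF_def LBs_def T2s_def VF_def FF_def using Y_props(1) one_nz by blast+
  have "(1::'a) * 1 ^ 2 = 1" by simp
  then show "VF \<subseteq> T1s" unfolding VF_def T1s_def using Y_props(1) by blast
qed

lemma T1s_subgroup: "subgroup T1s H"
proof (rule Bs_subsetI[OF Bs_subs(1)])
  have "(1::'a) * 1 ^ 2 = 1" by simp
  then show "s2 id 1 1 0 0 0 0 0 \<in> T1s" unfolding T1s_def using Y_props(1) by blast
  fix g h assume "g \<in> T1s" "h \<in> T1s"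
  then obtain \<nu> t u v w \<nu>' t' u' v' w' where
    g: "g = s2 id \<nu> t 0 0 u v w" "\<nu> \<in> Y" "\<nu> * t ^ 2 = 1" and h: "h = s2 id \<nu>' t' 0 0 u' v' w'" "\<nu>' \<in> Y" "\<nu>' * t' ^ 2 = 1"
    unfolding T1s_def by blast
  have t: "t \<noteq> 0" "t' \<noteq> 0" using g h by auto
  have "\<nu>' * \<nu> * (t' * t) ^ 2 = (\<nu> * t ^ 2) * (\<nu>' * t' ^ 2)" by (simp add: power_mult_distrib mult_ac)
  then have "\<nu>' * \<nu> * (t' * t) ^ 2 = 1" using g(3) h(3) by simp
  then show "g \<otimes> h \<in> T1s"
    unfolding g(1) h(1) s2_mult_0[OF g(2) h(2) t] T1s_def mult_zero_left mult_zero_right add_0_left add_0_right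
    using Y_props(3)[OF h(2) g(2)] by blast
qed

lemma T2s_subgroup: "subgroup T2s H"
proof (rule Bs_subsetI[OF Bs_subs(2)])
  show "s2 id 1 1 0 0 0 0 0 \<in> T2s" unfolding T2s_def using Y_props(1) by blast
  fix g h assume "g \<in> T2s" "h \<in> T2s"
  then obtain \<nu> e u v w \<nu>' e' u' v' w' where
    g: "g = s2 id \<nu> 1 0 e u v w" "\<nu> \<in> Y" and h: "h = s2 id \<nu>' 1 0 e' u' v' w'" "\<nu>' \<in> Y"
    unfolding T2s_def by blast
  show "g \<otimes> h \<in> T2s"
    unfolding g(1) h(1) s2_mult_0[OF g(2) h(2) one_nz one_nz] T2s_def mult_1_left
    using Y_props(3)[OF h(2) g(2)] by blast
qed

lemma LBs_subgroup: "subgroup LBs H"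
proof (rule Bs_subsetI[OF Bs_subs(3)])
  show "s2 id 1 1 0 0 0 0 0 \<in> LBs" unfolding LBs_def using one_nz by blast
  fix g h assume "g \<in> LBs" "h \<in> LBs"
  then obtain t e u v w t' e' u' v' w' where
    g: "g = s2 id 1 t 0 e u v w" "t \<noteq> 0" and h: "h = s2 id 1 t' 0 e' u' v' w'" "t' \<noteq> 0"
    unfolding LBs_def by blast
  have "t' * t \<noteq> 0" using g h by simp
  then show "g \<otimes> h \<in> LBs"
    unfolding g(1) h(1) s2_mult_0[OF Y_props(1) Y_props(1) g(2) h(2)] LBs_def mult_1_left by blast
qed

lemma VCF_subgroup: "subgroup VCF H"
proof (rule Bs_subsetI[OF Bs_subs(4)])
  show "s2 id 1 1 0 0 0 0 0 \<in> VCF" unfolding VCF_def by blast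
  fix g h assume "g \<in> VCF" "h \<in> VCF"
  then obtain e u v w e' u' v' w' where
    g: "g = s2 id 1 1 0 e u v w" and h: "h = s2 id 1 1 0 e' u' v' w'"
    unfolding VCF_def by blast
  show "g \<otimes> h \<in> VCF"
    unfolding g(1) h(1) s2_mult_0[OF Y_props(1) Y_props(1) one_nz one_nz] VCF_def mult_1_left by blast
qed

lemma VF_subgroup: "subgroup VF H"
proof (rule Bs_subsetI[OF Bs_subs(5)])
  show "s2 id 1 1 0 0 0 0 0 \<in> VF" unfolding VF_def by blast
  fix g h assume "g \<in> VF" "h \<in> VF"
  then obtain u v w u' v' w' where
    g: "g = s2 id 1 1 0 0 u v w" and h: "h = s2 id 1 1 0 0 u' v' w'"
    unfolding VF_def by blast
  show "g \<otimes> h \<in> VF"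
    unfolding g(1) h(1) s2_mult_0[OF Y_props(1) Y_props(1) one_nz one_nz] VF_def
      mult_1_left mult_zero_left mult_zero_right add_0_left by blast
qed

text \<open>The identity is the only idempotent of a group, so the product law alone locates
  it.\<close>

lemma one_eq: "\<one> = s2 id 1 1 0 0 0 0 0"
proof -
  have "s2 id 1 1 0 0 0 0 0 \<otimes> s2 id 1 1 0 0 0 0 0 = s2 id 1 1 0 0 0 0 0"
    by (subst s2_mult_0) (simp_all add: Y_props)
  moreover have "s2 id 1 1 0 0 0 0 0 \<in> carrier H" using s2_closed JP_one by simp
  ultimately show ?thesis by (metis l_cancel_one one_closed r_one)
qed

lemma one_eq_s1: "\<one> = s1 id 1 1 0 0 1 0 0 0"
  using one_eq s2_0[OF JP_one one_nz] by simp

lemma H1c_sub: "H1c \<subseteq> A1"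
  unfolding H1c_def A1_def by blast

lemma H2c_sub: "H2c \<subseteq> A2"
  unfolding H2c_def A2_def Y_JP by blast

lemma Bs_eq: "Bs = A12 \<inter> H1c" "Bs = A12 \<inter> H2c"
proof -
  show "Bs = A12 \<inter> H1c"
  proof (intro equalityI subsetI)
    fix g assume "g \<in> Bs"
    then obtain \<nu> t e u v w where g: "g = s2 id \<nu> t 0 e u v w" "(\<nu>, id) \<in> JP" "t \<noteq> 0"
      unfolding Bs_def Y_JP by blast
    then show "g \<in> A12 \<inter> H1c"
      unfolding A12_def H1c_def using s2_0[OF g(2,3), of e u v w] ok1_s2[OF g(2,3)] by blast
  next
    fix g assume "g \<in> A12 \<inter> H1c"
    then obtain f \<nu> t e u v w \<nu>' p x y m u' v' w' where g: "g = s2 f \<nu> t 0 e u v w" "(\<nu>, f) \<in> JP" "t \<noteq> 0"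
      and g': "g = s1 id \<nu>' p x y m u' v' w'" "ok1 id \<nu>' p x y m"
      unfolding A12_def H1c_def by blast
    have "s1 f \<nu> (\<nu> ^ 2 * t) e 0 (\<nu> / t) u v w = s1 id \<nu>' p x y m u' v' w'"
      using g g' s2_0[OF g(2,3)] by metis
    then have "f = id" unfolding s1_inj[OF ok1_s2[OF g(2,3)] g'(2)] by blast
    then show "g \<in> Bs" using g unfolding Bs_def Y_JP by blast
  qed
  show "Bs = A12 \<inter> H2c"
  proof (intro equalityI subsetI)
    fix g assume "g \<in> Bs"
    then show "g \<in> A12 \<inter> H2c" unfolding Bs_def A12_def H2c_def Y_JP by blast
  next
    fix g assume "g \<in> A12 \<inter> H2c"
    then obtain f \<nu> t e u v w \<nu>' t' D' e' u' v' w' where g: "g = s2 f \<nu> t 0 e u v w" "(\<nu>, f) \<in> JP" "t \<noteq> 0"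
      and g': "g = s2 id \<nu>' t' D' e' u' v' w'" "(\<nu>', id) \<in> JP" "t' \<noteq> 0"
      unfolding A12_def H2c_def Y_JP by blast
    then have "s2 f \<nu> t 0 e u v w = s2 id \<nu>' t' D' e' u' v' w'" by simp
    then have "f = id" unfolding s2_inj[OF g(2) g'(2) g(3) g'(3)] by blast
    then show "g \<in> Bs" using g unfolding Bs_def Y_JP by blast
  qed
qed

lemma LBs_eq: "L1s \<inter> Bs = LBs"
proof (intro equalityI subsetI)
  fix g assume "g \<in> L1s \<inter> Bs"
  then obtain \<nu> t e u v w p x y m u' v' w' where g: "g = s2 id \<nu> t 0 e u v w" "(\<nu>, id) \<in> JP" "t \<noteq> 0"
    and g': "g = s1 id 1 p x y m u' v' w'" "p * m - x * y = 1"
    unfolding Bs_def L1s_def Y_JP by blast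
  then have ok: "ok1 id 1 p x y m" by (simp add: ok1_id Y_props)
  have "s1 id \<nu> (\<nu> ^ 2 * t) e 0 (\<nu> / t) u v w = s1 id 1 p x y m u' v' w'"
    using g g' s2_0[OF g(2,3)] by metis
  then have "\<nu> = 1" unfolding s1_inj[OF ok1_s2[OF g(2,3)] ok] by blast
  then show "g \<in> LBs" using g unfolding LBs_def by blast
next
  fix g assume "g \<in> LBs"
  then obtain t e u v w where g: "g = s2 id 1 t 0 e u v w" "t \<noteq> 0" unfolding LBs_def by blast
  then have "g = s1 id 1 (1 ^ 2 * t) e 0 (1 / t) u v w" using s2_0[OF JP_one] by simp
  moreover have "(1 ^ 2 * t) * (1 / t) - e * 0 = 1" using g by simp
  ultimately have "g \<in> L1s" unfolding L1s_def by blast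
  then show "g \<in> L1s \<inter> Bs" using \<open>g \<in> LBs\<close> Bs_subs by blast
qed

lemma T2s_eq: "T2s \<subseteq> A12"
  using Bs_subs Bs_eq by blast

lemma Bs_factor: "Bs = LBs <#> T2s"
proof (intro equalityI subsetI)
  fix g assume "g \<in> Bs"
  then obtain \<nu> t e u v w where g: "g = s2 id \<nu> t 0 e u v w" "\<nu> \<in> Y" "t \<noteq> 0" unfolding Bs_def by blast
  \<comment> \<open>The entry \<open>e * t\<close> compensates the factor \<open>1 / t\<close> that
    the product law attaches to it.\<close>
  have "g = s2 id 1 t 0 0 0 0 0 \<otimes> s2 id \<nu> 1 0 (e * t) u v w"
    using g Y_props by (simp add: s2_mult_0)
  moreover have "s2 id 1 t 0 0 0 0 0 \<in> LBs" unfolding LBs_def using g by blast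
  moreover have "s2 id \<nu> 1 0 (e * t) u v w \<in> T2s" unfolding T2s_def using g by blast
  ultimately show "g \<in> LBs <#> T2s" unfolding set_mult_def by blast
next
  fix g assume "g \<in> LBs <#> T2s"
  then obtain h k where "g = h \<otimes> k" "h \<in> LBs" "k \<in> T2s" unfolding set_mult_def by blast
  then show "g \<in> Bs" using Bs_subs subgroup.m_closed[OF Bs_subgroup] by blast
qed

end

context group
begin

lemma conj_eqI: "k \<in> carrier G \<Longrightarrow> x \<in> carrier G \<Longrightarrow> z \<in> carrier G \<Longrightarrow> x \<otimes> k = k \<otimes> z \<Longrightarrow> inv k \<otimes> x \<otimes> k = z"
  by (simp add: m_assoc inv_cancel)

lemma conj_eqD: "k \<in> carrier G \<Longrightarrow> x \<in> carrier G \<Longrightarrow> x \<otimes> k = k \<otimes> (inv k \<otimes> x \<otimes> k)"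
  by (simp add: m_assoc inv_cancel)

end

context amalgam
begin

subsection \<open>Normal subgroups and the core\<close>

text \<open>Only the pair \<open>(\<nu>, f)\<close> matters. In \<open>g k = k z\<close> it gives
  \<open>fz \<circ> f = f\<close> and \<open>\<nu> * f \<nu>0 = \<nu>z * fz \<nu>\<close>, so the
  conjugate has the components \<open>id\<close> and \<open>f \<nu>0\<close>; its other entries stay
  unspecified.\<close>

lemma conj_A1:
  assumes k: "k = s1 f \<nu> p x y m u v w" "ok1 f \<nu> p x y m"
    and g: "g = s1 id \<nu>0 p0 x0 y0 m0 u0 v0 w0" "ok1 id \<nu>0 p0 x0 y0 m0"
  obtains p' x' y' m' u' v' w' where "inv k \<otimes> g \<otimes> k = s1 id (f \<nu>0) p' x' y' m' u' v' w'" "ok1 id (f \<nu>0) p' x' y' m'"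
proof -
  have kA: "k \<in> A1" "g \<in> A1" using k g unfolding A1_def by blast+
  then have kc: "k \<in> carrier H" "g \<in> carrier H" using A1_carrier by blast+
  have "inv k \<otimes> g \<otimes> k \<in> A1"
    using kA A1_subgroup by (simp add: subgroup.m_closed subgroup.m_inv_closed)
  then obtain fz \<nu>z p' x' y' m' u' v' w' where
    z: "inv k \<otimes> g \<otimes> k = s1 fz \<nu>z p' x' y' m' u' v' w'" "ok1 fz \<nu>z p' x' y' m'" unfolding A1_def by blast
  have eq: "s1 id \<nu>0 p0 x0 y0 m0 u0 v0 w0 \<otimes> s1 f \<nu> p x y m u v w = s1 f \<nu> p x y m u v w \<otimes> s1 fz \<nu>z p' x' y' m' u' v' w'"
    using conj_eqD[OF kc] unfolding z(1) unfolding k(1) g(1) .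
  have fr: "frob f" "frob fz" using k(2) z(2) JP_frob by (auto simp: ok1_def)
  have "f \<circ> id = fz \<circ> f \<and> \<nu> * f \<nu>0 = \<nu>z * fz \<nu>"
    using eq unfolding s1_mult[OF g(2) k(2)] s1_mult[OF k(2) z(2)]
      s1_inj[OF ok1_mult[OF g(2) k(2)] ok1_mult[OF k(2) z(2)]] by blast
  then have "fz \<circ> f = f" and nu: "\<nu> * f \<nu>0 = \<nu>z * fz \<nu>" by auto
  then have "fz = id" using frob_id_iff[OF fr] by simp
  moreover have "\<nu> \<noteq> 0" using k(2) JP_nz by (auto simp: ok1_def)
  ultimately have "\<nu>z = f \<nu>0" using nu by (simp add: mult.commute)
  then show ?thesis using that z \<open>fz = id\<close> by blast
qed

text \<open>The same comparison as for \<open>A1\<close>. In addition the quadratic coefficient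
  satisfies a linear equation, which later gives \<open>D' = 0\<close> when \<open>t0 = 1\<close>
  and \<open>D0 = 0\<close>.\<close>

lemma conj_A2:
  assumes k: "k = s2 f \<nu> t D e u v w" "(\<nu>, f) \<in> JP" "t \<noteq> 0"
    and g: "g = s2 id \<nu>0 t0 D0 e0 u0 v0 w0" "\<nu>0 \<in> Y" "t0 \<noteq> 0"
  obtains D' e' u' v' w' where "inv k \<otimes> g \<otimes> k = s2 id (f \<nu>0) (f t0) D' e' u' v' w'" "f \<nu>0 \<in> Y" "f t0 \<noteq> 0"
    "D' + f t0 ^ 3 * D = t ^ 3 * f D0 + D"
proof -
  have kA: "k \<in> A2" "g \<in> A2" using k g unfolding A2_def Y_JP by blast+
  then have kc: "k \<in> carrier H" "g \<in> carrier H" using A2_carrier by blast+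
  have "inv k \<otimes> g \<otimes> k \<in> A2"
    using kA A2_subgroup by (simp add: subgroup.m_closed subgroup.m_inv_closed)
  then obtain fz \<nu>z tz D' e' u' v' w' where
    z: "inv k \<otimes> g \<otimes> k = s2 fz \<nu>z tz D' e' u' v' w'" "(\<nu>z, fz) \<in> JP" "tz \<noteq> 0" unfolding A2_def by blast
  have eq: "s2 id \<nu>0 t0 D0 e0 u0 v0 w0 \<otimes> s2 f \<nu> t D e u v w = s2 f \<nu> t D e u v w \<otimes> s2 fz \<nu>z tz D' e' u' v' w'"
    using conj_eqD[OF kc] unfolding z(1) unfolding k(1) g(1) .
  have fr: "frob f" "frob fz" using k(2) z(2) JP_frob by auto
  have gJ: "(\<nu>0, id) \<in> JP" using g(2) Y_JP by simp
  have nz: "t * f t0 \<noteq> 0" "tz * fz t \<noteq> 0" using g(3) k(3) z(3) fr by (simp_all add: frob_simps)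
  have "f \<circ> id = fz \<circ> f \<and> \<nu> * f \<nu>0 = \<nu>z * fz \<nu> \<and> t * f t0 = tz * fz t \<and> t ^ 3 * f D0 + D = tz ^ 3 * fz D + D'"
    using eq unfolding s2_mult[OF gJ k(2) g(3) k(3)] s2_mult[OF k(2) z(2) k(3) z(3)]
      s2_inj[OF JP_mult[OF gJ k(2)] JP_mult[OF k(2) z(2)] nz] by blast
  then have eqs: "fz \<circ> f = f" "\<nu> * f \<nu>0 = \<nu>z * fz \<nu>" "t * f t0 = tz * fz t" "t ^ 3 * f D0 + D = tz ^ 3 * fz D + D'" by auto
  then have fz: "fz = id" using frob_id_iff[OF fr] by simp
  have "\<nu> \<noteq> 0" using k(2) JP_nz by auto
  then have "\<nu>z = f \<nu>0" "tz = f t0" using eqs(2,3) k(3) by (simp_all add: fz mult.commute)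
  then show ?thesis using that z eqs(4) unfolding fz Y_JP by (simp add: add.commute)
qed

lemma H1c_normal: "H1c \<lhd> H\<lparr>carrier := A1\<rparr>"
proof (rule normal_restrictI[OF A1_subgroup H1c_subgroup H1c_sub])
  fix k g assume k: "k \<in> A1" and g: "g \<in> H1c"
  have c: "k \<in> carrier H" "g \<in> carrier H" using k g A1_carrier H1c_sub by blast+
  obtain f \<nu> p x y m u v w where k': "k = s1 f \<nu> p x y m u v w" "ok1 f \<nu> p x y m" using k unfolding A1_def by blast
  obtain \<nu>0 p0 x0 y0 m0 u0 v0 w0 where g': "g = s1 id \<nu>0 p0 x0 y0 m0 u0 v0 w0" "ok1 id \<nu>0 p0 x0 y0 m0"
    using g unfolding H1c_def by blast
  obtain p' x' y' m' u' v' w' where "inv k \<otimes> g \<otimes> k = s1 id (f \<nu>0) p' x' y' m' u' v' w'" "ok1 id (f \<nu>0) p' x' y' m'"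
    by (rule conj_A1[OF k' g'])
  then have "inv k \<otimes> g \<otimes> k \<in> H1c" unfolding H1c_def by blast
  then show "\<exists>z\<in>H1c. g \<otimes> k = k \<otimes> z" using conj_eqD[OF c] by blast
qed

lemma L1s_normal: "L1s \<lhd> H\<lparr>carrier := A1\<rparr>"
proof (rule normal_restrictI[OF A1_subgroup L1s_subgroup])
  show "L1s \<subseteq> A1" using L1s_sub H1c_sub by blast
  fix k g assume k: "k \<in> A1" and g: "g \<in> L1s"
  have c: "k \<in> carrier H" "g \<in> carrier H" using k g A1_carrier H1c_sub L1s_sub by blast+
  obtain f \<nu> p x y m u v w where k': "k = s1 f \<nu> p x y m u v w" "ok1 f \<nu> p x y m" using k unfolding A1_def by blast
  obtain p0 x0 y0 m0 u0 v0 w0 where g': "g = s1 id 1 p0 x0 y0 m0 u0 v0 w0" "p0 * m0 - x0 * y0 = 1"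
    using g unfolding L1s_def by blast
  have ok: "ok1 id 1 p0 x0 y0 m0" using g' Y_props by (simp add: ok1_id)
  have f1: "f 1 = 1" using k'(2) JP_frob frob_simps(4) by (auto simp: ok1_def)
  obtain p' x' y' m' u' v' w' where "inv k \<otimes> g \<otimes> k = s1 id (f 1) p' x' y' m' u' v' w'" "ok1 id (f 1) p' x' y' m'"
    by (rule conj_A1[OF k' g'(1) ok])
  then have "inv k \<otimes> g \<otimes> k = s1 id 1 p' x' y' m' u' v' w'" "p' * m' - x' * y' = 1" by (simp_all add: f1 ok1_id)
  then have "inv k \<otimes> g \<otimes> k \<in> L1s" unfolding L1s_def by blast
  then show "\<exists>z\<in>L1s. g \<otimes> k = k \<otimes> z" using conj_eqD[OF c] by blast
qed

lemma H2c_normal: "H2c \<lhd> H\<lparr>carrier := A2\<rparr>"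
proof (rule normal_restrictI[OF A2_subgroup H2c_subgroup H2c_sub])
  fix k g assume k: "k \<in> A2" and g: "g \<in> H2c"
  have c: "k \<in> carrier H" "g \<in> carrier H" using k g A2_carrier H2c_sub by blast+
  obtain f \<nu> t D e u v w where k': "k = s2 f \<nu> t D e u v w" "(\<nu>, f) \<in> JP" "t \<noteq> 0" using k unfolding A2_def by blast
  obtain \<nu>0 t0 D0 e0 u0 v0 w0 where g': "g = s2 id \<nu>0 t0 D0 e0 u0 v0 w0" "\<nu>0 \<in> Y" "t0 \<noteq> 0"
    using g unfolding H2c_def by blast
  obtain D' e' u' v' w' where "inv k \<otimes> g \<otimes> k = s2 id (f \<nu>0) (f t0) D' e' u' v' w'" "f \<nu>0 \<in> Y" "f t0 \<noteq> 0"
    by (rule conj_A2[OF k' g'])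
  then have "inv k \<otimes> g \<otimes> k \<in> H2c" unfolding H2c_def by blast
  then show "\<exists>z\<in>H2c. g \<otimes> k = k \<otimes> z" using conj_eqD[OF c] by blast
qed

lemma T2s_conj:
  assumes k: "k \<in> A2" and g: "g \<in> T2s"
  shows "inv k \<otimes> g \<otimes> k \<in> T2s"
proof -
  obtain f \<nu> t D e u v w where k': "k = s2 f \<nu> t D e u v w" "(\<nu>, f) \<in> JP" "t \<noteq> 0" using k unfolding A2_def by blast
  obtain \<nu>0 e0 u0 v0 w0 where g': "g = s2 id \<nu>0 1 0 e0 u0 v0 w0" "\<nu>0 \<in> Y" using g unfolding T2s_def by blast
  have f: "f 1 = 1" "f 0 = 0" using frob_simps[OF JP_frob[OF k'(2)]] by auto
  obtain D' e' u' v' w' where z: "inv k \<otimes> g \<otimes> k = s2 id (f \<nu>0) (f 1) D' e' u' v' w'" "f \<nu>0 \<in> Y"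
    "D' + f 1 ^ 3 * D = t ^ 3 * f 0 + D"
    by (rule conj_A2[OF k' g' one_nz])
  then have "D' = 0" by (simp add: f)
  then show ?thesis using z(1,2) unfolding f T2s_def by blast
qed

text \<open>A homothety commutes with every matrix, so conjugation changes its parameters only by
  \<open>f\<close>, and the translation part of the conjugate can be solved for explicitly.\<close>

lemma T1s_conj:
  assumes k: "k \<in> A1" and g: "g \<in> T1s"
  shows "inv k \<otimes> g \<otimes> k \<in> T1s"
proof -
  obtain f \<nu> p x y m u v w where k': "k = s1 f \<nu> p x y m u v w" "ok1 f \<nu> p x y m" using k unfolding A1_def by blast
  obtain \<nu>0 t0 u0 v0 w0 where g': "g = s2 id \<nu>0 t0 0 0 u0 v0 w0" "\<nu>0 \<in> Y" "\<nu>0 * t0 ^ 2 = 1" using g unfolding T1s_def by blast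
  have t0: "t0 \<noteq> 0" using g'(3) by auto
  have c: "k \<in> carrier H" "g \<in> carrier H" using k g A1_carrier Bs_subs subgroup.subset[OF Bs_subgroup] by blast+
  have fr: "frob f" using k'(2) JP_frob by (auto simp: ok1_def)
  note fs = frob_simps[OF fr]
  have scal: "\<nu>' / t' = \<nu>' ^ 2 * t'" if "\<nu>' * t' ^ 2 = 1" for \<nu>' t' :: 'a
  proof -
    have nz: "t' \<noteq> 0" using that by auto
    have "\<nu>' ^ 2 * t' * t' = \<nu>' * (\<nu>' * t' ^ 2)" by (simp add: power2_eq_square)
    then show ?thesis using nz that by (simp add: divide_eq_eq)
  qed
  let ?n = "f \<nu>0" and ?t = "f t0"
  let ?l = "?n ^ 2 * ?t" and ?scal = "\<nu>0 ^ 2 * t0"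
  have n: "?n \<in> Y" "?t \<noteq> 0" "?n * ?t ^ 2 = 1"
    using Y_frob[OF fr g'(2)] t0 g'(3) by (simp_all add: fs) (metis fs(2,4,8))
  have gs: "g = s1 id \<nu>0 ?scal 0 0 ?scal u0 v0 w0" "ok1 id \<nu>0 ?scal 0 0 ?scal"
    using s2_0[of \<nu>0 id t0 0 u0 v0 w0] ok1_s2[of \<nu>0 id t0 0] g' t0 scal by (simp_all add: Y_JP)
  define z where "z U V W = s1 id ?n ?l 0 0 ?l U V W" for U V W
  have zs: "z U V W = s2 id ?n ?t 0 0 U V W" "ok1 id ?n ?l 0 0 ?l" for U V W
    using s2_0[of ?n id ?t 0 U V W] ok1_s2[of ?n id ?t 0] n scal by (simp_all add: Y_JP z_def)
  have zT: "z U V W \<in> T1s" for U V W unfolding zs(1) T1s_def using n by blast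
  have "f ?scal = ?l" by (simp add: fs)
  have id_f: "id \<circ> f = f \<circ> id" by simp
  have "g \<otimes> k = k \<otimes> z (p * f u0 + x * f v0 + u - ?l * u) (y * f u0 + m * f v0 + v - ?l * v) (\<nu> ^ 2 * f w0 + w - ?n ^ 2 * w)"
    unfolding gs(1) k'(1) z_def s1_mult[OF gs(2) k'(2)] s1_mult[OF k'(2) zs(2)]
    by (simp add: fs algebra_simps)
  then have "inv k \<otimes> g \<otimes> k = z (p * f u0 + x * f v0 + u - ?l * u) (y * f u0 + m * f v0 + v - ?l * v) (\<nu> ^ 2 * f w0 + w - ?n ^ 2 * w)"
    using c zT Bs_subs subgroup.subset[OF Bs_subgroup] by (intro conj_eqI) blast+
  then show ?thesis using zT by simp
qed

lemma T1s_sub: "T1s \<subseteq> A12"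
  using Bs_subs Bs_eq by blast

text \<open>Conjugation by the lower unitriangular map with entry \<open>s\<close> has to keep the
  matrix upper triangular. \<open>key\<close> records this for every \<open>s\<close>, and together
  these conditions leave only scalar matrices with \<open>f = id\<close>.\<close>

lemma A12_conj_A1:
  assumes g: "g \<in> A12" and conj: "\<And>k. k \<in> A1 \<Longrightarrow> inv k \<otimes> g \<otimes> k \<in> A12"
  shows "g \<in> T1s"
proof -
  obtain f \<nu> t e u v w where g': "g = s2 f \<nu> t 0 e u v w" "(\<nu>, f) \<in> JP" "t \<noteq> 0" using g unfolding A12_def by blast
  let ?p = "\<nu> ^ 2 * t" and ?m = "\<nu> / t"
  have fr: "frob f" using g'(2) JP_frob by auto
  note fs = frob_simps[OF fr]
  have gs: "g = s1 f \<nu> ?p e 0 ?m u v w" "ok1 f \<nu> ?p e 0 ?m"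
    using s2_0[OF g'(2,3)] ok1_s2[OF g'(2,3)] g'(1) by auto
  have gc: "g \<in> carrier H" using g A12_sub A1_carrier by blast
  have key: "\<exists>t'. s * ?p = (\<nu> / t') * f s \<and> s * e + ?m = \<nu> / t' \<and> t' \<noteq> 0 \<and> ?p = \<nu> ^ 2 * t' + e * f s" for s
  proof -
    define k where "k = s1 id 1 1 0 s 1 0 0 0"
    have ok: "ok1 id 1 1 0 s 1" by (simp add: ok1_id Y_props)
    have kA: "k \<in> A1" unfolding A1_def k_def using ok by blast
    then have kc: "k \<in> carrier H" using A1_carrier by blast
    obtain f' \<nu>' t' e' u' v' w' where z: "inv k \<otimes> g \<otimes> k = s2 f' \<nu>' t' 0 e' u' v' w'" "(\<nu>', f') \<in> JP" "t' \<noteq> 0"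
      using conj[OF kA] unfolding A12_def by blast
    have f': "f' 1 = 1" using JP_frob[OF z(2)] frob_simps(4) by blast
    have zs: "inv k \<otimes> g \<otimes> k = s1 f' \<nu>' (\<nu>' ^ 2 * t') e' 0 (\<nu>' / t') u' v' w'" "ok1 f' \<nu>' (\<nu>' ^ 2 * t') e' 0 (\<nu>' / t')"
      using s2_0[OF z(2,3)] ok1_s2[OF z(2,3)] z(1) by auto
    have "s1 f \<nu> ?p e 0 ?m u v w \<otimes> s1 id 1 1 0 s 1 0 0 0 =
        s1 id 1 1 0 s 1 0 0 0 \<otimes> s1 f' \<nu>' (\<nu>' ^ 2 * t') e' 0 (\<nu>' / t') u' v' w'"
      using conj_eqD[OF kc gc] unfolding zs(1) unfolding k_def gs(1) .
    from this[unfolded s1_mult[OF gs(2) ok] s1_mult[OF ok zs(2)] s1_inj[OF ok1_mult[OF gs(2) ok] ok1_mult[OF ok zs(2)]]]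
    have eqs: "f = f'" "\<nu> = \<nu>'" "?p = \<nu>' ^ 2 * t' + e' * f' s" "e = e'" "s * ?p = \<nu>' / t' * f' s" "s * e + ?m = \<nu>' / t'"
      by (auto simp: fun_eq_iff f' frob_simps[OF JP_frob[OF z(2)]])
    then show ?thesis using z(3) by metis
  qed
  have f1: "f (-1) = -1" "f 1 = 1" by (simp_all add: fs)
  \<comment> \<open>The values \<open>s = 1\<close> and \<open>s = -1\<close> give
    \<open>?p = e + ?m\<close> and \<open>?p = - e + ?m\<close>, hence
    \<open>2 * e = 0\<close>.\<close>
  have "?p = e + ?m" using key[of 1] by (simp only: f1 mult_1_left mult_1_right) metis
  moreover have "- ?p = - (- e + ?m)" using key[of "-1"] by (simp only: f1 mult_minus_left mult_minus_right mult_1_left mult_1_right) metis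
  ultimately have "e + ?m = - e + ?m" by simp
  then have "e + e = 0" by (simp add: algebra_simps)
  then have "2 * e = 0" by simp
  then have e: "e = 0" unfolding two by simp
  then have pm: "?p = ?m" using \<open>?p = e + ?m\<close> by simp
  have nz: "\<nu> \<noteq> 0" using JP_nz g'(2) by blast
  \<comment> \<open>With \<open>e = 0\<close> and equal diagonal entries, \<open>key\<close> reduces
    to this equation.\<close>
  have "f s = s" for s
  proof -
    obtain t' where t': "s * ?p = (\<nu> / t') * f s" "s * e + ?m = \<nu> / t'" using key[of s] by blast
    have "\<nu> / t' = ?p" using t'(2) pm unfolding e by (metis add_0 mult_zero_right)
    then have "s * ?p = ?p * f s" using t'(1) by (simp only:)
    then show ?thesis using nz g'(3) by (simp add: mult.commute)
  qed
  then have fid: "f = id" by (simp add: fun_eq_iff)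
  have "\<nu> ^ 2 * t * t = \<nu>" using pm g'(3) by (simp add: field_simps)
  then have "\<nu> * (\<nu> * t ^ 2) = \<nu> * 1" by (simp add: power2_eq_square mult_ac)
  then have "\<nu> * t ^ 2 = 1" using nz by simp
  moreover have "g = s2 id \<nu> t 0 0 u v w" "\<nu> \<in> Y" using g' fid e by (simp_all add: Y_JP)
  ultimately show ?thesis unfolding T1s_def by blast
qed

text \<open>Conjugation by \<tau> with parameter \<open>D\<close> may not create a quadratic term,
  which forces \<open>D = t ^ 3 * f D\<close> for all \<open>D\<close>. Taking \<open>D = 1\<close>
  gives \<open>t = 1\<close>, since cubing is injective, and then \<open>f = id\<close>.\<close>

lemma A12_conj_A2:
  assumes g: "g \<in> A12" and conj: "\<And>k. k \<in> A2 \<Longrightarrow> inv k \<otimes> g \<otimes> k \<in> A12"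
  shows "g \<in> T2s"
proof -
  obtain f \<nu> t e u v w where g': "g = s2 f \<nu> t 0 e u v w" "(\<nu>, f) \<in> JP" "t \<noteq> 0" using g unfolding A12_def by blast
  have fr: "frob f" using g'(2) JP_frob by auto
  have gc: "g \<in> carrier H" using g A12_sub A1_carrier by blast
  have key: "D = t ^ 3 * f D" for D
  proof -
    define k where "k = s2 id 1 1 D 0 0 0 0"
    have kA: "k \<in> A2" unfolding A2_def k_def using JP_one one_nz by blast
    then have kc: "k \<in> carrier H" using A2_carrier by blast
    obtain f' \<nu>' t' e' u' v' w' where z: "inv k \<otimes> g \<otimes> k = s2 f' \<nu>' t' 0 e' u' v' w'" "(\<nu>', f') \<in> JP" "t' \<noteq> 0"
      using conj[OF kA] unfolding A12_def by blast
    have f': "f' 1 = 1" using JP_frob[OF z(2)] frob_simps(4) by blast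
    have eq: "s2 f \<nu> t 0 e u v w \<otimes> s2 id 1 1 D 0 0 0 0 = s2 id 1 1 D 0 0 0 0 \<otimes> s2 f' \<nu>' t' 0 e' u' v' w'"
      using conj_eqD[OF kc gc] unfolding z(1) unfolding k_def g'(1) .
    have nz: "1 * id t \<noteq> 0" "t' * f' 1 \<noteq> 0" using g' z f' by simp_all
    from eq[unfolded s2_mult[OF g'(2) JP_one g'(3) one_nz] s2_mult[OF JP_one z(2) one_nz z(3)]
        s2_inj[OF JP_mult[OF g'(2) JP_one] JP_mult[OF JP_one z(2)] nz]]
    have "f = f'" "t = t'" "D = t' ^ 3 * f' D" by (auto simp: f')
    then show ?thesis by simp
  qed
  have "t ^ 3 = 1" using key[of 1] frob_simps(4)[OF fr] by simp
  then have "t = 1" unfolding cube_eq_1 .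
  moreover have "f = id" using key \<open>t ^ 3 = 1\<close> by (simp add: fun_eq_iff)
  ultimately have "g = s2 id \<nu> 1 0 e u v w" "\<nu> \<in> Y" using g' by (simp_all add: Y_JP)
  then show ?thesis unfolding T2s_def by blast
qed

section \<open>The groups T_1 and T_2, and the closures that determine the core\<close>

lemma largest_normal_A1: "largest_normal_in H (A1 \<inter> A2) A1 = T1s"
  unfolding A12_eq largest_normal_in_eq[OF A1_subgroup A12_subgroup A12_sub(1)]
  using T1s_sub T1s_conj A12_conj_A1 by blast

lemma largest_normal_A2: "largest_normal_in H (A1 \<inter> A2) A2 = T2s"
  unfolding A12_eq largest_normal_in_eq[OF A2_subgroup A12_subgroup A12_sub(2)]
  using T2s_eq T2s_conj A12_conj_A2 by blast

text \<open>Transvections generate SL_2, and a factor from \<open>VF\<close> supplies any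
  translation part.\<close>

lemma SL2_generated:
  assumes K: "subgroup K H" and VF: "VF \<subseteq> K" and C: "\<And>e. s1 id 1 1 e 0 1 0 0 0 \<in> K" "\<And>e. s1 id 1 1 0 e 1 0 0 0 \<in> K"
  shows "L1s \<subseteq> K"
proof
  fix g assume "g \<in> L1s"
  then obtain p x y m u v w where g: "g = s1 id 1 p x y m u v w" "p * m - x * y = 1" unfolding L1s_def by blast
  have ok: "ok1 id 1 p x y m" if "p * m - x * y = 1" for p x y m using that Y_props by (simp add: ok1_id)
  \<comment> \<open>The determinant condition is carried through the induction because the product
    law of \<open>s1\<close> is available only under \<open>ok1\<close>.\<close>
  have "p * m - x * y = 1 \<and> s1 id 1 p x y m 0 0 0 \<in> K"
  proof (rule SL2_induct[OF g(2), where P = "\<lambda>p x y m. p * m - x * y = 1 \<and> s1 id 1 p x y m 0 0 0 \<in> K"])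
    fix p x y m p' x' y' m' :: 'a
    assume 1: "p * m - x * y = 1 \<and> s1 id 1 p x y m 0 0 0 \<in> K" and 2: "p' * m' - x' * y' = 1 \<and> s1 id 1 p' x' y' m' 0 0 0 \<in> K"
    have "(p * p' + x * y') * (y * x' + m * m') - (p * x' + x * m') * (y * p' + m * y') = 1"
      using 1 2 by (simp only: det_mult) simp
    \<comment> \<open>The factors stand in the opposite order to the matrices, as composition runs
      from left to right.\<close>
    moreover have "s1 id 1 p' x' y' m' 0 0 0 \<otimes> s1 id 1 p x y m 0 0 0 =
        s1 id 1 (p * p' + x * y') (p * x' + x * m') (y * p' + m * y') (y * x' + m * m') 0 0 0"
      using s1_mult_id[OF ok ok, of p' m' x' y' p m x y 0 0 0 0 0 0] 1 2 by simp
    ultimately show "(p * p' + x * y') * (y * x' + m * m') - (p * x' + x * m') * (y * p' + m * y') = 1 \<and>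
        s1 id 1 (p * p' + x * y') (p * x' + x * m') (y * p' + m * y') (y * x' + m * m') 0 0 0 \<in> K"
      using subgroup.m_closed[OF K] 1 2 by metis
  qed (use C in auto)
  then have A: "s1 id 1 p x y m 0 0 0 \<in> K" by blast
  have "s1 id 1 1 0 0 1 u v w = s2 id 1 1 0 0 u v w"
    using s2_0[OF JP_one one_nz] by simp
  then have "s1 id 1 1 0 0 1 u v w \<in> K" using VF unfolding VF_def by auto
  then have "s1 id 1 p x y m 0 0 0 \<otimes> s1 id 1 1 0 0 1 u v w \<in> K" using subgroup.m_closed[OF K A] by blast
  moreover have "s1 id 1 p x y m 0 0 0 \<otimes> s1 id 1 1 0 0 1 u v w = g"
    unfolding g(1) using s1_mult_id[OF ok[OF g(2)] ok, of 1 1 0 0 0 0 0 u v w] by simp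
  ultimately show "g \<in> K" by simp
qed

text \<open>The Weyl element: conjugation by it exchanges upper and lower unitriangular maps, up to
  a sign of the entry. In the application it is a conjugate of \<open>p_delta\<close>.\<close>

definition \<delta> where "\<delta> = s1 id 1 0 1 (-1) 0 0 0 0"

lemma \<delta>_A1: "\<delta> \<in> A1"
proof -
  have "ok1 id 1 0 1 (-1) 0" using Y_props by (simp add: ok1_id)
  then show ?thesis unfolding \<delta>_def A1_def by blast
qed

lemma upper_eq: "s1 id 1 1 e 0 1 0 0 0 = s2 id 1 1 0 e 0 0 0"
  using s2_0[OF JP_one one_nz] by simp

lemma upper_VCF: "s1 id 1 1 e 0 1 0 0 0 \<in> VCF"
  unfolding upper_eq VCF_def by blast

lemma lower_conj: "s1 id 1 1 0 e 1 0 0 0 = inv \<delta> \<otimes> s1 id 1 1 (-e) 0 1 0 0 0 \<otimes> \<delta>"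
proof -
  have ok: "ok1 id 1 0 1 (-1) 0" "ok1 id 1 1 0 e 1" "ok1 id 1 1 (-e) 0 1" using Y_props by (simp_all add: ok1_id)
  have "s1 id 1 1 (-e) 0 1 0 0 0 \<otimes> \<delta> = \<delta> \<otimes> s1 id 1 1 0 e 1 0 0 0"
    unfolding \<delta>_def using s1_mult_id[OF ok(3) ok(1), of 0 0 0 0 0 0] s1_mult_id[OF ok(1,2), of 0 0 0 0 0 0] by simp
  then show ?thesis
    using \<delta>_A1 A1_carrier s1_closed[OF ok(2)] s1_closed[OF ok(3)] by (intro conj_eqI[symmetric]) blast+
qed

text \<open>\<open>T2s\<close> contains the translations and the upper unitriangular maps, and
  conjugation by \<delta> adds the lower ones, so the closure contains \<open>L1s\<close>. The
  diagonal elements of \<open>T2s\<close> then supply every \<nu> in \<open>Y\<close>.\<close>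

lemma H1c_closure: "H1c \<subseteq> conj_closure H T2s A1"
proof -
  have T2c: "T2s \<subseteq> carrier H" using Bs_subs subgroup.subset[OF Bs_subgroup] by blast
  let ?K = "conj_closure H T2s A1"
  have K: "subgroup ?K H" by (rule conj_closure_subgroup[OF T2c A1_carrier])
  have T2: "T2s \<subseteq> ?K" by (rule conj_closure_incl[OF T2c A1_subgroup])
  have "s1 id 1 1 e 0 1 0 0 0 \<in> T2s" for e using upper_VCF VCF_subs by blast
  then have "L1s \<subseteq> ?K"
    using T2 VCF_subs conj_closure_memI[OF _ \<delta>_A1] by (intro SL2_generated K) (auto simp: lower_conj)
  show ?thesis
  proof
    fix g assume "g \<in> H1c"
    then obtain \<nu> p x y m u v w where g: "g = s1 id \<nu> p x y m u v w" "\<nu> \<in> Y" "p * m - x * y = \<nu> ^ 3"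
      unfolding H1c_def ok1_id by blast
    have nz: "\<nu> \<noteq> 0" using Y_nz g(2) by blast
    \<comment> \<open>Dividing the first column by \<open>\<nu> ^ 2\<close> and the second by \<nu>
      splits off the diagonal element of \<open>T2s\<close> and leaves determinant 1.\<close>
    have det: "p / \<nu> ^ 2 * (m / \<nu>) - x / \<nu> * (y / \<nu> ^ 2) = 1"
    proof -
      have "p / \<nu> ^ 2 * (m / \<nu>) - x / \<nu> * (y / \<nu> ^ 2) = (p * m - x * y) / \<nu> ^ 3"
        by (simp add: diff_divide_distrib power2_eq_square power3_eq_cube mult_ac)
      then show ?thesis using g(3) nz by simp
    qed
    have T: "s2 id \<nu> 1 0 0 0 0 0 \<in> ?K" using T2 g(2) unfolding T2s_def by blast
    have L: "s1 id 1 (p / \<nu> ^ 2) (x / \<nu>) (y / \<nu> ^ 2) (m / \<nu>) u v w \<in> ?K"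
      using \<open>L1s \<subseteq> ?K\<close> det unfolding L1s_def by blast
    have ok: "ok1 id 1 (p / \<nu> ^ 2) (x / \<nu>) (y / \<nu> ^ 2) (m / \<nu>)" using det Y_props by (simp add: ok1_id)
    have s: "s2 id \<nu> 1 0 0 0 0 0 = s1 id \<nu> (\<nu> ^ 2) 0 0 \<nu> 0 0 0" "ok1 id \<nu> (\<nu> ^ 2) 0 0 \<nu>"
      using s2_0[of \<nu> id 1] ok1_s2[of \<nu> id 1 0] g(2) by (simp_all add: Y_JP)
    have "s2 id \<nu> 1 0 0 0 0 0 \<otimes> s1 id 1 (p / \<nu> ^ 2) (x / \<nu>) (y / \<nu> ^ 2) (m / \<nu>) u v w = g"
      unfolding s(1) s1_mult_id[OF s(2) ok] g(1) using nz by simp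
    then show "g \<in> ?K" using subgroup.m_closed[OF K T L] by simp
  qed
qed

text \<open>\<open>Bs\<close> has no quadratic terms, so the maps \<tau> must come from conjugation.
  The involution of \<open>Bs\<close> with \<open>t = -1\<close> inverts them; its product with a
  conjugate of itself is a \<tau> with doubled parameter, and 2 is invertible.\<close>

lemma H2c_closure: "H2c \<subseteq> conj_closure H Bs A2"
proof
  have Bc: "Bs \<subseteq> carrier H" using subgroup.subset[OF Bs_subgroup] .
  let ?K = "conj_closure H Bs A2"
  have K: "subgroup ?K H" by (rule conj_closure_subgroup[OF Bc A2_carrier])
  have BK: "Bs \<subseteq> ?K" by (rule conj_closure_incl[OF Bc A2_subgroup])
  have \<tau>: "s2 id 1 1 D 0 0 0 0 \<in> ?K" for D
  proof -
    define k where "k = s2 id 1 1 (-D) 0 0 0 0"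
    define b where "b = s2 id 1 (-1) 0 0 0 0 0"
    define z where "z = s2 id 1 (-1) (- D - D) 0 0 0 0"
    have nz: "(-1::'a) \<noteq> 0" by simp
    have k: "k \<in> A2" unfolding k_def A2_def using JP_one one_nz by blast
    have b: "b \<in> Bs" unfolding b_def Bs_def using Y_props(1) nz by blast
    have zc: "z \<in> carrier H" unfolding z_def by (rule s2_closed[OF JP_one nz])
    \<comment> \<open>In characteristic 3 the coefficient of the conjugate \<open>z\<close> is
      \<open>D\<close> itself, which is why the conjugating map carries the parameter
      \<open>- D\<close>.\<close>
    have "- D - D = D - (D + D + D)" by simp
    then have D: "- D - D = D" unfolding triple by simp
    then have "b \<otimes> k = k \<otimes> z"
      unfolding b_def k_def z_def s2_mult_id[OF Y_props(1) Y_props(1) nz one_nz] s2_mult_id[OF Y_props(1) Y_props(1) one_nz nz]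
      by simp
    then have "inv k \<otimes> b \<otimes> k = z" using k b zc A2_carrier Bc by (intro conj_eqI) blast+
    then have "z \<in> ?K" using conj_closure_memI[OF b k] by simp
    moreover have "b \<otimes> z = s2 id 1 1 D 0 0 0 0"
      unfolding b_def z_def D s2_mult_id[OF Y_props(1) Y_props(1) nz nz] by simp
    ultimately show ?thesis using subgroup.m_closed[OF K] BK b by (metis subsetD)
  qed
  fix g assume "g \<in> H2c"
  then obtain \<nu> t D e u v w where g: "g = s2 id \<nu> t D e u v w" "\<nu> \<in> Y" "t \<noteq> 0" unfolding H2c_def by blast
  have gc: "g \<in> carrier H" using \<open>g \<in> H2c\<close> H2c_sub A2_carrier by blast
  have \<tau>c: "s2 id 1 1 D 0 0 0 0 \<in> carrier H" for D by (rule s2_closed[OF JP_one one_nz])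
  have BsI: "s2 id \<nu> t 0 e' u' v' w' \<in> Bs" for e' u' v' w' using g(2,3) unfolding Bs_def by blast
  have "g \<otimes> s2 id 1 1 (-D) 0 0 0 0 \<in> Bs"
    unfolding g(1) s2_mult_id[OF g(2) Y_props(1) g(3) one_nz] by (simp add: BsI)
  then have "(g \<otimes> s2 id 1 1 (-D) 0 0 0 0) \<otimes> s2 id 1 1 D 0 0 0 0 \<in> ?K"
    using subgroup.m_closed[OF K _ \<tau>] BK by blast
  moreover have "s2 id 1 1 (-D) 0 0 0 0 \<otimes> s2 id 1 1 D 0 0 0 0 = \<one>"
    unfolding one_eq s2_mult_id[OF Y_props(1) Y_props(1) one_nz one_nz] by simp
  ultimately show "g \<in> ?K" using gc \<tau>c by (simp add: m_assoc)
qed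

lemma conj_closure_Bs: "conj_closure H Bs A1 = H1c" "conj_closure H Bs A2 = H2c"
proof -
  show "conj_closure H Bs A1 = H1c"
    using conj_closure_subset[OF H1c_normal A1_subgroup, of Bs] Bs_eq H1c_closure conj_closure_mono[OF Bs_subs(2)] by blast
  show "conj_closure H Bs A2 = H2c"
    using conj_closure_subset[OF H2c_normal A2_subgroup, of Bs] Bs_eq H2c_closure by blast
qed

lemma core_eq: "core_edge_group H A1 A2 = Bs"
proof (rule core_edge_group_eqI[OF _ _ conj_closure_Bs])
  show "subgroup Bs (H\<lparr>carrier := A1 \<inter> A2\<rparr>)"
    unfolding A12_eq using subgroup_incl[OF Bs_subgroup A12_subgroup] Bs_eq by blast
  show "largest_normal_in H (A1 \<inter> A2) A1 <#> largest_normal_in H (A1 \<inter> A2) A2 \<subseteq> Bs"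
    unfolding largest_normal_A1 largest_normal_A2 set_mult_def using Bs_subs subgroup.m_closed[OF Bs_subgroup] by blast
  show "Bs = A1 \<inter> A2 \<inter> H1c" "Bs = A1 \<inter> A2 \<inter> H2c" unfolding A12_eq using Bs_eq by blast+
  have "T2s \<subseteq> T1s <#> T2s"
  proof
    fix g assume g: "g \<in> T2s"
    then have "g = \<one> \<otimes> g" using Bs_subs subgroup.subset[OF Bs_subgroup] by auto
    then show "g \<in> T1s <#> T2s" unfolding set_mult_def using g subgroup.one_closed[OF T1s_subgroup] by blast
  qed
  then show "H1c \<subseteq> conj_closure H (largest_normal_in H (A1 \<inter> A2) A1 <#> largest_normal_in H (A1 \<inter> A2) A2) A1"
    unfolding largest_normal_A1 largest_normal_A2 using H1c_closure conj_closure_mono by blast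
qed

end

lemma (in group) normal_swap:
  assumes "N \<lhd> G" "n \<in> N" "k \<in> carrier G"
  shows "\<exists>n'\<in>N. k \<otimes> n = n' \<otimes> k"
proof (intro bexI)
  have "n \<in> carrier G" using assms normal_imp_subgroup subgroup.mem_carrier by metis
  then show "k \<otimes> n = (k \<otimes> n \<otimes> inv k) \<otimes> k" using assms by (simp add: m_assoc)
  show "k \<otimes> n \<otimes> inv k \<in> N" using normal.inv_op_closed2[OF assms(1,3,2)] .
qed

lemma additive_group_simps [simp]:
  "carrier additive_group = UNIV" "x \<otimes>\<^bsub>additive_group\<^esub> y = x + y" "\<one>\<^bsub>additive_group\<^esub> = 0"
  by (auto simp: additive_group_def)

lemma additive_group_group: "group (additive_group :: 'b::ab_group_add monoid)"
  using comm_group_additive_group by (rule comm_group.axioms(2))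

context amalgam
begin

subsection \<open>Largest normal 3-subgroups\<close>

lemma sub_carrier: "Bs \<subseteq> carrier H" "H1c \<subseteq> carrier H" "H2c \<subseteq> carrier H" "L1s \<subseteq> carrier H"
  by (rule subgroup.subset, rule Bs_subgroup H1c_subgroup H2c_subgroup L1s_subgroup)+

lemma Bs_pow:
  assumes "\<nu> \<in> Y" "t \<noteq> 0"
  shows "\<exists>e' u' v' w'. s2 id \<nu> t 0 e u v w [^] (k::nat) = s2 id (\<nu> ^ k) (t ^ k) 0 e' u' v' w'"
proof (induction k)
  case 0
  show ?case unfolding nat_pow_0 power_0 one_eq by blast
next
  case (Suc k)
  then obtain e' u' v' w' where IH: "s2 id \<nu> t 0 e u v w [^] k = s2 id (\<nu> ^ k) (t ^ k) 0 e' u' v' w'" by blast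
  have "t ^ k \<noteq> 0" using assms by simp
  show ?case
    unfolding nat_pow_Suc IH s2_mult_0[OF Y_pow[OF assms(1)] assms(1) \<open>t ^ k \<noteq> 0\<close> assms(2)] power_Suc by blast
qed

text \<open>\<nu> and \<open>t\<close> are multiplicative on \<open>Bs\<close>, and 1 is the only
  element of 3-power order in the multiplicative group of the field, so
  \<open>\<nu> = t = 1\<close>.\<close>

lemma Bs_3_element:
  assumes "g \<in> Bs" "g [^] (3 ^ k :: nat) = \<one>"
  shows "g \<in> VCF"
proof -
  obtain \<nu> t e u v w where g: "g = s2 id \<nu> t 0 e u v w" "\<nu> \<in> Y" "t \<noteq> 0" using assms(1) unfolding Bs_def by blast
  obtain e' u' v' w' where "g [^] (3 ^ k :: nat) = s2 id (\<nu> ^ 3 ^ k) (t ^ 3 ^ k) 0 e' u' v' w'"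
    using Bs_pow[OF g(2,3)] g(1) by metis
  then have eq: "s2 id (\<nu> ^ 3 ^ k) (t ^ 3 ^ k) 0 e' u' v' w' = s2 id 1 1 0 0 0 0 0" using assms(2) one_eq by simp
  have J: "(\<nu> ^ 3 ^ k, id) \<in> JP" using Y_pow[OF g(2)] by (simp add: Y_JP)
  have "t ^ 3 ^ k \<noteq> 0" using g(3) by simp
  from eq[unfolded s2_inj[OF J JP_one this one_nz]] have "\<nu> ^ 3 ^ k = 1" "t ^ 3 ^ k = 1" by blast+
  then have "\<nu> = 1" "t = 1" unfolding pow3_eq_1 .
  then show ?thesis unfolding VCF_def g(1) by blast
qed

lemma VCF_T1s: "VCF \<inter> T1s = VF"
proof (intro equalityI subsetI)
  fix g assume "g \<in> VCF \<inter> T1s"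
  then obtain e u v w \<nu> t u' v' w' where g: "g = s2 id 1 1 0 e u v w"
    and g': "g = s2 id \<nu> t 0 0 u' v' w'" "(\<nu>, id) \<in> JP" "\<nu> * t ^ 2 = 1"
    unfolding VCF_def T1s_def Y_JP by blast
  have t: "t \<noteq> 0" using g'(3) by auto
  have "s2 id 1 1 0 e u v w = s2 id \<nu> t 0 0 u' v' w'" using g g' by simp
  then have "e = 0" unfolding s2_inj[OF JP_one g'(2) one_nz t] by blast
  then show "g \<in> VF" unfolding VF_def g by blast
qed (use VCF_subs in blast)

lemma VCF_conj:
  assumes k: "k \<in> A2" and g: "g \<in> VCF"
  shows "inv k \<otimes> g \<otimes> k \<in> VCF"
proof -
  obtain f \<nu> t D e u v w where k': "k = s2 f \<nu> t D e u v w" "(\<nu>, f) \<in> JP" "t \<noteq> 0" using k unfolding A2_def by blast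
  obtain e0 u0 v0 w0 where g': "g = s2 id 1 1 0 e0 u0 v0 w0" using g unfolding VCF_def by blast
  have f: "f 1 = 1" "f 0 = 0" using frob_simps[OF JP_frob[OF k'(2)]] by auto
  obtain D' e' u' v' w' where z: "inv k \<otimes> g \<otimes> k = s2 id (f 1) (f 1) D' e' u' v' w'"
    "D' + f 1 ^ 3 * D = t ^ 3 * f 0 + D"
    by (rule conj_A2[OF k' g' Y_props(1) one_nz])
  then have "D' = 0" by (simp add: f)
  then show ?thesis using z(1) unfolding f VCF_def by blast
qed

lemma VCF_normal:
  assumes "subgroup K H" "VCF \<subseteq> K" "K \<subseteq> A2"
  shows "VCF \<lhd> H\<lparr>carrier := K\<rparr>"
proof (rule normal_restrictI[OF assms(1) VCF_subgroup assms(2)])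
  fix k g assume k: "k \<in> K" and g: "g \<in> VCF"
  then have "k \<in> carrier H" "g \<in> carrier H" using assms A2_carrier by blast+
  then show "\<exists>z\<in>VCF. g \<otimes> k = k \<otimes> z" using conj_eqD VCF_conj[of k g] k g assms(3) by blast
qed

text \<open>\<open>VF\<close> is the set of elements of 3-power order in \<open>T1s\<close>, and
  conjugation preserves this set because \<open>T1s\<close> is normal in \<open>A1\<close>.\<close>

lemma VF_conj:
  assumes k: "k \<in> A1" and g: "g \<in> VF"
  shows "inv k \<otimes> g \<otimes> k \<in> VF"
proof -
  obtain u v w where g': "g = s2 id 1 1 0 0 u v w" using g unfolding VF_def by blast
  have kc: "k \<in> carrier H" "g \<in> carrier H" using k g A1_carrier Bs_subs sub_carrier by blast+
  have "g [^] (3::nat) = \<one>"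
    unfolding g' one_eq by (simp add: numeral_3_eq_3 one_eq s2_mult_0 Y_props three)
  moreover have "(inv k \<otimes> g \<otimes> k) [^] (3::nat) = inv k \<otimes> g [^] (3::nat) \<otimes> k"
    using kc by (simp add: numeral_3_eq_3 m_assoc inv_cancel)
  ultimately have "(inv k \<otimes> g \<otimes> k) [^] (3 ^ 1 :: nat) = \<one>" using kc by simp
  moreover have "inv k \<otimes> g \<otimes> k \<in> T1s" using T1s_conj[OF k] VCF_subs g by blast
  moreover from this have "inv k \<otimes> g \<otimes> k \<in> Bs" using Bs_subs(1) by blast
  ultimately show ?thesis using Bs_3_element VCF_T1s by blast
qed

lemma VF_normal:
  assumes "subgroup K H" "VF \<subseteq> K" "K \<subseteq> A1"
  shows "VF \<lhd> H\<lparr>carrier := K\<rparr>"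
proof (rule normal_restrictI[OF assms(1) VF_subgroup assms(2)])
  fix k g assume k: "k \<in> K" and g: "g \<in> VF"
  then have "k \<in> carrier H" "g \<in> carrier H" using assms A1_carrier by blast+
  then show "\<exists>z\<in>VF. g \<otimes> k = k \<otimes> z" using conj_eqD VF_conj[of k g] k g assms(3) by blast
qed

lemma card_VF: "card VF = CARD('a) ^ 3"
proof -
  have "bij_betw (\<lambda>(u, v, w). s2 id 1 1 0 0 u v w) (UNIV :: ('a \<times> 'a \<times> 'a) set) VF"
    by (rule bij_betwI') (auto simp: s2_inj JP_one VF_def)
  then have "card (UNIV :: ('a \<times> 'a \<times> 'a) set) = card VF" by (rule bij_betw_same_card)
  then show ?thesis by (simp add: eval_nat_numeral)
qed

lemma card_VCF: "card VCF = CARD('a) ^ 4"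
proof -
  have "bij_betw (\<lambda>(e, u, v, w). s2 id 1 1 0 e u v w) (UNIV :: ('a \<times> 'a \<times> 'a \<times> 'a) set) VCF"
    by (rule bij_betwI') (auto simp: s2_inj JP_one VCF_def)
  then have "card (UNIV :: ('a \<times> 'a \<times> 'a \<times> 'a) set) = card VCF" by (rule bij_betw_same_card)
  then show ?thesis by (simp add: eval_nat_numeral)
qed

text \<open>All elements of 3-power order in a subgroup of \<open>Bs\<close> lie in
  \<open>VCF\<close>, so a normal 3-subgroup containing \<open>VCF \<inter> K\<close> is the largest
  one.\<close>

lemma Op_restrict:
  assumes K: "subgroup K H" "K \<subseteq> Bs" and P: "P \<lhd> H\<lparr>carrier := K\<rparr>" "card P = CARD('a) ^ n" "VCF \<inter> K \<subseteq> P"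
  shows "Op 3 (H\<lparr>carrier := K\<rparr>) = P"
proof -
  interpret K: group "H\<lparr>carrier := K\<rparr>" by (rule subgroup_imp_group[OF K(1)])
  show ?thesis
  proof (rule K.Op_eqI)
    have "K \<subseteq> carrier H" using K(1) by (rule subgroup.subset)
    then show "finite (carrier (H\<lparr>carrier := K\<rparr>))" using finite_subset[OF _ fin] by simp
    show "card P = 3 ^ (r * n)" using P by (simp add: card_field power_mult)
    fix x k assume "x \<in> carrier (H\<lparr>carrier := K\<rparr>)" "x [^]\<^bsub>H\<lparr>carrier := K\<rparr>\<^esub> (3 ^ k :: nat) = \<one>\<^bsub>H\<lparr>carrier := K\<rparr>\<^esub>"
    then show "x \<in> P" using Bs_3_element[of x k] K(2) P(3) by (auto simp flip: nat_pow_consistent)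
  qed (rule P(1))
qed

lemma A12_subs: "Bs \<subseteq> A2" "T2s \<subseteq> A2" "LBs \<subseteq> A2" "T1s \<subseteq> A1"
  using Bs_eq Bs_subs A12_sub by blast+

lemma Op_T1s: "Op 3 (H\<lparr>carrier := T1s\<rparr>) = VF"
  by (rule Op_restrict[OF T1s_subgroup Bs_subs(1) VF_normal[OF T1s_subgroup VCF_subs(4) A12_subs(4)] card_VF])
    (use VCF_T1s in blast)

lemma Op_T2s: "Op 3 (H\<lparr>carrier := T2s\<rparr>) = VCF"
  by (rule Op_restrict[OF T2s_subgroup Bs_subs(2) VCF_normal[OF T2s_subgroup VCF_subs(1) A12_subs(2)] card_VCF]) blast

lemma Op_Bs: "Op 3 (H\<lparr>carrier := Bs\<rparr>) = VCF"
  by (rule Op_restrict[OF Bs_subgroup order_refl VCF_normal[OF Bs_subgroup Bs_subs(4) A12_subs(1)] card_VCF]) blast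

lemma Op_LBs: "Op 3 (H\<lparr>carrier := LBs\<rparr>) = VCF"
  by (rule Op_restrict[OF LBs_subgroup Bs_subs(3) VCF_normal[OF LBs_subgroup VCF_subs(2) A12_subs(3)] card_VCF]) blast

lemma VF_L1s: "VF \<subseteq> L1s" "VCF \<subseteq> L1s"
  using VCF_subs LBs_eq by blast+

lemma L1s_closure: "conj_closure H VCF A1 = L1s"
proof
  show "conj_closure H VCF A1 \<subseteq> L1s"
    by (rule conj_closure_subset[OF L1s_normal A1_subgroup VF_L1s(2)])
  have c: "VCF \<subseteq> carrier H" using Bs_subs sub_carrier by blast
  have incl: "VCF \<subseteq> conj_closure H VCF A1" by (rule conj_closure_incl[OF c A1_subgroup])
  show "L1s \<subseteq> conj_closure H VCF A1"
  proof (rule SL2_generated[OF conj_closure_subgroup[OF c A1_carrier]])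
    show "VF \<subseteq> conj_closure H VCF A1" using incl VCF_subs by blast
    show "s1 id 1 1 e 0 1 0 0 0 \<in> conj_closure H VCF A1" for e using incl upper_VCF by blast
    show "s1 id 1 1 0 e 1 0 0 0 \<in> conj_closure H VCF A1" for e
      unfolding lower_conj using conj_closure_memI[OF upper_VCF \<delta>_A1] .
  qed
qed

text \<open>The last factor in the definition of L_1 is absorbed, since Q at x_1 already lies in the
  subgroup generated by the Q at its neighbours.\<close>

lemma L1s_VF: "L1s <#> VF = L1s"
proof
  show "L1s <#> VF \<subseteq> L1s"
    unfolding set_mult_def using VF_L1s subgroup.m_closed[OF L1s_subgroup] by blast
  show "L1s \<subseteq> L1s <#> VF"
  proof
    fix g assume g: "g \<in> L1s"
    then have "g = g \<otimes> \<one>" using sub_carrier by auto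
    then show "g \<in> L1s <#> VF" unfolding set_mult_def using g subgroup.one_closed[OF VF_subgroup] by blast
  qed
qed

subsection \<open>Centers and centralizers\<close>

lemma center_restrict: "center (H\<lparr>carrier := K\<rparr>) = {g \<in> K. \<forall>x\<in>K. g \<otimes> x = x \<otimes> g}"
  by (simp add: center_def centralizer_def)

lemma centralizer_restrict: "centralizer (H\<lparr>carrier := K\<rparr>) X = {g \<in> K. \<forall>x\<in>X. g \<otimes> x = x \<otimes> g}"
  by (simp add: centralizer_def)

lemma s2_trans: "s2 id 1 1 0 0 u v w = s1 id 1 1 0 0 1 u v w" "ok1 id 1 1 0 0 1"
  using s2_0[OF JP_one one_nz] by (simp_all add: ok1_id Y_props)

lemma ok1_mult_id:
  assumes "ok1 id \<nu> p x y m" "ok1 id \<nu>' p' x' y' m'"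
  shows "ok1 id (\<nu>' * \<nu>) (p' * p + x' * y) (p' * x + x' * m) (y' * p + m' * y) (y' * x + m' * m)"
  using ok1_mult[OF assms] by simp

lemma s1_commute_iff:
  assumes "ok1 id \<nu> p x y m" "ok1 id \<nu>' p' x' y' m'"
  shows "s1 id \<nu> p x y m u v w \<otimes> s1 id \<nu>' p' x' y' m' u' v' w' = s1 id \<nu>' p' x' y' m' u' v' w' \<otimes> s1 id \<nu> p x y m u v w \<longleftrightarrow>
    p' * p + x' * y = p * p' + x * y' \<and> p' * x + x' * m = p * x' + x * m' \<and>
    y' * p + m' * y = y * p' + m * y' \<and> y' * x + m' * m = y * x' + m * m' \<and>
    p' * u + x' * v + u' = p * u' + x * v' + u \<and> y' * u + m' * v + v' = y * u' + m * v' + v \<and>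
    \<nu>' ^ 2 * w + w' = \<nu> ^ 2 * w' + w"
proof -
  have "\<nu>' * \<nu> = \<nu> * \<nu>'" by (rule mult.commute)
  then show ?thesis
    unfolding s1_mult_id[OF assms] s1_mult_id[OF assms(2,1)] s1_inj[OF ok1_mult_id[OF assms] ok1_mult_id[OF assms(2,1)]]
    by blast
qed

lemma center_L1s: "center (H\<lparr>carrier := L1s\<rparr>) = FF"
  unfolding center_restrict
proof (intro equalityI subsetI)
  fix g assume "g \<in> {g \<in> L1s. \<forall>x\<in>L1s. g \<otimes> x = x \<otimes> g}"
  then have gL: "g \<in> L1s" and comm: "\<And>x. x \<in> L1s \<Longrightarrow> g \<otimes> x = x \<otimes> g" by blast+
  obtain p x y m u v w where g: "g = s1 id 1 p x y m u v w" "p * m - x * y = 1" using gL unfolding L1s_def by blast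
  have ok: "ok1 id 1 p x y m" using g(2) Y_props by (simp add: ok1_id)
  have okm: "ok1 id 1 (-1) 0 0 (-1)" using Y_props by (simp add: ok1_id)
  \<comment> \<open>Commuting with the map -1 of the plane kills the translation part
    \<open>(u, v)\<close>; commuting with all translations then forces the identity matrix.\<close>
  have "(-1) * (-1) - 0 * 0 = (1::'a)" by simp
  then have "s1 id 1 (-1) 0 0 (-1) 0 0 0 \<in> L1s" unfolding L1s_def by blast
  from comm[OF this, unfolded g(1) s1_commute_iff[OF ok okm]]
  have "- u = u" "- v = v" by simp_all
  moreover have zero: "a = 0" if "- a = a" for a :: 'a
  proof -
    have "2 * a = a - (- a)" by simp
    then have "2 * a = 0" unfolding that by simp
    then show ?thesis unfolding two by simp
  qed
  ultimately have uv: "u = 0" "v = 0" by blast+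
  have tr: "s1 id 1 1 0 0 1 a b 0 \<in> L1s" for a b
  proof -
    have "s2 id 1 1 0 0 a b 0 \<in> VF" unfolding VF_def by blast
    then show ?thesis using VF_L1s(1) unfolding s2_trans(1) by (rule subsetD[rotated])
  qed
  have eq: "p * a + x * b = a \<and> y * a + m * b = b" for a b
    using comm[OF tr[of a b], unfolded g(1) s1_commute_iff[OF ok s2_trans(2)]]
    by (simp add: uv)
  have "p = 1" "y = 0" "x = 0" "m = 1" using eq[of 1 0] eq[of 0 1] by simp_all
  then have "g = s2 id 1 1 0 0 0 0 w" using g(1) uv s2_trans(1) by simp
  then show "g \<in> FF" unfolding FF_def by blast
next
  fix g assume gF: "g \<in> FF"
  then obtain w0 where g: "g = s2 id 1 1 0 0 0 0 w0" unfolding FF_def by blast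
  have "g \<otimes> h = h \<otimes> g" if hX: "h \<in> L1s" for h
  proof -
    obtain p x y m u v w where h: "h = s1 id 1 p x y m u v w" "p * m - x * y = 1" using hX unfolding L1s_def by blast
    have ok: "ok1 id 1 p x y m" using h(2) Y_props by (simp add: ok1_id)
    show ?thesis
      unfolding g s2_trans(1) h(1) s1_mult_id[OF ok s2_trans(2)] s1_mult_id[OF s2_trans(2) ok]
      by (simp add: add.commute)
  qed
  then show "g \<in> {g \<in> L1s. \<forall>x\<in>L1s. g \<otimes> x = x \<otimes> g}" using gF VCF_subs VF_L1s by blast
qed

text \<open>An element acts on the third coordinate by \<open>\<nu> ^ 2\<close>, so it centralizes
  \<open>FF\<close> exactly when this is 1. The converse inclusion rests on
  \<open>square_root_Y\<close>: both square roots of 1 occur in \<open>Y\<close>.\<close>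

lemma centralizer_H1c: "centralizer (H\<lparr>carrier := H1c\<rparr>) FF =
    {s1 id \<nu> p x y m u v w | \<nu> p x y m u v w. \<nu> ^ 2 = 1 \<and> p * m - x * y = \<nu> ^ 3}"
  unfolding centralizer_restrict
proof (intro equalityI subsetI)
  fix g assume "g \<in> {g \<in> H1c. \<forall>x\<in>FF. g \<otimes> x = x \<otimes> g}"
  then have gL: "g \<in> H1c" and comm: "\<And>x. x \<in> FF \<Longrightarrow> g \<otimes> x = x \<otimes> g" by blast+
  obtain \<nu> p x y m u v w where g: "g = s1 id \<nu> p x y m u v w" "ok1 id \<nu> p x y m" using gL unfolding H1c_def by blast
  have "s1 id 1 1 0 0 1 0 0 1 \<in> FF" unfolding s2_trans(1)[symmetric] FF_def by blast
  from comm[OF this, unfolded g(1) s1_commute_iff[OF g(2) s2_trans(2)]]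
  have "\<nu> ^ 2 = 1" by simp
  then show "g \<in> {s1 id \<nu> p x y m u v w | \<nu> p x y m u v w. \<nu> ^ 2 = 1 \<and> p * m - x * y = \<nu> ^ 3}"
    using g unfolding ok1_id by blast
next
  fix g assume "g \<in> {s1 id \<nu> p x y m u v w | \<nu> p x y m u v w. \<nu> ^ 2 = 1 \<and> p * m - x * y = \<nu> ^ 3}"
  then obtain \<nu> p x y m u v w where g: "g = s1 id \<nu> p x y m u v w" "\<nu> ^ 2 = 1" "p * m - x * y = \<nu> ^ 3" by blast
  have ok: "ok1 id \<nu> p x y m" using g square_root_Y by (simp add: ok1_id)
  have "g \<otimes> h = h \<otimes> g" if hX: "h \<in> FF" for h
  proof -
    obtain w0 where h: "h = s1 id 1 1 0 0 1 0 0 w0" using hX unfolding FF_def s2_trans(1) by blast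
    show ?thesis
      unfolding g h s1_mult_id[OF ok s2_trans(2)] s1_mult_id[OF s2_trans(2) ok] by (simp add: g(2) add.commute)
  qed
  moreover have "g \<in> H1c" unfolding H1c_def using ok g(1) by blast
  ultimately show "g \<in> {g \<in> H1c. \<forall>x\<in>FF. g \<otimes> x = x \<otimes> g}" by blast
qed

text \<open>\<open>VCF\<close> is a Heisenberg group in \<open>e\<close>, \<open>u\<close>,
  \<open>v\<close> times the direction \<open>w\<close>: two elements commute exactly when
  \<open>e' * v = e * v'\<close>.\<close>

lemma center_VCF: "center (H\<lparr>carrier := VCF\<rparr>) = {s2 id 1 1 0 0 u 0 w | u w. True}"
  unfolding center_restrict
proof (intro equalityI subsetI)
  fix g assume "g \<in> {g \<in> VCF. \<forall>x\<in>VCF. g \<otimes> x = x \<otimes> g}"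
  then have gL: "g \<in> VCF" and comm: "\<And>x. x \<in> VCF \<Longrightarrow> g \<otimes> x = x \<otimes> g" by blast+
  obtain e u v w where g: "g = s2 id 1 1 0 e u v w" using gL unfolding VCF_def by blast
  have "s2 id 1 1 0 e' 0 v' 0 \<in> VCF" for e' v' unfolding VCF_def by blast
  from comm[OF this, unfolded g s2_mult_0[OF Y_props(1) Y_props(1) one_nz one_nz]]
  have eq: "s2 id (1 * 1) (1 * 1) 0 (1 ^ 2 * 1 * e + e' * (1 / 1)) (1 ^ 2 * 1 * u + e' * v + 0) (1 / 1 * v + v') (1 ^ 2 * w + 0) =
    s2 id (1 * 1) (1 * 1) 0 (1 ^ 2 * 1 * e' + e * (1 / 1)) (1 ^ 2 * 1 * 0 + e * v' + u) (1 / 1 * v' + v) (1 ^ 2 * 0 + w)" for e' v' .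
  have "v = 0" using eq[of 1 0] by (simp add: s2_inj JP_one)
  moreover have "e = 0" using eq[of 0 1] by (simp add: s2_inj JP_one)
  ultimately have "v = 0" "e = 0" by simp_all
  then show "g \<in> {s2 id 1 1 0 0 u 0 w | u w. True}" unfolding g by blast
next
  fix g assume "g \<in> {s2 id 1 1 0 0 u 0 w | u w. True}"
  then obtain u w where g: "g = s2 id 1 1 0 0 u 0 w" by blast
  have "g \<otimes> h = h \<otimes> g" if hX: "h \<in> VCF" for h
  proof -
    obtain e u' v' w' where h: "h = s2 id 1 1 0 e u' v' w'" using hX unfolding VCF_def by blast
    show ?thesis unfolding g h s2_mult_0[OF Y_props(1) Y_props(1) one_nz one_nz] by (simp add: add.commute)
  qed
  moreover have "g \<in> VCF" unfolding g VCF_def by blast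
  ultimately show "g \<in> {g \<in> VCF. \<forall>x\<in>VCF. g \<otimes> x = x \<otimes> g}" by blast
qed

lemma centralizer_H2c: "centralizer (H\<lparr>carrier := H2c\<rparr>) (center (H\<lparr>carrier := VCF\<rparr>)) =
    {s2 id \<nu> 1 0 e u v w | \<nu> e u v w. \<nu> ^ 2 = 1}"
  unfolding centralizer_restrict center_VCF
proof (intro equalityI subsetI)
  fix g assume "g \<in> {g \<in> H2c. \<forall>x\<in>{s2 id 1 1 0 0 u 0 w | u w. True}. g \<otimes> x = x \<otimes> g}"
  then have gL: "g \<in> H2c" and comm: "\<And>u w. g \<otimes> s2 id 1 1 0 0 u 0 w = s2 id 1 1 0 0 u 0 w \<otimes> g" by blast+
  obtain \<nu> t D e u v w where g: "g = s2 id \<nu> t D e u v w" "\<nu> \<in> Y" "t \<noteq> 0" using gL unfolding H2c_def by blast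
  have J: "(\<nu>, id) \<in> JP" using g(2) Y_JP by simp
  note eq = comm[unfolded g(1) s2_mult_id[OF g(2) Y_props(1) g(3) one_nz] s2_mult_id[OF Y_props(1) g(2) one_nz g(3)]]
  \<comment> \<open>The translation in direction \<open>w\<close> tests \<nu> and, through the term
    \<open>D ^ eps\<close> it produces in the first coordinate, also \<open>D\<close>; the
    translation in direction \<open>u\<close> tests \<open>t\<close>.\<close>
  have n: "\<nu> ^ 2 = 1" using eq[of 0 1] by (simp add: s2_inj J g(3) eps_0)
  have "t = 1" using eq[of 1 0] by (simp add: s2_inj J g(3) eps_0 n)
  moreover have "D ^ eps = 0" using eq[of 0 1] by (simp add: s2_inj J g(3) eps_0 n)
  then have "D = 0" unfolding eps_eq_0 .
  ultimately show "g \<in> {s2 id \<nu> 1 0 e u v w | \<nu> e u v w. \<nu> ^ 2 = 1}" using g n by blast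
next
  fix g assume "g \<in> {s2 id \<nu> 1 0 e u v w | \<nu> e u v w. \<nu> ^ 2 = 1}"
  then obtain \<nu> e u v w where g: "g = s2 id \<nu> 1 0 e u v w" "\<nu> ^ 2 = 1" by blast
  have Y: "\<nu> \<in> Y" using g square_root_Y by simp
  have "g \<otimes> s2 id 1 1 0 0 u' 0 w' = s2 id 1 1 0 0 u' 0 w' \<otimes> g" for u' w'
    unfolding g(1) s2_mult_0[OF Y_props(1) Y one_nz one_nz] s2_mult_0[OF Y Y_props(1) one_nz one_nz]
    by (simp add: g(2) add.commute)
  moreover have "g \<in> H2c" unfolding H2c_def g(1) using Y one_nz by blast
  ultimately show "g \<in> {g \<in> H2c. \<forall>x\<in>{s2 id 1 1 0 0 u 0 w | u w. True}. g \<otimes> x = x \<otimes> g}" by blast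
qed

lemma FF_iso: "H\<lparr>carrier := FF\<rparr> \<cong> (additive_group :: 'a monoid)"
proof -
  interpret A: group "additive_group :: 'a monoid" by (rule additive_group_group)
  have "(\<lambda>w. s2 id 1 1 0 0 0 0 w) \<in> iso additive_group (H\<lparr>carrier := FF\<rparr>)"
  proof (rule isoI)
    show "(\<lambda>w. s2 id 1 1 0 0 0 0 w) \<in> hom additive_group (H\<lparr>carrier := FF\<rparr>)"
      by (auto simp: hom_def FF_def s2_mult_0 Y_props)
    show "bij_betw (\<lambda>w. s2 id 1 1 0 0 0 0 w) (carrier additive_group) (carrier (H\<lparr>carrier := FF\<rparr>))"
      by (rule bij_betwI') (auto simp: s2_inj JP_one FF_def)
  qed
  then show ?thesis using A.iso_sym is_isoI by blast
qed

end

context amalgam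
begin

subsection \<open>Isomorphism types\<close>

text \<open>A determinant with square 1 is its own cube, so it can serve as \<nu>, and
  \<open>\<nu> ^ 2 = 1\<close> makes the third coordinate a direct factor. The comparison with the
  affine group reverses products.\<close>

lemma iso_affine:
  fixes KA :: "(('a^2) \<times> ('a^2^2)) set"
  assumes KA: "subgroup KA AGL" and det: "\<And>u v p x y m. aff u v p x y m \<in> KA \<Longrightarrow> (p * m - x * y) ^ 2 = 1"
  shows "H\<lparr>carrier := {s1 id (p * m - x * y) p x y m u v w | p x y m u v w. aff u v p x y m \<in> KA}\<rparr> \<cong>
    (additive_group :: 'a monoid) \<times>\<times> AGL\<lparr>carrier := KA\<rparr>" (is "H\<lparr>carrier := ?S\<rparr> \<cong> ?A")
proof -
  have grp: "group ?A"
    using group.subgroup_imp_group[OF AGL_group KA] additive_group_group by (rule DirProd_group[rotated])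
  define h where "h z = (case z of (w, v, A) \<Rightarrow>
    s1 id (det A) (A$1$1) (A$1$2) (A$2$1) (A$2$2) (v$1) (v$2) w)" for z :: "'a \<times> ('a^2) \<times> ('a^2^2)"
  have h: "h (w, aff u v p x y m) = s1 id (p * m - x * y) p x y m u v w" for w u v p x y m
    by (simp add: h_def aff_def det_mat2)
  have ok: "ok1 id (p * m - x * y) p x y m" if "aff u v p x y m \<in> KA" for u v p x y m
  proof -
    have "(p * m - x * y) ^ 3 = (p * m - x * y) ^ 2 * (p * m - x * y)" by (simp add: power3_eq_cube power2_eq_square)
    then show ?thesis using det[OF that] square_root_Y by (simp add: ok1_id)
  qed
  have elem: "\<exists>w u v p x y m. z = (w, aff u v p x y m) \<and> aff u v p x y m \<in> KA" if "z \<in> carrier ?A" for z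
  proof -
    obtain w g where z: "z = (w, g)" by (cases z)
    obtain u v p x y m where "g = aff u v p x y m" by (rule aff_surj)
    then have "z = (w, aff u v p x y m)" "aff u v p x y m \<in> KA" using that z by simp_all
    then show ?thesis by blast
  qed
  show ?thesis
  proof (rule group.antihom_iso[OF grp])
    show "antihom ?A (H\<lparr>carrier := ?S\<rparr>) h"
      unfolding antihom_def
    proof (intro conjI ballI subsetI)
      fix g assume "g \<in> h ` carrier ?A"
      then obtain w u v p x y m where "g = h (w, aff u v p x y m)" "aff u v p x y m \<in> KA" using elem by blast
      then have "g \<in> ?S" unfolding h by blast
      then show "g \<in> carrier (H\<lparr>carrier := ?S\<rparr>)" by simp
    next
      fix z z' assume "z \<in> carrier ?A" "z' \<in> carrier ?A"
      then obtain w u v p x y m w' u' v' p' x' y' m' where z: "z = (w, aff u v p x y m)" "aff u v p x y m \<in> KA"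
        and z': "z' = (w', aff u' v' p' x' y' m')" "aff u' v' p' x' y' m' \<in> KA" using elem by meson
      have d2: "(p * m - x * y) ^ 2 = 1" using det[OF z(2)] .
      have "z \<otimes>\<^bsub>?A\<^esub> z' = (w + w', aff (u + p * u' + x * v') (v + y * u' + m * v')
          (p * p' + x * y') (p * x' + x * m') (y * p' + m * y') (y * x' + m * m'))"
        unfolding z z' by (simp add: aff_mult)
      then have "h (z \<otimes>\<^bsub>?A\<^esub> z') = s1 id ((p * m - x * y) * (p' * m' - x' * y'))
          (p * p' + x * y') (p * x' + x * m') (y * p' + m * y') (y * x' + m * m')
          (u + p * u' + x * v') (v + y * u' + m * v') (w + w')"
        by (simp only: h det_mult)
      also have "\<dots> = h z' \<otimes> h z"
        unfolding z(1) z'(1) h s1_mult_id[OF ok[OF z'(2)] ok[OF z(2)]] d2 by (simp add: add_ac)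
      finally show "h (z \<otimes>\<^bsub>?A\<^esub> z') = h z' \<otimes>\<^bsub>H\<lparr>carrier := ?S\<rparr>\<^esub> h z" by simp
    qed
    show "bij_betw h (carrier ?A) (carrier (H\<lparr>carrier := ?S\<rparr>))"
    proof (rule bij_betwI')
      fix z z' assume "z \<in> carrier ?A" "z' \<in> carrier ?A"
      then obtain w u v p x y m w' u' v' p' x' y' m' where z: "z = (w, aff u v p x y m)" "aff u v p x y m \<in> KA"
        and z': "z' = (w', aff u' v' p' x' y' m')" "aff u' v' p' x' y' m' \<in> KA" using elem by meson
      show "(h z = h z') = (z = z')"
        unfolding z(1) z'(1) h s1_inj[OF ok[OF z(2)] ok[OF z'(2)]] by (auto simp: aff_eq_iff)
    next
      fix z assume "z \<in> carrier ?A"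
      then obtain w u v p x y m where z: "z = (w, aff u v p x y m)" "aff u v p x y m \<in> KA" using elem by blast
      then have "h z \<in> ?S" unfolding z(1) h by blast
      then show "h z \<in> carrier (H\<lparr>carrier := ?S\<rparr>)" by simp
    next
      fix g assume "g \<in> carrier (H\<lparr>carrier := ?S\<rparr>)"
      then obtain p x y m u v w where g: "g = s1 id (p * m - x * y) p x y m u v w" "aff u v p x y m \<in> KA" by auto
      then show "\<exists>z\<in>carrier ?A. g = h z" by (intro bexI[of _ "(w, aff u v p x y m)"]) (simp_all add: h)
    qed
  qed
qed

lemma L1s_iso: "H\<lparr>carrier := L1s\<rparr> \<cong> (additive_group :: 'a monoid) \<times>\<times> (ASL :: (('a^2) \<times> ('a^2^2)) monoid)"
proof -
  have "L1s = {s1 id (p * m - x * y) p x y m u v w | p x y m u v w. aff u v p x y m \<in> {(v, A). det A = 1}}"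
    unfolding aff_SL L1s_def by (intro Collect_cong) metis
  moreover have "(p * m - x * y) ^ 2 = 1" if "aff u v p x y m \<in> {(v, A). det A = 1}" for u v p x y m :: 'a
    using that unfolding aff_SL by simp
  ultimately show ?thesis unfolding ASL_eq using iso_affine[OF SL_subgroup] by simp
qed

lemma card_L1s: "card L1s = CARD('a) ^ 4 * (CARD('a) ^ 2 - 1)"
  using iso_same_card[OF L1s_iso] card_ASL by (simp add: Coset.order_def card_cartesian_product eval_nat_numeral)

text \<open>\<open>L1s\<close> has order \<open>q ^ 4 * (q ^ 2 - 1)\<close>, where the second factor
  is prime to 3.\<close>

lemma VCF_Syl: "VCF \<in> Syl 3 (H\<lparr>carrier := L1s\<rparr>)"
proof -
  have "subgroup VCF (H\<lparr>carrier := L1s\<rparr>)"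
    using subgroup_incl[OF VCF_subgroup L1s_subgroup VF_L1s(2)] .
  then show ?thesis
    using multiplicity_card[OF not_3_dvd_square, of 4] by (simp add: Syl_def Coset.order_def card_L1s card_VCF)
qed

lemma DirProd_cong:
  assumes "group (K1 :: ('x, 'y) monoid_scheme)" "K1 \<cong> K2"
  shows "(additive_group :: 'a monoid) \<times>\<times> K1 \<cong> (additive_group :: 'a monoid) \<times>\<times> K2"
  by (rule group.DirProd_iso_trans[OF additive_group_group iso_refl assms(2)])

lemma LBs_iso:
  assumes S0: "S0 \<in> Syl 3 (ASL :: (('a^2) \<times> ('a^2^2)) monoid)"
  shows "H\<lparr>carrier := LBs\<rparr> \<cong> (additive_group :: 'a monoid) \<times>\<times> ASL2_S0 S0"
proof -
  let ?K = "{aff u v p x 0 m | u v p x m. p * m = (1::'a)}"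
  \<comment> \<open>Any admissible pair of index and exponent gives access to the statement of
    \<open>index_K2\<close> on Sylow normalizers; exponent 1 is the simplest.\<close>
  have d: "(CARD('a) - 1) * 1 = CARD('a) - 1" "card {a::'a. a ^ 1 = 1} = 1" by simp_all
  have K: "subgroup ?K AGL"
  proof (rule group.finite_subgroupI[OF AGL_group finite_AGL])
    show "?K \<subseteq> carrier AGL" by (auto simp: aff_carrier)
    have "(1::'a) * 1 = 1" by simp
    then show "?K \<noteq> {}" by blast
    fix g h assume "g \<in> ?K" "h \<in> ?K"
    then obtain u v p x m u' v' p' x' m' where g: "g = aff u v p x 0 m" "p * m = 1"
      and h: "h = aff u' v' p' x' 0 m'" "p' * m' = 1" by blast
    have "g \<otimes>\<^bsub>AGL\<^esub> h = aff (u + p * u' + x * v') (v + m * v') (p * p') (p * x' + x * m') 0 (m * m')"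
      unfolding g h by (simp add: aff_mult)
    moreover have "(p * p') * (m * m') = (p * m) * (p' * m')" by (simp add: mult_ac)
    then have "(p * p') * (m * m') = 1" using g h by simp
    ultimately show "g \<otimes>\<^bsub>AGL\<^esub> h \<in> ?K" by blast
  qed
  have "LBs = {s1 id (p * m - x * y) p x y m u v w | p x y m u v w. aff u v p x y m \<in> ?K}" (is "_ = ?R")
  proof (intro equalityI subsetI)
    fix g assume "g \<in> LBs"
    then obtain t e u v w where g: "g = s2 id 1 t 0 e u v w" "t \<noteq> 0" unfolding LBs_def by blast
    have "t * (1 / t) = 1" using g(2) by simp
    then have "aff u v t e 0 (1 / t) \<in> ?K" "t * (1 / t) - e * 0 = 1" by (blast, simp)
    moreover have "g = s1 id 1 t e 0 (1 / t) u v w" using s2_0[OF JP_one g(2)] g(1) by simp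
    ultimately have "g = s1 id (t * (1 / t) - e * 0) t e 0 (1 / t) u v w \<and> aff u v t e 0 (1 / t) \<in> ?K" by simp
    then show "g \<in> ?R" by blast
  next
    fix g assume "g \<in> ?R"
    then obtain p x y m u v w where g: "g = s1 id (p * m - x * y) p x y m u v w" "aff u v p x y m \<in> ?K" by blast
    then have y: "y = 0" "p * m = 1" by (auto simp: aff_eq_iff)
    then have "p \<noteq> 0" by auto
    with y have p: "p \<noteq> 0" "m = 1 / p" by (simp_all add: eq_divide_eq mult.commute)
    have "g = s1 id 1 p x 0 (1 / p) u v w" using g(1) y p by simp
    then have "g = s2 id 1 p 0 x u v w" using s2_0[OF JP_one p(1)] by simp
    then show "g \<in> LBs" unfolding LBs_def using p by blast
  qed
  moreover have "(p * m - x * y) ^ 2 = 1" if "aff u v p x y m \<in> ?K" for u v p x y m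
    using that by (auto simp: aff_eq_iff)
  ultimately have "H\<lparr>carrier := LBs\<rparr> \<cong> (additive_group :: 'a monoid) \<times>\<times> AGL\<lparr>carrier := ?K\<rparr>"
    using iso_affine[OF K] by simp
  also have "\<dots> \<cong> (additive_group :: 'a monoid) \<times>\<times> ASL2_S0 S0"
    by (rule DirProd_cong[OF group.subgroup_imp_group[OF AGL_group K] index_K2(3)[OF S0 d]])
  finally show ?thesis .
qed

lemma KK_iff: "aff u v p x y m \<in> KK n \<longleftrightarrow> y = 0 \<and> p = m ^ 2 \<and> m \<noteq> 0 \<and> m ^ n = 1"
  unfolding KK_def mem_Collect_eq aff_eq_iff by blast

lemma det3: "(\<nu>::'a) ^ 2 = 1 \<Longrightarrow> \<nu> ^ 3 = \<nu>"
  by (simp add: power3_eq_cube power2_eq_square)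

lemma half_index: "(CARD('a) - 1) div 2 * 2 = CARD('a) - 1" "card {a::'a. a ^ 2 = 1} = 2"
  using half card_square_roots by auto

text \<open>The subgroup of AGL_2 of index \<open>(q - 1) / 2\<close> is where the determinant
  squares to 1, and by \<open>det3\<close> this determinant is \<nu> itself.\<close>

lemma H1c_centralizer_iso: "H\<lparr>carrier := centralizer (H\<lparr>carrier := H1c\<rparr>) FF\<rparr> \<cong>
    (additive_group :: 'a monoid) \<times>\<times> index_subgroup (AGL :: (('a^2) \<times> ('a^2^2)) monoid) ((CARD('a) - 1) div 2)"
proof -
  let ?K = "{(v :: 'a^2, A :: 'a^2^2). det A \<noteq> 0 \<and> det A ^ 2 = 1}"
  have K: "subgroup ?K AGL"
  proof (rule group.finite_subgroupI[OF AGL_group finite_AGL])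
    have "(0, mat 1) \<in> ?K" by simp
    then show "?K \<noteq> {}" by blast
  qed (auto simp: AGL_carrier invertible_det_nz det_mul power_mult_distrib)
  have mem: "aff u v p x y m \<in> ?K \<longleftrightarrow> (p * m - x * y) ^ 2 = 1" for u v p x y m
    by (auto simp: aff_def det_mat2 power2_eq_square)
  have "{s1 id \<nu> p x y m u v w | \<nu> p x y m u v w. \<nu> ^ 2 = 1 \<and> p * m - x * y = \<nu> ^ 3} =
      {s1 id (p * m - x * y) p x y m u v w | p x y m u v w. aff u v p x y m \<in> ?K}"
    unfolding mem using det3 by (intro Collect_cong) metis
  then have "H\<lparr>carrier := centralizer (H\<lparr>carrier := H1c\<rparr>) FF\<rparr> \<cong> (additive_group :: 'a monoid) \<times>\<times> AGL\<lparr>carrier := ?K\<rparr>"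
    unfolding centralizer_H1c using iso_affine[OF K] mem by simp
  then show ?thesis unfolding index_AGL2[OF half_index] .
qed

text \<open>At \<open>t = 1\<close> and \<open>D = 0\<close> the matrix is triangular with diagonal
  \<open>(\<nu> ^ 2, \<nu>)\<close>, the shape that defines \<open>KK\<close>, and
  \<open>\<nu> ^ 2 = 1\<close> selects \<open>KK 2\<close>.\<close>

lemma H2c_centralizer_iso:
  assumes S0: "S0 \<in> Syl 3 (ASL :: (('a^2) \<times> ('a^2^2)) monoid)"
  shows "H\<lparr>carrier := centralizer (H\<lparr>carrier := H2c\<rparr>) (center (H\<lparr>carrier := VCF\<rparr>))\<rparr> \<cong>
    (additive_group :: 'a monoid) \<times>\<times> index_subgroup (K2_S0 S0) ((CARD('a) - 1) div 2)"
proof -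
  have KK: "group (AGL\<lparr>carrier := KK 2\<rparr>)" by (rule group.subgroup_imp_group[OF AGL_group KK_subgroup])
  have "{s2 id \<nu> 1 0 e u v w | \<nu> e u v w. \<nu> ^ 2 = 1} =
      {s1 id (p * m - x * y) p x y m u v w | p x y m u v w. aff u v p x y m \<in> KK 2}" (is "?L = ?R")
  proof (intro equalityI subsetI)
    fix g assume "g \<in> ?L"
    then obtain \<nu> e u v w where g: "g = s2 id \<nu> 1 0 e u v w" "\<nu> ^ 2 = 1" by blast
    then have J: "(\<nu>, id) \<in> JP" using square_root_Y_JP by blast
    have "\<nu> \<noteq> 0" using JP_nz J by blast
    then have "aff u v (\<nu> ^ 2) e 0 \<nu> \<in> KK 2" unfolding KK_def using g(2) by blast
    moreover have d: "\<nu> ^ 2 * \<nu> - e * 0 = \<nu>" using g(2) by simp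
    have "g = s1 id \<nu> (\<nu> ^ 2) e 0 \<nu> u v w" using g(1) s2_0[OF J one_nz] by simp
    then have "g = s1 id (\<nu> ^ 2 * \<nu> - e * 0) (\<nu> ^ 2) e 0 \<nu> u v w" unfolding d .
    ultimately show "g \<in> ?R" by blast
  next
    fix g assume "g \<in> ?R"
    then obtain p x y m u v w where g: "g = s1 id (p * m - x * y) p x y m u v w" "aff u v p x y m \<in> KK 2" by blast
    from g(2) have m: "y = 0" "p = m ^ 2" "m ^ 2 = 1" unfolding KK_iff by blast+
    then have J: "(m, id) \<in> JP" using square_root_Y_JP by blast
    have "g = s1 id m (m ^ 2 * 1) x 0 (m / 1) u v w" using g(1) m by simp
    then have "g = s2 id m 1 0 x u v w" using s2_0[OF J one_nz] by simp
    then show "g \<in> ?L" using m by blast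
  qed
  moreover have "(p * m - x * y) ^ 2 = 1" if "aff u v p x y m \<in> KK 2" for u v p x y m
  proof -
    have "y = 0" "p = m ^ 2" "m ^ 2 = 1" using that unfolding KK_iff by blast+
    then show ?thesis by simp
  qed
  ultimately have "H\<lparr>carrier := centralizer (H\<lparr>carrier := H2c\<rparr>) (center (H\<lparr>carrier := VCF\<rparr>))\<rparr> \<cong>
      (additive_group :: 'a monoid) \<times>\<times> AGL\<lparr>carrier := KK 2\<rparr>"
    unfolding centralizer_H2c using iso_affine[OF KK_subgroup] by simp
  also have "AGL\<lparr>carrier := KK 2\<rparr> \<cong> index_subgroup (K2_S0 S0) ((CARD('a) - 1) div 2)"
  proof -
    have "index_subgroup (K2_S0 S0) ((CARD('a) - 1) div 2) \<cong> AGL\<lparr>carrier := KK 2\<rparr>"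
      by (rule index_K2(2)[OF S0 half_index])
    moreover have "group (index_subgroup (K2_S0 S0) ((CARD('a) - 1) div 2))"
      by (rule index_K2(1)[OF S0 half_index])
    ultimately show ?thesis using group.iso_sym by blast
  qed
  then have "(additive_group :: 'a monoid) \<times>\<times> AGL\<lparr>carrier := KK 2\<rparr> \<cong>
      (additive_group :: 'a monoid) \<times>\<times> index_subgroup (K2_S0 S0) ((CARD('a) - 1) div 2)"
    by (rule DirProd_cong[OF KK])
  finally show ?thesis .
qed

definition dY :: nat where "dY = (CARD('a) - 1) div card Y"

lemma dY: "dY * card Y = CARD('a) - 1" "dY dvd CARD('a) - 1"
  using card_Y(1) by (auto simp: dY_def)

text \<open>Dropping the third translation coordinate leaves the triangular affine maps with
  diagonal \<open>(\<nu> ^ 2, \<nu>)\<close> and \<nu> in \<open>Y\<close>, which are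
  \<open>KK (card Y)\<close>; what is dropped is \<open>FF\<close>.\<close>

lemma T2s_quotient:
  assumes S0: "S0 \<in> Syl 3 (ASL :: (('a^2) \<times> ('a^2^2)) monoid)"
  shows "FF \<lhd> H\<lparr>carrier := T2s\<rparr>" "H\<lparr>carrier := T2s\<rparr> Mod FF \<cong> index_subgroup (K2_S0 S0) dY"
proof -
  let ?K = "AGL\<lparr>carrier := KK (card Y)\<rparr> :: (('a^2) \<times> ('a^2^2)) monoid"
  have K: "group ?K" by (rule group.subgroup_imp_group[OF AGL_group KK_subgroup])
  have G: "group (H\<lparr>carrier := T2s\<rparr>)" by (rule subgroup_imp_group[OF T2s_subgroup])
  define E where "E = (\<lambda>(u, v, x, m, w). s2 id m 1 0 x u v w)"
  define k where "k = (\<lambda>(u :: 'a, v, x, m, w :: 'a). aff u v (m ^ 2) x 0 m)"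
  let ?P = "UNIV \<times> UNIV \<times> UNIV \<times> Y \<times> (UNIV :: 'a set)"
  have E: "carrier (H\<lparr>carrier := T2s\<rparr>) = E ` ?P" by (force simp: T2s_def E_def)
  have Y': "m \<in> Y \<longleftrightarrow> m \<noteq> 0 \<and> m ^ card Y = 1" for m using Y_I Y_D Y_nz by blast
  have kP: "carrier ?K = k ` ?P"
  proof (intro equalityI subsetI)
    fix g assume "g \<in> carrier ?K"
    then obtain u v x m where g: "g = aff u v (m ^ 2) x 0 m" "m \<in> Y" unfolding Y' by (auto simp: KK_def)
    then have "g = k (u, v, x, m, 0)" "(u, v, x, m, 0) \<in> ?P" by (simp_all add: k_def)
    then show "g \<in> k ` ?P" by (rule image_eqI)
  next
    fix g assume "g \<in> k ` ?P"
    then obtain u v x m w where "g = k (u, v, x, m, w)" "m \<in> Y" by blast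
    then show "g \<in> carrier ?K" unfolding Y' by (auto simp: k_def KK_def)
  qed
  have wd: "k p = k p'" if "p \<in> ?P" "p' \<in> ?P" "E p = E p'" for p p'
    using that by (auto simp: E_def k_def s2_inj Y_JP)
  have mult: "\<exists>p''\<in>?P. E p \<otimes>\<^bsub>H\<lparr>carrier := T2s\<rparr>\<^esub> E p' = E p'' \<and> k p'' = k p' \<otimes>\<^bsub>?K\<^esub> k p"
    if pP: "p \<in> ?P" "p' \<in> ?P" for p p'
  proof -
    obtain u v x m w u' v' x' m' w' where p: "p = (u, v, x, m, w)" "m \<in> Y" and p': "p' = (u', v', x', m', w')" "m' \<in> Y"
      using pP by blast
    let ?p = "(m' ^ 2 * u + x' * v + u', m' * v + v', m' ^ 2 * x + x' * m, m' * m, m' ^ 2 * w + w')"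
    have "E p \<otimes> E p' = E ?p"
      unfolding p p' E_def prod.case s2_mult_0[OF p(2) p'(2) one_nz one_nz] by simp
    moreover have "k ?p = k p' \<otimes>\<^bsub>AGL\<^esub> k p"
      unfolding p p' k_def prod.case KK_mult by (simp add: aff_eq_iff algebra_simps)
    moreover have "?p \<in> ?P" using Y_props(3)[OF p'(2) p(2)] by simp
    ultimately show ?thesis by (intro bexI[of _ ?p]) simp_all
  qed
  have ker: "E ` {p \<in> ?P. k p = \<one>\<^bsub>?K\<^esub>} = FF"
  proof (intro equalityI subsetI)
    fix g assume "g \<in> E ` {p \<in> ?P. k p = \<one>\<^bsub>?K\<^esub>}"
    then obtain u v x m w where g: "g = E (u, v, x, m, w)" "k (u, v, x, m, w) = \<one>\<^bsub>?K\<^esub>" by blast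
    then have "u = 0 \<and> v = 0 \<and> x = 0 \<and> m = 1" by (simp add: k_def aff_one aff_eq_iff)
    then show "g \<in> FF" unfolding g(1) FF_def E_def by auto
  next
    fix g assume "g \<in> FF"
    then obtain w where g: "g = s2 id 1 1 0 0 0 0 w" unfolding FF_def by blast
    then have "g = E (0, 0, 0, 1, w)" by (simp add: E_def)
    moreover have "(0, 0, 0, 1, w) \<in> {p \<in> ?P. k p = \<one>\<^bsub>?K\<^esub>}" using Y_props by (simp add: k_def aff_one)
    ultimately show "g \<in> E ` {p \<in> ?P. k p = \<one>\<^bsub>?K\<^esub>}" by (rule image_eqI)
  qed
  show "FF \<lhd> H\<lparr>carrier := T2s\<rparr>"
    using Mod_iso_params_anti(2)[OF G K E kP wd mult] unfolding ker .
  have "H\<lparr>carrier := T2s\<rparr> Mod FF \<cong> ?K"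
    using Mod_iso_params_anti(1)[OF G K E kP wd mult] unfolding ker .
  also have "?K \<cong> index_subgroup (K2_S0 S0) dY"
    using group.iso_sym[OF index_K2(1)[OF S0 dY(1) Y_roots(2)] index_K2(2)[OF S0 dY(1) Y_roots(2)]] .
  finally show "H\<lparr>carrier := T2s\<rparr> Mod FF \<cong> index_subgroup (K2_S0 S0) dY" .
qed

text \<open>Only the map \<open>x \<mapsto> \<nu> * f x\<close> is kept; it is trivial when
  \<open>\<nu> = 1\<close> and \<open>f = id\<close>, and then the determinant is 1. Products keep
  their order here, since \<open>AGammaL1\<close> also composes from left to right.\<close>

lemma A1_quotient: "H\<lparr>carrier := A1\<rparr> Mod L1s \<cong>
    AGammaL1\<lparr>carrier := stabilizer (AGammaL1\<lparr>carrier := PJ\<rparr>) (\<lambda>g y. g y) 0\<rparr>"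
proof -
  let ?C = "{(\<lambda>x. \<nu> * f x) | \<nu> f. (\<nu>, f) \<in> JP}"
  let ?K = "AGammaL1\<lparr>carrier := ?C\<rparr> :: ('a \<Rightarrow> 'a) monoid"
  have comp: "(\<lambda>x. \<nu>' * f' x) \<circ> (\<lambda>x. \<nu> * f x) = (\<lambda>x. (\<nu>' * f' \<nu>) * (f' \<circ> f) x)" if "(\<nu>', f') \<in> JP" for \<nu> f \<nu>' f'
    using frob_simps(2)[OF JP_frob[OF that]] by (simp add: fun_eq_iff)
  have Csub: "subgroup ?C AGammaL1"
  proof (rule group.finite_subgroupI[OF AGammaL1_group])
    show "?C \<subseteq> carrier AGammaL1"
      using PJ_stabilizer subgroup.subset[OF PJ_subgroup] by (auto simp: stabilizer_def)
    show "?C \<noteq> {}" using JP_one by blast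
    fix g h assume "g \<in> ?C" "h \<in> ?C"
    then obtain \<nu> f \<nu>' f' where "g = (\<lambda>x. \<nu> * f x)" "(\<nu>, f) \<in> JP" "h = (\<lambda>x. \<nu>' * f' x)" "(\<nu>', f') \<in> JP" by blast
    then show "g \<otimes>\<^bsub>AGammaL1\<^esub> h \<in> ?C" unfolding AGammaL1_mult using comp JP_mult by blast
  qed simp
  have K: "group ?K" by (rule group.subgroup_imp_group[OF AGammaL1_group Csub])
  have G: "group (H\<lparr>carrier := A1\<rparr>)" by (rule subgroup_imp_group[OF A1_subgroup])
  define E where "E = (\<lambda>(f, \<nu>, p, x, y, m, u, v, w). s1 f \<nu> p x y m u v w)"
  define k :: "_ \<Rightarrow> 'a \<Rightarrow> 'a" where "k = (\<lambda>(f, \<nu>, p :: 'a, x :: 'a, y :: 'a, m :: 'a, u :: 'a, v :: 'a, w :: 'a) z. \<nu> * f z)"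
  let ?P = "{(f, \<nu>, p, x, y, m, u, v, w). ok1 f \<nu> p x y m}"
  have E: "carrier (H\<lparr>carrier := A1\<rparr>) = E ` ?P" by (force simp: A1_def E_def)
  have kP: "carrier ?K = k ` ?P"
  proof (intro equalityI subsetI)
    fix g assume "g \<in> carrier ?K"
    then obtain \<nu> f where g: "g = (\<lambda>x. \<nu> * f x)" "(\<nu>, f) \<in> JP" by auto
    then have "g = k (f, \<nu>, \<nu> ^ 2 * 1, 0, 0, \<nu> / 1, 0, 0, 0)" "(f, \<nu>, \<nu> ^ 2 * 1, 0, 0, \<nu> / 1, 0, 0, 0) \<in> ?P"
      using ok1_s2[OF g(2) one_nz] by (simp_all add: k_def)
    then show "g \<in> k ` ?P" by (rule image_eqI)
  next
    fix g assume "g \<in> k ` ?P"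
    then obtain f \<nu> p x y m u v w where "g = k (f, \<nu>, p, x, y, m, u, v, w)" "ok1 f \<nu> p x y m" by blast
    then show "g \<in> carrier ?K" by (auto simp: k_def ok1_def)
  qed
  have wd: "k p = k p'" if "p \<in> ?P" "p' \<in> ?P" "E p = E p'" for p p'
    using that by (auto simp: E_def k_def s1_inj)
  have mult: "\<exists>p''\<in>?P. E p \<otimes>\<^bsub>H\<lparr>carrier := A1\<rparr>\<^esub> E p' = E p'' \<and> k p'' = k p \<otimes>\<^bsub>?K\<^esub> k p'"
    if pP: "p \<in> ?P" "p' \<in> ?P" for p p'
  proof -
    obtain f \<nu> a x y m u v w f' \<nu>' a' x' y' m' u' v' w' where p: "p = (f, \<nu>, a, x, y, m, u, v, w)" "ok1 f \<nu> a x y m"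
      and p': "p' = (f', \<nu>', a', x', y', m', u', v', w')" "ok1 f' \<nu>' a' x' y' m'" using pP by blast
    let ?p = "(f' \<circ> f, \<nu>' * f' \<nu>, a' * f' a + x' * f' y, a' * f' x + x' * f' m, y' * f' a + m' * f' y, y' * f' x + m' * f' m,
      a' * f' u + x' * f' v + u', y' * f' u + m' * f' v + v', \<nu>' ^ 2 * f' w + w')"
    have "E p \<otimes> E p' = E ?p" unfolding p p' E_def prod.case s1_mult[OF p(2) p'(2)] ..
    moreover have "k ?p = k p' \<circ> k p"
      using comp[of \<nu>' f' \<nu> f] p'(2) unfolding p p' k_def prod.case by (simp add: ok1_def)
    moreover have "?p \<in> ?P" using ok1_mult[OF p(2) p'(2)] by simp
    ultimately show ?thesis by (intro bexI[of _ ?p]) (simp_all add: AGammaL1_mult)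
  qed
  have one: "\<one>\<^bsub>?K\<^esub> = id" by (simp add: AGammaL1_def)
  have ker: "E ` {p \<in> ?P. k p = \<one>\<^bsub>?K\<^esub>} = L1s"
  proof (intro equalityI subsetI)
    fix g assume "g \<in> E ` {p \<in> ?P. k p = \<one>\<^bsub>?K\<^esub>}"
    then obtain f \<nu> p x y m u v w where g: "g = E (f, \<nu>, p, x, y, m, u, v, w)" "ok1 f \<nu> p x y m"
      "k (f, \<nu>, p, x, y, m, u, v, w) = id" unfolding one by blast
    have all: "\<nu> * f z = z" for z using g(3) by (simp add: k_def fun_eq_iff)
    have "f 1 = 1" using g(2) frob_simps(4)[OF JP_frob] by (auto simp: ok1_def)
    then have "\<nu> = 1" using all[of 1] by simp
    moreover from this have "f = id" using all by (simp add: fun_eq_iff)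
    ultimately have "g = s1 id 1 p x y m u v w" "p * m - x * y = 1" using g by (simp_all add: E_def ok1_def)
    then show "g \<in> L1s" unfolding L1s_def by blast
  next
    fix g assume "g \<in> L1s"
    then obtain p x y m u v w where g: "g = s1 id 1 p x y m u v w" "p * m - x * y = 1" unfolding L1s_def by blast
    then have "g = E (id, 1, p, x, y, m, u, v, w)" by (simp add: E_def)
    moreover have "(id, 1, p, x, y, m, u, v, w) \<in> {p \<in> ?P. k p = \<one>\<^bsub>?K\<^esub>}"
      unfolding one using g(2) Y_props by (simp add: k_def ok1_id fun_eq_iff)
    ultimately show "g \<in> E ` {p \<in> ?P. k p = \<one>\<^bsub>?K\<^esub>}" by (rule image_eqI)
  qed
  show ?thesis
    using Mod_iso_params(1)[OF G K E kP wd mult] unfolding ker PJ_stabilizer .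
qed

text \<open>The matrix determines \<nu> as the unique cube root \<open>det A ^ eps\<close> of its
  determinant, so the elements without translation form a copy of the matrix group. \<kappa>
  transposes the matrix to match composition from left to right.\<close>

lemma H1c_semidirect:
  "is_semidirect (H\<lparr>carrier := H1c\<rparr>) (additive_group :: ('a^3) monoid) (index_subgroup (GL :: ('a^2^2) monoid) dY)"
proof -
  let ?K = "{A :: 'a^2^2. det A \<noteq> 0 \<and> det A ^ card Y = 1}"
  have idx: "index_subgroup (GL :: ('a^2^2) monoid) dY = GL\<lparr>carrier := ?K\<rparr>"
    by (rule index_GL2[OF dY(1) Y_roots(2)])
  have K: "subgroup ?K GL"
  proof (rule group.finite_subgroupI[OF GL_group])
    have "mat 1 \<in> ?K" by simp
    then show "?K \<noteq> {}" by blast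
  qed (auto simp: invertible_det_nz det_mul power_mult_distrib)
  interpret G: group "H\<lparr>carrier := H1c\<rparr>" by (rule subgroup_imp_group[OF H1c_subgroup])
  define \<iota> :: "'a^3 \<Rightarrow> 'h" where "\<iota> v = s2 id 1 1 0 0 (v $ 1) (v $ 2) (v $ 3)" for v
  define \<kappa> :: "'a^2^2 \<Rightarrow> 'h" where "\<kappa> A = s1 id (det A ^ eps) (A$1$1) (A$2$1) (A$1$2) (A$2$2) 0 0 0" for A
  have ok: "ok1 id (det A ^ eps) (A$1$1) (A$2$1) (A$1$2) (A$2$2)" if "A \<in> ?K" for A
  proof -
    have "(det A ^ eps) ^ card Y = (det A ^ card Y) ^ eps" by (simp add: mult.commute flip: power_mult)
    then have "det A ^ eps \<in> Y" using that by (intro Y_I) simp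
    moreover have "(A$1$1) * (A$2$2) - (A$2$1) * (A$1$2) = (det A ^ eps) ^ 3"
      unfolding eps_cube(1) by (simp add: det_2 mult.commute)
    ultimately show ?thesis by (simp add: ok1_id)
  qed
  have \<kappa>c: "\<kappa> A \<in> H1c" if "A \<in> ?K" for A unfolding \<kappa>_def H1c_def using ok[OF that] by blast
  have \<iota>_img: "\<iota> ` UNIV = VF"
  proof (intro equalityI subsetI)
    fix g assume "g \<in> VF"
    then obtain u v w where "g = s2 id 1 1 0 0 u v w" unfolding VF_def by blast
    then have "g = \<iota> (vector [u, v, w])" by (simp add: \<iota>_def)
    then show "g \<in> \<iota> ` UNIV" by blast
  qed (auto simp: \<iota>_def VF_def)
  have VFn: "VF \<lhd> H\<lparr>carrier := H1c\<rparr>"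
    using VF_L1s L1s_sub H1c_sub by (intro VF_normal H1c_subgroup) blast+
  have VFsub: "VF \<subseteq> H1c" using VF_L1s L1s_sub by blast
  show ?thesis
    unfolding idx
  proof (rule G.is_semidirectI[of _ _ \<iota> \<kappa>])
    show "group (additive_group :: ('a^3) monoid)" by (rule additive_group_group)
    show "group (GL\<lparr>carrier := ?K\<rparr>)" by (rule group.subgroup_imp_group[OF GL_group K])
    show "\<iota> \<in> hom additive_group (H\<lparr>carrier := H1c\<rparr>)"
      using \<iota>_img VFsub by (auto simp: hom_def) (simp add: \<iota>_def s2_mult_0 Y_props)
    show "inj_on \<iota> (carrier additive_group)"
      by (rule inj_onI) (auto simp: \<iota>_def s2_inj JP_one vec_eq_iff forall_3)
    show "\<kappa> \<in> hom (GL\<lparr>carrier := ?K\<rparr>) (H\<lparr>carrier := H1c\<rparr>)"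
    proof (rule homI)
      fix A assume "A \<in> carrier (GL\<lparr>carrier := ?K\<rparr>)"
      then show "\<kappa> A \<in> carrier (H\<lparr>carrier := H1c\<rparr>)" using \<kappa>c by simp
    next
      fix A A' assume "A \<in> carrier (GL\<lparr>carrier := ?K\<rparr>)" "A' \<in> carrier (GL\<lparr>carrier := ?K\<rparr>)"
      then have A: "A \<in> ?K" "A' \<in> ?K" by simp_all
      have e: "(A ** A') $ i $ j = A $ i $ 1 * A' $ 1 $ j + A $ i $ 2 * A' $ 2 $ j" for i j
        by (simp add: matrix_matrix_mult_def sum_2)
      have "\<kappa> (A ** A') = \<kappa> A \<otimes> \<kappa> A'"
        unfolding \<kappa>_def s1_mult_id[OF ok[OF A(1)] ok[OF A(2)]]
        by (simp add: det_mul power_mult_distrib e mult_ac)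
      then show "\<kappa> (A \<otimes>\<^bsub>GL\<lparr>carrier := ?K\<rparr>\<^esub> A') = \<kappa> A \<otimes>\<^bsub>H\<lparr>carrier := H1c\<rparr>\<^esub> \<kappa> A'" by simp
    qed
    show "inj_on \<kappa> (carrier (GL\<lparr>carrier := ?K\<rparr>))"
    proof (rule inj_onI)
      fix A A' assume "A \<in> carrier (GL\<lparr>carrier := ?K\<rparr>)" "A' \<in> carrier (GL\<lparr>carrier := ?K\<rparr>)" and eq: "\<kappa> A = \<kappa> A'"
      then have A: "A \<in> ?K" "A' \<in> ?K" by simp_all
      from eq[unfolded \<kappa>_def s1_inj[OF ok[OF A(1)] ok[OF A(2)]]] show "A = A'" by (simp add: vec_eq_iff forall_2)
    qed
    show "\<iota> ` carrier additive_group \<lhd> H\<lparr>carrier := H1c\<rparr>" using VFn \<iota>_img by simp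
    show "\<iota> ` carrier additive_group \<inter> \<kappa> ` carrier (GL\<lparr>carrier := ?K\<rparr>) \<subseteq> {\<one>\<^bsub>H\<lparr>carrier := H1c\<rparr>\<^esub>}"
    proof
      fix g assume g: "g \<in> \<iota> ` carrier additive_group \<inter> \<kappa> ` carrier (GL\<lparr>carrier := ?K\<rparr>)"
      then have "g \<in> VF" using \<iota>_img by simp
      then obtain u v w where g1: "g = s1 id 1 1 0 0 1 u v w" unfolding VF_def s2_trans(1) by blast
      obtain A where A: "A \<in> ?K" "g = \<kappa> A" using g by auto
      have "s1 id 1 1 0 0 1 u v w = s1 id (det A ^ eps) (A$1$1) (A$2$1) (A$1$2) (A$2$2) 0 0 0"
        using g1 A(2) \<kappa>_def by simp
      then have "u = 0 \<and> v = 0 \<and> w = 0" unfolding s1_inj[OF s2_trans(2) ok[OF A(1)]] by blast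
      then show "g \<in> {\<one>\<^bsub>H\<lparr>carrier := H1c\<rparr>\<^esub>}" using g1 one_eq_s1 by simp
    qed
    fix g assume "g \<in> carrier (H\<lparr>carrier := H1c\<rparr>)"
    then obtain \<nu> p x y m u v w where g: "g = s1 id \<nu> p x y m u v w" "\<nu> \<in> Y" "p * m - x * y = \<nu> ^ 3"
      unfolding H1c_def ok1_id by auto
    have okg: "ok1 id \<nu> p x y m" using g by (simp add: ok1_id)
    \<comment> \<open>The off-diagonal entries change places because \<kappa> transposes.\<close>
    define A where "A = mat2 p y x m"
    have dA: "det A = \<nu> ^ 3" using g(3) by (simp add: A_def det_mat2 mult.commute)
    then have dA': "det A ^ eps = \<nu>" by (simp add: eps_cube)
    have A: "A \<in> ?K" using g(2) Y_nz Y_D Y_pow[OF g(2), of 3] by (simp add: dA)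
    have "s2 id 1 1 0 0 u v w \<in> VF" unfolding VF_def by blast
    moreover have "g = \<kappa> A \<otimes> s2 id 1 1 0 0 u v w"
      unfolding \<kappa>_def dA' s2_trans(1) using g(1) s1_mult_id[OF okg s2_trans(2)] by (simp add: A_def)
    ultimately obtain n where "n \<in> VF" and n: "g = n \<otimes> \<kappa> A"
      using G.normal_swap[OF VFn, of _ "\<kappa> A"] \<kappa>c[OF A] by auto
    then obtain a where "n = \<iota> a" using \<iota>_img by blast
    then have "g = \<iota> a \<otimes>\<^bsub>H\<lparr>carrier := H1c\<rparr>\<^esub> \<kappa> A" using n by simp
    moreover have "a \<in> carrier additive_group" "A \<in> carrier (GL\<lparr>carrier := ?K\<rparr>)" using A by simp_all
    ultimately show "\<exists>n\<in>carrier additive_group. \<exists>k\<in>carrier (GL\<lparr>carrier := ?K\<rparr>). g = \<iota> n \<otimes>\<^bsub>H\<lparr>carrier := H1c\<rparr>\<^esub> \<kappa> k"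
      by blast
  qed
qed

text \<open>Products compose the maps with linear part \<open>t ^ 3\<close> and constant part
  \<open>D\<close> as in the affine group of the line, while \<nu> is an independent GL_1 factor.
  Hence \<open>t\<close> is recovered as the cube root \<open>det B ^ eps\<close>.\<close>

lemma H2c_semidirect:
  "is_semidirect (H\<lparr>carrier := H2c\<rparr>) (H\<lparr>carrier := VCF\<rparr>)
    (index_subgroup (GL :: ('a^1^1) monoid) dY \<times>\<times> (AGL :: (('a^1) \<times> ('a^1^1)) monoid))"
proof -
  let ?K1 = "{A :: 'a^1^1. det A \<noteq> 0 \<and> det A ^ card Y = 1}"
  have idx: "index_subgroup (GL :: ('a^1^1) monoid) dY = GL\<lparr>carrier := ?K1\<rparr>"
    by (rule index_GL1[OF dY(1) Y_roots(2)])
  have K1: "subgroup ?K1 GL"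
  proof (rule group.finite_subgroupI[OF GL_group])
    have "mat 1 \<in> ?K1" by simp
    then show "?K1 \<noteq> {}" by blast
  qed (auto simp: invertible_det_nz det_mul power_mult_distrib)
  let ?K = "GL\<lparr>carrier := ?K1\<rparr> \<times>\<times> (AGL :: (('a^1) \<times> ('a^1^1)) monoid)"
  interpret G: group "H\<lparr>carrier := H2c\<rparr>" by (rule subgroup_imp_group[OF H2c_subgroup])
  define \<kappa> :: "('a^1^1) \<times> ('a^1) \<times> ('a^1^1) \<Rightarrow> 'h" where
    "\<kappa> z = (case z of (A, v, B) \<Rightarrow> s2 id (det A) (det B ^ eps) (v $ 1) 0 0 0 0)" for z
  have elem: "\<exists>A v B. z = (A, v, B) \<and> det A \<in> Y \<and> det B ^ eps \<noteq> 0" if "z \<in> carrier ?K" for z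
    using that Y_I by (auto simp: AGL_carrier invertible_det_nz)
  have VCFn: "VCF \<lhd> H\<lparr>carrier := H2c\<rparr>"
    using Bs_subs Bs_eq H2c_sub by (intro VCF_normal H2c_subgroup) blast+
  have VCFsub: "VCF \<subseteq> H2c" using Bs_subs Bs_eq by blast
  show ?thesis
    unfolding idx
  proof (rule G.is_semidirect_antihomI[of _ _ "\<lambda>x. x" \<kappa>])
    show "group (H\<lparr>carrier := VCF\<rparr>)" by (rule subgroup_imp_group[OF VCF_subgroup])
    show "group ?K" by (rule DirProd_group[OF group.subgroup_imp_group[OF GL_group K1] AGL_group])
    show "(\<lambda>x. x) \<in> hom (H\<lparr>carrier := VCF\<rparr>) (H\<lparr>carrier := H2c\<rparr>)" using VCFsub by (auto simp: hom_def)
    show "inj_on (\<lambda>x. x) (carrier (H\<lparr>carrier := VCF\<rparr>))" by simp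
    show "antihom ?K (H\<lparr>carrier := H2c\<rparr>) \<kappa>"
      unfolding antihom_def
    proof (intro conjI ballI subsetI)
      fix g assume "g \<in> \<kappa> ` carrier ?K"
      then obtain A v B where "g = \<kappa> (A, v, B)" "det A \<in> Y" "det B ^ eps \<noteq> 0" using elem by blast
      then have "g \<in> H2c" unfolding \<kappa>_def prod.case H2c_def by blast
      then show "g \<in> carrier (H\<lparr>carrier := H2c\<rparr>)" by simp
    next
      fix z z' assume zz: "z \<in> carrier ?K" "z' \<in> carrier ?K"
      obtain A v B where z: "z = (A, v, B)" "det A \<in> Y" "det B ^ eps \<noteq> 0" using elem[OF zz(1)] by blast
      obtain A' v' B' where z': "z' = (A', v', B')" "det A' \<in> Y" "det B' ^ eps \<noteq> 0" using elem[OF zz(2)] by blast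
      have Bv: "(B *v v') $ 1 = det B * v' $ 1" by (simp add: matrix_vector_mult_def det_1)
      have "\<kappa> (A ** A', v + B *v v', B ** B') = \<kappa> z' \<otimes> \<kappa> z"
        unfolding z(1) z'(1) \<kappa>_def prod.case s2_mult_id[OF z'(2) z(2) z'(3) z(3)] eps_cube(1)
        by (simp add: det_mul power_mult_distrib Bv add.commute)
      then show "\<kappa> (z \<otimes>\<^bsub>?K\<^esub> z') = \<kappa> z' \<otimes>\<^bsub>H\<lparr>carrier := H2c\<rparr>\<^esub> \<kappa> z" by (simp add: z(1) z'(1))
    qed
    show "inj_on \<kappa> (carrier ?K)"
    proof (rule inj_onI)
      fix z z' assume zz: "z \<in> carrier ?K" "z' \<in> carrier ?K" and eq: "\<kappa> z = \<kappa> z'"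
      obtain A v B where z: "z = (A, v, B)" "det A \<in> Y" "det B ^ eps \<noteq> 0" using elem[OF zz(1)] by blast
      obtain A' v' B' where z': "z' = (A', v', B')" "det A' \<in> Y" "det B' ^ eps \<noteq> 0" using elem[OF zz(2)] by blast
      have J: "(det A, id) \<in> JP" "(det A', id) \<in> JP" using z z' Y_JP by simp_all
      from eq[unfolded z(1) z'(1) \<kappa>_def prod.case s2_inj[OF J z(3) z'(3)] eps_inj]
      show "z = z'" unfolding z(1) z'(1) by (simp add: det_1 vec_eq_iff)
    qed
    show "(\<lambda>x. x) ` carrier (H\<lparr>carrier := VCF\<rparr>) \<lhd> H\<lparr>carrier := H2c\<rparr>" using VCFn by simp
    show "(\<lambda>x. x) ` carrier (H\<lparr>carrier := VCF\<rparr>) \<inter> \<kappa> ` carrier ?K \<subseteq> {\<one>\<^bsub>H\<lparr>carrier := H2c\<rparr>\<^esub>}"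
    proof
      fix g assume g: "g \<in> (\<lambda>x. x) ` carrier (H\<lparr>carrier := VCF\<rparr>) \<inter> \<kappa> ` carrier ?K"
      then obtain e u v w where g1: "g = s2 id 1 1 0 e u v w" unfolding VCF_def by auto
      obtain z where z: "z \<in> carrier ?K" "g = \<kappa> z" using g by blast
      obtain A v' B where z': "z = (A, v', B)" "det A \<in> Y" "det B ^ eps \<noteq> 0" using elem[OF z(1)] by blast
      have J: "(det A, id) \<in> JP" using z' Y_JP by simp
      have "s2 id 1 1 0 e u v w = s2 id (det A) (det B ^ eps) (v' $ 1) 0 0 0 0"
        using g1 z(2) unfolding z'(1) \<kappa>_def by simp
      then have "e = 0 \<and> u = 0 \<and> v = 0 \<and> w = 0" unfolding s2_inj[OF JP_one J one_nz z'(3)] by blast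
      then show "g \<in> {\<one>\<^bsub>H\<lparr>carrier := H2c\<rparr>\<^esub>}" using g1 one_eq by simp
    qed
    fix g assume "g \<in> carrier (H\<lparr>carrier := H2c\<rparr>)"
    then obtain \<nu> t D e u v w where g: "g = s2 id \<nu> t D e u v w" "\<nu> \<in> Y" "t \<noteq> 0" unfolding H2c_def by auto
    have nz: "\<nu> \<noteq> 0" using Y_nz g by blast
    define z where "z = (mat \<nu> :: 'a^1^1, vec D :: 'a^1, mat (t ^ 3) :: 'a^1^1)"
    have zK: "z \<in> carrier ?K"
      using g nz Y_D by (simp add: z_def AGL_carrier invertible_det_nz det_1 mat_def)
    have \<kappa>z: "\<kappa> z = s2 id \<nu> t D 0 0 0 0" by (simp add: \<kappa>_def z_def det_1 mat_def eps_cube)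
    \<comment> \<open>The product law multiplies this entry by \<open>\<nu> / t\<close>, so
      \<open>e * t / \<nu>\<close> restores \<open>e\<close>.\<close>
    have "s2 id 1 1 0 (e * t / \<nu>) u v w \<in> VCF" unfolding VCF_def by blast
    moreover have "g = \<kappa> z \<otimes> s2 id 1 1 0 (e * t / \<nu>) u v w"
      unfolding \<kappa>z s2_mult_id[OF g(2) Y_props(1) g(3) one_nz] using g(1,3) nz by (simp add: eps_0)
    moreover have "\<kappa> z \<in> H2c" unfolding \<kappa>z H2c_def using g by blast
    ultimately obtain n where "n \<in> VCF" "g = n \<otimes> \<kappa> z"
      using G.normal_swap[OF VCFn, of _ "\<kappa> z"] by auto
    then show "\<exists>n\<in>carrier (H\<lparr>carrier := VCF\<rparr>). \<exists>k\<in>carrier ?K. g = n \<otimes>\<^bsub>H\<lparr>carrier := H2c\<rparr>\<^esub> \<kappa> k"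
      using zK by auto
  qed
qed

end

section \<open>The permutations of \<open>\<Omega>\<close>\<close>

lemma (in group) generate_closed:
  assumes "finite (carrier G)" "X \<subseteq> carrier G" "X \<noteq> {}" "\<And>x y. x \<in> X \<Longrightarrow> y \<in> X \<Longrightarrow> x \<otimes> y \<in> X"
  shows "generate G X = X"
proof
  show "generate G X \<subseteq> X" using finite_subgroupI[OF assms] by (intro generate_subgroup_incl) auto
qed (auto intro: generate.incl)

context gf3
begin

definition r1 :: "('a \<Rightarrow> 'a) \<Rightarrow> 'a \<Rightarrow> 'a \<Rightarrow> 'a \<Rightarrow> 'a \<Rightarrow> 'a \<Rightarrow> 'a \<Rightarrow> 'a \<Rightarrow> 'a \<Rightarrow> 'a perm3" where
  "r1 f \<nu> p x y m u v w = (\<lambda>(a, b, c). (p * f a + x * f b + u, y * f a + m * f b + v, \<nu> ^ 2 * f c + w))"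

text \<open>A diagonal semilinear map followed by \<tau> with parameter \<open>D\<close>, plus shear
  and translation: squaring the second coordinate \<open>\<nu> / t * f b\<close> gives the factor
  \<open>\<nu> ^ 2 / t ^ 2\<close>, and the third coordinate \<open>\<nu> ^ 2 * f c\<close> gives
  the factor of \<open>D ^ eps\<close>.\<close>

definition r2 :: "('a \<Rightarrow> 'a) \<Rightarrow> 'a \<Rightarrow> 'a \<Rightarrow> 'a \<Rightarrow> 'a \<Rightarrow> 'a \<Rightarrow> 'a \<Rightarrow> 'a \<Rightarrow> 'a perm3" where
  "r2 f \<nu> t D e u v w = (\<lambda>(a, b, c).
    (\<nu> ^ 2 * t * f a + e * f b + D * (\<nu> ^ 2 / t ^ 2) * f b ^ 2 + D ^ eps * \<nu> ^ 2 * f c + u,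
     \<nu> / t * f b + v, \<nu> ^ 2 * f c + w))"

abbreviation jj :: "'a \<Rightarrow> ('a \<Rightarrow> 'a) \<Rightarrow> 'a perm3" where
  "jj \<nu> f \<equiv> r1 f \<nu> (\<nu> ^ 2) 0 0 \<nu> 0 0 0"

lemma r1_mult:
  assumes "frob f'"
  shows "r1 f' \<nu>' p' x' y' m' u' v' w' \<circ> r1 f \<nu> p x y m u v w =
    r1 (f' \<circ> f) (\<nu>' * f' \<nu>) (p' * f' p + x' * f' y) (p' * f' x + x' * f' m)
      (y' * f' p + m' * f' y) (y' * f' x + m' * f' m)
      (p' * f' u + x' * f' v + u') (y' * f' u + m' * f' v + v') (\<nu>' ^ 2 * f' w + w')"
  by (simp add: r1_def fun_eq_iff frob_simps[OF assms] algebra_simps power_mult_distrib)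

text \<open>Closure under composition depends on \<open>D\<close> and \<open>D ^ eps\<close>
  transforming together: \<open>D\<close> scales by \<open>t' ^ 3\<close> and \<open>D ^ eps\<close>
  by \<open>t'\<close>, because the power \<open>eps\<close> is additive and inverts cubing.\<close>

lemma r2_mult:
  assumes f': "frob f'" and "t \<noteq> 0" "t' \<noteq> 0"
  shows "r2 f' \<nu>' t' D' e' u' v' w' \<circ> r2 f \<nu> t D e u v w =
    r2 (f' \<circ> f) (\<nu>' * f' \<nu>) (t' * f' t) (t' ^ 3 * f' D + D')
      (\<nu>' ^ 2 * t' * f' e + e' * (f' \<nu> / f' t) + 2 * D' * (\<nu>' ^ 2 / t' ^ 2) * (f' \<nu> / f' t) * f' v)
      (\<nu>' ^ 2 * t' * f' u + e' * f' v + D' * (\<nu>' ^ 2 / t' ^ 2) * (f' v) ^ 2 + D' ^ eps * \<nu>' ^ 2 * f' w + u')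
      (\<nu>' / t' * f' v + v') (\<nu>' ^ 2 * f' w + w')"
proof -
  note fs = frob_simps[OF f']
  have eps3: "(t' ^ 3 * f' D + D') ^ eps = t' * f' D ^ eps + D' ^ eps"
    by (simp add: eps_add power_mult_distrib eps_cube)
  have nz: "f' t \<noteq> 0" using assms fs by simp
  have sq: "D' * (\<nu>' ^ 2 / t' ^ 2) * (\<nu> / t * b + v) ^ 2 =
      D' * (\<nu>' ^ 2 / t' ^ 2) * (\<nu> ^ 2 / t ^ 2) * b ^ 2 + 2 * D' * (\<nu>' ^ 2 / t' ^ 2) * (\<nu> / t) * v * b
      + D' * (\<nu>' ^ 2 / t' ^ 2) * v ^ 2" for \<nu> t b v :: 'a
    by (simp add: power2_eq_square algebra_simps)
  have coef: "(t' ^ 3 * f' D + D') * ((\<nu>' * f' \<nu>) ^ 2 / (t' * f' t) ^ 2) =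
      \<nu>' ^ 2 * t' * (f' D * (f' \<nu> ^ 2 / f' t ^ 2)) + D' * (\<nu>' ^ 2 / t' ^ 2) * (f' \<nu> ^ 2 / f' t ^ 2)"
    using nz assms by (simp add: power2_eq_square power3_eq_cube field_simps)
  show ?thesis
  proof (rule ext, clarify)
    fix a b c
    show "(r2 f' \<nu>' t' D' e' u' v' w' \<circ> r2 f \<nu> t D e u v w) (a, b, c) =
      r2 (f' \<circ> f) (\<nu>' * f' \<nu>) (t' * f' t) (t' ^ 3 * f' D + D')
      (\<nu>' ^ 2 * t' * f' e + e' * (f' \<nu> / f' t) + 2 * D' * (\<nu>' ^ 2 / t' ^ 2) * (f' \<nu> / f' t) * f' v)
      (\<nu>' ^ 2 * t' * f' u + e' * f' v + D' * (\<nu>' ^ 2 / t' ^ 2) * (f' v) ^ 2 + D' ^ eps * \<nu>' ^ 2 * f' w + u')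
      (\<nu>' / t' * f' v + v') (\<nu>' ^ 2 * f' w + w') (a, b, c)"
      unfolding r2_def comp_apply prod.case fs sq coef eps3
      by (simp add: algebra_simps power_mult_distrib)
  qed
qed

lemma r2_0: "t \<noteq> 0 \<Longrightarrow> r2 f \<nu> t 0 e u v w = r1 f \<nu> (\<nu> ^ 2 * t) e 0 (\<nu> / t) u v w"
  using eps_pos by (simp add: r1_def r2_def fun_eq_iff power_0_left)

text \<open>The coefficients are read off at the origin and at the unit vectors. Only the square of
  \<nu> is visible in such a map; the determinant \<open>\<nu> ^ 3\<close> fixes its sign
  later.\<close>

lemma r1_eqD:
  assumes eq: "r1 f \<nu> p x y m u v w = r1 f' \<nu>' p' x' y' m' u' v' w'"
    and f: "frob f" "frob f'" and nz: "\<nu> \<noteq> 0"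
  shows "f = f'" "\<nu> ^ 2 = \<nu>' ^ 2" "p = p'" "x = x'" "y = y'" "m = m'" "u = u'" "v = v'" "w = w'"
proof -
  note fs = frob_simps[OF f(1)] frob_simps[OF f(2)]
  have e: "r1 f \<nu> p x y m u v w z = r1 f' \<nu>' p' x' y' m' u' v' w' z" for z using eq by simp
  show uvw: "u = u'" "v = v'" "w = w'" using e[of "(0, 0, 0)"] by (simp_all add: r1_def fs)
  show "p = p'" "y = y'" using e[of "(1, 0, 0)"] by (simp_all add: r1_def fs uvw)
  show "x = x'" "m = m'" using e[of "(0, 1, 0)"] by (simp_all add: r1_def fs uvw)
  show nn: "\<nu> ^ 2 = \<nu>' ^ 2" using e[of "(0, 0, 1)"] by (simp add: r1_def fs uvw)
  have "\<nu>' ^ 2 \<noteq> 0" using nz nn by (metis power_eq_0_iff zero_less_numeral)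
  then show "f = f'" using e[of "(0, 0, _)"] by (simp add: r1_def fs uvw nn fun_eq_iff)
qed

lemma r2_eqD:
  assumes eq: "r2 f \<nu> t D e u v w = r2 f' \<nu>' t' D' e' u' v' w'"
    and f: "frob f" "frob f'" and nz: "\<nu> \<noteq> 0" "t \<noteq> 0" "t' \<noteq> 0"
  shows "f = f'" "\<nu> = \<nu>'" "t = t'" "D = D'" "e = e'" "u = u'" "v = v'" "w = w'"
proof -
  note fs = frob_simps[OF f(1)] frob_simps[OF f(2)]
  have e: "r2 f \<nu> t D e u v w z = r2 f' \<nu>' t' D' e' u' v' w' z" for z using eq by simp
  show uvw: "u = u'" "v = v'" "w = w'" using e[of "(0, 0, 0)"] by (simp_all add: r2_def fs)
  have nn: "\<nu> ^ 2 = \<nu>' ^ 2" using e[of "(0, 0, 1)"] by (simp add: r2_def fs uvw)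
  have nz': "\<nu>' ^ 2 \<noteq> 0" using nz nn by (metis power_eq_0_iff zero_less_numeral)
  then show "f = f'" using e[of "(0, 0, _)"] by (simp add: r2_def fs uvw nn fun_eq_iff)
  show t: "t = t'" using e[of "(1, 0, 0)"] nz' by (simp add: r2_def fs uvw nn)
  show n: "\<nu> = \<nu>'" using e[of "(0, 1, 0)"] nz by (simp add: r2_def fs uvw t)
  have "D ^ eps = D' ^ eps" using e[of "(0, 0, 1)"] nz' by (simp add: r2_def fs uvw nn)
  then show D: "D = D'" unfolding eps_inj .
  show "e = e'" using e[of "(0, 1, 0)"] by (simp add: r2_def fs uvw t n D)
qed

text \<open>\<open>D ^ eps\<close> governs the influence of the third coordinate on the first, which
  is absent from \<open>r1\<close> maps.\<close>

lemma r1_r2D: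
  assumes eq: "r1 f \<nu> p x y m u v w = r2 f' \<nu>' t D e u' v' w'"
    and f: "frob f" "frob f'" and nz: "\<nu>' \<noteq> 0"
  shows "D = 0"
proof -
  note fs = frob_simps[OF f(1)] frob_simps[OF f(2)]
  have e: "r1 f \<nu> p x y m u v w z = r2 f' \<nu>' t D e u' v' w' z" for z using eq by simp
  have "u = u'" using e[of "(0, 0, 0)"] by (simp add: r1_def r2_def fs)
  then have "D ^ eps = 0" using e[of "(0, 0, 1)"] nz by (simp add: r1_def r2_def fs)
  then show ?thesis unfolding eps_eq_0 .
qed

lemma r1_bij:
  assumes f: "frob f" and det: "p * m - x * y \<noteq> 0" and nz: "\<nu> \<noteq> 0"
  shows "bij (r1 f \<nu> p x y m u v w)"
proof -
  note fs = frob_simps[OF f]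
  have "inj (r1 f \<nu> p x y m u v w)"
  proof (rule injI)
    fix z z' assume eq: "r1 f \<nu> p x y m u v w z = r1 f \<nu> p x y m u v w z'"
    obtain a b c a' b' c' where z: "z = (a, b, c)" "z' = (a', b', c')" by (metis prod_cases3)
    have "r1 f \<nu> p x y m u v w (a, b, c) = r1 f \<nu> p x y m u v w (a', b', c')" using eq z by simp
    then have 1: "p * f a + x * f b = p * f a' + x * f b'" and 2: "y * f a + m * f b = y * f a' + m * f b'"
      and 3: "f c = f c'" using nz by (simp_all add: r1_def)
    have "(p * m - x * y) * f a = m * (p * f a + x * f b) - x * (y * f a + m * f b)" by (simp add: algebra_simps)
    also have "\<dots> = (p * m - x * y) * f a'" unfolding 1 2 by (simp add: algebra_simps)
    finally have "f a = f a'" using det by simp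
    have "(p * m - x * y) * f b = p * (y * f a + m * f b) - y * (p * f a + x * f b)" by (simp add: algebra_simps)
    also have "\<dots> = (p * m - x * y) * f b'" unfolding 1 2 by (simp add: algebra_simps)
    finally have "f b = f b'" using det by simp
    show "z = z'" using \<open>f a = f a'\<close> \<open>f b = f b'\<close> 3 by (simp add: fs z)
  qed
  then show ?thesis by (metis bijI finite_UNIV_inj_surj finite)
qed

lemma r2_bij:
  assumes f: "frob f" and nz: "\<nu> \<noteq> 0" "t \<noteq> 0"
  shows "bij (r2 f \<nu> t D e u v w)"
proof -
  have "inj (r2 f \<nu> t D e u v w)"
    by (rule injI) (auto simp: r2_def frob_simps[OF f] nz)
  then show ?thesis by (metis bijI finite_UNIV_inj_surj finite)
qed

section \<open>The generators, and the groups they generate, as explicit maps\<close>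

lemma p_alpha_r1: "p_alpha u v w = r1 id 1 1 0 0 1 u v w"
  by (simp add: p_alpha_def r1_def fun_eq_iff)

lemma p_gamma_r1: "p_gamma e = r1 id 1 1 e 0 1 0 0 0"
  by (simp add: p_gamma_def r1_def fun_eq_iff)

lemma p_delta_r1: "p_delta = r1 id 1 0 1 (-1) 0 0 0 0"
  by (simp add: p_delta_def r1_def fun_eq_iff)

text \<open>The product of the two parameters is \<open>m ^ 3\<close>, and the exponent
  \<open>2 * eps\<close> turns it into \<open>m ^ 2\<close>.\<close>

lemma p_beta_S: "p_beta (m ^ 2) m = jj m id"
proof -
  have "(m ^ 2 * m) ^ (2 * eps) = m ^ 2"
    using eps_cube(2)[of m] by (simp add: power_mult mult.commute[of 2] power3_eq_cube power2_eq_square)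
  then show ?thesis by (simp add: p_beta_def r1_def fun_eq_iff eps(1))
qed

lemma p_beta_T: "m \<noteq> 0 \<Longrightarrow> p_beta m (inverse m) = r1 id 1 m 0 0 (1 / m) 0 0 0"
  by (simp add: p_beta_def r1_def fun_eq_iff divide_inverse)

lemma p_tau_r2: "p_tau d = r2 id 1 1 d 0 0 0 0"
  by (simp add: p_tau_def r2_def fun_eq_iff eps(1))

lemma Sym_generate_closed:
  fixes X :: "'a perm3 set"
  assumes "X \<subseteq> {f. bij f}" "X \<noteq> {}" "\<And>x y. x \<in> X \<Longrightarrow> y \<in> X \<Longrightarrow> y \<circ> x \<in> X"
  shows "generate Sym X = X"
  using group.generate_closed[OF Sym_group Sym_finite, of X] assms by simp

lemma P_V_eq: "P_V = {p_alpha u v 0 | u v :: 'a. True}"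
  unfolding P_V_def
proof (rule Sym_generate_closed)
  show "{p_alpha u v 0 | u v :: 'a. True} \<subseteq> {f. bij f}" by (auto simp: p_alpha_r1 frob_id intro!: r1_bij)
  fix g h assume "g \<in> {p_alpha u v 0 | u v :: 'a. True}" "h \<in> {p_alpha u v 0 | u v :: 'a. True}"
  then obtain u v u' v' where g: "g = p_alpha u v (0::'a)" and h: "h = p_alpha u' v' (0::'a)" by blast
  have "h \<circ> g = p_alpha (u + u') (v + v') 0"
    unfolding g h p_alpha_r1 r1_mult[OF frob_id(1)] by simp
  then show "h \<circ> g \<in> {p_alpha u v 0 | u v :: 'a. True}" by blast
qed blast

lemma P_F_eq: "P_F = {p_alpha 0 0 w | w :: 'a. True}"
  unfolding P_F_def
proof (rule Sym_generate_closed)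
  show "{p_alpha 0 0 w | w :: 'a. True} \<subseteq> {f. bij f}" by (auto simp: p_alpha_r1 frob_id intro!: r1_bij)
  fix g h assume "g \<in> {p_alpha 0 0 w | w :: 'a. True}" "h \<in> {p_alpha 0 0 w | w :: 'a. True}"
  then obtain w w' where g: "g = p_alpha 0 0 (w::'a)" and h: "h = p_alpha 0 0 (w'::'a)" by blast
  have "h \<circ> g = p_alpha 0 0 (w + w')"
    unfolding g h p_alpha_r1 r1_mult[OF frob_id(1)] by simp
  then show "h \<circ> g \<in> {p_alpha 0 0 w | w :: 'a. True}" by blast
qed blast

lemma P_C_eq: "P_C = {p_gamma e | e :: 'a. True}"
  unfolding P_C_def
proof (rule Sym_generate_closed)
  show "{p_gamma e | e :: 'a. True} \<subseteq> {f. bij f}" by (auto simp: p_gamma_r1 frob_id intro!: r1_bij)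
  fix g h assume "g \<in> {p_gamma e | e :: 'a. True}" "h \<in> {p_gamma e | e :: 'a. True}"
  then obtain e e' where g: "g = p_gamma (e::'a)" and h: "h = p_gamma (e'::'a)" by blast
  have "h \<circ> g = p_gamma (e + e')"
    unfolding g h p_gamma_r1 r1_mult[OF frob_id(1)] by simp
  then show "h \<circ> g \<in> {p_gamma e | e :: 'a. True}" by blast
qed blast

lemma P_S_eq: "P_S = {jj m id | m. m \<noteq> 0}"
proof -
  have "generate Sym {jj m id | m. m \<noteq> 0} = {jj m id | m. m \<noteq> 0}"
  proof (rule Sym_generate_closed)
    show "{jj m id | m. m \<noteq> 0} \<subseteq> {f. bij f}" by (auto simp: frob_id intro!: r1_bij)
    show "{jj m id | m. m \<noteq> 0} \<noteq> {}" using one_neq_zero by blast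
    fix g h assume "g \<in> {jj m id | m. m \<noteq> 0}" "h \<in> {jj m id | m. m \<noteq> 0}"
    then obtain m m' where g: "g = jj m id" "m \<noteq> 0" and h: "h = jj m' id" "m' \<noteq> 0" by blast
    have "h \<circ> g = jj (m' * m) id"
      unfolding g h r1_mult[OF frob_id(1)] by (simp add: power_mult_distrib)
    moreover have "m' * m \<noteq> 0" using g h by simp
    ultimately show "h \<circ> g \<in> {jj m id | m. m \<noteq> 0}" by blast
  qed
  then show ?thesis unfolding P_S_def p_beta_S .
qed

lemma P_T_eq: "P_T = {r1 id 1 m 0 0 (1 / m) 0 0 0 | m. m \<noteq> 0}"
proof -
  let ?T = "{r1 id 1 m 0 0 (1 / m) 0 0 0 | m. m \<noteq> 0}"
  have "generate Sym ?T = ?T"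
  proof (rule Sym_generate_closed)
    show "?T \<subseteq> {f. bij f}" by (auto simp: frob_id intro!: r1_bij)
    show "?T \<noteq> {}" using one_neq_zero by blast
    fix g h assume "g \<in> ?T" "h \<in> ?T"
    then obtain m m' where g: "g = r1 id 1 m 0 0 (1 / m) 0 0 0" "m \<noteq> 0" and h: "h = r1 id 1 m' 0 0 (1 / m') 0 0 0" "m' \<noteq> 0" by blast
    have "h \<circ> g = r1 id 1 (m' * m) 0 0 (1 / (m' * m)) 0 0 0"
      unfolding g h r1_mult[OF frob_id(1)] by simp
    moreover have "m' * m \<noteq> 0" using g h by simp
    ultimately show "h \<circ> g \<in> ?T" by blast
  qed
  moreover have "{p_beta m (inverse m) | m::'a. m \<noteq> 0} = ?T"
    by (intro Collect_cong) (metis p_beta_T)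
  ultimately show ?thesis unfolding P_T_def by simp
qed

lemma P_E_eq: "P_E = {p_tau d | d :: 'a. True}"
  unfolding P_E_def
proof (rule Sym_generate_closed)
  show "{p_tau d | d :: 'a. True} \<subseteq> {f. bij f}" by (auto simp: p_tau_r2 frob_id intro!: r2_bij)
  fix g h assume "g \<in> {p_tau d | d :: 'a. True}" "h \<in> {p_tau d | d :: 'a. True}"
  then obtain d d' where g: "g = p_tau (d::'a)" and h: "h = p_tau (d'::'a)" by blast
  have "h \<circ> g = p_tau (d + d')"
    unfolding g h p_tau_r2 r2_mult[OF frob_id(1) one_neq_zero one_neq_zero] by simp
  then show "h \<circ> g \<in> {p_tau d | d :: 'a. True}" by blast
qed blast

lemma P_Sigma_eq: "P_Sigma = {jj 1 f | f. frob f}"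
proof
  interpret Sym: group "Sym :: ('a \<times> 'a \<times> 'a \<Rightarrow> 'a \<times> 'a \<times> 'a) monoid" by (rule Sym_group)
  have ps: "p_sigma = jj 1 (\<lambda>x. x ^ 3 ^ 1)" by (simp add: p_sigma_def r1_def fun_eq_iff)
  have frob1: "frob (\<lambda>x. x ^ 3 ^ 1)" unfolding frob_def by blast
  have mult: "jj 1 g \<circ> jj 1 f = jj 1 (g \<circ> f)" if "frob g" for f g
    unfolding r1_mult[OF that] by (simp add: frob_simps[OF that])
  have "subgroup {jj 1 f | f. frob f} Sym"
  proof (rule Sym.finite_subgroupI[OF Sym_finite])
    show "{jj 1 f | f. frob f} \<subseteq> carrier Sym" by (auto intro!: r1_bij)
    show "{jj 1 f | f. frob f} \<noteq> {}" using frob_id by blast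
    fix g h assume "g \<in> {jj 1 f | f. frob f}" "h \<in> {jj 1 f | f. frob f}"
    then obtain f f' where "g = jj 1 f" "frob f" "h = jj 1 f'" "frob f'" by blast
    then show "g \<otimes>\<^bsub>Sym\<^esub> h \<in> {jj 1 f | f. frob f}" using mult frob_comp by auto
  qed
  then show "P_Sigma \<subseteq> {jj 1 f | f. frob f}"
    unfolding P_Sigma_def using ps frob1 by (intro Sym.generate_subgroup_incl) auto
  have "jj 1 (\<lambda>x. x ^ 3 ^ i) \<in> P_Sigma" for i
  proof (induction i)
    case 0
    have "jj 1 (\<lambda>x. x ^ 3 ^ 0) = \<one>\<^bsub>Sym\<^esub>" by (simp add: r1_def fun_eq_iff)
    then show ?case unfolding P_Sigma_def by (metis generate.one)
  next
    case (Suc i)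
    have "p_sigma \<in> P_Sigma" unfolding P_Sigma_def by (rule generate.incl) simp
    with Suc have "jj 1 (\<lambda>x. x ^ 3 ^ i) \<otimes>\<^bsub>Sym\<^esub> p_sigma \<in> P_Sigma"
      unfolding P_Sigma_def by (rule generate.eng)
    moreover have "jj 1 (\<lambda>x. x ^ 3 ^ i) \<otimes>\<^bsub>Sym\<^esub> p_sigma = jj 1 ((\<lambda>x. x ^ 3 ^ 1) \<circ> (\<lambda>x. x ^ 3 ^ i))"
      unfolding ps Sym_simps by (rule mult[OF frob1])
    moreover have "(\<lambda>x::'a. x ^ 3 ^ 1) \<circ> (\<lambda>x. x ^ 3 ^ i) = (\<lambda>x. x ^ 3 ^ Suc i)"
      by (auto simp: fun_eq_iff mult.commute simp flip: power_mult)
    ultimately show ?case by simp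
  qed
  then show "{jj 1 f | f. frob f} \<subseteq> P_Sigma" unfolding frob_def by blast
qed

text \<open>This is SL_2 on the first two coordinates: \<open>P_C\<close> supplies the upper
  unitriangular maps and conjugation by \<open>p_delta\<close> the lower ones.\<close>

lemma P_M_eq: "P_M = {r1 id 1 p x y m 0 0 0 | p x y m. p * m - x * y = 1}"
proof
  interpret Sym: group "Sym :: ('a \<times> 'a \<times> 'a \<Rightarrow> 'a \<times> 'a \<times> 'a) monoid" by (rule Sym_group)
  let ?M = "{r1 id 1 p x y m 0 0 0 | p x y m. p * m - x * y = (1::'a)}"
  have MI: "p * m - x * y = 1 \<Longrightarrow> r1 id 1 p x y m 0 0 0 \<in> ?M" for p x y m by blast
  have M: "subgroup ?M Sym"
  proof (rule Sym.finite_subgroupI[OF Sym_finite])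
    show "?M \<subseteq> carrier Sym" by (auto simp: frob_id intro!: r1_bij)
    show "?M \<noteq> {}" using MI[of 1 1 0 0] by auto
    fix g h assume "g \<in> ?M" "h \<in> ?M"
    then obtain p x y m p' x' y' m' where g: "g = r1 id 1 p x y m 0 0 0" "p * m - x * y = 1"
      and h: "h = r1 id 1 p' x' y' m' 0 0 0" "p' * m' - x' * y' = 1" by blast
    have "(p' * p + x' * y) * (y' * x + m' * m) - (p' * x + x' * m) * (y' * p + m' * y) = (p' * m' - x' * y') * (p * m - x * y)"
      by (simp add: algebra_simps)
    then have "(p' * p + x' * y) * (y' * x + m' * m) - (p' * x + x' * m) * (y' * p + m' * y) = 1" using g h by simp
    moreover have "g \<otimes>\<^bsub>Sym\<^esub> h = r1 id 1 (p' * p + x' * y) (p' * x + x' * m) (y' * p + m' * y) (y' * x + m' * m) 0 0 0"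
      unfolding g h by (simp add: r1_mult[OF frob_id(1)])
    ultimately show "g \<otimes>\<^bsub>Sym\<^esub> h \<in> ?M" using MI by simp
  qed
  have d: "p_delta \<in> ?M" unfolding p_delta_r1 by (rule MI) simp
  then have "P_D \<subseteq> ?M" unfolding P_D_def by (intro Sym.generate_subgroup_incl M) simp
  moreover have "P_C \<subseteq> ?M"
  proof
    fix g :: "'a perm3" assume "g \<in> P_C"
    then obtain e where "g = r1 id 1 1 e 0 1 0 0 0" unfolding P_C_eq p_gamma_r1 by blast
    then show "g \<in> ?M" using MI[of 1 1 e 0] by simp
  qed
  moreover have "P_T \<subseteq> ?M"
  proof
    fix g :: "'a perm3" assume "g \<in> P_T"
    then obtain m where m: "g = r1 id 1 m 0 0 (1 / m) 0 0 0" "m \<noteq> 0" unfolding P_T_eq by blast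
    then have "m * (1 / m) - 0 * 0 = 1" by simp
    from MI[OF this] show "g \<in> ?M" using m by simp
  qed
  ultimately show "P_M \<subseteq> ?M" unfolding P_M_def by (intro Sym.generate_subgroup_incl M) blast
  have PMs: "subgroup (P_M :: 'a perm3 set) Sym"
    unfolding P_M_def using \<open>P_D \<subseteq> ?M\<close> \<open>P_C \<subseteq> ?M\<close> \<open>P_T \<subseteq> ?M\<close> subgroup.subset[OF M]
    by (intro Sym.generate_is_subgroup) blast
  have C: "r1 id 1 1 e 0 1 0 0 0 \<in> P_M" for e
  proof -
    have "r1 id 1 1 e 0 1 0 0 0 \<in> P_C" unfolding P_C_eq p_gamma_r1 by blast
    then show ?thesis unfolding P_M_def by (intro generate.incl) blast
  qed
  have "p_delta \<in> P_D" unfolding P_D_def by (rule generate.incl) simp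
  then have dM: "p_delta \<in> P_M" unfolding P_M_def by (intro generate.incl) blast
  have low: "r1 id 1 1 0 e 1 0 0 0 \<in> P_M" for e
  proof -
    have "inv\<^bsub>Sym\<^esub> p_delta \<otimes>\<^bsub>Sym\<^esub> r1 id 1 1 (-e) 0 1 0 0 0 \<otimes>\<^bsub>Sym\<^esub> p_delta = r1 id 1 1 0 e 1 0 0 0"
    proof (rule Sym.conj_eqI)
      show "p_delta \<in> carrier (Sym :: ('a \<times> 'a \<times> 'a \<Rightarrow> 'a \<times> 'a \<times> 'a) monoid)" using d subgroup.subset[OF M] by blast
      show "r1 id 1 1 (-e) 0 1 0 0 0 \<otimes>\<^bsub>Sym\<^esub> p_delta = p_delta \<otimes>\<^bsub>Sym\<^esub> r1 id 1 1 0 e 1 0 0 0"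
        by (simp add: p_delta_r1 r1_mult frob_id)
    qed (auto simp: frob_id intro!: r1_bij)
    then show ?thesis using PMs dM C[of "-e"] by (metis subgroup.m_closed subgroup.m_inv_closed)
  qed
  show "?M \<subseteq> P_M"
  proof clarify
    fix p x y m :: 'a assume det: "p * m - x * y = 1"
    show "r1 id 1 p x y m 0 0 0 \<in> P_M"
    proof (rule SL2_induct[OF det, where P = "\<lambda>p x y m. r1 id 1 p x y m 0 0 0 \<in> P_M"])
      fix p x y m p' x' y' m' :: 'a
      assume "r1 id 1 p x y m 0 0 0 \<in> P_M" "r1 id 1 p' x' y' m' 0 0 0 \<in> P_M"
      then have "r1 id 1 p' x' y' m' 0 0 0 \<otimes>\<^bsub>Sym\<^esub> r1 id 1 p x y m 0 0 0 \<in> P_M"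
        using subgroup.m_closed[OF PMs] by blast
      then show "r1 id 1 (p * p' + x * y') (p * x' + x * m') (y * p' + m * y') (y * x' + m * m') 0 0 0 \<in> P_M"
        by (simp add: r1_mult[OF frob_id(1)])
    qed (rule C low)+
  qed
qed

lemma jj_mult: "frob f' \<Longrightarrow> jj \<nu>' f' \<circ> jj \<nu> f = jj (\<nu>' * f' \<nu>) (f' \<circ> f)"
  by (simp add: r1_mult frob_simps power_mult_distrib)

lemma frob_surj: "frob f \<Longrightarrow> \<exists>x. f x = y"
  by (metis bij_pointE frob_bij)

lemma P_SSigma_eq: "P_SSigma = {jj \<nu> f | \<nu> f. \<nu> \<noteq> 0 \<and> frob f}"
proof (intro equalityI subsetI)
  fix g :: "'a perm3" assume "g \<in> P_SSigma"
  then obtain m f where "g = jj m id \<otimes>\<^bsub>Sym\<^esub> jj 1 f" "m \<noteq> 0" "frob f"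
    unfolding P_SSigma_def set_mult_def P_S_eq P_Sigma_eq by blast
  then have "g = jj (f m) f" "f m \<noteq> 0" using jj_mult[of f 1 id m] by (simp_all add: frob_simps)
  then show "g \<in> {jj \<nu> f | \<nu> f. \<nu> \<noteq> 0 \<and> frob f}" using \<open>frob f\<close> by blast
next
  fix g :: "'a perm3" assume "g \<in> {jj \<nu> f | \<nu> f. \<nu> \<noteq> 0 \<and> frob f}"
  then obtain \<nu> f where g: "g = jj \<nu> f" "\<nu> \<noteq> 0" "frob f" by blast
  \<comment> \<open>The factor from \<open>P_S\<close> is applied before \<open>f\<close> and so
    reappears as \<open>f m\<close>; hence the preimage.\<close>
  obtain m where m: "f m = \<nu>" using frob_surj[OF g(3)] by blast
  then have "m \<noteq> 0" using g frob_simps(3) by blast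
  moreover have "g = jj m id \<otimes>\<^bsub>Sym\<^esub> jj 1 f" using jj_mult[OF g(3), of 1 id m] g(1) m by simp
  ultimately show "g \<in> P_SSigma"
    unfolding P_SSigma_def set_mult_def P_S_eq P_Sigma_eq using g(3) by blast
qed

text \<open>The decomposition into a factor from \<open>C\<close> and one from
  \<open>S\<Sigma>\<close> is unique, so the \<open>THE\<close> is well defined. Conjugation by
  \<open>jj \<nu> f\<close> scales the first coordinate by \<open>\<nu> ^ 2\<close> and the second
  by \<nu>, hence the parameter of \<open>p_gamma\<close>, after applying \<open>f\<close>, by the
  quotient \<nu>.\<close>

lemma C_act_eq:
  assumes "\<nu> \<noteq> 0" "frob f"
  shows "C_act (p_gamma e \<otimes>\<^bsub>Sym\<^esub> jj \<nu> f) (p_gamma z) = p_gamma (\<nu> * f (z + e))"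
  unfolding C_act_def
proof (rule the_equality)
  interpret Sym: group "Sym :: ('a \<times> 'a \<times> 'a \<Rightarrow> 'a \<times> 'a \<times> 'a) monoid" by (rule Sym_group)
  have conj: "inv\<^bsub>Sym\<^esub> jj \<nu> f \<otimes>\<^bsub>Sym\<^esub> (p_gamma z \<otimes>\<^bsub>Sym\<^esub> p_gamma e) \<otimes>\<^bsub>Sym\<^esub> jj \<nu> f = p_gamma (\<nu> * f (z + e))"
  proof (rule Sym.conj_eqI)
    show "jj \<nu> f \<in> carrier Sym" using assms by (auto intro!: r1_bij)
    show "p_gamma z \<otimes>\<^bsub>Sym\<^esub> p_gamma e \<in> carrier Sym" "p_gamma (\<nu> * f (z + e)) \<in> carrier Sym"
      by (auto simp: p_gamma_r1 frob_id intro!: bij_comp r1_bij)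
    show "p_gamma z \<otimes>\<^bsub>Sym\<^esub> p_gamma e \<otimes>\<^bsub>Sym\<^esub> jj \<nu> f = jj \<nu> f \<otimes>\<^bsub>Sym\<^esub> p_gamma (\<nu> * f (z + e))"
      unfolding p_gamma_r1
      by (simp add: r1_mult frob_id frob_simps[OF assms(2)] assms(2) power2_eq_square algebra_simps)
  qed
  have mem: "p_gamma e \<in> P_C" "jj \<nu> f \<in> P_SSigma"
    using assms unfolding P_C_eq P_SSigma_eq by blast+
  then show "\<exists>c\<in>P_C. \<exists>s\<in>P_SSigma. p_gamma e \<otimes>\<^bsub>Sym\<^esub> jj \<nu> f = c \<otimes>\<^bsub>Sym\<^esub> s \<and>
      p_gamma (\<nu> * f (z + e)) = inv\<^bsub>Sym\<^esub> s \<otimes>\<^bsub>Sym\<^esub> (p_gamma z \<otimes>\<^bsub>Sym\<^esub> c) \<otimes>\<^bsub>Sym\<^esub> s"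
    using conj by metis
  fix g assume "\<exists>c\<in>P_C. \<exists>s\<in>P_SSigma. p_gamma e \<otimes>\<^bsub>Sym\<^esub> jj \<nu> f = c \<otimes>\<^bsub>Sym\<^esub> s \<and>
      g = inv\<^bsub>Sym\<^esub> s \<otimes>\<^bsub>Sym\<^esub> (p_gamma z \<otimes>\<^bsub>Sym\<^esub> c) \<otimes>\<^bsub>Sym\<^esub> s"
  then obtain e' \<nu>' f' where c: "p_gamma e \<otimes>\<^bsub>Sym\<^esub> jj \<nu> f = p_gamma e' \<otimes>\<^bsub>Sym\<^esub> jj \<nu>' f'" "\<nu>' \<noteq> 0" "frob f'"
    and g: "g = inv\<^bsub>Sym\<^esub> jj \<nu>' f' \<otimes>\<^bsub>Sym\<^esub> (p_gamma z \<otimes>\<^bsub>Sym\<^esub> p_gamma e') \<otimes>\<^bsub>Sym\<^esub> jj \<nu>' f'"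
    unfolding P_C_eq P_SSigma_eq by blast
  have prod: "p_gamma e \<otimes>\<^bsub>Sym\<^esub> jj \<nu> f = r1 f \<nu> (\<nu> ^ 2) (\<nu> ^ 2 * f e) 0 \<nu> 0 0 0" if "frob f" for e \<nu> f
    unfolding p_gamma_r1 using r1_mult[OF that] by (simp add: frob_simps[OF that])
  have eq: "r1 f \<nu> (\<nu> ^ 2) (\<nu> ^ 2 * f e) 0 \<nu> 0 0 0 = r1 f' \<nu>' (\<nu>' ^ 2) (\<nu>' ^ 2 * f' e') 0 \<nu>' 0 0 0"
    using c prod assms(2) by simp
  have "f = f'" "\<nu> = \<nu>'" "\<nu> ^ 2 * f e = \<nu>' ^ 2 * f' e'"
    using r1_eqD[OF eq assms(2) c(3) assms(1)] by blast+
  then have "e = e'" using assms frob_simps(9)[OF assms(2)] by simp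
  then show "g = p_gamma (\<nu> * f (z + e))" using g conj \<open>f = f'\<close> \<open>\<nu> = \<nu>'\<close> by simp
qed

lemma p_gamma_inj: "p_gamma e = p_gamma e' \<longleftrightarrow> (e::'a) = e'"
  using r1_eqD(4)[of id 1 1 e 0 1 0 0 0 id 1 1 e' 0 1 0 0 0] frob_id by (auto simp: p_gamma_r1)

end

section \<open>Vertex stabilizers in coset graphs\<close>

context group
begin

lemma vstab_iff:
  assumes A: "subgroup A G" and g: "g \<in> carrier G"
  shows "h \<in> vstab G (A #> g) \<longleftrightarrow> h \<in> carrier G \<and> g \<otimes> h \<otimes> inv g \<in> A"
proof (cases "h \<in> carrier G")
  case True
  have AG: "A \<subseteq> carrier G" using A by (rule subgroup.subset)
  have "A #> g #> h = A #> g \<longleftrightarrow> A #> (g \<otimes> h \<otimes> inv g) = A"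
  proof
    assume "A #> g #> h = A #> g"
    then have "A #> g #> h #> inv g = A" using g AG by (simp add: coset_mult_assoc)
    then show "A #> (g \<otimes> h \<otimes> inv g) = A" using g AG True by (simp add: coset_mult_assoc m_assoc)
  next
    assume "A #> (g \<otimes> h \<otimes> inv g) = A"
    then have "A #> (g \<otimes> h \<otimes> inv g) #> g = A #> g" by simp
    then show "A #> g #> h = A #> g" using g AG True by (simp add: coset_mult_assoc m_assoc)
  qed
  also have "\<dots> \<longleftrightarrow> g \<otimes> h \<otimes> inv g \<in> A"
    using coset_join1[OF _ _ A, of "g \<otimes> h \<otimes> inv g"] coset_join2[OF _ A, of "g \<otimes> h \<otimes> inv g"] g True by (metis inv_closed m_closed)
  finally show ?thesis using True by (simp add: vstab_def stabilizer_def)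
qed (simp add: vstab_def stabilizer_def)

lemma vstab_eq:
  assumes A: "subgroup A G" and g: "g \<in> carrier G"
  shows "vstab G (A #> g) = (\<lambda>x. inv g \<otimes> x \<otimes> g) ` A"
proof (intro equalityI subsetI)
  fix h assume "h \<in> vstab G (A #> g)"
  then have h: "h \<in> carrier G" "g \<otimes> h \<otimes> inv g \<in> A" using vstab_iff[OF assms] by blast+
  then have "h = inv g \<otimes> (g \<otimes> h \<otimes> inv g) \<otimes> g" using g by (simp add: m_assoc inv_cancel)
  then show "h \<in> (\<lambda>x. inv g \<otimes> x \<otimes> g) ` A" using h(2) by (rule image_eqI)
next
  fix h assume "h \<in> (\<lambda>x. inv g \<otimes> x \<otimes> g) ` A"
  then obtain x where x: "x \<in> A" "h = inv g \<otimes> x \<otimes> g" by blast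
  moreover have "x \<in> carrier G" using x A subgroup.mem_carrier by metis
  ultimately show "h \<in> vstab G (A #> g)" using vstab_iff[OF assms] g by (simp add: m_assoc inv_cancel)
qed

lemma vstab_subgroup:
  assumes A: "subgroup A G" and g: "g \<in> carrier G"
  shows "subgroup (vstab G (A #> g)) G"
proof -
  have "(\<lambda>x. inv g \<otimes> x \<otimes> g) = cj (inv g)" using g by (simp add: cj_def fun_eq_iff)
  then show ?thesis unfolding vstab_eq[OF assms] using cj_subgroup[OF inv_closed[OF g] A] by metis
qed

text \<open>A coset of \<open>B\<close> meeting \<open>A g\<close> contains some \<open>a g\<close>,
  and right multiplication by the conjugate of \<open>a\<close> carries \<open>B g\<close> to it. So
  the neighbours form one orbit of the stabilizer.\<close>

lemma nbrs_coset_graph: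
  assumes A: "subgroup A G" and B: "subgroup B G" and neq: "A \<noteq> B" and g: "g \<in> carrier G"
  shows "nbrs (coset_graph G A B) (A #> g) = (\<lambda>k. B #> g #> k) ` vstab G (A #> g)"
proof -
  have AG: "A \<subseteq> carrier G" and BG: "B \<subseteq> carrier G" using A B subgroup.subset by blast+
  \<comment> \<open>A common coset would give \<open>A = B\<close>; this excludes the second
    alternative in the adjacency relation.\<close>
  have notB: "A #> g \<notin> rcosets B"
  proof
    assume "A #> g \<in> rcosets B"
    then obtain h where h: "h \<in> carrier G" "A #> g = B #> h" by (auto simp: RCOSETS_def)
    have "g \<in> A #> g" by (rule rcos_self[OF g A])
    then have "B #> g = B #> h" using h repr_independence[OF _ h(1) B] by simp
    then have "A #> g #> inv g = B #> g #> inv g" using h by simp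
    then show False using neq g AG BG by (simp add: coset_mult_assoc)
  qed
  have inA: "A #> g \<in> rcosets A" using g AG by (rule rcosetsI[rotated])
  show ?thesis
  proof (intro equalityI subsetI)
    fix w assume "w \<in> nbrs (coset_graph G A B) (A #> g)"
    then have w: "(A #> g) \<inter> w \<noteq> {}" "w \<in> rcosets B"
      using notB by (auto simp: nbrs_def coset_graph_def)
    then obtain y where y: "y \<in> A #> g" "y \<in> w" by blast
    then obtain a where a: "a \<in> A" "y = a \<otimes> g" by (auto simp: r_coset_def)
    obtain h where h: "h \<in> carrier G" "w = B #> h" using w(2) by (auto simp: RCOSETS_def)
    have ac: "a \<in> carrier G" using a AG by blast
    have "w = B #> y" using y h repr_independence[OF _ h(1) B] by simp
    also have "\<dots> = B #> g #> (inv g \<otimes> a \<otimes> g)"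
      using a(2) ac g BG by (simp add: coset_mult_assoc m_assoc inv_cancel)
    finally have "w = B #> g #> (inv g \<otimes> a \<otimes> g)" .
    moreover have "inv g \<otimes> a \<otimes> g \<in> vstab G (A #> g)" unfolding vstab_eq[OF A g] using a(1) by blast
    ultimately show "w \<in> (\<lambda>k. B #> g #> k) ` vstab G (A #> g)" by (rule image_eqI)
  next
    fix w assume "w \<in> (\<lambda>k. B #> g #> k) ` vstab G (A #> g)"
    then obtain a where a: "a \<in> A" "w = B #> g #> (inv g \<otimes> a \<otimes> g)" unfolding vstab_eq[OF A g] by blast
    have ac: "a \<in> carrier G" using a AG by blast
    have w: "w = B #> (a \<otimes> g)" using a(2) ac g BG by (simp add: coset_mult_assoc m_assoc inv_cancel)
    then have "w \<in> rcosets B" using rcosetsI[OF BG] ac g by simp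
    moreover have "a \<otimes> g \<in> A #> g" using a(1) by (auto simp: r_coset_def)
    moreover have "a \<otimes> g \<in> w" unfolding w using ac g by (intro rcos_self B) simp
    ultimately show "w \<in> nbrs (coset_graph G A B) (A #> g)"
      using inA by (auto simp: nbrs_def coset_graph_def)
  qed
qed

lemma coset_graph_commute: "coset_graph G A B = coset_graph G B A"
  by (auto simp: coset_graph_def)

text \<open>The neighbours form one orbit of \<open>A'\<close>, with point stabilizer
  \<open>A' \<inter> B'\<close>, and the kernel of a transitive action is the intersection of the
  conjugates of a point stabilizer. This identifies the vertex kernels with T_1 and T_2.\<close>

lemma vker_coset_graph:
  assumes A: "subgroup A G" and B: "subgroup B G" and neq: "A \<noteq> B" and g: "g \<in> carrier G"
  defines "A' \<equiv> vstab G (A #> g)" and "B' \<equiv> vstab G (B #> g)"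
  shows "vker G (coset_graph G A B) (A #> g) = largest_normal_in G (A' \<inter> B') A'"
proof -
  have A': "subgroup A' G" and B': "subgroup B' G" unfolding A'_def B'_def using vstab_subgroup A B g by blast+
  have AB: "subgroup (A' \<inter> B') G" by (rule subgroups_Inter_pair[OF A' B'])
  have A'c: "A' \<subseteq> carrier G" using A' subgroup.subset by blast
  have BG: "B \<subseteq> carrier G" using B subgroup.subset by blast
  have fixed: "B #> g #> k #> h = B #> g #> k \<longleftrightarrow> k \<otimes> h \<otimes> inv k \<in> B'"
    if c: "k \<in> carrier G" "h \<in> carrier G" for k h
  proof -
    have "B #> g #> k #> h = B #> g #> k \<longleftrightarrow> h \<in> vstab G (B #> (g \<otimes> k))"
      using c g BG by (simp add: vstab_def stabilizer_def coset_mult_assoc)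
    also have "\<dots> \<longleftrightarrow> g \<otimes> k \<otimes> h \<otimes> inv (g \<otimes> k) \<in> B" using vstab_iff[OF B] c g by simp
    also have "\<dots> \<longleftrightarrow> k \<otimes> h \<otimes> inv k \<in> B'"
      unfolding B'_def using vstab_iff[OF B g] c g by (simp add: inv_mult_group m_assoc)
    finally show ?thesis .
  qed
  have "vker G (coset_graph G A B) (A #> g) = {h \<in> A'. \<forall>k\<in>A'. k \<otimes> h \<otimes> inv k \<in> B'}"
  proof -
    have "vker G (coset_graph G A B) (A #> g) = {h \<in> A'. \<forall>k\<in>A'. B #> g #> k #> h = B #> g #> k}"
      unfolding vker_def nbrs_coset_graph[OF A B neq g] A'_def[symmetric] by blast
    moreover have "(\<forall>k\<in>A'. B #> g #> k #> h = B #> g #> k) \<longleftrightarrow> (\<forall>k\<in>A'. k \<otimes> h \<otimes> inv k \<in> B')" if h: "h \<in> A'" for h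
    proof (intro ball_cong refl)
      fix k assume "k \<in> A'"
      then show "(B #> g #> k #> h = B #> g #> k) = (k \<otimes> h \<otimes> inv k \<in> B')"
        using h A'c by (intro fixed) blast+
    qed
    ultimately show ?thesis by blast
  qed
  also have "\<dots> = {h \<in> A' \<inter> B'. \<forall>k\<in>A'. inv k \<otimes> h \<otimes> k \<in> A' \<inter> B'}"
  proof (intro equalityI subsetI)
    fix h assume "h \<in> {h \<in> A'. \<forall>k\<in>A'. k \<otimes> h \<otimes> inv k \<in> B'}"
    then have h: "h \<in> A'" "\<And>k. k \<in> A' \<Longrightarrow> k \<otimes> h \<otimes> inv k \<in> B'" by blast+
    have hc: "h \<in> carrier G" using h A'c by blast
    have "h \<in> B'" using h(2)[OF subgroup.one_closed[OF A']] hc by simp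
    moreover have "inv k \<otimes> h \<otimes> k \<in> A' \<inter> B'" if k: "k \<in> A'" for k
    proof
      show "inv k \<otimes> h \<otimes> k \<in> A'" using k h A' by (simp add: subgroup.m_closed subgroup.m_inv_closed)
      show "inv k \<otimes> h \<otimes> k \<in> B'"
        using h(2)[OF subgroup.m_inv_closed[OF A' k]] k A'c by (simp add: subset_iff)
    qed
    ultimately show "h \<in> {h \<in> A' \<inter> B'. \<forall>k\<in>A'. inv k \<otimes> h \<otimes> k \<in> A' \<inter> B'}" using h(1) by blast
  next
    fix h assume "h \<in> {h \<in> A' \<inter> B'. \<forall>k\<in>A'. inv k \<otimes> h \<otimes> k \<in> A' \<inter> B'}"
    then have h: "h \<in> A'" "\<And>k. k \<in> A' \<Longrightarrow> inv k \<otimes> h \<otimes> k \<in> B'" by blast+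
    have "k \<otimes> h \<otimes> inv k \<in> B'" if k: "k \<in> A'" for k
      using h(2)[OF subgroup.m_inv_closed[OF A' k]] k A'c by (simp add: subset_iff)
    then show "h \<in> {h \<in> A'. \<forall>k\<in>A'. k \<otimes> h \<otimes> inv k \<in> B'}" using h(1) by blast
  qed
  also have "\<dots> = largest_normal_in G (A' \<inter> B') A'"
    by (rule largest_normal_in_eq[OF A' AB, symmetric]) blast
  finally show ?thesis .
qed

end

context amalgam
begin

text \<open>The maps \<tau> represent all right cosets of \<open>A12\<close> in \<open>A2\<close>,
  so there are at most \<open>q\<close> of them. This bounds the number of neighbours of
  x_2.\<close>

lemma A2_decomp:
  assumes "k \<in> A2"
  obtains b D where "b \<in> A12" "k = b \<otimes> s2 id 1 1 D 0 0 0 0"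
proof -
  obtain f \<nu> t D e u v w where k: "k = s2 f \<nu> t D e u v w" "(\<nu>, f) \<in> JP" "t \<noteq> 0" using assms unfolding A2_def by blast
  have kc: "k \<in> carrier H" using assms A2_carrier by blast
  have \<tau>c: "s2 id 1 1 D 0 0 0 0 \<in> carrier H" for D by (rule s2_closed[OF JP_one one_nz])
  have I: "s2 f \<nu> t 0 e' u' v' w' \<in> A12" for e' u' v' w' using k(2,3) unfolding A12_def by blast
  have "k \<otimes> s2 id 1 1 (-D) 0 0 0 0 \<in> A12"
    unfolding k(1) s2_mult[OF k(2) JP_one k(3) one_nz] by (simp add: I)
  moreover have "s2 id 1 1 (-D) 0 0 0 0 \<otimes> s2 id 1 1 D 0 0 0 0 = \<one>"
    unfolding one_eq s2_mult_id[OF Y_props(1) Y_props(1) one_nz one_nz] by simp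
  then have "k = (k \<otimes> s2 id 1 1 (-D) 0 0 0 0) \<otimes> s2 id 1 1 D 0 0 0 0"
    using kc \<tau>c by (simp add: m_assoc)
  ultimately show ?thesis using that by blast
qed

lemma A1_neq_A2: "A1 \<noteq> A2"
proof
  assume "A1 = A2"
  then have "A1 = A12" using A12_eq by blast
  then have "\<delta> \<in> A12" using \<delta>_A1 by blast
  then obtain f \<nu> t e u v w where d: "\<delta> = s2 f \<nu> t 0 e u v w" "(\<nu>, f) \<in> JP" "t \<noteq> 0" unfolding A12_def by blast
  have ok: "ok1 id 1 0 1 (-1) 0" using Y_props by (simp add: ok1_id)
  have "s1 id 1 0 1 (-1) 0 0 0 0 = s1 f \<nu> (\<nu> ^ 2 * t) e 0 (\<nu> / t) u v w"
    using d(1) s2_0[OF d(2,3)] \<delta>_def by simp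
  then have "(-1::'a) = 0" unfolding s1_inj[OF ok ok1_s2[OF d(2,3)]] by blast
  then show False by simp
qed

end

section \<open>The groups \<open>G\<^sub>1\<close> and \<open>G\<^sub>2\<close>\<close>

locale delta_graph = gf3 r ty for r and ty :: "'a::{field,finite} itself" +
  fixes Jhat :: "'a perm3 set"
  assumes adm: "admissible Jhat"
begin

definition JP :: "('a \<times> ('a \<Rightarrow> 'a)) set" where
  "JP = {(\<nu>, f). \<nu> \<noteq> 0 \<and> frob f \<and> jj \<nu> f \<in> Jhat}"

lemma Jhat_elem:
  assumes "g \<in> Jhat"
  obtains e \<nu> f where "g = p_gamma e \<otimes>\<^bsub>Sym\<^esub> jj \<nu> f" "\<nu> \<noteq> 0" "frob f"
proof -
  have "g \<in> P_CSSigma" using assms adm unfolding admissible_def by blast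
  then show ?thesis
    using that unfolding P_CSSigma_def set_mult_def P_C_eq P_SSigma_eq by blast
qed

lemma gamma_0: "p_gamma 0 = (id :: 'a perm3)"
  by (simp add: p_gamma_def fun_eq_iff)

lemma J_of_eq: "J_of Jhat = {jj \<nu> f | \<nu> f. (\<nu>, f) \<in> JP}"
proof (intro equalityI subsetI)
  fix g assume "g \<in> J_of Jhat"
  then have g: "g \<in> Jhat" "C_act g (p_gamma 0) = p_gamma 0" by (auto simp: J_of_def stabilizer_def)
  obtain e \<nu> f where e: "g = p_gamma e \<otimes>\<^bsub>Sym\<^esub> jj \<nu> f" "\<nu> \<noteq> 0" "frob f" by (rule Jhat_elem[OF g(1)])
  have "\<nu> * f (0 + e) = 0" using g(2) unfolding e(1) C_act_eq[OF e(2,3)] p_gamma_inj .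
  then have "e = 0" using e(2) frob_simps(10)[OF e(3)] by simp
  then have "g = jj \<nu> f" using e(1) gamma_0 by simp
  then show "g \<in> {jj \<nu> f | \<nu> f. (\<nu>, f) \<in> JP}" using e g(1) unfolding JP_def by blast
next
  fix g assume "g \<in> {jj \<nu> f | \<nu> f. (\<nu>, f) \<in> JP}"
  then obtain \<nu> f where g: "g = jj \<nu> f" "\<nu> \<noteq> 0" "frob f" "g \<in> Jhat" unfolding JP_def by blast
  have "g = p_gamma 0 \<otimes>\<^bsub>Sym\<^esub> jj \<nu> f" using g(1) gamma_0 by simp
  then have "C_act g (p_gamma 0) = p_gamma (\<nu> * f (0 + 0))" using C_act_eq[OF g(2,3)] by simp
  then show "g \<in> J_of Jhat" using g(4) frob_simps(3)[OF g(3)] by (simp add: J_of_def stabilizer_def)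
qed

sublocale semilinear r ty JP
proof unfold_locales
  have sub: "subgroup Jhat Sym" using adm unfolding admissible_def by blast
  show "(1, id) \<in> JP"
  proof -
    have "jj 1 id = \<one>\<^bsub>Sym\<^esub>" by (simp add: r1_def fun_eq_iff)
    then have "jj 1 id \<in> Jhat" using subgroup.one_closed[OF sub] by metis
    then show ?thesis by (simp add: JP_def frob_id)
  qed
  show "(\<nu>' * f' \<nu>, f' \<circ> f) \<in> JP" if "(\<nu>, f) \<in> JP" "(\<nu>', f') \<in> JP" for \<nu> f \<nu>' f'
  proof -
    have c: "\<nu> \<noteq> 0" "frob f" "jj \<nu> f \<in> Jhat" "\<nu>' \<noteq> 0" "frob f'" "jj \<nu>' f' \<in> Jhat" using that by (auto simp: JP_def)
    have "jj \<nu> f \<otimes>\<^bsub>Sym\<^esub> jj \<nu>' f' \<in> Jhat" using subgroup.m_closed[OF sub] c by blast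
    then have "jj (\<nu>' * f' \<nu>) (f' \<circ> f) \<in> Jhat" unfolding Sym_simps jj_mult[OF c(5)] .
    then show ?thesis using c frob_comp by (simp add: JP_def frob_simps)
  qed
  show "\<exists>f. (x, f) \<in> JP" if x: "x \<noteq> 0" for x
  proof -
    have tt: "two_transitive_on (P_C :: 'a perm3 set) Jhat C_act" using adm unfolding admissible_def by blast
    have C: "p_gamma z \<in> P_C" for z :: 'a unfolding P_C_eq by blast
    have "p_gamma 0 \<noteq> p_gamma (1::'a)" "p_gamma 0 \<noteq> p_gamma x" unfolding p_gamma_inj using x by simp_all
    \<comment> \<open>The pairs of parameters \<open>(0, 1)\<close> and \<open>(0, x)\<close> yield
      an element fixing \<open>p_gamma 0\<close>, so one of \<open>J\<close>; its \<nu> is the image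
      of 1.\<close>
    then have "\<exists>g\<in>Jhat. C_act g (p_gamma 0) = p_gamma 0 \<and> C_act g (p_gamma 1) = p_gamma x"
      using tt[unfolded two_transitive_on_def, rule_format, OF C C C C] by blast
    then obtain g where g: "g \<in> Jhat" "C_act g (p_gamma 0) = p_gamma 0" "C_act g (p_gamma 1) = p_gamma x" by blast
    then have "g \<in> J_of Jhat" by (simp add: J_of_def stabilizer_def)
    then obtain \<nu> f where jf: "g = jj \<nu> f" "(\<nu>, f) \<in> JP" unfolding J_of_eq by blast
    have c: "\<nu> \<noteq> 0" "frob f" using jf(2) by (auto simp: JP_def)
    have "g = p_gamma 0 \<otimes>\<^bsub>Sym\<^esub> jj \<nu> f" using jf(1) gamma_0 by simp
    then have "p_gamma (\<nu> * f (1 + 0)) = p_gamma x" using C_act_eq[OF c, of 0 1] g(3) by metis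
    then have "\<nu> = x" unfolding p_gamma_inj using frob_simps(4)[OF c(2)] by simp
    then show ?thesis using jf(2) by blast
  qed
qed (auto simp: JP_def)

lemma G1_eq: "G1_of Jhat = {r1 f \<nu> p x y m u v w | f \<nu> p x y m u v w. ok1 f \<nu> p x y m}"
proof (intro equalityI subsetI)
  fix g assume "g \<in> G1_of Jhat"
  then obtain u v p x y m w \<nu> f where g: "g = p_alpha u v 0 \<otimes>\<^bsub>Sym\<^esub> r1 id 1 p x y m 0 0 0 \<otimes>\<^bsub>Sym\<^esub> p_alpha 0 0 w \<otimes>\<^bsub>Sym\<^esub> jj \<nu> f"
    "p * m - x * y = 1" "(\<nu>, f) \<in> JP"
    unfolding G1_of_def P_K1_def set_mult_def P_V_eq P_M_eq P_F_eq J_of_eq by blast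
  have f: "frob f" using JP_frob g(3) by blast
  note fs = frob_simps[OF f]
  have g1: "g = r1 f \<nu> (\<nu> ^ 2 * f p) (\<nu> ^ 2 * f x) (\<nu> * f y) (\<nu> * f m) (\<nu> ^ 2 * (f p * f u + f x * f v)) (\<nu> * (f y * f u + f m * f v)) (\<nu> ^ 2 * f w)"
    unfolding g(1) p_alpha_r1 Sym_simps by (simp add: r1_def fun_eq_iff fs algebra_simps)
  have "f p * f m - f x * f y = f (p * m - x * y)" by (simp add: fs)
  then have "f p * f m - f x * f y = 1" using g(2) by (simp add: fs)
  moreover have "\<nu> ^ 2 * f p * (\<nu> * f m) - \<nu> ^ 2 * f x * (\<nu> * f y) = \<nu> ^ 3 * (f p * f m - f x * f y)"
    by (simp add: algebra_simps power2_eq_square power3_eq_cube)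
  ultimately have "\<nu> ^ 2 * f p * (\<nu> * f m) - \<nu> ^ 2 * f x * (\<nu> * f y) = \<nu> ^ 3" by simp
  then have "ok1 f \<nu> (\<nu> ^ 2 * f p) (\<nu> ^ 2 * f x) (\<nu> * f y) (\<nu> * f m)" using g(3) by (simp add: ok1_def)
  then show "g \<in> {r1 f \<nu> p x y m u v w | f \<nu> p x y m u v w. ok1 f \<nu> p x y m}" unfolding g1 by blast
next
  fix g assume "g \<in> {r1 f \<nu> p x y m u v w | f \<nu> p x y m u v w. ok1 f \<nu> p x y m}"
  then obtain f \<nu> p x y m u v w where g: "g = r1 f \<nu> p x y m u v w" "ok1 f \<nu> p x y m" by blast
  have J: "(\<nu>, f) \<in> JP" and det: "p * m - x * y = \<nu> ^ 3" using g(2) by (simp_all add: ok1_def)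
  have f: "frob f" and nz: "\<nu> \<noteq> 0" using JP_frob JP_nz J by blast+
  note fs = frob_simps[OF f]
  \<comment> \<open>The factor from \<open>J\<close> comes last and acts on the result of all the
    others, so their parameters are preimages under \<open>f\<close> of rescaled entries.\<close>
  obtain p0 x0 y0 m0 U V W where pre: "f p0 = p / \<nu> ^ 2" "f x0 = x / \<nu> ^ 2" "f y0 = y / \<nu>" "f m0 = m / \<nu>"
    "f U = u / \<nu> ^ 2" "f V = v / \<nu>" "f W = w / \<nu> ^ 2"
    using frob_surj[OF f] by meson
  have "f (p0 * m0 - x0 * y0) = (p * m - x * y) / \<nu> ^ 3"
    by (simp add: fs pre diff_divide_distrib power2_eq_square power3_eq_cube mult_ac)
  then have "f (p0 * m0 - x0 * y0) = 1" using det nz by simp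
  then have d0: "p0 * m0 - x0 * y0 = 1" unfolding fs(11) .
  \<comment> \<open>The translation precedes the matrix in the product, so \<open>(u0, v0)\<close>
    is the inverse matrix applied to \<open>(U, V)\<close>.\<close>
  define u0 where "u0 = m0 * U - x0 * V"
  define v0 where "v0 = p0 * V - y0 * U"
  have "p0 * u0 + x0 * v0 = (p0 * m0 - x0 * y0) * U" "y0 * u0 + m0 * v0 = (p0 * m0 - x0 * y0) * V"
    by (simp_all add: u0_def v0_def algebra_simps)
  then have uv: "p0 * u0 + x0 * v0 = U" "y0 * u0 + m0 * v0 = V" using d0 by simp_all
  have "p_alpha u0 v0 0 \<otimes>\<^bsub>Sym\<^esub> r1 id 1 p0 x0 y0 m0 0 0 0 = r1 id 1 p0 x0 y0 m0 U V 0"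
    unfolding p_alpha_r1 Sym_simps r1_mult[OF frob_id(1)] by (simp add: uv)
  then have "p_alpha u0 v0 0 \<otimes>\<^bsub>Sym\<^esub> r1 id 1 p0 x0 y0 m0 0 0 0 \<otimes>\<^bsub>Sym\<^esub> p_alpha 0 0 W \<otimes>\<^bsub>Sym\<^esub> jj \<nu> f = g"
    unfolding g(1) p_alpha_r1 using nz by (simp add: r1_def fun_eq_iff fs pre algebra_simps)
  moreover have "p_alpha u0 v0 0 \<in> P_V" "r1 id 1 p0 x0 y0 m0 0 0 0 \<in> P_M" "p_alpha 0 0 W \<in> P_F" "jj \<nu> f \<in> J_of Jhat"
    unfolding P_V_eq P_M_eq P_F_eq J_of_eq using d0 J by blast+
  ultimately show "g \<in> G1_of Jhat"
    unfolding G1_of_def P_K1_def set_mult_def by blast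
qed

lemma G2_eq: "G2_of Jhat = {r2 f \<nu> t D e u v w | f \<nu> t D e u v w. (\<nu>, f) \<in> JP \<and> t \<noteq> 0}"
proof (intro equalityI subsetI)
  fix g assume "g \<in> G2_of Jhat"
  then obtain u v e d t w \<nu> f where g: "g = p_alpha u v 0 \<otimes>\<^bsub>Sym\<^esub> p_gamma e \<otimes>\<^bsub>Sym\<^esub> p_tau d \<otimes>\<^bsub>Sym\<^esub> r1 id 1 t 0 0 (1 / t) 0 0 0
      \<otimes>\<^bsub>Sym\<^esub> p_alpha 0 0 w \<otimes>\<^bsub>Sym\<^esub> jj \<nu> f" "t \<noteq> 0" "(\<nu>, f) \<in> JP"
    unfolding G2_of_def P_K2_def set_mult_def P_V_eq P_C_eq P_E_eq P_T_eq P_F_eq J_of_eq by blast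
  have f: "frob f" using JP_frob g(3) by blast
  note fs = frob_simps[OF f]
  have nz: "f t \<noteq> 0" using g(2) fs by simp
  have t1: "r1 id 1 t 0 0 (1 / t) u v w = r2 id 1 t 0 0 u v w" if "t \<noteq> 0" for t u v w using r2_0[OF that, of id 1] by simp
  have j: "jj \<nu> f = r2 f \<nu> 1 0 0 0 0 0" using r2_0[OF one_neq_zero, of f \<nu>] by simp
  have a: "r1 id 1 1 e 0 1 u v w = r2 id 1 1 0 e u v w" for e u v w using r2_0[OF one_neq_zero, of id 1] by simp
  have "\<exists>D e' u' v' w'. g = r2 f \<nu> (f t) D e' u' v' w'"
    unfolding g(1) p_alpha_r1 p_gamma_r1 p_tau_r2 t1[OF g(2)] j a Sym_simps
      r2_mult[OF frob_id(1) one_neq_zero one_neq_zero] r2_mult[OF frob_id(1) one_neq_zero g(2)]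
    using g(2) by (simp add: r2_mult frob_id f frob_simps(4)[OF f]) blast
  then show "g \<in> {r2 f \<nu> t D e u v w | f \<nu> t D e u v w. (\<nu>, f) \<in> JP \<and> t \<noteq> 0}" using nz g(3) by blast
next
  fix g assume "g \<in> {r2 f \<nu> t D e u v w | f \<nu> t D e u v w. (\<nu>, f) \<in> JP \<and> t \<noteq> 0}"
  then obtain f \<nu> t D e u v w where g: "g = r2 f \<nu> t D e u v w" "(\<nu>, f) \<in> JP" "t \<noteq> 0" by blast
  have f: "frob f" and nz: "\<nu> \<noteq> 0" using JP_frob JP_nz g(2) by blast+
  note fs = frob_simps[OF f]
  \<comment> \<open>The shift by \<open>v0\<close> acts before the shear and the quadratic map, so
    expanding them at \<open>b + v0\<close> creates extra terms; \<open>e0\<close> and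
    \<open>u0\<close> are chosen to cancel these.\<close>
  obtain t0 where t0: "f t0 = t" using frob_surj[OF f] by blast
  obtain D0 where D0: "f D0 = D / t ^ 3" using frob_surj[OF f] by blast
  obtain v0 where v0: "f v0 = v * t / \<nu>" using frob_surj[OF f] by blast
  obtain W where W: "f W = w / \<nu> ^ 2" using frob_surj[OF f] by blast
  obtain e0 where e0: "f e0 = e / (\<nu> ^ 2 * t) - 2 * f D0 * f v0" using frob_surj[OF f] by blast
  obtain u0 where u0: "f u0 = u / (\<nu> ^ 2 * t) - f e0 * f v0 - f D0 * f v0 ^ 2" using frob_surj[OF f] by blast
  have t0nz: "t0 \<noteq> 0" using t0 g(3) fs by auto
  have Deps: "t * f D0 ^ eps = D ^ eps"
    using g(3) by (simp add: D0 power_divide eps_cube)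
  have D0': "\<nu> ^ 2 * (t * f D0) = D * (\<nu> ^ 2 / t ^ 2)" using g(3) by (simp add: D0 power2_eq_square power3_eq_cube)
  have ucoef: "\<nu> ^ 2 * (t * (f u0 + f e0 * f v0 + f D0 * f v0 ^ 2)) = u" using u0 nz g(3) by simp
  have ecoef: "\<nu> ^ 2 * (t * (f e0 + 2 * f D0 * f v0)) = e" using e0 nz g(3) by simp
  have vcoef: "\<nu> * (f v0 / t) = v" using v0 nz g(3) by simp
  have wcoef: "\<nu> ^ 2 * f W = w" using W nz by simp
  let ?h = "p_alpha u0 v0 0 \<otimes>\<^bsub>Sym\<^esub> p_gamma e0 \<otimes>\<^bsub>Sym\<^esub> p_tau D0 \<otimes>\<^bsub>Sym\<^esub> r1 id 1 t0 0 0 (1 / t0) 0 0 0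
      \<otimes>\<^bsub>Sym\<^esub> p_alpha 0 0 W \<otimes>\<^bsub>Sym\<^esub> jj \<nu> f"
  have "?h z = g z" for z
  proof -
    obtain a b c where z: "z = (a, b, c)" by (metis prod_cases3)
    have h: "?h (a, b, c) = (\<nu> ^ 2 * f (t0 * (a + u0 + e0 * (b + v0) + D0 * (b + v0) ^ 2 + D0 ^ eps * c)),
        \<nu> * f ((b + v0) / t0), \<nu> ^ 2 * f (c + W))"
      by (simp add: r1_def p_alpha_def p_gamma_def p_tau_def eps(1))
    have "\<nu> ^ 2 * f (t0 * (a + u0 + e0 * (b + v0) + D0 * (b + v0) ^ 2 + D0 ^ eps * c)) =
        \<nu> ^ 2 * t * f a + \<nu> ^ 2 * (t * (f e0 + 2 * f D0 * f v0)) * f b + \<nu> ^ 2 * (t * f D0) * f b ^ 2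
        + t * f D0 ^ eps * \<nu> ^ 2 * f c + \<nu> ^ 2 * (t * (f u0 + f e0 * f v0 + f D0 * f v0 ^ 2))"
      by (simp add: fs t0) (simp add: algebra_simps power2_eq_square)
    also have "\<dots> = \<nu> ^ 2 * t * f a + e * f b + D * (\<nu> ^ 2 / t ^ 2) * f b ^ 2 + D ^ eps * \<nu> ^ 2 * f c + u"
      unfolding ecoef D0' Deps ucoef ..
    finally have 1: "\<nu> ^ 2 * f (t0 * (a + u0 + e0 * (b + v0) + D0 * (b + v0) ^ 2 + D0 ^ eps * c)) =
      \<nu> ^ 2 * t * f a + e * f b + D * (\<nu> ^ 2 / t ^ 2) * f b ^ 2 + D ^ eps * \<nu> ^ 2 * f c + u" .
    have 2: "\<nu> * f ((b + v0) / t0) = \<nu> / t * f b + v"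
      using vcoef by (simp add: fs t0 add_divide_distrib distrib_left)
    have 3: "\<nu> ^ 2 * f (c + W) = \<nu> ^ 2 * f c + w" using wcoef by (simp add: fs distrib_left)
    show ?thesis unfolding z h 1 2 3 g(1) r2_def by simp
  qed
  then have "?h = g" by (rule ext)
  moreover have "p_alpha u0 v0 0 \<in> P_V" "p_gamma e0 \<in> P_C" "p_tau D0 \<in> P_E" "r1 id 1 t0 0 0 (1 / t0) 0 0 0 \<in> P_T"
    "p_alpha 0 0 W \<in> P_F" "jj \<nu> f \<in> J_of Jhat"
    unfolding P_V_eq P_C_eq P_E_eq P_T_eq P_F_eq J_of_eq using t0nz g(2) by blast+
  ultimately show "g \<in> G2_of Jhat"
    unfolding G2_of_def P_K2_def set_mult_def by blast
qed

end

section \<open>Conjugates of the base amalgam at arbitrary arcs\<close>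

context delta_graph
begin

abbreviation H0 :: "'a perm3 monoid" where "H0 \<equiv> G_of Jhat"

lemma r1_Sym: "ok1 f \<nu> p x y m \<Longrightarrow> bij (r1 f \<nu> p x y m u v w)"
  using JP_frob JP_nz by (intro r1_bij) (auto simp: ok1_def)

lemma r2_Sym: "(\<nu>, f) \<in> JP \<Longrightarrow> t \<noteq> 0 \<Longrightarrow> bij (r2 f \<nu> t D e u v w)"
  using JP_frob JP_nz by (intro r2_bij) auto

lemma G_Sym: "G1_of Jhat \<union> G2_of Jhat \<subseteq> carrier Sym"
  unfolding G1_eq G2_eq using r1_Sym r2_Sym by auto

lemma H0_group: "group H0"
  unfolding G_of_def
  by (rule group.subgroup_imp_group[OF Sym_group group.generate_is_subgroup[OF Sym_group G_Sym]])

lemma H0_mult: "x \<otimes>\<^bsub>H0\<^esub> y = y \<circ> x"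
  by (simp add: G_of_def)

lemma G_carrier: "G1_of Jhat \<subseteq> carrier H0" "G2_of Jhat \<subseteq> carrier H0"
  unfolding G_of_def by (auto intro: generate.incl)

interpretation H0: group H0 by (rule H0_group)

text \<open>The conjugation that carries the stabilizers of the base vertices to those of the cosets
  through \<open>g\<close>.\<close>

definition em :: "'a perm3 \<Rightarrow> 'a perm3 \<Rightarrow> 'a perm3" where
  "em g x = inv\<^bsub>H0\<^esub> g \<otimes>\<^bsub>H0\<^esub> x \<otimes>\<^bsub>H0\<^esub> g"

lemma em_eq: "g \<in> carrier H0 \<Longrightarrow> em g = H0.cj (inv\<^bsub>H0\<^esub> g)"
  by (simp add: em_def H0.cj_def fun_eq_iff)

lemma em_closed: "g \<in> carrier H0 \<Longrightarrow> x \<in> carrier H0 \<Longrightarrow> em g x \<in> carrier H0"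
  by (simp add: em_def)

lemma em_mult: "g \<in> carrier H0 \<Longrightarrow> x \<in> carrier H0 \<Longrightarrow> y \<in> carrier H0 \<Longrightarrow> em g x \<otimes>\<^bsub>H0\<^esub> em g y = em g (y \<circ> x)"
  by (simp add: em_eq H0.cj_mult[symmetric] H0_mult[symmetric])

lemma em_inj: "g \<in> carrier H0 \<Longrightarrow> x \<in> carrier H0 \<Longrightarrow> y \<in> carrier H0 \<Longrightarrow> em g x = em g y \<longleftrightarrow> x = y"
  using inj_on_eq_iff[OF H0.cj_inj[of "inv\<^bsub>H0\<^esub> g"]] by (simp add: em_eq)

lemma r1_H0: "ok1 f \<nu> p x y m \<Longrightarrow> r1 f \<nu> p x y m u v w \<in> carrier H0"
  using G_carrier(1) unfolding G1_eq by blast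

lemma r2_H0: "(\<nu>, f) \<in> JP \<Longrightarrow> t \<noteq> 0 \<Longrightarrow> r2 f \<nu> t D e u v w \<in> carrier H0"
  using G_carrier(2) unfolding G2_eq by blast

text \<open>Coordinates thus exist at every arc: at the given one they describe the stabilizers, at
  the others the groups Q of the neighbours.\<close>

lemma amalgam_at:
  assumes g: "g \<in> carrier H0"
  shows "amalgam r JP H0 (\<lambda>f \<nu> p x y m u v w. em g (r1 f \<nu> p x y m u v w)) (\<lambda>f \<nu> t D e u v w. em g (r2 f \<nu> t D e u v w))"
proof (intro amalgam.intro amalgam_axioms.intro semilinear_axioms H0_group)
  show "finite (carrier H0)" by simp
next
  fix f \<nu> p x y m u v w assume ok: "ok1 f \<nu> p x y m"
  show "em g (r1 f \<nu> p x y m u v w) \<in> carrier H0" by (rule em_closed[OF g r1_H0[OF ok]])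
  fix f' \<nu>' p' x' y' m' u' v' w' assume ok': "ok1 f' \<nu>' p' x' y' m'"
  have f: "frob f" "frob f'" "\<nu> \<noteq> 0" using ok ok' JP_frob JP_nz by (auto simp: ok1_def)
  show "em g (r1 f \<nu> p x y m u v w) \<otimes>\<^bsub>H0\<^esub> em g (r1 f' \<nu>' p' x' y' m' u' v' w') =
      em g (r1 (f' \<circ> f) (\<nu>' * f' \<nu>) (p' * f' p + x' * f' y) (p' * f' x + x' * f' m)
        (y' * f' p + m' * f' y) (y' * f' x + m' * f' m)
        (p' * f' u + x' * f' v + u') (y' * f' u + m' * f' v + v') (\<nu>' ^ 2 * f' w + w'))"
    unfolding em_mult[OF g r1_H0[OF ok] r1_H0[OF ok']] r1_mult[OF f(2)] ..
  show "(em g (r1 f \<nu> p x y m u v w) = em g (r1 f' \<nu>' p' x' y' m' u' v' w')) =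
      (f = f' \<and> \<nu> = \<nu>' \<and> p = p' \<and> x = x' \<and> y = y' \<and> m = m' \<and> u = u' \<and> v = v' \<and> w = w')"
    unfolding em_inj[OF g r1_H0[OF ok] r1_H0[OF ok']]
  proof
    assume eq: "r1 f \<nu> p x y m u v w = r1 f' \<nu>' p' x' y' m' u' v' w'"
    note D = r1_eqD[OF eq f]
    \<comment> \<open>Equal matrices have equal determinants, and injectivity of cubing removes the
      sign ambiguity left by the squares.\<close>
    have "\<nu> ^ 3 = \<nu>' ^ 3" using ok ok' D by (simp add: ok1_def)
    then have "\<nu> = \<nu>'" unfolding cube_inj .
    then show "f = f' \<and> \<nu> = \<nu>' \<and> p = p' \<and> x = x' \<and> y = y' \<and> m = m' \<and> u = u' \<and> v = v' \<and> w = w'" using D by blast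
  qed blast
next
  fix \<nu> :: 'a and f and t D e u v w :: 'a assume J: "(\<nu>, f) \<in> JP" "t \<noteq> 0"
  show "em g (r2 f \<nu> t D e u v w) \<in> carrier H0" by (rule em_closed[OF g r2_H0[OF J]])
  show "em g (r2 f \<nu> t 0 e u v w) = em g (r1 f \<nu> (\<nu> ^ 2 * t) e 0 (\<nu> / t) u v w)" unfolding r2_0[OF J(2)] ..
next
  fix \<nu> :: 'a and f and \<nu>' :: 'a and f' and t t' D e u v w D' e' u' v' w' :: 'a assume J: "(\<nu>, f) \<in> JP" and J': "(\<nu>', f') \<in> JP" and t: "t \<noteq> 0" "t' \<noteq> 0"
  have f: "frob f" "frob f'" "\<nu> \<noteq> 0" using J J' JP_frob JP_nz by auto
  show "em g (r2 f \<nu> t D e u v w) \<otimes>\<^bsub>H0\<^esub> em g (r2 f' \<nu>' t' D' e' u' v' w') =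
      em g (r2 (f' \<circ> f) (\<nu>' * f' \<nu>) (t' * f' t) (t' ^ 3 * f' D + D')
        (\<nu>' ^ 2 * t' * f' e + e' * (f' \<nu> / f' t) + 2 * D' * (\<nu>' ^ 2 / t' ^ 2) * (f' \<nu> / f' t) * f' v)
        (\<nu>' ^ 2 * t' * f' u + e' * f' v + D' * (\<nu>' ^ 2 / t' ^ 2) * (f' v) ^ 2 + D' ^ eps * \<nu>' ^ 2 * f' w + u')
        (\<nu>' / t' * f' v + v') (\<nu>' ^ 2 * f' w + w'))"
    unfolding em_mult[OF g r2_H0[OF J t(1)] r2_H0[OF J' t(2)]] r2_mult[OF f(2) t] ..
  show "(em g (r2 f \<nu> t D e u v w) = em g (r2 f' \<nu>' t' D' e' u' v' w')) =
      (f = f' \<and> \<nu> = \<nu>' \<and> t = t' \<and> D = D' \<and> e = e' \<and> u = u' \<and> v = v' \<and> w = w')"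
    unfolding em_inj[OF g r2_H0[OF J t(1)] r2_H0[OF J' t(2)]]
  proof
    assume eq: "r2 f \<nu> t D e u v w = r2 f' \<nu>' t' D' e' u' v' w'"
    show "f = f' \<and> \<nu> = \<nu>' \<and> t = t' \<and> D = D' \<and> e = e' \<and> u = u' \<and> v = v' \<and> w = w'"
      by (intro conjI r2_eqD[OF eq f t])
  qed blast
next
  fix f \<nu> p x y m \<nu>' f' t u v w D e u' v' w'
  assume ok: "ok1 f \<nu> p x y m" and J': "(\<nu>', f') \<in> JP" "t \<noteq> 0"
    and eq: "em g (r1 f \<nu> p x y m u v w) = em g (r2 f' \<nu>' t D e u' v' w')"
  have f: "frob f" "frob f'" "\<nu>' \<noteq> 0" using ok J' JP_frob JP_nz by (auto simp: ok1_def)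
  show "D = 0" using r1_r2D[OF _ f] eq unfolding em_inj[OF g r1_H0[OF ok] r2_H0[OF J']] by blast
qed

definition VF0 :: "'a perm3 set" where "VF0 = {r2 id 1 1 0 0 u v w | u v w. True}"
definition VCF0 :: "'a perm3 set" where "VCF0 = {r2 id 1 1 0 e u v w | e u v w. True}"

lemma em_one: "x \<in> carrier H0 \<Longrightarrow> em \<one>\<^bsub>H0\<^esub> x = x"
  by (simp add: em_def)

lemma G_subgroup: "subgroup (G1_of Jhat) H0" "subgroup (G2_of Jhat) H0" and G_neq: "G1_of Jhat \<noteq> G2_of Jhat"
proof -
  interpret A: amalgam r "TYPE('a)" JP H0 "\<lambda>f \<nu> p x y m u v w. em \<one>\<^bsub>H0\<^esub> (r1 f \<nu> p x y m u v w)"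
    "\<lambda>f \<nu> t D e u v w. em \<one>\<^bsub>H0\<^esub> (r2 f \<nu> t D e u v w)"
    by (rule amalgam_at) simp
  have "A.A1 = G1_of Jhat" unfolding A.A1_def G1_eq using em_one[OF r1_H0] by (intro Collect_cong) metis
  moreover have "A.A2 = G2_of Jhat" unfolding A.A2_def G2_eq using em_one[OF r2_H0] by (intro Collect_cong) metis
  ultimately show "subgroup (G1_of Jhat) H0" "subgroup (G2_of Jhat) H0" "G1_of Jhat \<noteq> G2_of Jhat"
    using A.A1_subgroup A.A2_subgroup A.A1_neq_A2 by auto
qed

lemma vstab_em:
  assumes "g \<in> carrier H0"
  shows "vstab H0 (G1_of Jhat #>\<^bsub>H0\<^esub> g) = {em g (r1 f \<nu> p x y m u v w) | f \<nu> p x y m u v w. ok1 f \<nu> p x y m}"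
    "vstab H0 (G2_of Jhat #>\<^bsub>H0\<^esub> g) = {em g (r2 f \<nu> t D e u v w) | f \<nu> t D e u v w. (\<nu>, f) \<in> JP \<and> t \<noteq> 0}"
  unfolding H0.vstab_eq[OF G_subgroup(1) assms] H0.vstab_eq[OF G_subgroup(2) assms]
  unfolding G1_eq G2_eq em_def by blast+

text \<open>The kernel at the vertex is \<open>T1s\<close> or \<open>T2s\<close> of the amalgam
  conjugated by \<open>g\<close>, whose largest normal 3-subgroup is known in coordinates.\<close>

lemma Op_vker:
  assumes g: "g \<in> carrier H0"
  shows "Op 3 (H0\<lparr>carrier := vker H0 (Delta Jhat) (G1_of Jhat #>\<^bsub>H0\<^esub> g)\<rparr>) = em g ` VF0"
    "Op 3 (H0\<lparr>carrier := vker H0 (Delta Jhat) (G2_of Jhat #>\<^bsub>H0\<^esub> g)\<rparr>) = em g ` VCF0"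
proof -
  interpret A: amalgam r "TYPE('a)" JP H0 "\<lambda>f \<nu> p x y m u v w. em g (r1 f \<nu> p x y m u v w)"
    "\<lambda>f \<nu> t D e u v w. em g (r2 f \<nu> t D e u v w)"
    by (rule amalgam_at[OF g])
  have A1: "vstab H0 (G1_of Jhat #>\<^bsub>H0\<^esub> g) = A.A1" and A2: "vstab H0 (G2_of Jhat #>\<^bsub>H0\<^esub> g) = A.A2"
    unfolding vstab_em[OF g] A.A1_def A.A2_def by blast+
  have "vker H0 (Delta Jhat) (G1_of Jhat #>\<^bsub>H0\<^esub> g) = A.T1s"
    unfolding Delta_def H0.vker_coset_graph[OF G_subgroup G_neq g] A1 A2 by (rule A.largest_normal_A1)
  moreover have "A.VF = em g ` VF0" unfolding A.VF_def VF0_def by blast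
  ultimately show "Op 3 (H0\<lparr>carrier := vker H0 (Delta Jhat) (G1_of Jhat #>\<^bsub>H0\<^esub> g)\<rparr>) = em g ` VF0"
    using A.Op_T1s by simp
  have "vker H0 (Delta Jhat) (G2_of Jhat #>\<^bsub>H0\<^esub> g) = A.T2s"
    unfolding Delta_def H0.coset_graph_commute[of "G1_of Jhat"]
      H0.vker_coset_graph[OF G_subgroup(2,1) G_neq[symmetric] g] A1 A2
    using A.largest_normal_A2 by (simp add: Int_commute)
  moreover have "A.VCF = em g ` VCF0" unfolding A.VCF_def VCF0_def by blast
  ultimately show "Op 3 (H0\<lparr>carrier := vker H0 (Delta Jhat) (G2_of Jhat #>\<^bsub>H0\<^esub> g)\<rparr>) = em g ` VCF0"
    using A.Op_T2s by simp
qed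

text \<open>Adjacent cosets share an element \<open>g\<close>, which represents both. The valency
  decides the orientation: a coset of \<open>G2_of Jhat\<close> has at most \<open>q\<close>
  neighbours, one for each map \<tau>.\<close>

lemma arc_cases:
  assumes arc: "(x1, x2) \<in> parcs (Delta Jhat)" and card: "card (nbrs (Delta Jhat) x1) = CARD('a) + 1"
  obtains g where "g \<in> carrier H0" "x1 = G1_of Jhat #>\<^bsub>H0\<^esub> g" "x2 = G2_of Jhat #>\<^bsub>H0\<^esub> g"
proof -
  have common: "\<exists>g\<in>carrier H0. y1 = K1 #>\<^bsub>H0\<^esub> g \<and> y2 = K2 #>\<^bsub>H0\<^esub> g"
    if y: "y1 \<inter> y2 \<noteq> {}" "y1 \<in> rcosets\<^bsub>H0\<^esub> K1" "y2 \<in> rcosets\<^bsub>H0\<^esub> K2" and K: "subgroup K1 H0" "subgroup K2 H0" for y1 y2 K1 K2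
  proof -
    obtain g where g: "g \<in> y1" "g \<in> y2" using y(1) by blast
    obtain h1 h2 where h: "h1 \<in> carrier H0" "y1 = K1 #>\<^bsub>H0\<^esub> h1" "h2 \<in> carrier H0" "y2 = K2 #>\<^bsub>H0\<^esub> h2"
      using y(2,3) by (auto simp: RCOSETS_def)
    have "g \<in> carrier H0"
      using g(1) h(1,2) subgroup.elemrcos_carrier[OF K(1) H0_group] by blast
    moreover have "y1 = K1 #>\<^bsub>H0\<^esub> g" "y2 = K2 #>\<^bsub>H0\<^esub> g"
      using H0.repr_independence[OF _ h(1) K(1)] H0.repr_independence[OF _ h(3) K(2)] g h by auto
    ultimately show ?thesis by blast
  qed
  have "x1 \<inter> x2 \<noteq> {}" and "x1 \<in> rcosets\<^bsub>H0\<^esub> (G1_of Jhat) \<and> x2 \<in> rcosets\<^bsub>H0\<^esub> (G2_of Jhat) \<or>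
      x1 \<in> rcosets\<^bsub>H0\<^esub> (G2_of Jhat) \<and> x2 \<in> rcosets\<^bsub>H0\<^esub> (G1_of Jhat)"
    using arc by (auto simp: Delta_def coset_graph_def)
  moreover have False if x: "x1 \<inter> x2 \<noteq> {}" "x1 \<in> rcosets\<^bsub>H0\<^esub> (G2_of Jhat)" "x2 \<in> rcosets\<^bsub>H0\<^esub> (G1_of Jhat)"
  proof -
    obtain g where g: "g \<in> carrier H0" "x1 = G2_of Jhat #>\<^bsub>H0\<^esub> g"
      using common[OF x G_subgroup(2,1)] by blast
    interpret A: amalgam r "TYPE('a)" JP H0 "\<lambda>f \<nu> p x y m u v w. em g (r1 f \<nu> p x y m u v w)"
      "\<lambda>f \<nu> t D e u v w. em g (r2 f \<nu> t D e u v w)"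
      by (rule amalgam_at[OF g(1)])
    let ?C = "G1_of Jhat #>\<^bsub>H0\<^esub> g"
    have A1: "vstab H0 ?C = A.A1" and A2: "vstab H0 (G2_of Jhat #>\<^bsub>H0\<^esub> g) = A.A2"
      unfolding vstab_em[OF g(1)] A.A1_def A.A2_def by blast+
    have Cc: "?C \<subseteq> carrier H0" using G_carrier(1) g(1) by (simp add: H0.r_coset_subset_G)
    have "nbrs (Delta Jhat) x1 = (\<lambda>k. ?C #>\<^bsub>H0\<^esub> k) ` A.A2"
      unfolding Delta_def H0.coset_graph_commute[of "G1_of Jhat"] g(2)
        H0.nbrs_coset_graph[OF G_subgroup(2,1) G_neq[symmetric] g(1)] A2 ..
    also have "\<dots> \<subseteq> range (\<lambda>D. ?C #>\<^bsub>H0\<^esub> em g (r2 id 1 1 D 0 0 0 0))"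
    proof clarify
      fix k assume "k \<in> A.A2"
      then obtain b D where k: "b \<in> A.A12" "k = b \<otimes>\<^bsub>H0\<^esub> em g (r2 id 1 1 D 0 0 0 0)" by (rule A.A2_decomp)
      have "b \<in> vstab H0 ?C" using k(1) A.A12_sub A1 by blast
      then have b: "b \<in> carrier H0" "?C #>\<^bsub>H0\<^esub> b = ?C" by (simp_all add: vstab_def stabilizer_def)
      have "em g (r2 id 1 1 D 0 0 0 0) \<in> carrier H0" by (rule A.s2_closed[OF JP_one one_neq_zero])
      then have "?C #>\<^bsub>H0\<^esub> k = ?C #>\<^bsub>H0\<^esub> em g (r2 id 1 1 D 0 0 0 0)"
        unfolding k(2) using H0.coset_mult_assoc[OF Cc b(1)] b(2) by simp
      then show "?C #>\<^bsub>H0\<^esub> k \<in> range (\<lambda>D. ?C #>\<^bsub>H0\<^esub> em g (r2 id 1 1 D 0 0 0 0))" by blast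
    qed
    finally have "card (nbrs (Delta Jhat) x1) \<le> card (range (\<lambda>D. ?C #>\<^bsub>H0\<^esub> em g (r2 id 1 1 D 0 0 0 0)))"
      by (intro card_mono) auto
    also have "\<dots> \<le> CARD('a)" by (rule card_image_le) simp
    finally show False using card by simp
  qed
  ultimately show ?thesis using common[OF _ _ _ G_subgroup] that by blast
qed

end

theorem theorem1p2:
  fixes q r :: nat
    and Jhat :: "'a::{field,finite} perm3 set"
    and H :: "'a perm3 monoid"
    and \<Gamma> :: "'a perm3 set pair_pre_digraph"
    and x1 x2 :: "'a perm3 set"
    and H1 H2 T1 T2 B H1s H2s L1 :: "'a perm3 set"
    and Q :: "'a perm3 set \<Rightarrow> 'a perm3 set"
    and S0 :: "(('a^2) \<times> ('a^2^2)) set"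
  assumes q: "q = 3 ^ r" "r \<ge> 1" "CARD('a) = q"
    and Jhat: "admissible Jhat"
    and H: "H = G_of Jhat"
    and \<Gamma>: "\<Gamma> = Delta Jhat"
    and arc: "(x1, x2) \<in> parcs \<Gamma>" "card (nbrs \<Gamma> x1) = q + 1" "card (nbrs \<Gamma> x2) = q"
    and stab: "H1 = vstab H x1" "H2 = vstab H x2"
    and T: "T1 = largest_normal_in H (H1 \<inter> H2) H1" "T2 = largest_normal_in H (H1 \<inter> H2) H2"
    and core: "B = core_edge_group H H1 H2"
      "H1s = conj_closure H B H1" "H2s = conj_closure H B H2"
    and Q: "\<And>z. z \<in> pverts \<Gamma> \<Longrightarrow> Q z = Op 3 (H\<lparr>carrier := vker H \<Gamma> z\<rparr>)"
    and L1: "L1 = generate H (\<Union>u\<in>nbrs \<Gamma> x1. Q u) <#>\<^bsub>H\<^esub> Q x1"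
    and S0: "S0 \<in> Syl 3 ASL"
  shows
    "(\<exists>d. d dvd q - 1 \<and>
      \<comment> \<open>(i)\<close>
      H\<lparr>carrier := L1\<rparr> \<cong> (additive_group :: 'a monoid) \<times>\<times> (ASL :: (('a^2) \<times> ('a^2^2)) monoid) \<and>
      H\<lparr>carrier := center (H\<lparr>carrier := L1\<rparr>)\<rparr> \<cong> (additive_group :: 'a monoid) \<and>
      Op 3 (H\<lparr>carrier := B\<rparr>) = Op 3 (H\<lparr>carrier := L1 \<inter> B\<rparr>) \<and>
      Op 3 (H\<lparr>carrier := L1 \<inter> B\<rparr>) = Op 3 (H\<lparr>carrier := T2\<rparr>) \<and>
      Op 3 (H\<lparr>carrier := T2\<rparr>) \<in> Syl 3 (H\<lparr>carrier := L1\<rparr>) \<and>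
      \<comment> \<open>(ii)\<close>
      B = (L1 \<inter> B) <#>\<^bsub>H\<^esub> T2 \<and>
      H\<lparr>carrier := L1 \<inter> B\<rparr> \<cong> (additive_group :: 'a monoid) \<times>\<times> ASL2_S0 S0 \<and>
      center (H\<lparr>carrier := L1\<rparr>) \<lhd> H\<lparr>carrier := T2\<rparr> \<and>
      H\<lparr>carrier := T2\<rparr> Mod center (H\<lparr>carrier := L1\<rparr>) \<cong> index_subgroup (K2_S0 S0) d \<and>
      \<comment> \<open>(iii)\<close>
      is_semidirect (H\<lparr>carrier := H1s\<rparr>)
        (additive_group :: ('a^3) monoid) (index_subgroup (GL :: ('a^2^2) monoid) d) \<and>
      H\<lparr>carrier := centralizer (H\<lparr>carrier := H1s\<rparr>) (center (H\<lparr>carrier := L1\<rparr>))\<rparr> \<cong>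
        (additive_group :: 'a monoid) \<times>\<times>
        index_subgroup (AGL :: (('a^2) \<times> ('a^2^2)) monoid) ((q - 1) div 2) \<and>
      \<comment> \<open>(iv)\<close>
      is_semidirect (H\<lparr>carrier := H2s\<rparr>)
        (H\<lparr>carrier := Op 3 (H\<lparr>carrier := T2\<rparr>)\<rparr>)
        (index_subgroup (GL :: ('a^1^1) monoid) d \<times>\<times> (AGL :: (('a^1) \<times> ('a^1^1)) monoid)) \<and>
      H\<lparr>carrier := centralizer (H\<lparr>carrier := H2s\<rparr>)
          (center (H\<lparr>carrier := Op 3 (H\<lparr>carrier := T2\<rparr>)\<rparr>))\<rparr> \<cong>
        (additive_group :: 'a monoid) \<times>\<times> index_subgroup (K2_S0 S0) ((q - 1) div 2)) \<and>
    L1 \<lhd> H\<lparr>carrier := H1\<rparr> \<and>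
    (\<exists>P x. subgroup P (AGammaL1 :: ('a \<Rightarrow> 'a) monoid) \<and>
       two_transitive_on UNIV P (\<lambda>g y. g y) \<and>
       H\<lparr>carrier := H1\<rparr> Mod L1 \<cong>
         AGammaL1\<lparr>carrier := stabilizer (AGammaL1\<lparr>carrier := P\<rparr>) (\<lambda>g y. g y) x\<rparr>)"
proof -
  interpret delta_graph r "TYPE('a)" Jhat
    using q Jhat by unfold_locales simp_all
  have Hq: "CARD('a) = q" using q by simp
  interpret H: group H unfolding H by (rule H0_group)
  have card: "card (nbrs (Delta Jhat) x1) = CARD('a) + 1" using arc(2) \<Gamma> Hq by simp
  obtain g where g: "g \<in> carrier H" and x: "x1 = G1_of Jhat #>\<^bsub>H\<^esub> g" "x2 = G2_of Jhat #>\<^bsub>H\<^esub> g"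
    using arc_cases[OF arc(1)[unfolded \<Gamma>] card] unfolding H by blast
  \<comment> \<open>Since \<open>g\<close> represents both ends of the arc, the stabilizers are
    exactly \<open>A1\<close> and \<open>A2\<close> of this instance.\<close>
  interpret A: amalgam r "TYPE('a)" JP H "\<lambda>f \<nu> p x y m u v w. em g (r1 f \<nu> p x y m u v w)"
    "\<lambda>f \<nu> t D e u v w. em g (r2 f \<nu> t D e u v w)"
    unfolding H by (rule amalgam_at[OF g[unfolded H]])
  note sub = G_subgroup[folded H]
  have H1: "H1 = A.A1" and H2: "H2 = A.A2"
    unfolding stab x A.A1_def A.A2_def unfolding H by (rule vstab_em[OF g[unfolded H]])+
  have B: "B = A.Bs" unfolding core H1 H2 by (rule A.core_eq)
  have H1s: "H1s = A.H1c" and H2s: "H2s = A.H2c" unfolding core(2,3) B H1 H2 by (rule A.conj_closure_Bs)+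
  have T2: "T2 = A.T2s" unfolding T H1 H2 by (rule A.largest_normal_A2)
  have VCF: "A.VCF = em g ` VCF0" and VF: "A.VF = em g ` VF0"
    unfolding A.VCF_def VCF0_def A.VF_def VF0_def by blast+
  have x1_vert: "x1 \<in> pverts \<Gamma>"
    unfolding \<Gamma> Delta_def x coset_graph_def using H.rcosetsI[OF _ g] subgroup.subset[OF sub(1)] by (simp add: H)
  have Qx1: "Q x1 = A.VF"
    unfolding Q[OF x1_vert] unfolding VF \<Gamma> x H by (rule Op_vker(1)[OF g[unfolded H]])
  have nbrs: "nbrs \<Gamma> x1 = (\<lambda>k. x2 #>\<^bsub>H\<^esub> k) ` A.A1"
    using H.nbrs_coset_graph[OF sub G_neq g] stab(1) H1 unfolding \<Gamma> Delta_def H[symmetric] x by simp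
  \<comment> \<open>The neighbour is represented by \<open>g k\<close>, and conjugation by
    \<open>g k\<close> is conjugation by \<open>g\<close> followed by conjugation by
    \<open>k\<close>; so its Q is the conjugate of \<open>VCF\<close> by \<open>k\<close>.\<close>
  have Qu: "Q (x2 #>\<^bsub>H\<^esub> k) = {inv\<^bsub>H\<^esub> k \<otimes>\<^bsub>H\<^esub> z \<otimes>\<^bsub>H\<^esub> k | z. z \<in> A.VCF}" if k: "k \<in> A.A1" for k
  proof -
    have kc: "k \<in> carrier H" using k A.A1_carrier by blast
    have gk: "g \<otimes>\<^bsub>H\<^esub> k \<in> carrier H" using g kc by simp
    have u: "x2 #>\<^bsub>H\<^esub> k = G2_of Jhat #>\<^bsub>H\<^esub> (g \<otimes>\<^bsub>H\<^esub> k)"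
      unfolding x using H.coset_mult_assoc[OF subgroup.subset[OF sub(2)] g kc] .
    then have "x2 #>\<^bsub>H\<^esub> k \<in> pverts \<Gamma>"
      unfolding \<Gamma> Delta_def coset_graph_def using H.rcosetsI[OF _ gk] subgroup.subset[OF sub(2)] by (simp add: H)
    from Q[OF this] have "Q (x2 #>\<^bsub>H\<^esub> k) = em (g \<otimes>\<^bsub>H\<^esub> k) ` VCF0"
      unfolding \<Gamma> u unfolding H by (simp only: Op_vker(2)[OF gk[unfolded H]])
    also have "\<dots> = {inv\<^bsub>H\<^esub> k \<otimes>\<^bsub>H\<^esub> z \<otimes>\<^bsub>H\<^esub> k | z. z \<in> A.VCF}"
    proof -
      have "em (g \<otimes>\<^bsub>H\<^esub> k) y = inv\<^bsub>H\<^esub> k \<otimes>\<^bsub>H\<^esub> em g y \<otimes>\<^bsub>H\<^esub> k" if "y \<in> VCF0" for y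
      proof -
        have "y \<in> carrier H" using that r2_H0[OF JP_one one_neq_zero] unfolding VCF0_def H by blast
        then show ?thesis using g kc unfolding em_def H[symmetric] by (simp add: H.inv_mult_group H.m_assoc)
      qed
      then show ?thesis unfolding VCF by (auto simp: image_iff)
    qed
    finally show ?thesis .
  qed
  \<comment> \<open>The union is the generating set in \<open>conj_closure H VCF A1\<close>, a
    closure already identified as \<open>L1s\<close>.\<close>
  have "(\<Union>u\<in>nbrs \<Gamma> x1. Q u) = {inv\<^bsub>H\<^esub> k \<otimes>\<^bsub>H\<^esub> z \<otimes>\<^bsub>H\<^esub> k | z k. z \<in> A.VCF \<and> k \<in> A.A1}"
    unfolding nbrs using Qu by auto
  then have "generate H (\<Union>u\<in>nbrs \<Gamma> x1. Q u) = A.L1s"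
    using A.L1s_closure unfolding conj_closure_def by simp
  then have L1: "L1 = A.L1s" unfolding L1 Qx1 using A.L1s_VF by simp
  have LB: "L1 \<inter> B = A.LBs" unfolding L1 B by (rule A.LBs_eq)
  show ?thesis
    unfolding LB
    unfolding L1 T2 B H1s H2s H1 A.center_L1s A.Op_Bs A.Op_LBs A.Op_T2s Hq[symmetric]
    \<comment> \<open>The witnesses are \<open>dY\<close> for the divisor, and the group
      \<open>PJ\<close> with the point 0 for the last claim.\<close>
    by (intro conjI exI[of _ A.dY] exI[of _ PJ] exI[of _ 0] refl A.dY(2) A.L1s_iso A.FF_iso A.VCF_Syl A.Bs_factor
        A.LBs_iso[OF S0] A.T2s_quotient[OF S0] A.H1c_semidirect A.H1c_centralizer_iso A.H2c_semidirect
        A.H2c_centralizer_iso[OF S0] A.L1s_normal A.A1_quotient PJ_subgroup PJ_two_transitive)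
qed

end
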